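(* There exist positive constants $c,c',c_1,C_1,C_2,C_3$ (absolute, up to dependence on the balance constants $c_{low},c_{up}$) such that the following holds. Let $\{(x_i,y_i)\}_{i=1}^n$ be a $(\rho,\varepsilon_0,\delta)$ corrupted dataset with $\rho>0$, with ground truth labels $\tilde y=(\tilde y_1,\dots,\tilde y_n)$, cluster-center matrix $C\in\mathbb{R}^{K\times d}$ and $\lambda(C)>0$. Suppose $|\phi(0)|,|\phi'|,|\phi''|\le\Gamma$ for some $\Gamma\ge1$, write $\Lambda=\log\!\big(\Gamma\sqrt{n\log K}/\rho\big)$, and suppose $$\varepsilon_0\le c_1\frac{\lambda(C)}{\Gamma^2K\Lambda}\qquad\text{and}\qquad k\ge C_2\,\Gamma^{10}\frac{K^2\|C\|^4}{\lambda(C)^4}\Lambda^6 .$$ Let $f(W,x)=v^T\phi(Wx)$, $W\in\mathbb{R}^{k\times d}$, with $v$ fixed with half its entries $1/\sqrt k$ and half $-1/\sqrt k$. Let $\eta\le\frac{K}{2c_{up}n\Gamma^2\|C\|^2}$, let $W_0$ have i.i.d. $\mathcal N(0,1)$ entries, and run gradient descent $W_{t+1}=W_t-\eta\nabla\mathcal L(W_t)$ on $\mathcal L(W)=\frac12\sum_{i=1}^n(y_i-f(W,x_i))^2$. Then with probability at least $1-3/K^{100}-K\exp(-100d)$, for $\tau=C_1\frac{K}{\eta n\lambda(C)}\Lambda$, all of the following hold. 1. With $f(W,X)=(f(W,x_1),\dots,f(W,x_n))$, $$\frac{\|f(W_\tau,X)-\tilde y\|_{\ell_2}}{\sqrt n}\le4\rho+c\,\frac{\varepsilon_0\Gamma^3K\sqrt{\log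 K}}{\lambda(C)}\Lambda .$$ 2. If $\rho\le\delta/8$, the number $\mathrm{err}(W_\tau)$ of indices $i\in\{1,\dots,n\}$ for which $\arg\min_{\alpha_\ell:1\le\ell\le\bar K}|f(W_\tau,x_i)-\alpha_\ell|=\tilde y_i$ fails satisfies $$\frac{\mathrm{err}(W_\tau)}{n}\le c\,\frac{\varepsilon_0K}{\delta}\,\frac{\Gamma^3\sqrt{\log K}}{\lambda(C)}\Lambda .$$ 3. If $\rho\le\delta/8$ and $\varepsilon_0\le c'\delta\min\Big(\frac{\lambda(C)^2}{\Gamma^5K^2\Lambda^3},\frac{1}{\Gamma\sqrt d}\Big)$, then for every cluster center $c_\ell$ and every $x\in\mathbb{R}^d$ with $\|x-c_\ell\|_{\ell_2}\le\varepsilon_0$, the value $\arg\min_{\alpha_r:1\le r\le\bar K}|f(W_\tau,x)-\alpha_r|$ equals the ground truth label of $c_\ell$. 4. For every iteration count $0\le t\le\tau$, $$\|W_t-W_0\|_F\le C_3\left(\Gamma\sqrt{\frac{K\log K}{\lambda(C)}}+t\,\eta\,\varepsilon_0\frac{\Gamma^4Kn}{\lambda(C)}\Lambda^2\right).$$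
   Context: Norms: $\|\cdot\|$ is the spectral norm, $\|\cdot\|_F$ the Frobenius norm, $\|\cdot\|_{\ell_2}$ the Euclidean norm. $\phi$ is applied entrywise. If $k$ is odd, one entry of $v$ is set to zero and the remaining ones are split evenly between $1/\sqrt k$ and $-1/\sqrt k$. Iteration counts are understood to be rounded to an integer. $(\varepsilon_0,\delta)$ clusterable dataset: pairs $\{(x_i,\tilde y_i)\}_{i=1}^n$ with $x_i\in\mathbb{R}^d$, $\|x_i\|_{\ell_2}=1$, partitioned into $K$ clusters; the $\ell$-th cluster has $n_\ell$ points with $c_{low}\frac nK\le n_\ell\le c_{up}\frac nK$, where $0<c_{low}<c_{up}$ are fixed numerical constants. The cluster centers $c_1,\dots,c_K\in\mathbb{R}^d$ have unit Euclidean norm and are the rows of $C$; every $x_i$ in the $\ell$-th cluster satisfies $\|x_i-c_\ell\|_{\ell_2}\le\varepsilon_0$. The labels belong to $\{\alpha_1,\dots,\alpha_{\bar K}\}\subset[-1,1]$, $\bar K\le K$ classes; all points of one cluster have the same label (the ground truth label of that cluster center), but a class may contain several clusters. Labels are separated, $|\alpha_r-\alpha_s|\ge\delta>0$ for $r\ne s$, and for any two clusters $\ell,\ell'$ belonging to different classes $\|c_\ell-c_{\ell'}\|_{\ell_2}\ge2\varepsilon_0$. $(\rho,\varepsilon_0,\delta)$ corrupted dataset: $\{(x_i,y_i)\}_{i=1}^n$ obtained from an $(\varepsilon_0,\delta)$ clusterable dataset $\{(x_i,\tilde y_i)\}_{i=1}^n$ by changing, in each cluster $\ell$, at most $\rho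 n_\ell$ of the labels to other values in $\{\alpha_1,\dots,\alpha_{\bar K}\}$ (arbitrarily). The $\tilde y_i$ are the ground truth labels. Neural net cluster covariance: with $g\sim\mathcal N(0,I_d)$, $\Sigma(C)=(CC^T)\odot\mathbb{E}_g[\phi'(Cg)\phi'(Cg)^T]$ ($\odot$ is the entrywise product); $\lambda(C)$ is the minimum eigenvalue of $\Sigma(C)$.
   Formalization: The corruption level is assumed to satisfy ρ ≤ 1 (a fraction of each cluster's labels); for ρ > 1 no new datasets arise, but Λ can be arbitrarily small, τ then rounds to 0 and claim 1 fails. *)

theory Defs
  imports
    "HOL-Probability.Probability"
    "Jordan_Normal_Form.Matrix"
    "Jordan_Normal_Form.Spectral_Radius"
begin

(* The constants of the theorem must not depend on n, d, K or k, so these are natural numbers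
   (not index types) and vectors and matrices are those of Jordan_Normal_Form.  All indices
   start at 0. *)

type_synonym rvec = "real Matrix.vec"
type_synonym rmat = "real Matrix.mat"

definition l2_norm :: "rvec \<Rightarrow> real" where
  "l2_norm u = sqrt (scalar_prod u u)"

definition frobenius_norm :: "rmat \<Rightarrow> real" where
  "frobenius_norm A = sqrt (\<Sum>i<dim_row A. \<Sum>j<dim_col A. (A $$ (i, j))\<^sup>2)"

definition spectral_norm :: "rmat \<Rightarrow> real" where
  "spectral_norm A = (SUP u \<in> {u \<in> carrier_vec (dim_col A). l2_norm u \<le> 1}. l2_norm (A *\<^sub>v u))"

definition std_gaussian :: "'i set \<Rightarrow> ('i \<Rightarrow> real) measure" where
  "std_gaussian I = PiM I (\<lambda>_. density lborel std_normal_density)"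

(* entrywise product with the matrix of expectations E[phi'((C g)_i) phi'((C g)_j)] *)
definition cluster_cov :: "(real \<Rightarrow> real) \<Rightarrow> rmat \<Rightarrow> rmat" where
  "cluster_cov \<phi>' C = Matrix.mat (dim_row C) (dim_row C) (\<lambda>(i, j).
     (C * transpose_mat C) $$ (i, j) *
     (\<integral>\<omega>. map_vec \<phi>' (C *\<^sub>v Matrix.vec (dim_col C) \<omega>) $ i *
          map_vec \<phi>' (C *\<^sub>v Matrix.vec (dim_col C) \<omega>) $ j \<partial>std_gaussian {..<dim_col C}))"

definition min_eig_cov :: "(real \<Rightarrow> real) \<Rightarrow> rmat \<Rightarrow> real" where
  "min_eig_cov \<phi>' C = Min (spectrum (cluster_cov \<phi>' C))"

(* Point i lies in cluster cl i, whose class is cls (cl i); its ground truth label is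
   \<alpha> (cls (cl i)).  Row l of C is the center of cluster l. *)
definition clusterable_dataset ::
  "real \<Rightarrow> real \<Rightarrow> real \<Rightarrow> real \<Rightarrow> nat \<Rightarrow> nat \<Rightarrow> nat \<Rightarrow> nat \<Rightarrow>
   (nat \<Rightarrow> rvec) \<Rightarrow> (nat \<Rightarrow> real) \<Rightarrow> (nat \<Rightarrow> nat) \<Rightarrow> rmat \<Rightarrow> (nat \<Rightarrow> real) \<Rightarrow> (nat \<Rightarrow> nat) \<Rightarrow> bool"
where
  "clusterable_dataset c_low c_up \<epsilon>\<^sub>0 \<delta> n d K Kbar x ytil cl C \<alpha> cls \<longleftrightarrow>
     0 < n \<and> 0 < K \<and> Kbar \<le> K \<and> 0 < \<delta> \<and>
     (\<forall>i<n. x i \<in> carrier_vec d \<and> l2_norm (x i) = 1) \<and>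
     (\<forall>i<n. cl i < K) \<and>
     (\<forall>l<K. c_low * (real n / real K) \<le> real (card {i. i < n \<and> cl i = l}) \<and>
            real (card {i. i < n \<and> cl i = l}) \<le> c_up * (real n / real K)) \<and>
     C \<in> carrier_mat K d \<and>
     (\<forall>l<K. l2_norm (Matrix.row C l) = 1) \<and>
     (\<forall>i<n. l2_norm (x i - Matrix.row C (cl i)) \<le> \<epsilon>\<^sub>0) \<and>
     (\<forall>r<Kbar. \<bar>\<alpha> r\<bar> \<le> 1) \<and>
     (\<forall>r<Kbar. \<forall>s<Kbar. r \<noteq> s \<longrightarrow> \<delta> \<le> \<bar>\<alpha> r - \<alpha> s\<bar>) \<and>
     (\<forall>l<K. cls l < Kbar) \<and>
     (\<forall>i<n. ytil i = \<alpha> (cls (cl i))) \<and>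
     (\<forall>l<K. \<forall>m<K. cls l \<noteq> cls m \<longrightarrow>
        2 * \<epsilon>\<^sub>0 \<le> l2_norm (Matrix.row C l - Matrix.row C m))"

(* \<rho> is a fraction of the points of a cluster, hence \<rho> \<le> 1.  Larger values would admit no
   further datasets, but they can make log (\<Gamma> sqrt (n log K) / \<rho>) arbitrarily small. *)
definition corrupted_dataset ::
  "real \<Rightarrow> real \<Rightarrow> real \<Rightarrow> real \<Rightarrow> real \<Rightarrow> nat \<Rightarrow> nat \<Rightarrow> nat \<Rightarrow> nat \<Rightarrow>
   (nat \<Rightarrow> rvec) \<Rightarrow> (nat \<Rightarrow> real) \<Rightarrow> (nat \<Rightarrow> real) \<Rightarrow> (nat \<Rightarrow> nat) \<Rightarrow> rmat \<Rightarrow> (nat \<Rightarrow> real) \<Rightarrow> (nat \<Rightarrow> nat) \<Rightarrow> bool"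
where
  "corrupted_dataset c_low c_up \<rho> \<epsilon>\<^sub>0 \<delta> n d K Kbar x y ytil cl C \<alpha> cls \<longleftrightarrow>
     clusterable_dataset c_low c_up \<epsilon>\<^sub>0 \<delta> n d K Kbar x ytil cl C \<alpha> cls \<and>
     0 \<le> \<rho> \<and> \<rho> \<le> 1 \<and>
     (\<forall>i<n. y i \<in> \<alpha> ` {..<Kbar}) \<and>
     (\<forall>l<K. real (card {i. i < n \<and> cl i = l \<and> y i \<noteq> ytil i})
              \<le> \<rho> * real (card {i. i < n \<and> cl i = l}))"

definition balanced_output :: "nat \<Rightarrow> rvec \<Rightarrow> bool" where
  "balanced_output k v \<longleftrightarrow> v \<in> carrier_vec k \<and>
     (\<forall>i<k. v $ i \<in> {1 / sqrt (real k), - (1 / sqrt (real k)), 0}) \<and>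
     card {i. i < k \<and> v $ i = 1 / sqrt (real k)} = k div 2 \<and>
     card {i. i < k \<and> v $ i = - (1 / sqrt (real k))} = k div 2"

definition net :: "(real \<Rightarrow> real) \<Rightarrow> rvec \<Rightarrow> rmat \<Rightarrow> rvec \<Rightarrow> real" where
  "net \<phi> v W z = scalar_prod v (map_vec \<phi> (W *\<^sub>v z))"

definition loss :: "(real \<Rightarrow> real) \<Rightarrow> rvec \<Rightarrow> nat \<Rightarrow> (nat \<Rightarrow> rvec) \<Rightarrow> (nat \<Rightarrow> real) \<Rightarrow> rmat \<Rightarrow> real" where
  "loss \<phi> v n x y W = (1 / 2) * (\<Sum>i<n. (y i - net \<phi> v W (x i))\<^sup>2)"

(* matrix of the partial derivatives with respect to the entries of W *)
definition grad :: "(rmat \<Rightarrow> real) \<Rightarrow> rmat \<Rightarrow> rmat" where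
  "grad L W = Matrix.mat (dim_row W) (dim_col W) (\<lambda>p.
     deriv (\<lambda>s. L (Matrix.mat (dim_row W) (dim_col W) (\<lambda>q. if q = p then s else W $$ q))) (W $$ p))"

primrec grad_descent :: "(rmat \<Rightarrow> real) \<Rightarrow> real \<Rightarrow> rmat \<Rightarrow> nat \<Rightarrow> rmat" where
  "grad_descent L \<eta> W\<^sub>0 0 = W\<^sub>0"
| "grad_descent L \<eta> W\<^sub>0 (Suc t) =
     grad_descent L \<eta> W\<^sub>0 t - \<eta> \<cdot>\<^sub>m grad L (grad_descent L \<eta> W\<^sub>0 t)"

(* The set of all minimizers: "the argmin equals a" is rendered as "nearest_labels A z = {a}",
   so a tie never counts as a correct classification. *)
definition nearest_labels :: "real set \<Rightarrow> real \<Rightarrow> real set" where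
  "nearest_labels A z = {a. is_arg_min (\<lambda>a. \<bar>z - a\<bar>) (\<lambda>a. a \<in> A) a}"

end

theory Submission
  imports Defs
begin

text \<open>Group the residuals by cluster: \<open>agg\<close> is the projection of the residual onto the span of the
  normalised cluster indicators. If all inputs sat at their centers, gradient descent would only see
  this \<open>K\<close>-dimensional part, and the Jacobian restricted to it has smallest singular value about
  \<open>sqrt (n \<lambda>(C) / K)\<close>: at initialisation the kernel concentrates around \<open>\<Sigma>(C)\<close>, and within radius
  \<open>R \<approx> \<Gamma> sqrt (K log K / \<lambda>(C))\<close> of \<open>W\<^sub>0\<close> it moves little since the width \<open>k\<close> is large. The norm of the
  image of the projected residual, summed along the trajectory, bounds the path length and telescopes
  against the decrease of the projected residual, so the iterates never leave that ball. Placing the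
  inputs \<open>\<epsilon>\<^sub>0\<close> away from the centers perturbs each step by \<open>O(\<Gamma> \<epsilon>\<^sub>0 sqrt n)\<close> times the residual, which the
  smallness of \<open>\<epsilon>\<^sub>0\<close> keeps under control up to time \<open>\<tau>\<close>. At time \<open>\<tau>\<close> the projected residual is below \<open>\<rho>\<close>, up to that error: on
  each cluster the network fits the average of the corrupted labels, which differs from the true label
  by at most \<open>2 \<rho>\<close>, and it varies little around the center.

  The probabilistic input is sub-Gaussianity of \<open>\<Sum>r. v r * \<psi> (neuron r)\<close> for Lipschitz \<open>\<psi>\<close>, which needs no
  Gaussian isoperimetry: neurons with opposite output weights are paired off, and only symmetrised
  moment generating functions appear.\<close>

section \<open>Euclidean norms of finite families\<close>

text \<open>The residual component orthogonal to the cluster indicators contains the labels minus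
  their cluster averages, a fixed vector that never decays. It reaches the weights only through
  differences between the Jacobians at an input and at its center. Hence the whole residual only has
  to stay bounded, and the admissible \<epsilon> is inversely proportional to the training time. A
  step involves two different Jacobians: the gradient takes the current weights, the change of the
  outputs takes intermediate weights from the mean value theorem, different for each input. Their
  product is not positive semidefinite, so both are compared in Frobenius norm with the Jacobian at
  initialisation, whose singular values are under control. The failure probability must not depend
  on \<open>n\<close>, which rules out union bounds over the data. The third item concerns all
  points of a ball: chaining over lattices costs \<open>sqrt d\<close>, and compactness makes the
  event measurable. Numerical constants are generous. Exponents 103 and 106 leave room for union
  bounds below \<open>3 / K ^ 100\<close>; the lower bound \<open>1 / 12 \<le> \<Lambda>\<close>
  supplies any missing power of \<Lambda>.\<close>

lemma L2_set_scale: "L2_set (\<lambda>i. c * f i) A = \<bar>c\<bar> * L2_set f A"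
  by (simp add: L2_set_def power_mult_distrib sum_distrib_left[symmetric] real_sqrt_mult)

lemma L2_set_minus: "L2_set (\<lambda>i. - f i) A = L2_set f A"
  by (simp add: L2_set_def)

lemma L2_set_triangle_diff: "L2_set (\<lambda>i. f i - g i) A \<le> L2_set f A + L2_set g A"
  using L2_set_triangle_ineq[of f "\<lambda>i. - g i" A] by (simp add: L2_set_minus)

lemma L2_set_power2: "(L2_set f A)\<^sup>2 = (\<Sum>i\<in>A. (f i)\<^sup>2)"
  by (simp add: L2_set_def sum_nonneg)

lemma L2_set_abs_mono:
  assumes "\<And>i. i \<in> A \<Longrightarrow> \<bar>f i\<bar> \<le> \<bar>g i\<bar>"
  shows "L2_set f A \<le> L2_set g A"
  unfolding L2_set_def by (intro real_sqrt_le_mono sum_mono) (use assms abs_le_square_iff in blast)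

lemma L2_set_Cauchy_Schwarz: "\<bar>\<Sum>i\<in>A. f i * g i\<bar> \<le> L2_set f A * L2_set g A"
proof -
  have "\<bar>\<Sum>i\<in>A. f i * g i\<bar> \<le> (\<Sum>i\<in>A. \<bar>f i\<bar> * \<bar>g i\<bar>)"
    by (rule order_trans[OF sum_abs]) (simp add: abs_mult)
  then show ?thesis using L2_set_mult_ineq by (rule order_trans)
qed

text \<open>Together with \<open>L2_set_swap\<close> this allows a Frobenius norm to be computed by
  rows or by columns.\<close>

lemma L2_set_Times:
  "L2_set (\<lambda>p. f (fst p) (snd p)) (A \<times> B) = L2_set (\<lambda>a. L2_set (f a) B) A"
  by (simp add: L2_set_def sum_nonneg sum.cartesian_product case_prod_beta)

lemma L2_set_prod: "L2_set (\<lambda>p. a (fst p) * b (snd p)) (A \<times> B) = L2_set a A * L2_set b B"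
  by (subst L2_set_Times) (simp add: L2_set_scale L2_set_nonneg L2_set_def
      power_mult_distrib sum_nonneg sum_distrib_right[symmetric] real_sqrt_mult)

lemma L2_set_swap:
  "L2_set (\<lambda>p. f (snd p) (fst p)) (B \<times> A) = L2_set (\<lambda>p. f (fst p) (snd p)) (A \<times> B)"
  unfolding L2_set_def
  by (intro arg_cong[where f = sqrt] sum.reindex_bij_witness[of _ prod.swap prod.swap]) auto

text \<open>Cauchy-Schwarz in every row. The Frobenius norm is affordable for small differences of
  Jacobians; for the Jacobian itself the sharper operator norm \<open>\<beta>\<close> is
  kept.\<close>

lemma L2_set_apply_le:
  "L2_set (\<lambda>a. \<Sum>b\<in>B. M a b * u b) A \<le> L2_set (\<lambda>p. M (fst p) (snd p)) (A \<times> B) * L2_set u B"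
proof -
  have "L2_set (\<lambda>a. \<Sum>b\<in>B. M a b * u b) A \<le> L2_set (\<lambda>a. L2_set u B * L2_set (M a) B) A"
    by (rule L2_set_abs_mono) (use L2_set_Cauchy_Schwarz in \<open>simp add: L2_set_nonneg mult.commute\<close>)
  also have "\<dots> = L2_set (\<lambda>p. M (fst p) (snd p)) (A \<times> B) * L2_set u B"
    by (subst L2_set_scale) (simp add: L2_set_Times L2_set_nonneg mult.commute)
  finally show ?thesis .
qed

lemma L2_set_apply_transpose_le:
  "L2_set (\<lambda>b. \<Sum>a\<in>A. M a b * u a) B \<le> L2_set (\<lambda>p. M (fst p) (snd p)) (A \<times> B) * L2_set u A"
  using L2_set_apply_le[of "\<lambda>b a. M a b" u A B] L2_set_swap[of M B A] by simp

text \<open>The operator norm of a matrix equals that of its transpose: test against the image itself.\<close>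
lemma operator_bound_transpose:
  assumes \<beta>: "0 \<le> \<beta>"
    and b: "\<And>q. L2_set (\<lambda>p. \<Sum>l\<in>L. B l p * q l) P \<le> \<beta> * L2_set q L"
  shows "L2_set (\<lambda>l. \<Sum>p\<in>P. B l p * u p) L \<le> \<beta> * L2_set u P"
proof -
  define q where "q l = (\<Sum>p\<in>P. B l p * u p)" for l
  have "(L2_set q L)\<^sup>2 = (\<Sum>l\<in>L. (\<Sum>p\<in>P. B l p * u p) * q l)"
    unfolding L2_set_power2 by (simp add: power2_eq_square flip: q_def)
  also have "\<dots> = (\<Sum>p\<in>P. (\<Sum>l\<in>L. B l p * q l) * u p)"
    unfolding sum_distrib_right by (subst sum.swap) (simp add: mult_ac)
  also have "\<dots> \<le> L2_set (\<lambda>p. \<Sum>l\<in>L. B l p * q l) P * L2_set u P"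
    by (rule order_trans[OF abs_ge_self L2_set_Cauchy_Schwarz])
  also have "\<dots> \<le> \<beta> * L2_set q L * L2_set u P"
    by (intro mult_right_mono b L2_set_nonneg)
  finally have *: "L2_set q L * L2_set q L \<le> L2_set q L * (\<beta> * L2_set u P)"
    by (simp add: power2_eq_square mult_ac)
  show ?thesis
  proof (cases "L2_set q L = 0")
    case False
    then have "0 < L2_set q L" by (simp add: L2_set_nonneg order_less_le)
    with * have "L2_set q L \<le> \<beta> * L2_set u P" by simp
    then show ?thesis by (simp add: q_def[abs_def])
  next
    case True
    then show ?thesis using \<beta> by (simp add: q_def[abs_def] L2_set_nonneg)
  qed
qed

text \<open>The decrease is measured by \<open>h\<close> and not by the norm of \<open>Q\<close>, so that the gradient norms along a
  trajectory are summable.\<close>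
lemma perturbed_gradient_step:
  fixes B Bt Ba :: "'l \<Rightarrow> 'p \<Rightarrow> real" and Q :: "'l \<Rightarrow> real" and e :: "'p \<Rightarrow> real"
  assumes op: "\<And>q. L2_set (\<lambda>p. \<Sum>l\<in>L. B l p * q l) P \<le> \<beta> * L2_set q L"
    and low: "\<mu> * L2_set Q L \<le> L2_set (\<lambda>p. \<Sum>l\<in>L. B l p * Q l) P"
    and Bt: "L2_set (\<lambda>x. Bt (fst x) (snd x) - B (fst x) (snd x)) (L \<times> P) \<le> D1"
    and Ba: "L2_set (\<lambda>x. Ba (fst x) (snd x) - B (fst x) (snd x)) (L \<times> P) \<le> D2"
    and \<mu>: "0 < \<mu>" "\<mu> \<le> \<beta>" and \<eta>: "0 < \<eta>" "\<eta> * \<beta>\<^sup>2 \<le> 1"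
    and D: "\<beta> * D1 \<le> \<mu>\<^sup>2 / 8" "\<beta> * D2 \<le> \<mu>\<^sup>2 / 8"
    and e: "L2_set e P \<le> \<epsilon>"
    and g: "\<And>p. g p = (\<Sum>l\<in>L. Bt l p * Q l) + e p"
    and Q': "\<And>l. l \<in> L \<Longrightarrow> Q' l = Q l - \<eta> * (\<Sum>p\<in>P. Ba l p * g p)"
    and h: "h = L2_set (\<lambda>p. \<Sum>l\<in>L. B l p * Q l) P"
  shows "L2_set g P \<le> 9 / 8 * h + \<epsilon>" "L2_set Q' L + \<eta> * \<mu> / 8 * h \<le> L2_set Q L + 2 * \<eta> * \<beta> * \<epsilon>"
    "\<eta> * h \<le> L2_set Q L / \<mu>"
proof -
  \<comment> \<open>The gradient is the ideal direction \<open>b\<close>, of norm \<open>h\<close>,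
    plus \<open>a\<close>, caused by \<open>Bt\<close> in place of \<open>B\<close>, plus
    \<open>e\<close>. The part \<open>a\<close> is at most \<open>h / 8\<close> and is charged to
    \<open>h\<close>; only \<open>e\<close> leaves an absolute error.\<close>
  define b where "b p = (\<Sum>l\<in>L. B l p * Q l)" for p
  define a where "a p = (\<Sum>l\<in>L. (Bt l p - B l p) * Q l)" for p
  define q where "q = L2_set Q L"
  have q0: "0 \<le> q" and h0: "0 \<le> h" and \<epsilon>0: "0 \<le> \<epsilon>"
    using order_trans[OF L2_set_nonneg e] by (auto simp: q_def h L2_set_nonneg)
  have hb: "h = L2_set b P" by (simp add: h b_def[abs_def])
  have D10: "0 \<le> D1" and D20: "0 \<le> D2" using order_trans[OF L2_set_nonneg Bt] order_trans[OF L2_set_nonneg Ba] by auto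
  have \<beta>0: "0 < \<beta>" using \<mu> by simp
  note op' = operator_bound_transpose[OF less_imp_le[OF \<beta>0] op]
  have hq: "\<mu> * q \<le> h" "h \<le> \<beta> * q" using low op by (simp_all add: h q_def)
  have small: "D \<le> \<mu> / 8" if "\<beta> * D \<le> \<mu>\<^sup>2 / 8" "0 \<le> D" for D
  proof -
    have "\<mu> * D \<le> \<beta> * D" using that \<mu> by (intro mult_right_mono)
    with that(1) have "\<mu> * D \<le> \<mu> * (\<mu> / 8)" by (simp add: power2_eq_square)
    then show ?thesis using \<mu>(1) by (simp only: mult_le_cancel_left_pos)
  qed
  have aq: "L2_set a P \<le> D1 * q"
    unfolding a_def q_def
    by (rule order_trans[OF L2_set_apply_transpose_le mult_right_mono[OF Bt L2_set_nonneg]])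
  also have D1q: "\<dots> \<le> D1 * (h / \<mu>)"
    using hq \<mu> D10 by (intro mult_left_mono) (simp_all add: field_simps)
  finally have ah: "L2_set a P \<le> D1 * (h / \<mu>)" .
  have g_eq: "g p = b p + (a p + e p)" for p
    by (simp add: g a_def b_def sum_subtractf left_diff_distrib)
  have ae: "L2_set (\<lambda>p. a p + e p) P \<le> D1 * (h / \<mu>) + \<epsilon>"
    using L2_set_triangle_ineq[of a e P] ah e by linarith
  have gh: "L2_set g P \<le> h + (D1 * (h / \<mu>) + \<epsilon>)"
    using L2_set_triangle_ineq[of b "\<lambda>p. a p + e p" P] ae unfolding hb by (simp add: g_eq[abs_def])
  have "D1 * (h / \<mu>) \<le> \<mu> / 8 * (h / \<mu>)"
    using small[OF D(1) D10] \<mu> h0 by (intro mult_right_mono) auto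
  then have D1h: "D1 * (h / \<mu>) \<le> h / 8" using \<mu> by simp
  with gh show g': "L2_set g P \<le> 9 / 8 * h + \<epsilon>" by linarith
  have "\<eta> * (\<mu> * \<beta>) \<le> \<eta> * (\<beta> * \<beta>)" using \<eta> \<mu> by (intro mult_left_mono mult_right_mono) auto
  with \<eta>(2) have \<eta>\<mu>: "\<eta> * \<mu> * \<beta> \<le> 1" by (simp add: power2_eq_square mult.assoc)
  have "\<eta> * \<mu> * h \<le> \<eta> * \<mu> * (\<beta> * q)" using hq \<eta> \<mu> by (intro mult_left_mono) auto
  also have "\<dots> \<le> 1 * q" using mult_right_mono[OF \<eta>\<mu> q0] by (simp add: mult_ac)
  finally have \<eta>h: "\<eta> * \<mu> * h \<le> q" by simp
  then show "\<eta> * h \<le> L2_set Q L / \<mu>" using \<mu> by (simp add: q_def field_simps)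
  \<comment> \<open>For the unperturbed step the cross term is
    \<open>2 * \<eta> * h\<^sup>2\<close>, and \<open>\<eta> * \<beta>\<^sup>2 \<le> 1\<close> lets
    the quadratic term consume at most half of it.\<close>
  have "(L2_set (\<lambda>l. Q l - \<eta> * y l) L)\<^sup>2
      = q\<^sup>2 - 2 * \<eta> * (\<Sum>l\<in>L. Q l * y l) + \<eta>\<^sup>2 * (L2_set y L)\<^sup>2" for y
    unfolding q_def L2_set_power2 power2_diff power_mult_distrib sum_distrib_left
    by (simp only: sum.distrib sum_subtractf) (simp add: mult_ac)
  from this[of "\<lambda>l. \<Sum>p\<in>P. B l p * b p"]
  have "(L2_set (\<lambda>l. Q l - \<eta> * (\<Sum>p\<in>P. B l p * b p)) L)\<^sup>2
      = q\<^sup>2 - 2 * \<eta> * (\<Sum>l\<in>L. Q l * (\<Sum>p\<in>P. B l p * b p)) + \<eta>\<^sup>2 * (L2_set (\<lambda>l. \<Sum>p\<in>P. B l p * b p) L)\<^sup>2" .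
  also have "(\<Sum>l\<in>L. Q l * (\<Sum>p\<in>P. B l p * b p)) = (\<Sum>p\<in>P. b p * (\<Sum>l\<in>L. B l p * Q l))"
    unfolding sum_distrib_left by (subst sum.swap) (simp add: mult_ac)
  also have "\<dots> = h\<^sup>2" unfolding hb L2_set_power2 by (simp add: power2_eq_square flip: b_def)
  also have "q\<^sup>2 - 2 * \<eta> * h\<^sup>2 + \<eta>\<^sup>2 * (L2_set (\<lambda>l. \<Sum>p\<in>P. B l p * b p) L)\<^sup>2 \<le> q\<^sup>2 - \<eta> * h\<^sup>2"
  proof -
    have "(L2_set (\<lambda>l. \<Sum>p\<in>P. B l p * b p) L)\<^sup>2 \<le> (\<beta> * h)\<^sup>2"
      unfolding hb by (intro power_mono op' L2_set_nonneg)
    then have "\<eta>\<^sup>2 * (L2_set (\<lambda>l. \<Sum>p\<in>P. B l p * b p) L)\<^sup>2 \<le> \<eta>\<^sup>2 * (\<beta> * h)\<^sup>2"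
      by (intro mult_left_mono) auto
    moreover have "\<eta> * h\<^sup>2 * (\<eta> * \<beta>\<^sup>2) \<le> \<eta> * h\<^sup>2 * 1" using \<eta> by (intro mult_left_mono) auto
    ultimately show ?thesis by (simp add: power2_eq_square algebra_simps)
  qed
  \<comment> \<open>Completing the square with \<open>\<mu> * q \<le> h\<close> turns the decrease
    of the squared norm into a decrease of the norm that is linear in \<open>h\<close>.\<close>
  also have "\<dots> \<le> (q - \<eta> * \<mu> / 2 * h)\<^sup>2"
  proof -
    have "\<eta> * h * (\<mu> * q) \<le> \<eta> * h * h" using hq \<eta> h0 by (intro mult_left_mono) auto
    moreover have "0 \<le> (\<eta> * \<mu> / 2 * h)\<^sup>2" by simp
    ultimately show ?thesis by (simp add: power2_eq_square algebra_simps)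
  qed
  finally have "(L2_set (\<lambda>l. Q l - \<eta> * (\<Sum>p\<in>P. B l p * b p)) L)\<^sup>2 \<le> (q - \<eta> * \<mu> / 2 * h)\<^sup>2"
    by simp
  moreover have "0 \<le> q - \<eta> * \<mu> / 2 * h" using \<eta>h q0 by simp
  ultimately have 1: "L2_set (\<lambda>l. Q l - \<eta> * (\<Sum>p\<in>P. B l p * b p)) L \<le> q - \<eta> * \<mu> / 2 * h"
    by (rule power2_le_imp_le)
  have 2: "L2_set (\<lambda>l. \<Sum>p\<in>P. B l p * (a p + e p)) L \<le> \<beta> * (D1 * (h / \<mu>) + \<epsilon>)"
    using order_trans[OF op' mult_left_mono[OF ae]] \<beta>0 by simp
  have 3: "L2_set (\<lambda>l. \<Sum>p\<in>P. (Ba l p - B l p) * g p) L \<le> D2 * (9 / 8 * h + \<epsilon>)"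
    by (rule order_trans[OF L2_set_apply_le mult_mono[OF Ba g']]) (use D20 in \<open>auto simp: L2_set_nonneg\<close>)
  have "L2_set Q' L = L2_set (\<lambda>l. (Q l - \<eta> * (\<Sum>p\<in>P. B l p * b p))
      - (\<eta> * (\<Sum>p\<in>P. B l p * (a p + e p)) + \<eta> * (\<Sum>p\<in>P. (Ba l p - B l p) * g p))) L"
  proof (rule L2_set_cong[OF refl])
    fix l assume l: "l \<in> L"
    have "(\<Sum>p\<in>P. Ba l p * g p)
        = (\<Sum>p\<in>P. B l p * b p) + (\<Sum>p\<in>P. B l p * (a p + e p)) + (\<Sum>p\<in>P. (Ba l p - B l p) * g p)"
      by (simp add: g_eq algebra_simps sum.distrib sum_subtractf)
    then show "Q' l = (Q l - \<eta> * (\<Sum>p\<in>P. B l p * b p))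
      - (\<eta> * (\<Sum>p\<in>P. B l p * (a p + e p)) + \<eta> * (\<Sum>p\<in>P. (Ba l p - B l p) * g p))"
      using Q'[OF l] by (simp add: algebra_simps)
  qed
  also have "\<dots> \<le> (q - \<eta> * \<mu> / 2 * h) + (\<eta> * (\<beta> * (D1 * (h / \<mu>) + \<epsilon>)) + \<eta> * (D2 * (9 / 8 * h + \<epsilon>)))"
  proof (rule order_trans[OF L2_set_triangle_diff add_mono[OF 1]], rule order_trans[OF L2_set_triangle_ineq add_mono])
    show "L2_set (\<lambda>l. \<eta> * (\<Sum>p\<in>P. B l p * (a p + e p))) L \<le> \<eta> * (\<beta> * (D1 * (h / \<mu>) + \<epsilon>))"
      using mult_left_mono[OF 2, of \<eta>] \<eta> unfolding L2_set_scale by simp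
    show "L2_set (\<lambda>l. \<eta> * (\<Sum>p\<in>P. (Ba l p - B l p) * g p)) L \<le> \<eta> * (D2 * (9 / 8 * h + \<epsilon>))"
      using mult_left_mono[OF 3, of \<eta>] \<eta> unfolding L2_set_scale by simp
  qed
  \<comment> \<open>The two perturbations cost 1/8 and 9/64 of \<open>\<eta> * \<mu> * h\<close>,
    together less than 3/8, so of the gain 1/2 at least 1/8 survives.\<close>
  also have "\<dots> \<le> q - \<eta> * \<mu> / 8 * h + 2 * \<eta> * \<beta> * \<epsilon>"
  proof -
    have "\<beta> * (D1 * (h / \<mu>)) \<le> \<mu>\<^sup>2 / 8 * (h / \<mu>)"
      using mult_right_mono[OF D(1), of "h / \<mu>"] h0 \<mu> by (simp add: mult.assoc)
    also have "\<dots> = \<mu> * h / 8" using \<mu> by (simp add: power2_eq_square)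
    finally have A: "\<beta> * (D1 * (h / \<mu>)) \<le> \<mu> * h / 8" .
    have D2: "D2 \<le> \<mu> / 8" by (rule small[OF D(2) D20])
    have B: "D2 * (9 / 8 * h) \<le> \<mu> / 8 * (9 / 8 * h)" using D2 h0 by (intro mult_right_mono) auto
    have C: "D2 * \<epsilon> \<le> \<beta> * \<epsilon>" using D2 \<mu> \<epsilon>0 by (intro mult_right_mono) auto
    have "\<mu> * h \<ge> 0" using \<mu> h0 by simp
    with A B C have "\<beta> * (D1 * (h / \<mu>) + \<epsilon>) + D2 * (9 / 8 * h + \<epsilon>) \<le> 3 / 8 * (\<mu> * h) + 2 * (\<beta> * \<epsilon>)"
      by (simp add: distrib_left)
    from mult_left_mono[OF this, of \<eta>] \<eta> show ?thesis by (simp add: algebra_simps)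
  qed
  finally show "L2_set Q' L + \<eta> * \<mu> / 8 * h \<le> L2_set Q L + 2 * \<eta> * \<beta> * \<epsilon>"
    by (simp add: q_def)
qed

section \<open>Shallow networks\<close>

text \<open>Weights are functions on index pairs: their Frobenius norm is then an
  \<open>L2_set\<close> over a product, and a sample point of the Gaussian product measure is itself
  a weight matrix.\<close>

definition preact :: "nat \<Rightarrow> (nat \<times> nat \<Rightarrow> real) \<Rightarrow> (nat \<Rightarrow> real) \<Rightarrow> nat \<Rightarrow> real" where
  "preact d W x r = (\<Sum>j<d. W (r, j) * x j)"

lemma preact_diff: "preact d W x r - preact d W' x r = preact d (\<lambda>p. W p - W' p) x r"
  by (simp add: preact_def sum_subtractf left_diff_distrib)

lemma preact_diff_right: "preact d W x r - preact d W x' r = preact d W (\<lambda>j. x j - x' j) r"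
  by (simp add: preact_def sum_subtractf right_diff_distrib)

lemma preact_L2: "L2_set (preact d W x) {..<k} \<le> L2_set W ({..<k} \<times> {..<d}) * L2_set x {..<d}"
  using L2_set_apply_le[of "\<lambda>r j. W (r, j)" x "{..<d}" "{..<k}"] by (simp add: preact_def[abs_def])

locale shallow_net =
  fixes k d :: nat and v :: "nat \<Rightarrow> real" and \<phi> \<phi>' :: "real \<Rightarrow> real" and \<Gamma> :: real
  assumes k: "0 < k"
    and deriv: "\<And>z. (\<phi> has_real_derivative \<phi>' z) (at z)"
    and bound: "\<And>z. \<bar>\<phi>' z\<bar> \<le> \<Gamma>"
    and lip: "\<And>a b. \<bar>\<phi>' a - \<phi>' b\<bar> \<le> \<Gamma> * \<bar>a - b\<bar>"
    and v: "\<And>r. r < k \<Longrightarrow> \<bar>v r\<bar> \<le> 1 / sqrt (real k)"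
    and \<Gamma>: "1 \<le> \<Gamma>"
begin

abbreviation "P \<equiv> {..<k} \<times> {..<d}"

definition out :: "(nat \<times> nat \<Rightarrow> real) \<Rightarrow> (nat \<Rightarrow> real) \<Rightarrow> real" where
  "out W x = (\<Sum>r<k. v r * \<phi> (preact d W x r))"

definition jac :: "(nat \<times> nat \<Rightarrow> real) \<Rightarrow> (nat \<Rightarrow> real) \<Rightarrow> nat \<times> nat \<Rightarrow> real" where
  "jac W x p = v (fst p) * \<phi>' (preact d W x (fst p)) * x (snd p)"

lemma L2_v_mult:
  assumes "\<And>r. r < k \<Longrightarrow> \<bar>a r\<bar> \<le> c * \<bar>b r\<bar>" "0 \<le> c"
  shows "L2_set (\<lambda>r. v r * a r) {..<k} \<le> c / sqrt (real k) * L2_set b {..<k}"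
proof -
  have "L2_set (\<lambda>r. v r * a r) {..<k} \<le> L2_set (\<lambda>r. c / sqrt (real k) * b r) {..<k}"
  proof (rule L2_set_abs_mono)
    fix r assume "r \<in> {..<k}"
    then have "\<bar>v r\<bar> * \<bar>a r\<bar> \<le> 1 / sqrt (real k) * (c * \<bar>b r\<bar>)"
      by (intro mult_mono v assms) auto
    then show "\<bar>v r * a r\<bar> \<le> \<bar>c / sqrt (real k) * b r\<bar>"
      using assms(2) by (simp add: abs_mult)
  qed
  also have "\<dots> = c / sqrt (real k) * L2_set b {..<k}"
    unfolding L2_set_scale using assms(2) by simp
  finally show ?thesis .
qed

lemma L2_v_slope:
  assumes "\<And>r. r < k \<Longrightarrow> \<bar>a r\<bar> \<le> \<Gamma>"
  shows "L2_set (\<lambda>r. v r * a r) {..<k} \<le> \<Gamma>"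
  using L2_v_mult[of a \<Gamma> "\<lambda>_. 1"] assms \<Gamma> k by (simp add: L2_set_def)

text \<open>\<open>jac\<close> is the outer product of a slope vector and the input, and the two
  factors are changed one at a time. The slope part carries \<open>1 / sqrt k\<close>: in a wide
  network, moving the weights by a bounded distance barely changes the Jacobian.\<close>

lemma jac_diff:
  "L2_set (\<lambda>p. jac W x p - jac W' x' p) P
     \<le> \<Gamma> * L2_set (\<lambda>j. x j - x' j) {..<d}
       + \<Gamma> / sqrt (real k) * L2_set (\<lambda>r. preact d W x r - preact d W' x' r) {..<k} * L2_set x' {..<d}"
proof -
  let ?a = "\<lambda>r. v r * \<phi>' (preact d W x r)" and ?b = "\<lambda>r. v r * (\<phi>' (preact d W x r) - \<phi>' (preact d W' x' r))"
  have "L2_set (\<lambda>p. jac W x p - jac W' x' p) P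
      = L2_set (\<lambda>p. ?a (fst p) * (x (snd p) - x' (snd p)) + ?b (fst p) * x' (snd p)) P"
    by (simp add: jac_def algebra_simps)
  also have "\<dots> \<le> L2_set (\<lambda>p. ?a (fst p) * (x (snd p) - x' (snd p))) P + L2_set (\<lambda>p. ?b (fst p) * x' (snd p)) P"
    by (rule L2_set_triangle_ineq)
  also have "\<dots> = L2_set ?a {..<k} * L2_set (\<lambda>j. x j - x' j) {..<d} + L2_set ?b {..<k} * L2_set x' {..<d}"
    using L2_set_prod[of ?a "\<lambda>j. x j - x' j" "{..<k}" "{..<d}"] L2_set_prod[of ?b x' "{..<k}" "{..<d}"] by simp
  also have "\<dots> \<le> \<Gamma> * L2_set (\<lambda>j. x j - x' j) {..<d}
       + \<Gamma> / sqrt (real k) * L2_set (\<lambda>r. preact d W x r - preact d W' x' r) {..<k} * L2_set x' {..<d}"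
    using \<Gamma> by (intro add_mono mult_right_mono L2_v_slope L2_v_mult bound lip L2_set_nonneg) auto
  finally show ?thesis .
qed

text \<open>Restricting to segments in weight space reduces everything to the one-variable mean
  value theorem.\<close>

definition interp :: "real \<Rightarrow> (nat \<times> nat \<Rightarrow> real) \<Rightarrow> (nat \<times> nat \<Rightarrow> real) \<Rightarrow> nat \<times> nat \<Rightarrow> real" where
  "interp s W W' p = W p + s * (W' p - W p)"

lemma interp_0 [simp]: "interp 0 W W' = W" and interp_1 [simp]: "interp 1 W W' = W'"
  by (simp_all add: interp_def fun_eq_iff)

lemma interp_dist:
  assumes "0 \<le> s" "s \<le> 1" "L2_set (\<lambda>p. W p - W0 p) P \<le> R" "L2_set (\<lambda>p. W' p - W0 p) P \<le> R"
  shows "L2_set (\<lambda>p. interp s W W' p - W0 p) P \<le> R"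
proof -
  have "L2_set (\<lambda>p. interp s W W' p - W0 p) P = L2_set (\<lambda>p. (1 - s) * (W p - W0 p) + s * (W' p - W0 p)) P"
    by (simp add: interp_def algebra_simps)
  also have "\<dots> \<le> (1 - s) * L2_set (\<lambda>p. W p - W0 p) P + s * L2_set (\<lambda>p. W' p - W0 p) P"
    using assms(1,2) by (intro order_trans[OF L2_set_triangle_ineq]) (simp add: L2_set_scale)
  also have "\<dots> \<le> (1 - s) * R + s * R"
    using assms by (intro add_mono mult_left_mono) auto
  finally show ?thesis by (simp add: algebra_simps)
qed

lemma out_interp_deriv:
  "((\<lambda>s. out (interp s W W') x) has_real_derivative
     (\<Sum>p\<in>P. jac (interp s W W') x p * (W' p - W p))) (at s)"
proof -
  have pre: "preact d (interp s W W') x r = preact d W x r + s * preact d (\<lambda>p. W' p - W p) x r" for s r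
    by (simp add: preact_def interp_def sum.distrib sum_subtractf sum_distrib_left algebra_simps)
  have "((\<lambda>s. out (interp s W W') x) has_real_derivative
     (\<Sum>r<k. v r * (\<phi>' (preact d (interp s W W') x r) * preact d (\<lambda>p. W' p - W p) x r))) (at s)"
    unfolding out_def pre
    by (intro DERIV_sum DERIV_cmult DERIV_chain2[OF deriv]) (auto intro!: derivative_eq_intros)
  also have "(\<Sum>r<k. v r * (\<phi>' (preact d (interp s W W') x r) * preact d (\<lambda>p. W' p - W p) x r))
      = (\<Sum>r<k. \<Sum>j<d. jac (interp s W W') x (r, j) * (W' (r, j) - W (r, j)))"
    unfolding jac_def preact_def[of d "\<lambda>p. W' p - W p"] by (simp add: sum_distrib_left mult_ac)
  also have "\<dots> = (\<Sum>p\<in>P. jac (interp s W W') x p * (W' p - W p))"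
    by (simp add: sum.cartesian_product case_prod_beta)
  finally show ?thesis .
qed

lemma out_mvt:
  obtains s where "0 \<le> s" "s \<le> 1" "out W' x - out W x = (\<Sum>p\<in>P. jac (interp s W W') x p * (W' p - W p))"
proof -
  have "\<exists>s. 0 < s \<and> s < 1 \<and> out (interp 1 W W') x - out (interp 0 W W') x
      = (1 - 0) * (\<Sum>p\<in>P. jac (interp s W W') x p * (W' p - W p))"
    by (rule MVT2) (auto intro: out_interp_deriv)
  then show ?thesis using that by (auto intro: less_imp_le)
qed

text \<open>Applying the mean value theorem to the difference, and not to each output, gives the
  same \<open>s\<close> for both inputs, so that a small difference of Jacobians appears.\<close>

lemma out_mvt_diff:
  obtains s where "0 \<le> s" "s \<le> 1"
    "(out W' x - out W' z) - (out W x - out W z)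
       = (\<Sum>p\<in>P. (jac (interp s W W') x p - jac (interp s W W') z p) * (W' p - W p))"
proof -
  have "\<exists>s. 0 < s \<and> s < 1 \<and> (out (interp 1 W W') x - out (interp 1 W W') z) - (out (interp 0 W W') x - out (interp 0 W W') z)
      = (1 - 0) * ((\<Sum>p\<in>P. jac (interp s W W') x p * (W' p - W p)) - (\<Sum>p\<in>P. jac (interp s W W') z p * (W' p - W p)))"
    by (rule MVT2) (auto intro!: DERIV_diff out_interp_deriv)
  then show ?thesis using that by (auto intro: less_imp_le simp: sum_subtractf left_diff_distrib)
qed

text \<open>The change of the preactivations is \<open>W - W0\<close> applied to
  \<open>x - z\<close>, at most \<open>R * \<epsilon>\<close>, plus \<open>W0\<close> applied to
  \<open>x - z\<close>, which depends on the initialisation only and is bounded with high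
  probability later.\<close>

lemma jac_diff_ball:
  assumes W: "L2_set (\<lambda>p. W p - W0 p) P \<le> R" and x: "L2_set (\<lambda>j. x j - z j) {..<d} \<le> \<epsilon>"
    and z: "L2_set z {..<d} = 1"
  shows "L2_set (\<lambda>p. jac W x p - jac W z p) P
     \<le> \<Gamma> * \<epsilon> + \<Gamma> / sqrt (real k) * (R * \<epsilon> + L2_set (preact d W0 (\<lambda>j. x j - z j)) {..<k})"
proof -
  have R: "0 \<le> R" using order_trans[OF L2_set_nonneg W] .
  have "L2_set (\<lambda>r. preact d W x r - preact d W z r) {..<k}
      = L2_set (\<lambda>r. preact d (\<lambda>p. W p - W0 p) (\<lambda>j. x j - z j) r + preact d W0 (\<lambda>j. x j - z j) r) {..<k}"
    by (simp add: preact_diff_right flip: preact_diff)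
  also have "\<dots> \<le> R * \<epsilon> + L2_set (preact d W0 (\<lambda>j. x j - z j)) {..<k}"
    using R order_trans[OF preact_L2 mult_mono[OF W x R L2_set_nonneg]]
    by (intro order_trans[OF L2_set_triangle_ineq] add_mono) auto
  finally show ?thesis
    using \<Gamma> x by (intro order_trans[OF jac_diff] add_mono mult_left_mono) (auto simp: z intro!: mult_left_mono divide_right_mono)
qed

text \<open>Here the weights move as well, so \<open>R\<close> appears without the factor
  \<epsilon>; only the division by \<open>sqrt k\<close> makes this term small.\<close>

lemma jac_diff_init:
  assumes W: "L2_set (\<lambda>p. W p - W0 p) P \<le> R" and x: "L2_set (\<lambda>j. x j - z j) {..<d} \<le> \<epsilon>"
    and z: "L2_set z {..<d} = 1" and x1: "L2_set x {..<d} = 1"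
  shows "L2_set (\<lambda>p. jac W x p - jac W0 z p) P
     \<le> \<Gamma> * \<epsilon> + \<Gamma> / sqrt (real k) * (R + L2_set (preact d W0 (\<lambda>j. x j - z j)) {..<k})"
proof -
  have R: "0 \<le> R" using order_trans[OF L2_set_nonneg W] .
  have "L2_set (\<lambda>r. preact d W x r - preact d W0 z r) {..<k}
      = L2_set (\<lambda>r. preact d (\<lambda>p. W p - W0 p) x r + preact d W0 (\<lambda>j. x j - z j) r) {..<k}"
    by (simp flip: preact_diff_right preact_diff)
  also have "\<dots> \<le> R + L2_set (preact d W0 (\<lambda>j. x j - z j)) {..<k}"
    using order_trans[OF preact_L2[of d "\<lambda>p. W p - W0 p" x k]] W x1
    by (intro order_trans[OF L2_set_triangle_ineq] add_mono) auto
  finally show ?thesis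
    using \<Gamma> x by (intro order_trans[OF jac_diff] add_mono mult_left_mono) (auto simp: z intro!: mult_left_mono divide_right_mono)
qed

end

section \<open>Gradient descent on clustered data\<close>

locale clusters =
  fixes n K :: nat and cl :: "nat \<Rightarrow> nat"
  assumes cl: "\<And>i. i < n \<Longrightarrow> cl i < K"
begin

definition block :: "nat \<Rightarrow> nat set" where "block l = {i. i < n \<and> cl i = l}"

text \<open>Coordinates with respect to the orthonormal family of normalised indicators; an empty
  block contributes 0 by the convention for division.\<close>

definition agg :: "(nat \<Rightarrow> real) \<Rightarrow> nat \<Rightarrow> real" where
  "agg u l = (\<Sum>i\<in>block l. u i) / sqrt (real (card (block l)))"

definition avg :: "(nat \<Rightarrow> real) \<Rightarrow> nat \<Rightarrow> real" where
  "avg u l = (\<Sum>i\<in>block l. u i) / real (card (block l))"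

lemma finite_block [simp]: "finite (block l)"
  by (simp add: block_def)

lemma card_block_pos: "i < n \<Longrightarrow> 0 < card (block (cl i))"
  by (auto simp: card_gt_0_iff block_def)

lemma sum_clusters: "(\<Sum>i<n. f i) = (\<Sum>l<K. \<Sum>i\<in>block l. f i)"
  using sum.group[of "{..<n}" "{..<K}" cl f] cl by (simp add: block_def image_subset_iff)

lemma agg_L2: "L2_set (agg u) {..<K} \<le> L2_set u {..<n}"
  unfolding L2_set_def
proof (rule real_sqrt_le_mono)
  have "(agg u l)\<^sup>2 \<le> (\<Sum>i\<in>block l. (u i)\<^sup>2)" for l
  proof -
    have "(\<Sum>i\<in>block l. u i)\<^sup>2 \<le> real (card (block l)) * (\<Sum>i\<in>block l. (u i)\<^sup>2)"
      using sum_squared_le_sum_of_squares[of u "block l"] by (simp add: mult.commute)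
    then show ?thesis
      by (cases "block l = {}") (auto simp: agg_def power_divide divide_le_eq mult.commute card_gt_0_iff)
  qed
  then show "(\<Sum>l<K. (agg u l)\<^sup>2) \<le> (\<Sum>i<n. (u i)\<^sup>2)"
    unfolding sum_clusters by (rule sum_mono)
qed

lemma agg_const: "agg (\<lambda>i. f (cl i)) l = sqrt (real (card (block l))) * f l"
proof -
  have "(\<Sum>i\<in>block l. f (cl i)) = real (card (block l)) * f l" by (simp add: block_def)
  then show ?thesis by (simp add: agg_def real_div_sqrt flip: times_divide_eq_left)
qed

lemma avg_L2: "L2_set (\<lambda>i. avg u (cl i)) {..<n} = L2_set (agg u) {..<K}"
proof -
  have "(\<Sum>i<n. (avg u (cl i))\<^sup>2) = (\<Sum>l<K. \<Sum>i\<in>block l. (avg u l)\<^sup>2)"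
    unfolding sum_clusters by (intro sum.cong) (auto simp: block_def)
  also have "\<dots> = (\<Sum>l<K. (agg u l)\<^sup>2)"
    by (intro sum.cong) (auto simp: avg_def agg_def power2_eq_square)
  finally show ?thesis by (simp add: L2_set_def)
qed

lemma resid_avg_L2: "L2_set (\<lambda>i. u i - avg u (cl i)) {..<n} \<le> L2_set u {..<n}"
  unfolding L2_set_def
proof (rule real_sqrt_le_mono)
  have "(\<Sum>i\<in>block l. (u i - avg u (cl i))\<^sup>2) \<le> (\<Sum>i\<in>block l. (u i)\<^sup>2)" for l
  proof -
    have "(\<Sum>i\<in>block l. (u i - avg u (cl i))\<^sup>2) = (\<Sum>i\<in>block l. (u i)\<^sup>2 - 2 * avg u l * u i + (avg u l)\<^sup>2)"
      by (intro sum.cong) (auto simp: block_def power2_diff)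
    also have "\<dots> = (\<Sum>i\<in>block l. (u i)\<^sup>2) - 2 * avg u l * (\<Sum>i\<in>block l. u i) + card (block l) * (avg u l)\<^sup>2"
      by (simp add: sum.distrib sum_subtractf sum_distrib_left)
    also have "(\<Sum>i\<in>block l. u i) = card (block l) * avg u l"
      by (cases "block l = {}") (simp_all add: avg_def)
    finally have "(\<Sum>i\<in>block l. (u i - avg u (cl i))\<^sup>2) = (\<Sum>i\<in>block l. (u i)\<^sup>2) - card (block l) * (avg u l)\<^sup>2"
      by (simp add: power2_eq_square)
    then show ?thesis by simp
  qed
  then show "(\<Sum>i<n. (u i - avg u (cl i))\<^sup>2) \<le> (\<Sum>i<n. (u i)\<^sup>2)"
    unfolding sum_clusters by (rule sum_mono)
qed

text \<open>For every parameter \<open>p\<close> separately, \<open>agg\<close> is a contraction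
  from data indices to clusters. Exchanging the order of the norms transfers Frobenius bounds for
  per-input Jacobians to the aggregated ones.\<close>

lemma agg_L2_Times:
  "L2_set (\<lambda>x. agg (\<lambda>i. M i (snd x)) (fst x)) ({..<K} \<times> P) \<le> L2_set (\<lambda>i. L2_set (M i) P) {..<n}"
proof -
  have "L2_set (\<lambda>x. agg (\<lambda>i. M i (snd x)) (fst x)) ({..<K} \<times> P)
      = L2_set (\<lambda>p. L2_set (agg (\<lambda>i. M i p)) {..<K}) P"
    using L2_set_swap[of "\<lambda>p l. agg (\<lambda>i. M i p) l" "{..<K}" P]
      L2_set_Times[of "\<lambda>p l. agg (\<lambda>i. M i p) l" P "{..<K}"] by simp
  also have "\<dots> \<le> L2_set (\<lambda>p. L2_set (\<lambda>i. M i p) {..<n}) P"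
    by (intro L2_set_mono agg_L2 L2_set_nonneg)
  also have "\<dots> = L2_set (\<lambda>i. L2_set (M i) P) {..<n}"
    using L2_set_swap[of "\<lambda>p i. M i p" "{..<n}" P] L2_set_Times[of "\<lambda>p i. M i p" P "{..<n}"]
      L2_set_Times[of M "{..<n}" P] by simp
  finally show ?thesis .
qed

end

lemma L2_set_const: "L2_set (\<lambda>_. c) {..<n::nat} = sqrt (real n) * \<bar>c\<bar>"
  by (simp add: L2_set_def real_sqrt_mult)

locale clustered_gd = shallow_net k d v \<phi> \<phi>' \<Gamma> + clusters n K cl
  for k d v \<phi> \<phi>' \<Gamma> n K cl +
  fixes X c :: "nat \<Rightarrow> nat \<Rightarrow> real" and y :: "nat \<Rightarrow> real" and \<eta> \<epsilon> :: real
    and W0 :: "nat \<times> nat \<Rightarrow> real"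
  assumes X: "\<And>i. i < n \<Longrightarrow> L2_set (X i) {..<d} = 1"
    and c: "\<And>l. l < K \<Longrightarrow> L2_set (c l) {..<d} = 1"
    and near: "\<And>i. i < n \<Longrightarrow> L2_set (\<lambda>j. X i j - c (cl i) j) {..<d} \<le> \<epsilon>"
    and y: "\<And>i. i < n \<Longrightarrow> \<bar>y i\<bar> \<le> 1"
    and \<eta>: "0 < \<eta>" and \<epsilon>: "0 \<le> \<epsilon>"
begin

definition res :: "(nat \<times> nat \<Rightarrow> real) \<Rightarrow> nat \<Rightarrow> real" where
  "res W i = out W (X i) - y i"

definition gap :: "(nat \<times> nat \<Rightarrow> real) \<Rightarrow> nat \<Rightarrow> real" where
  "gap W i = out W (X i) - out W (c (cl i))"

definition gr :: "(nat \<times> nat \<Rightarrow> real) \<Rightarrow> nat \<times> nat \<Rightarrow> real" where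
  "gr W p = (\<Sum>i<n. res W i * jac W (X i) p)"

primrec gd :: "nat \<Rightarrow> nat \<times> nat \<Rightarrow> real" where
  "gd 0 = W0"
| "gd (Suc t) = (\<lambda>p. gd t p - \<eta> * gr (gd t) p)"

text \<open>The factor is the norm of the cluster indicator, so that with all inputs at their
  centers the gradient is exactly \<open>cjac\<close> transposed applied to
  \<open>agg (res W)\<close>.\<close>

definition cjac :: "(nat \<times> nat \<Rightarrow> real) \<Rightarrow> nat \<Rightarrow> nat \<times> nat \<Rightarrow> real" where
  "cjac W l p = sqrt (real (card (block l))) * jac W (c l) p"

text \<open>The second sum is the only place where the residual component orthogonal to the
  indicators enters the gradient.\<close>

lemma gr_split:
  "gr W p = (\<Sum>l<K. cjac W l p * agg (res W) l) + (\<Sum>i<n. (jac W (X i) p - jac W (c (cl i)) p) * res W i)"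
proof -
  have "(\<Sum>i<n. jac W (c (cl i)) p * res W i) = (\<Sum>l<K. \<Sum>i\<in>block l. jac W (c l) p * res W i)"
    unfolding sum_clusters by (intro sum.cong) (auto simp: block_def)
  also have "\<dots> = (\<Sum>l<K. cjac W l p * agg (res W) l)"
  proof (intro sum.cong refl)
    fix l
    show "(\<Sum>i\<in>block l. jac W (c l) p * res W i) = cjac W l p * agg (res W) l"
      by (cases "block l = {}") (simp_all add: cjac_def agg_def sum_distrib_left[symmetric])
  qed
  finally show ?thesis by (simp add: gr_def left_diff_distrib sum_subtractf mult.commute[of "res W _"])
qed

text \<open>Within a cluster the output at the center is constant, so subtracting cluster averages
  removes it. What remains comes from \<open>gap W\<close> and from the labels, whose norm is at
  most \<open>sqrt n\<close>.\<close>

lemma res_L2: "L2_set (res W) {..<n} \<le> L2_set (agg (res W)) {..<K} + L2_set (gap W) {..<n} + sqrt (real n)"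
proof -
  define u where "u i = gap W i - y i" for i
  have "res W i - avg (res W) (cl i) = u i - avg u (cl i)" if i: "i < n" for i
  proof -
    have "res W j = u j + out W (c (cl i))" if "j \<in> block (cl i)" for j
      using that by (simp add: res_def u_def gap_def block_def)
    then have "avg (res W) (cl i) = avg u (cl i) + out W (c (cl i))"
      using card_block_pos[OF i] by (auto simp: avg_def sum.distrib add_divide_distrib card_gt_0_iff)
    then show ?thesis by (simp add: res_def u_def gap_def)
  qed
  then have "L2_set (\<lambda>i. res W i - avg (res W) (cl i)) {..<n} = L2_set (\<lambda>i. u i - avg u (cl i)) {..<n}"
    by (intro L2_set_cong) auto
  also have "\<dots> \<le> L2_set u {..<n}" by (rule resid_avg_L2)
  also have "\<dots> \<le> L2_set (gap W) {..<n} + L2_set y {..<n}"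
    unfolding u_def by (rule L2_set_triangle_diff)
  also have "L2_set y {..<n} \<le> L2_set (\<lambda>_. 1) {..<n}"
    by (rule L2_set_abs_mono) (use y in auto)
  finally have "L2_set (\<lambda>i. res W i - avg (res W) (cl i)) {..<n} \<le> L2_set (gap W) {..<n} + sqrt (real n)"
    by (simp add: L2_set_const)
  then show ?thesis
    using L2_set_triangle_ineq[of "\<lambda>i. avg (res W) (cl i)" "\<lambda>i. res W i - avg (res W) (cl i)" "{..<n}"]
    by (simp add: avg_L2)
qed

end

text \<open>\<open>\<mu>\<close> and \<open>\<beta>\<close> enclose the singular values of the
  initial Jacobian at the centers, \<open>b\<close> and \<open>a\<close> bound the initial residual
  and gap, and \<open>D\<close> bounds the effect of leaving the centers. The last two assumptions
  close the bootstrap: as long as the residual stays below \<open>\<rho>\<close> and the weights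
  within \<open>R\<close>, the accumulated drift up to time \<open>T\<close> keeps them
  there.\<close>

locale gd_regime = clustered_gd +
  fixes \<sigma> \<beta> \<mu> a b R D \<rho> :: real and T :: nat
  assumes init_near: "L2_set (\<lambda>i. L2_set (preact d W0 (\<lambda>j. X i j - c (cl i) j)) {..<k}) {..<n} \<le> \<sigma> * sqrt (real n) * sqrt (real k) * \<epsilon>"
    and op: "\<And>q. L2_set (\<lambda>p. \<Sum>l<K. cjac W0 l p * q l) P \<le> \<beta> * L2_set q {..<K}"
    and low: "\<And>q. \<mu> * L2_set q {..<K} \<le> L2_set (\<lambda>p. \<Sum>l<K. cjac W0 l p * q l) P"
    and \<mu>: "0 < \<mu>" "\<mu> \<le> \<beta>" and \<eta>\<beta>: "\<eta> * \<beta>\<^sup>2 \<le> 1"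
    and Rk: "R \<le> sqrt (real k)" and \<sigma>: "0 \<le> \<sigma>"
    and D: "D = (2 + \<sigma>) * \<Gamma> * \<epsilon> * sqrt (real n)"
    and small: "\<beta> * (sqrt (real n) * \<Gamma> * ((1 + \<sigma>) * \<epsilon> + R / sqrt (real k))) \<le> \<mu>\<^sup>2 / 8"
    and b: "L2_set (res W0) {..<n} \<le> b"
    and a: "L2_set (gap W0) {..<n} \<le> a"
    and \<rho>0: "0 \<le> \<rho>"
    and \<rho>: "b + 2 * real T * \<eta> * \<beta> * (D * \<rho>) + (a + D * R) + sqrt (real n) \<le> \<rho>"
    and R: "9 / \<mu> * (b + 2 * real T * \<eta> * \<beta> * (D * \<rho>)) + real T * \<eta> * (D * \<rho>) \<le> R"
begin

lemma D0: "0 \<le> D" using D \<sigma> \<epsilon> \<Gamma> by simp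

lemma b0: "0 \<le> b" and a0: "0 \<le> a"
  using order_trans[OF L2_set_nonneg b] order_trans[OF L2_set_nonneg a] by auto

text \<open>The weights \<open>Wf i\<close> depend on \<open>i\<close> because each input has its
  own intermediate point. By \<open>R \<le> sqrt k\<close> the movement of the weights costs no more
  than another \<open>\<Gamma> * \<epsilon>\<close>, whence the 2 in \<open>D\<close>.\<close>

lemma jac_near_L2:
  assumes "\<And>i. i < n \<Longrightarrow> L2_set (\<lambda>p. Wf i p - W0 p) P \<le> R"
  shows "L2_set (\<lambda>i. L2_set (\<lambda>p. jac (Wf i) (X i) p - jac (Wf i) (c (cl i)) p) P) {..<n} \<le> D"
proof (cases "n = 0")
  case True
  then show ?thesis using D0 by simp
next
  case False
  then have R0: "0 \<le> R" using order_trans[OF L2_set_nonneg assms[of 0]] by simp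
  have "L2_set (\<lambda>i. L2_set (\<lambda>p. jac (Wf i) (X i) p - jac (Wf i) (c (cl i)) p) P) {..<n}
      \<le> L2_set (\<lambda>i. 2 * \<Gamma> * \<epsilon> + \<Gamma> / sqrt (real k) * L2_set (preact d W0 (\<lambda>j. X i j - c (cl i) j)) {..<k}) {..<n}"
  proof (rule L2_set_mono)
    fix i assume "i \<in> {..<n}"
    then have i: "i < n" by simp
    have "\<Gamma> / sqrt (real k) * (R * \<epsilon>) = \<Gamma> * \<epsilon> * (R / sqrt (real k))" by simp
    also have "\<dots> \<le> \<Gamma> * \<epsilon> * 1"
      using Rk k \<Gamma> \<epsilon> by (intro mult_left_mono) (auto simp: divide_le_eq)
    finally show "L2_set (\<lambda>p. jac (Wf i) (X i) p - jac (Wf i) (c (cl i)) p) P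
      \<le> 2 * \<Gamma> * \<epsilon> + \<Gamma> / sqrt (real k) * L2_set (preact d W0 (\<lambda>j. X i j - c (cl i) j)) {..<k}"
      using jac_diff_ball[OF assms[OF i] near[OF i] c[OF cl[OF i]]] by (simp add: distrib_left)
  qed (simp add: L2_set_nonneg)
  also have "\<dots> \<le> sqrt (real n) * (2 * \<Gamma> * \<epsilon>) + \<Gamma> / sqrt (real k) * (\<sigma> * sqrt (real n) * sqrt (real k) * \<epsilon>)"
  proof (rule order_trans[OF L2_set_triangle_ineq add_mono])
    show "L2_set (\<lambda>i. 2 * \<Gamma> * \<epsilon>) {..<n} \<le> sqrt (real n) * (2 * \<Gamma> * \<epsilon>)"
      unfolding L2_set_const using \<Gamma> \<epsilon> by simp
    show "L2_set (\<lambda>i. \<Gamma> / sqrt (real k) * L2_set (preact d W0 (\<lambda>j. X i j - c (cl i) j)) {..<k}) {..<n}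
        \<le> \<Gamma> / sqrt (real k) * (\<sigma> * sqrt (real n) * sqrt (real k) * \<epsilon>)"
      unfolding L2_set_scale using mult_left_mono[OF init_near, of "\<Gamma> / sqrt (real k)"] \<Gamma> by simp
  qed
  also have "\<dots> = D" using k by (simp add: D algebra_simps)
  finally show ?thesis .
qed

lemma jac_init_L2:
  assumes "\<And>i. i < n \<Longrightarrow> L2_set (\<lambda>p. Wf i p - W0 p) P \<le> R"
  shows "L2_set (\<lambda>i. L2_set (\<lambda>p. jac (Wf i) (X i) p - jac W0 (c (cl i)) p) P) {..<n}
     \<le> sqrt (real n) * \<Gamma> * ((1 + \<sigma>) * \<epsilon> + R / sqrt (real k))"
proof (cases "n = 0")
  case False
  then have R0: "0 \<le> R" using order_trans[OF L2_set_nonneg assms[of 0]] by simp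
  have "L2_set (\<lambda>i. L2_set (\<lambda>p. jac (Wf i) (X i) p - jac W0 (c (cl i)) p) P) {..<n}
      \<le> L2_set (\<lambda>i. (\<Gamma> * \<epsilon> + \<Gamma> / sqrt (real k) * R) + \<Gamma> / sqrt (real k) * L2_set (preact d W0 (\<lambda>j. X i j - c (cl i) j)) {..<k}) {..<n}"
  proof (rule L2_set_mono)
    fix i assume "i \<in> {..<n}"
    then have i: "i < n" by simp
    show "L2_set (\<lambda>p. jac (Wf i) (X i) p - jac W0 (c (cl i)) p) P
      \<le> (\<Gamma> * \<epsilon> + \<Gamma> / sqrt (real k) * R) + \<Gamma> / sqrt (real k) * L2_set (preact d W0 (\<lambda>j. X i j - c (cl i) j)) {..<k}"
      using jac_diff_init[OF assms[OF i] near[OF i] c[OF cl[OF i]] X[OF i]] by (simp add: distrib_left)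
  qed (simp add: L2_set_nonneg)
  also have "\<dots> \<le> sqrt (real n) * (\<Gamma> * \<epsilon> + \<Gamma> / sqrt (real k) * R) + \<Gamma> / sqrt (real k) * (\<sigma> * sqrt (real n) * sqrt (real k) * \<epsilon>)"
  proof (rule order_trans[OF L2_set_triangle_ineq add_mono])
    show "L2_set (\<lambda>i. \<Gamma> * \<epsilon> + \<Gamma> / sqrt (real k) * R) {..<n} \<le> sqrt (real n) * (\<Gamma> * \<epsilon> + \<Gamma> / sqrt (real k) * R)"
      unfolding L2_set_const using \<Gamma> \<epsilon> R0 by simp
    show "L2_set (\<lambda>i. \<Gamma> / sqrt (real k) * L2_set (preact d W0 (\<lambda>j. X i j - c (cl i) j)) {..<k}) {..<n}
        \<le> \<Gamma> / sqrt (real k) * (\<sigma> * sqrt (real n) * sqrt (real k) * \<epsilon>)"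
      unfolding L2_set_scale using mult_left_mono[OF init_near, of "\<Gamma> / sqrt (real k)"] \<Gamma> by simp
  qed
  also have "\<dots> = sqrt (real n) * \<Gamma> * ((1 + \<sigma>) * \<epsilon> + R / sqrt (real k))"
    using k by (simp add: algebra_simps)
  finally show ?thesis .
qed simp

text \<open>At the centers the argument of \<open>jac_diff_init\<close> is run with distance 0; the
  bound is then enlarged to the one of \<open>jac_init_L2\<close>, so that one constant serves both
  Jacobians of a step.\<close>

lemma jac_center_L2:
  assumes W: "L2_set (\<lambda>p. W p - W0 p) P \<le> R"
  shows "L2_set (\<lambda>i. L2_set (\<lambda>p. jac W (c (cl i)) p - jac W0 (c (cl i)) p) P) {..<n}
     \<le> sqrt (real n) * \<Gamma> * ((1 + \<sigma>) * \<epsilon> + R / sqrt (real k))"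
proof -
  have R0: "0 \<le> R" using order_trans[OF L2_set_nonneg W] by simp
  have "L2_set (\<lambda>i. L2_set (\<lambda>p. jac W (c (cl i)) p - jac W0 (c (cl i)) p) P) {..<n}
      \<le> L2_set (\<lambda>i. \<Gamma> / sqrt (real k) * R) {..<n}"
  proof (rule L2_set_mono)
    fix i assume "i \<in> {..<n}"
    then have i: "i < n" by simp
    show "L2_set (\<lambda>p. jac W (c (cl i)) p - jac W0 (c (cl i)) p) P \<le> \<Gamma> / sqrt (real k) * R"
      using jac_diff_init[OF W _ c[OF cl[OF i]] c[OF cl[OF i]], of 0] by (simp add: preact_def[abs_def] L2_set_def)
  qed (simp add: L2_set_nonneg)
  also have "\<dots> = sqrt (real n) * \<Gamma> * (R / sqrt (real k))"
    unfolding L2_set_const using \<Gamma> R0 by simp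
  also have "\<dots> \<le> sqrt (real n) * \<Gamma> * ((1 + \<sigma>) * \<epsilon> + R / sqrt (real k))"
    using \<Gamma> \<sigma> \<epsilon> by (intro mult_left_mono) auto
  finally show ?thesis .
qed

text \<open>The drift of the gap is a difference of Jacobians, of size \<open>D\<close>, times the
  distance from \<open>W0\<close>, at most \<open>R\<close>.\<close>

lemma gap_L2:
  assumes W: "L2_set (\<lambda>p. W p - W0 p) P \<le> R"
  shows "L2_set (gap W) {..<n} \<le> a + D * R"
proof -
  have R0: "0 \<le> R" using order_trans[OF L2_set_nonneg W] by simp
  have ex: "\<exists>s. 0 \<le> s \<and> s \<le> 1 \<and> gap W i - gap W0 i
       = (\<Sum>p\<in>P. (jac (interp s W0 W) (X i) p - jac (interp s W0 W) (c (cl i)) p) * (W p - W0 p))" for i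
    unfolding gap_def by (rule out_mvt_diff[of W "X i" "c (cl i)" W0]) blast
  obtain s where s: "0 \<le> s i \<and> s i \<le> 1 \<and> gap W i - gap W0 i
       = (\<Sum>p\<in>P. (jac (interp (s i) W0 W) (X i) p - jac (interp (s i) W0 W) (c (cl i)) p) * (W p - W0 p))" for i
    by (rule exE[OF choice[OF allI[OF ex]]]) (rule that, erule spec)
  note s = s[THEN conjunct1] s[THEN conjunct2, THEN conjunct1] s[THEN conjunct2, THEN conjunct2]
  have ball: "L2_set (\<lambda>p. interp (s i) W0 W p - W0 p) P \<le> R" for i
    using W R0 by (intro interp_dist s) (auto simp: L2_set_def)
  have "L2_set (\<lambda>i. gap W i - gap W0 i) {..<n}
      \<le> L2_set (\<lambda>i. R * L2_set (\<lambda>p. jac (interp (s i) W0 W) (X i) p - jac (interp (s i) W0 W) (c (cl i)) p) P) {..<n}"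
  proof (rule L2_set_abs_mono)
    fix i
    have "\<bar>gap W i - gap W0 i\<bar> \<le> L2_set (\<lambda>p. jac (interp (s i) W0 W) (X i) p - jac (interp (s i) W0 W) (c (cl i)) p) P * L2_set (\<lambda>p. W p - W0 p) P"
      unfolding s(3) by (rule L2_set_Cauchy_Schwarz)
    also have "\<dots> \<le> L2_set (\<lambda>p. jac (interp (s i) W0 W) (X i) p - jac (interp (s i) W0 W) (c (cl i)) p) P * R"
      by (intro mult_left_mono W L2_set_nonneg)
    finally show "\<bar>gap W i - gap W0 i\<bar> \<le> \<bar>R * L2_set (\<lambda>p. jac (interp (s i) W0 W) (X i) p - jac (interp (s i) W0 W) (c (cl i)) p) P\<bar>"
      using R0 by (simp add: abs_mult L2_set_nonneg mult.commute)
  qed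
  also have "\<dots> \<le> R * D"
    unfolding L2_set_scale using jac_near_L2[OF ball] R0 by (simp add: mult_left_mono)
  finally show ?thesis
    using L2_set_triangle_ineq[of "gap W0" "\<lambda>i. gap W i - gap W0 i" "{..<n}"] a by (simp add: mult.commute)
qed

definition h :: "nat \<Rightarrow> real" where
  "h t = L2_set (\<lambda>p. \<Sum>l<K. cjac W0 l p * agg (res (gd t)) l) P"

lemma h_nonneg: "0 \<le> h t"
  by (simp add: h_def L2_set_nonneg)

text \<open>\<open>Bt\<close> is the Jacobian at the centers with current weights, \<open>Ba\<close>
  the aggregated Jacobian at the inputs with intermediate weights. Only the last claim needs the
  next iterate in the ball; the first two are available beforehand and serve to prove that it is
  there.\<close>

lemma step:
  assumes W: "L2_set (\<lambda>p. gd t p - W0 p) P \<le> R" and r: "L2_set (res (gd t)) {..<n} \<le> \<rho>"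
  shows "L2_set (gr (gd t)) P \<le> 9 / 8 * h t + D * \<rho>"
    and "\<eta> * h t \<le> L2_set (agg (res (gd t))) {..<K} / \<mu>"
    and "L2_set (\<lambda>p. gd (Suc t) p - W0 p) P \<le> R \<Longrightarrow>
      L2_set (agg (res (gd (Suc t)))) {..<K} + \<eta> * \<mu> / 8 * h t \<le> L2_set (agg (res (gd t))) {..<K} + 2 * \<eta> * \<beta> * (D * \<rho>)"
proof -
  define D2 where "D2 = sqrt (real n) * \<Gamma> * ((1 + \<sigma>) * \<epsilon> + R / sqrt (real k))"
  have \<beta>0: "0 < \<beta>" using \<mu> by simp
  have D2: "\<beta> * D2 \<le> \<mu>\<^sup>2 / 8" using small by (simp add: D2_def)
  define e where "e p = (\<Sum>i<n. (jac (gd t) (X i) p - jac (gd t) (c (cl i)) p) * res (gd t) i)" for p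
  have "L2_set e P \<le> L2_set (\<lambda>x. jac (gd t) (X (fst x)) (snd x) - jac (gd t) (c (cl (fst x))) (snd x)) ({..<n} \<times> P)
     * L2_set (res (gd t)) {..<n}"
    unfolding e_def[abs_def] by (rule L2_set_apply_transpose_le)
  also have "L2_set (\<lambda>x. jac (gd t) (X (fst x)) (snd x) - jac (gd t) (c (cl (fst x))) (snd x)) ({..<n} \<times> P)
    = L2_set (\<lambda>i. L2_set (\<lambda>p. jac (gd t) (X i) p - jac (gd t) (c (cl i)) p) P) {..<n}"
    by (rule L2_set_Times)
  also have "\<dots> * L2_set (res (gd t)) {..<n} \<le> D * \<rho>"
    using jac_near_L2[of "\<lambda>_. gd t"] W r D0 by (intro mult_mono) (auto simp: L2_set_nonneg)
  finally have e: "L2_set e P \<le> D * \<rho>" .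
  have Bt: "L2_set (\<lambda>x. cjac (gd t) (fst x) (snd x) - cjac W0 (fst x) (snd x)) ({..<K} \<times> P) \<le> D2"
  proof -
    have "cjac (gd t) l p - cjac W0 l p = agg (\<lambda>i. jac (gd t) (c (cl i)) p - jac W0 (c (cl i)) p) l" for l p
      using agg_const[of "\<lambda>l. jac (gd t) (c l) p - jac W0 (c l) p" l] by (simp add: cjac_def right_diff_distrib)
    then show ?thesis
      using order_trans[OF agg_L2_Times jac_center_L2[OF W]] by (simp add: D2_def)
  qed
  note g = gr_split[of "gd t", folded e_def]
  \<comment> \<open>These two conclusions do not see the next residual, so \<open>Ba\<close> is
    filled with the initial Jacobian itself, with error 0.\<close>
  show "L2_set (gr (gd t)) P \<le> 9 / 8 * h t + D * \<rho>" "\<eta> * h t \<le> L2_set (agg (res (gd t))) {..<K} / \<mu>"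
    using perturbed_gradient_step(1,3)[OF op low Bt, where Ba = "cjac W0" and ?D2.0 = 0 and \<eta> = \<eta> and e = e and \<epsilon> = "D * \<rho>"
        and g = "gr (gd t)" and h = "h t"
        and Q' = "\<lambda>l. agg (res (gd t)) l - \<eta> * (\<Sum>p\<in>P. cjac W0 l p * gr (gd t) p)"]
      \<mu> \<eta> \<eta>\<beta> D2 e g by (simp_all add: h_def L2_set_def)
  assume W': "L2_set (\<lambda>p. gd (Suc t) p - W0 p) P \<le> R"
  have ex: "\<exists>s. 0 \<le> s \<and> s \<le> 1 \<and> out (gd (Suc t)) (X i) - out (gd t) (X i)
       = (\<Sum>p\<in>P. jac (interp s (gd t) (gd (Suc t))) (X i) p * (gd (Suc t) p - gd t p))" for i
    by (rule out_mvt[of "gd (Suc t)" "X i" "gd t"]) blast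
  obtain s where s: "0 \<le> s i \<and> s i \<le> 1 \<and> out (gd (Suc t)) (X i) - out (gd t) (X i)
       = (\<Sum>p\<in>P. jac (interp (s i) (gd t) (gd (Suc t))) (X i) p * (gd (Suc t) p - gd t p))" for i
    by (rule exE[OF choice[OF allI[OF ex]]]) (rule that, erule spec)
  note s = s[THEN conjunct1] s[THEN conjunct2, THEN conjunct1] s[THEN conjunct2, THEN conjunct2]
  define J where "J i = jac (interp (s i) (gd t) (gd (Suc t))) (X i)" for i
  have ball: "L2_set (\<lambda>p. interp (s i) (gd t) (gd (Suc t)) p - W0 p) P \<le> R" for i
    by (rule interp_dist[OF s(1,2) W W'])
  have Ba: "L2_set (\<lambda>x. agg (\<lambda>i. J i (snd x)) (fst x) - cjac W0 (fst x) (snd x)) ({..<K} \<times> P) \<le> D2"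
  proof -
    have "agg (\<lambda>i. J i p) l - cjac W0 l p = agg (\<lambda>i. J i p - jac W0 (c (cl i)) p) l" for l p
      using agg_const[of "\<lambda>l. jac W0 (c l) p" l] by (simp add: cjac_def agg_def sum_subtractf diff_divide_distrib)
    then show ?thesis
      using order_trans[OF agg_L2_Times jac_init_L2[OF ball]] by (simp add: D2_def J_def)
  qed
  have Q': "agg (res (gd (Suc t))) l = agg (res (gd t)) l - \<eta> * (\<Sum>p\<in>P. agg (\<lambda>i. J i p) l * gr (gd t) p)" for l
  proof -
    have "res (gd (Suc t)) i = res (gd t) i - \<eta> * (\<Sum>p\<in>P. J i p * gr (gd t) p)" for i
    proof -
      have "out (gd (Suc t)) (X i) - out (gd t) (X i) = - \<eta> * (\<Sum>p\<in>P. J i p * gr (gd t) p)"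
        unfolding s(3) J_def[symmetric] by (simp add: sum_distrib_left sum_negf mult_ac)
      then show ?thesis by (simp add: res_def)
    qed
    then have "(\<Sum>i\<in>block l. res (gd (Suc t)) i) = (\<Sum>i\<in>block l. res (gd t) i) - \<eta> * (\<Sum>i\<in>block l. \<Sum>p\<in>P. J i p * gr (gd t) p)"
      by (simp add: sum_subtractf sum_distrib_left)
    also have "(\<Sum>i\<in>block l. \<Sum>p\<in>P. J i p * gr (gd t) p) = (\<Sum>p\<in>P. (\<Sum>i\<in>block l. J i p) * gr (gd t) p)"
      unfolding sum_distrib_right by (rule sum.swap)
    finally have *: "(\<Sum>i\<in>block l. res (gd (Suc t)) i)
      = (\<Sum>i\<in>block l. res (gd t) i) - \<eta> * (\<Sum>p\<in>P. (\<Sum>i\<in>block l. J i p) * gr (gd t) p)" .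
    have "(\<Sum>p\<in>P. x p / z * w p) = (\<Sum>p\<in>P. x p * w p) / z" for x w and z :: real
      by (simp add: sum_divide_distrib)
    then show ?thesis unfolding agg_def * by (simp add: diff_divide_distrib)
  qed
  show "L2_set (agg (res (gd (Suc t)))) {..<K} + \<eta> * \<mu> / 8 * h t \<le> L2_set (agg (res (gd t))) {..<K} + 2 * \<eta> * \<beta> * (D * \<rho>)"
    by (rule perturbed_gradient_step(2)[OF op low Bt Ba \<mu> \<eta> \<eta>\<beta> D2 D2 e g Q' h_def])
qed


text \<open>The energy, projected residual plus \<open>\<eta> * \<mu> / 8\<close> times the sum of
  the \<open>h s\<close>, grows per step by at most the noise drift
  \<open>2 * \<eta> * \<beta> * (D * \<rho>)\<close>. It therefore bounds the path length. The
  geometric decay follows from the same one-step inequality by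
  \<open>\<mu> * q t \<le> h t\<close>.\<close>

lemma trajectory:
  assumes "t \<le> T"
  shows "L2_set (agg (res (gd t))) {..<K} + \<eta> * \<mu> / 8 * (\<Sum>s<t. h s) \<le> b + 2 * real t * \<eta> * \<beta> * (D * \<rho>)"
    and "L2_set (\<lambda>p. gd t p - W0 p) P \<le> 9 / \<mu> * (b + 2 * real t * \<eta> * \<beta> * (D * \<rho>)) + real t * \<eta> * (D * \<rho>)"
    and "L2_set (agg (res (gd t))) {..<K} \<le> (1 - \<eta> * \<mu>\<^sup>2 / 8) ^ t * b + 2 * real t * \<eta> * \<beta> * (D * \<rho>)"
proof -
  define q where "q t = L2_set (agg (res (gd t))) {..<K}" for t
  define S where "S t = (\<Sum>s<t. h s)" for t
  define E where "E = D * \<rho>"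
  define B where "B t = b + 2 * real t * \<eta> * \<beta> * E" for t
  have E0: "0 \<le> E" using D0 \<rho>0 by (simp add: E_def)
  have \<beta>0: "0 < \<beta>" using \<mu> by simp
  have q0: "0 \<le> q t" and S0: "0 \<le> S t" for t
    by (auto simp: q_def L2_set_nonneg S_def h_nonneg sum_nonneg)
  have B0: "0 \<le> B t" for t using b0 \<eta> \<beta>0 E0 by (simp add: B_def)
  have B_mono: "B s \<le> B t" if "s \<le> t" for s t
    using that \<eta> \<beta>0 E0 by (auto simp: B_def intro!: mult_right_mono)
  have inball: "L2_set (\<lambda>p. gd t p - W0 p) P \<le> R"
    if "t \<le> T" "\<eta> * S t \<le> 8 / \<mu> * B t" "L2_set (\<lambda>p. gd t p - W0 p) P \<le> 9 / 8 * (\<eta> * S t) + real t * \<eta> * E" for t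
  proof -
    have "9 / 8 * (\<eta> * S t) \<le> 9 / \<mu> * B t" using that(2) by simp
    also have "\<dots> \<le> 9 / \<mu> * B T" using B_mono[OF that(1)] \<mu> by (intro mult_left_mono) auto
    finally have "9 / 8 * (\<eta> * S t) \<le> 9 / \<mu> * B T" .
    moreover have "real t * \<eta> * E \<le> real T * \<eta> * E"
      using that(1) \<eta> E0 by (intro mult_right_mono) auto
    ultimately show ?thesis using that(3) R unfolding B_def E_def by linarith
  qed
  have main: "q t + \<eta> * \<mu> / 8 * S t \<le> B t \<and> \<eta> * S t \<le> 8 / \<mu> * B t \<and>
     L2_set (\<lambda>p. gd t p - W0 p) P \<le> 9 / 8 * (\<eta> * S t) + real t * \<eta> * E \<and>
     q t \<le> (1 - \<eta> * \<mu>\<^sup>2 / 8) ^ t * b + 2 * real t * \<eta> * \<beta> * E" if "t \<le> T" for t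
    using that
  proof (induction t)
    case 0
    have "q 0 \<le> b" unfolding q_def using order_trans[OF agg_L2 b] by simp
    then show ?case using b0 \<mu> by (simp add: S_def B_def L2_set_def)
  next
    case (Suc t)
    then have IH: "q t + \<eta> * \<mu> / 8 * S t \<le> B t" "\<eta> * S t \<le> 8 / \<mu> * B t"
     "L2_set (\<lambda>p. gd t p - W0 p) P \<le> 9 / 8 * (\<eta> * S t) + real t * \<eta> * E"
     "q t \<le> (1 - \<eta> * \<mu>\<^sup>2 / 8) ^ t * b + 2 * real t * \<eta> * \<beta> * E" and tT: "t \<le> T" by auto
    have W: "L2_set (\<lambda>p. gd t p - W0 p) P \<le> R" by (rule inball[OF tT IH(2,3)])
    have "q t \<le> B t" using IH(1) S0[of t] \<eta> \<mu> by (smt (verit) mult_nonneg_nonneg divide_nonneg_nonneg)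
    also have "B t \<le> B T" by (rule B_mono[OF tT])
    finally have "L2_set (res (gd t)) {..<n} \<le> \<rho>"
      using res_L2[of "gd t"] gap_L2[OF W] \<rho> unfolding q_def B_def E_def by linarith
    note st = step[OF W this, folded q_def E_def]
    have SS: "S (Suc t) = S t + h t" by (simp add: S_def)
    \<comment> \<open>The bound on the sum up to \<open>Suc t\<close> must come before the energy
      inequality there, which presupposes that the new iterate lies in the ball. The unspent
      \<open>q t\<close> pays for the additional \<open>h t\<close>, since
      \<open>\<eta> * h t \<le> q t / \<mu>\<close>.\<close>
    have "\<eta> * S t \<le> 8 / \<mu> * (B t - q t)"
      using IH(1) \<mu> by (simp add: field_simps)
    moreover have "q t / \<mu> \<le> 8 / \<mu> * q t" using q0[of t] \<mu> by (simp add: field_simps)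
    ultimately have "\<eta> * S (Suc t) \<le> 8 / \<mu> * B t"
      using st(2) by (simp add: SS distrib_left right_diff_distrib)
    also have "\<dots> \<le> 8 / \<mu> * B (Suc t)" using B_mono[of t "Suc t"] \<mu> by (intro mult_left_mono) auto
    finally have S': "\<eta> * S (Suc t) \<le> 8 / \<mu> * B (Suc t)" .
    have "L2_set (\<lambda>p. gd (Suc t) p - W0 p) P = L2_set (\<lambda>p. (gd t p - W0 p) - \<eta> * gr (gd t) p) P"
      by (simp add: algebra_simps)
    also have "\<dots> \<le> L2_set (\<lambda>p. gd t p - W0 p) P + \<eta> * L2_set (gr (gd t)) P"
      using \<eta> by (intro order_trans[OF L2_set_triangle_diff]) (simp add: L2_set_scale)
    also have "\<dots> \<le> (9 / 8 * (\<eta> * S t) + real t * \<eta> * E) + \<eta> * (9 / 8 * h t + E)"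
      using IH(3) st(1) \<eta> by (intro add_mono mult_left_mono) auto
    also have "\<dots> = 9 / 8 * (\<eta> * S (Suc t)) + real (Suc t) * \<eta> * E"
      by (simp add: SS algebra_simps)
    finally have W'': "L2_set (\<lambda>p. gd (Suc t) p - W0 p) P \<le> 9 / 8 * (\<eta> * S (Suc t)) + real (Suc t) * \<eta> * E" .
    have q': "q (Suc t) + \<eta> * \<mu> / 8 * h t \<le> q t + 2 * \<eta> * \<beta> * E"
      by (rule st(3)[OF inball[OF Suc.prems S' W'']])
    have "q (Suc t) + \<eta> * \<mu> / 8 * S (Suc t) \<le> B (Suc t)"
      using q' IH(1) by (simp add: SS B_def algebra_simps)
    moreover have "q (Suc t) \<le> (1 - \<eta> * \<mu>\<^sup>2 / 8) ^ Suc t * b + 2 * real (Suc t) * \<eta> * \<beta> * E"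
    proof -
      have "\<mu> * q t \<le> h t" using low by (simp add: q_def h_def)
      then have "\<eta> * \<mu> / 8 * (\<mu> * q t) \<le> \<eta> * \<mu> / 8 * h t" using \<eta> \<mu> by (intro mult_left_mono) auto
      then have 1: "q (Suc t) \<le> (1 - \<eta> * \<mu>\<^sup>2 / 8) * q t + 2 * \<eta> * \<beta> * E"
        using q' by (simp add: power2_eq_square algebra_simps)
      have "\<eta> * \<mu>\<^sup>2 \<le> \<eta> * \<beta>\<^sup>2" using \<mu> \<eta> by (intro mult_left_mono power_mono) auto
      then have c: "0 \<le> 1 - \<eta> * \<mu>\<^sup>2 / 8" "1 - \<eta> * \<mu>\<^sup>2 / 8 \<le> 1" using \<eta>\<beta> \<eta> mult_pos_pos[OF \<eta> zero_less_power[OF \<mu>(1), of 2]] by linarith+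
      have "(1 - \<eta> * \<mu>\<^sup>2 / 8) * q t \<le> (1 - \<eta> * \<mu>\<^sup>2 / 8) * ((1 - \<eta> * \<mu>\<^sup>2 / 8) ^ t * b + 2 * real t * \<eta> * \<beta> * E)"
        by (intro mult_left_mono IH(4) c)
      also have "\<dots> \<le> (1 - \<eta> * \<mu>\<^sup>2 / 8) ^ Suc t * b + 1 * (2 * real t * \<eta> * \<beta> * E)"
        unfolding distrib_left using c \<eta> \<beta>0 E0
        by (intro add_mono mult_right_mono) auto
      finally show ?thesis using 1 by (simp add: algebra_simps)
    qed
    ultimately show ?case using S' W'' by simp
  qed
  note m = main[OF assms]
  show "L2_set (agg (res (gd t))) {..<K} + \<eta> * \<mu> / 8 * (\<Sum>s<t. h s) \<le> b + 2 * real t * \<eta> * \<beta> * (D * \<rho>)"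
   "L2_set (agg (res (gd t))) {..<K} \<le> (1 - \<eta> * \<mu>\<^sup>2 / 8) ^ t * b + 2 * real t * \<eta> * \<beta> * (D * \<rho>)"
    using m by (auto simp: q_def S_def B_def E_def)
  have "9 / 8 * (\<eta> * S t) \<le> 9 / \<mu> * B t" using m by simp
  then show "L2_set (\<lambda>p. gd t p - W0 p) P \<le> 9 / \<mu> * (b + 2 * real t * \<eta> * \<beta> * (D * \<rho>)) + real t * \<eta> * (D * \<rho>)"
    using m unfolding B_def E_def by linarith
qed

lemma trajectory_ball:
  assumes "t \<le> T"
  shows "L2_set (\<lambda>p. gd t p - W0 p) P \<le> R"
proof -
  have E0: "0 \<le> D * \<rho>" using D0 \<rho>0 by simp
  have "9 / \<mu> * (b + 2 * real t * \<eta> * \<beta> * (D * \<rho>)) + real t * \<eta> * (D * \<rho>)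
     \<le> 9 / \<mu> * (b + 2 * real T * \<eta> * \<beta> * (D * \<rho>)) + real T * \<eta> * (D * \<rho>)"
    using assms \<eta> \<mu> E0 by (intro add_mono mult_left_mono mult_right_mono) auto
  then show ?thesis using trajectory(2)[OF assms] R by linarith
qed

end

section \<open>Gaussian weights\<close>

abbreviation "normal1 \<equiv> density lborel (\<lambda>x. ennreal (std_normal_density x))"

lemma prob_space_std_gaussian: "prob_space (std_gaussian I)"
  unfolding std_gaussian_def by (intro prob_space_PiM prob_space_normal_density) simp

lemma sets_std_gaussian [measurable_cong]: "sets (std_gaussian I) = sets (PiM I (\<lambda>_. borel))"
  unfolding std_gaussian_def by (intro sets_PiM_cong) auto

definition lin :: "nat \<Rightarrow> (nat \<Rightarrow> real) \<Rightarrow> (nat \<Rightarrow> real) \<Rightarrow> real" where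
  "lin d u w = (\<Sum>j<d. w j * u j)"

text \<open>The restriction makes the row an extensional function, hence a point of the product
  space under \<open>std_gaussian {..<d}\<close>.\<close>

definition neuron :: "nat \<Rightarrow> nat \<Rightarrow> (nat \<times> nat \<Rightarrow> real) \<Rightarrow> nat \<Rightarrow> real" where
  "neuron d r \<omega> = (\<lambda>j\<in>{..<d}. \<omega> (r, j))"

lemma preact_lin: "preact d \<omega> u r = lin d u (neuron d r \<omega>)"
  by (simp add: preact_def lin_def neuron_def)

lemma lin_measurable [measurable]: "lin d u \<in> borel_measurable (std_gaussian {..<d})"
  unfolding lin_def[abs_def] by measurable

lemma neuron_measurable:
  assumes "r < k" shows "neuron d r \<in> measurable (std_gaussian ({..<k} \<times> {..<d})) (std_gaussian {..<d})"
  unfolding neuron_def[abs_def] std_gaussian_def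
  using assms by (intro measurable_restrict measurable_component_singleton) auto

lemma preact_measurable [measurable]:
  "r < k \<Longrightarrow> (\<lambda>\<omega>. preact d \<omega> u r) \<in> borel_measurable (std_gaussian ({..<k} \<times> {..<d}))"
  unfolding preact_lin by (rule measurable_compose[OF neuron_measurable lin_measurable])

lemma distr_neuron:
  assumes "r < k"
  shows "distr (std_gaussian ({..<k} \<times> {..<d})) (std_gaussian {..<d}) (neuron d r) = std_gaussian {..<d}"
  unfolding std_gaussian_def neuron_def[abs_def]
  by (rule distr_PiM_reindex) (use assms in \<open>auto intro: prob_space_normal_density simp: inj_on_def\<close>)

lemma indep_coords:
  "prob_space.indep_vars (std_gaussian I) (\<lambda>_. normal1) (\<lambda>i \<omega>. \<omega> i) I"
proof (cases "I = {}")
  case True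
  interpret prob_space "std_gaussian I" by (rule prob_space_std_gaussian)
  show ?thesis unfolding indep_vars_def indep_sets_def using True by auto
next
  case False
  interpret prob_space "std_gaussian I" by (rule prob_space_std_gaussian)
  have p: "prob_space normal1" by (rule prob_space_normal_density) simp
  show ?thesis
  proof (subst indep_vars_iff_distr_eq_PiM'[OF False])
    show "random_variable normal1 (\<lambda>\<omega>. \<omega> i)" if "i \<in> I" for i
      unfolding std_gaussian_def using that by measurable
    have "distr (std_gaussian I) (PiM I (\<lambda>_. normal1)) (\<lambda>x. \<lambda>i\<in>I. x i) = distr (std_gaussian I) (std_gaussian I) (\<lambda>x. x)"
      by (intro distr_cong) (auto simp: std_gaussian_def space_PiM PiE_def extensional_restrict)
    also have "\<dots> = PiM I (\<lambda>_. normal1)" by (simp add: distr_id2) (simp add: std_gaussian_def)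
    also have "\<dots> = PiM I (\<lambda>i. distr (std_gaussian I) normal1 (\<lambda>\<omega>. \<omega> i))"
    proof (intro PiM_cong refl)
      fix i assume "i \<in> I"
      then show "normal1 = distr (std_gaussian I) normal1 (\<lambda>\<omega>. \<omega> i)"
        unfolding std_gaussian_def using distr_PiM_component[of I "\<lambda>_. normal1" i] p by simp
    qed
    finally show "distr (std_gaussian I) (PiM I (\<lambda>_. normal1)) (\<lambda>x. \<lambda>i\<in>I. x i)
        = PiM I (\<lambda>i. distr (std_gaussian I) normal1 (\<lambda>\<omega>. \<omega> i))" .
  qed
qed

lemma indep_neurons:
  "prob_space.indep_vars (std_gaussian ({..<k} \<times> {..<d})) (\<lambda>_. std_gaussian {..<d}) (neuron d) {..<k}"
proof -
  interpret prob_space "std_gaussian ({..<k} \<times> {..<d})" by (rule prob_space_std_gaussian)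
  have "indep_vars (\<lambda>r. PiM ({r} \<times> {..<d}) (\<lambda>_. normal1)) (\<lambda>r \<omega>. restrict (\<lambda>i. \<omega> i) ({r} \<times> {..<d})) {..<k}"
    by (rule indep_vars_restrict[OF indep_coords]) (auto simp: disjoint_family_on_def)
  then have "indep_vars (\<lambda>_. std_gaussian {..<d})
     (\<lambda>r \<omega>. neuron d r (restrict (\<lambda>i. \<omega> i) ({r} \<times> {..<d}))) {..<k}"
  proof (rule indep_vars_compose2)
    show "neuron d r \<in> measurable (PiM ({r} \<times> {..<d}) (\<lambda>_. normal1)) (std_gaussian {..<d})" for r
      unfolding neuron_def[abs_def] std_gaussian_def
      by (intro measurable_restrict measurable_component_singleton) auto
  qed
  also have "(\<lambda>r \<omega>. neuron d r (restrict (\<lambda>i. \<omega> i) ({r} \<times> {..<d}))) = neuron d"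
    by (auto simp: neuron_def fun_eq_iff)
  finally show ?thesis .
qed

text \<open>All exponential moments below factor over the neurons by this; nonnegative integrals
  spare every integrability condition.\<close>

lemma nn_integral_prod_neurons:
  fixes h :: "nat \<Rightarrow> (nat \<Rightarrow> real) \<Rightarrow> ennreal"
  assumes h: "\<And>r. r < k \<Longrightarrow> h r \<in> borel_measurable (std_gaussian {..<d})"
  shows "(\<integral>\<^sup>+\<omega>. (\<Prod>r<k. h r (neuron d r \<omega>)) \<partial>std_gaussian ({..<k} \<times> {..<d}))
    = (\<Prod>r<k. \<integral>\<^sup>+w. h r w \<partial>std_gaussian {..<d})"
proof -
  interpret prob_space "std_gaussian ({..<k} \<times> {..<d})" by (rule prob_space_std_gaussian)
  have "(\<integral>\<^sup>+\<omega>. (\<Prod>r<k. h r (neuron d r \<omega>)) \<partial>std_gaussian ({..<k} \<times> {..<d}))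
     = (\<Prod>r<k. \<integral>\<^sup>+\<omega>. h r (neuron d r \<omega>) \<partial>std_gaussian ({..<k} \<times> {..<d}))"
    by (rule indep_vars_nn_integral) (auto intro: indep_vars_compose2[OF indep_neurons] h)
  also have "\<dots> = (\<Prod>r<k. \<integral>\<^sup>+w. h r w \<partial>std_gaussian {..<d})"
  proof (intro prod.cong refl)
    fix r assume "r \<in> {..<k}"
    then have r: "r < k" by simp
    show "(\<integral>\<^sup>+\<omega>. h r (neuron d r \<omega>) \<partial>std_gaussian ({..<k} \<times> {..<d})) = (\<integral>\<^sup>+w. h r w \<partial>std_gaussian {..<d})"
      by (subst distr_neuron[OF r, symmetric], subst nn_integral_distr[OF neuron_measurable[OF r]]) (use h[OF r] in auto)
  qed
  finally show ?thesis .
qed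

lemma distr_lin:
  assumes u: "0 < L2_set u {..<d}"
  shows "distr (std_gaussian {..<d}) borel (lin d u) = density lborel (\<lambda>x. ennreal (normal_density 0 (L2_set u {..<d}) x))"
proof -
  interpret prob_space "std_gaussian {..<d}" by (rule prob_space_std_gaussian)
  \<comment> \<open>Zero coefficients are dropped because a normal density requires a positive
    standard deviation.\<close>
  define J where "J = {j. j < d \<and> u j \<noteq> 0}"
  have J: "finite J" "J \<subseteq> {..<d}" by (auto simp: J_def)
  have sumJ: "(\<Sum>j\<in>J. (u j)\<^sup>2) = (\<Sum>j<d. (u j)\<^sup>2)"
    by (rule sum.mono_neutral_left) (auto simp: J_def)
  have "J \<noteq> {}"
  proof
    assume "J = {}"
    then have "L2_set u {..<d} = 0" using sumJ by (simp add: L2_set_def)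
    then show False using u by simp
  qed
  have ind: "indep_vars (\<lambda>_. borel) (\<lambda>j w. 0 + u j * w j) J"
    by (rule indep_vars_compose2[OF indep_vars_subset[OF indep_coords J(2)]]) auto
  have dist: "distributed (std_gaussian {..<d}) lborel (\<lambda>w. 0 + u j * w j)
      (\<lambda>x. ennreal (normal_density (0 + u j * 0) (\<bar>u j\<bar> * 1) x))" if "j \<in> J" for j
  proof (rule normal_density_affine)
    have j: "j \<in> {..<d}" using that J by auto
    have "distr (std_gaussian {..<d}) lborel (\<lambda>w. w j) = distr (PiM {..<d} (\<lambda>_. normal1)) normal1 (\<lambda>w. w j)"
      unfolding std_gaussian_def by (intro distr_cong) auto
    also have "\<dots> = normal1"
      by (rule distr_PiM_component[OF prob_space_normal_density]) (use j in auto)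
    finally show "distributed (std_gaussian {..<d}) lborel (\<lambda>w. w j) (\<lambda>x. ennreal (normal_density 0 1 x))"
      unfolding distributed_def using j by auto
  qed (use that in \<open>auto simp: J_def\<close>)
  have "distributed (std_gaussian {..<d}) lborel (\<lambda>w. \<Sum>j\<in>J. 0 + u j * w j)
     (\<lambda>x. ennreal (normal_density (\<Sum>j\<in>J. 0 + u j * 0) (sqrt (\<Sum>j\<in>J. (\<bar>u j\<bar> * 1)\<^sup>2)) x))"
    by (rule sum_indep_normal[OF J(1) \<open>J \<noteq> {}\<close> ind _ dist]) (auto simp: J_def)
  also have "(\<lambda>w. \<Sum>j\<in>J. 0 + u j * w j) = lin d u"
    unfolding lin_def fun_eq_iff by (auto simp: mult.commute J_def intro!: sum.mono_neutral_left)
  finally have "distributed (std_gaussian {..<d}) lborel (lin d u) (\<lambda>x. ennreal (normal_density 0 (L2_set u {..<d}) x))"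
    using sumJ by (simp add: L2_set_def lin_def[of d u "\<lambda>_. 0"])
  then have "distr (std_gaussian {..<d}) lborel (lin d u) = density lborel (\<lambda>x. ennreal (normal_density 0 (L2_set u {..<d}) x))"
    by (simp add: distributed_def)
  also have "distr (std_gaussian {..<d}) lborel (lin d u) = distr (std_gaussian {..<d}) borel (lin d u)"
    by (intro distr_cong) auto
  finally show ?thesis .
qed

section \<open>Moment generating functions of Gaussian linear forms and of their squares\<close>

lemma nn_integral_normal_density_eq_1:
  assumes "0 < \<sigma>" shows "(\<integral>\<^sup>+x. ennreal (normal_density m \<sigma> x) \<partial>lborel) = 1"
proof -
  interpret prob_space "density lborel (normal_density m \<sigma>)" by (rule prob_space_normal_density[OF assms])
  show ?thesis using emeasure_space_1 by (simp add: emeasure_density)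
qed

lemma normal_mgf:
  assumes "0 < \<sigma>"
  shows "(\<integral>\<^sup>+x. ennreal (normal_density 0 \<sigma> x) * ennreal (exp (t * x)) \<partial>lborel) = ennreal (exp (t\<^sup>2 * \<sigma>\<^sup>2 / 2))"
proof -
  have "normal_density 0 \<sigma> x * exp (t * x) = exp (t\<^sup>2 * \<sigma>\<^sup>2 / 2) * normal_density (\<sigma>\<^sup>2 * t) \<sigma> x" for x
  proof -
    have "- (x\<^sup>2 / (2 * \<sigma>\<^sup>2)) + t * x = t\<^sup>2 * \<sigma>\<^sup>2 / 2 - (x - \<sigma>\<^sup>2 * t)\<^sup>2 / (2 * \<sigma>\<^sup>2)"
      using assms by (simp add: field_simps power2_eq_square)
    then show ?thesis
      by (simp add: normal_density_def exp_add[symmetric])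
  qed
  then have "(\<integral>\<^sup>+x. ennreal (normal_density 0 \<sigma> x) * ennreal (exp (t * x)) \<partial>lborel)
      = (\<integral>\<^sup>+x. ennreal (exp (t\<^sup>2 * \<sigma>\<^sup>2 / 2)) * ennreal (normal_density (\<sigma>\<^sup>2 * t) \<sigma> x) \<partial>lborel)"
    by (intro nn_integral_cong) (simp flip: ennreal_mult)
  also have "\<dots> = ennreal (exp (t\<^sup>2 * \<sigma>\<^sup>2 / 2))"
    by (subst nn_integral_cmult) (simp_all add: nn_integral_normal_density_eq_1[OF assms])
  finally show ?thesis .
qed

text \<open>The added exponent cancels half of the Gaussian one, leaving a normal density of twice
  the variance; the ratio of the normalising factors is \<open>sqrt 2\<close>.\<close>

lemma normal_square_mgf:
  assumes "0 < \<sigma>"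
  shows "(\<integral>\<^sup>+x. ennreal (normal_density 0 \<sigma> x) * ennreal (exp (x\<^sup>2 / (4 * \<sigma>\<^sup>2))) \<partial>lborel) = ennreal (sqrt 2)"
proof -
  have "normal_density 0 \<sigma> x * exp (x\<^sup>2 / (4 * \<sigma>\<^sup>2)) = sqrt 2 * normal_density 0 (sqrt 2 * \<sigma>) x" for x
  proof -
    have "- (x\<^sup>2 / (2 * \<sigma>\<^sup>2)) + x\<^sup>2 / (4 * \<sigma>\<^sup>2) = - (x\<^sup>2 / (4 * \<sigma>\<^sup>2))"
      using assms by (simp add: field_simps)
    moreover have "sqrt 2 * (sqrt 2 * z) = 2 * z" for z :: real
      by (simp flip: mult.assoc)
    ultimately show ?thesis using assms
      by (simp add: normal_density_def exp_add[symmetric] power_mult_distrib real_sqrt_mult divide_simps)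
  qed
  then have "(\<integral>\<^sup>+x. ennreal (normal_density 0 \<sigma> x) * ennreal (exp (x\<^sup>2 / (4 * \<sigma>\<^sup>2))) \<partial>lborel)
      = (\<integral>\<^sup>+x. ennreal (sqrt 2) * ennreal (normal_density 0 (sqrt 2 * \<sigma>) x) \<partial>lborel)"
    by (intro nn_integral_cong) (simp flip: ennreal_mult)
  also have "\<dots> = ennreal (sqrt 2)"
    by (subst nn_integral_cmult) (use assms in \<open>simp_all add: nn_integral_normal_density_eq_1\<close>)
  finally show ?thesis .
qed

lemma lin_mgf:
  "(\<integral>\<^sup>+w. ennreal (exp (t * lin d u w)) \<partial>std_gaussian {..<d}) = ennreal (exp (t\<^sup>2 * (L2_set u {..<d})\<^sup>2 / 2))"
proof (cases "L2_set u {..<d} = 0")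
  case True
  then have "lin d u w = 0" for w by (simp add: L2_set_eq_0_iff lin_def)
  then show ?thesis using prob_space.emeasure_space_1[OF prob_space_std_gaussian, of "{..<d}"] by (simp add: True)
next
  case False
  then have u: "0 < L2_set u {..<d}" by (simp add: L2_set_nonneg order_less_le)
  have "(\<integral>\<^sup>+w. ennreal (exp (t * lin d u w)) \<partial>std_gaussian {..<d})
     = (\<integral>\<^sup>+x. ennreal (exp (t * x)) \<partial>distr (std_gaussian {..<d}) borel (lin d u))"
    by (subst nn_integral_distr) auto
  also have "\<dots> = (\<integral>\<^sup>+x. ennreal (normal_density 0 (L2_set u {..<d}) x) * ennreal (exp (t * x)) \<partial>lborel)"
    unfolding distr_lin[OF u] by (subst nn_integral_density) auto
  finally show ?thesis by (simp add: normal_mgf[OF u])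
qed

lemma lin_square_mgf:
  assumes u: "0 < L2_set u {..<d}"
  shows "(\<integral>\<^sup>+w. ennreal (exp ((lin d u w)\<^sup>2 / (4 * (L2_set u {..<d})\<^sup>2))) \<partial>std_gaussian {..<d}) = ennreal (sqrt 2)"
proof -
  have "(\<integral>\<^sup>+w. ennreal (exp ((lin d u w)\<^sup>2 / (4 * (L2_set u {..<d})\<^sup>2))) \<partial>std_gaussian {..<d})
     = (\<integral>\<^sup>+x. ennreal (exp (x\<^sup>2 / (4 * (L2_set u {..<d})\<^sup>2))) \<partial>distr (std_gaussian {..<d}) borel (lin d u))"
    by (subst nn_integral_distr) auto
  also have "\<dots> = (\<integral>\<^sup>+x. ennreal (normal_density 0 (L2_set u {..<d}) x) * ennreal (exp (x\<^sup>2 / (4 * (L2_set u {..<d})\<^sup>2))) \<partial>lborel)"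
    unfolding distr_lin[OF u] by (subst nn_integral_density) auto
  finally show ?thesis by (simp add: normal_square_mgf[OF u])
qed

lemma preact_square_mgf:
  assumes u: "0 < L2_set u {..<d}"
  shows "(\<integral>\<^sup>+\<omega>. ennreal (exp ((L2_set (preact d \<omega> u) {..<k})\<^sup>2 / (4 * (L2_set u {..<d})\<^sup>2))) \<partial>std_gaussian ({..<k} \<times> {..<d})) = ennreal (sqrt 2 ^ k)"
proof -
  have "(\<integral>\<^sup>+\<omega>. ennreal (exp ((L2_set (preact d \<omega> u) {..<k})\<^sup>2 / (4 * (L2_set u {..<d})\<^sup>2))) \<partial>std_gaussian ({..<k} \<times> {..<d}))
    = (\<integral>\<^sup>+\<omega>. (\<Prod>r<k. ennreal (exp ((lin d u (neuron d r \<omega>))\<^sup>2 / (4 * (L2_set u {..<d})\<^sup>2)))) \<partial>std_gaussian ({..<k} \<times> {..<d}))"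
    by (intro nn_integral_cong) (simp add: L2_set_power2 preact_lin sum_divide_distrib exp_sum prod_ennreal)
  also have "\<dots> = (\<Prod>r<k. ennreal (sqrt 2))"
    by (subst nn_integral_prod_neurons) (simp_all add: lin_square_mgf[OF u])
  finally show ?thesis by (simp add: ennreal_power)
qed

section \<open>Concentration\<close>

lemma (in prob_space) Markov_exp:
  assumes f [measurable]: "f \<in> borel_measurable M" and f0: "\<And>x. x \<in> space M \<Longrightarrow> 0 \<le> f x"
    and A: "(\<integral>\<^sup>+x. ennreal (f x) \<partial>M) \<le> ennreal A" "0 \<le> A" and B: "0 < B"
  shows "prob {x \<in> space M. B \<le> f x} \<le> A / B"
proof -
  have "emeasure M {x \<in> space M. 1 \<le> ennreal (1 / B) * ennreal (f x)}
      \<le> ennreal (1 / B) * (\<integral>\<^sup>+x. ennreal (f x) * indicator (space M) x \<partial>M)"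
    by (rule nn_integral_Markov_inequality) measurable
  also have "(\<integral>\<^sup>+x. ennreal (f x) * indicator (space M) x \<partial>M) = (\<integral>\<^sup>+x. ennreal (f x) \<partial>M)"
    by (intro nn_integral_cong) simp
  also have "ennreal (1 / B) * \<dots> \<le> ennreal (1 / B) * ennreal A"
    by (intro mult_left_mono A) simp
  also have "\<dots> = ennreal (A / B)"
    using A B by (simp flip: ennreal_mult)
  also have "{x \<in> space M. 1 \<le> ennreal (1 / B) * ennreal (f x)} = {x \<in> space M. B \<le> f x}"
    using B f0 by (auto simp: field_simps simp flip: ennreal_mult ennreal_1)
  finally show ?thesis
    using A B by (simp add: emeasure_eq_measure)
qed

lemma (in prob_space) subgaussian_tail:
  fixes Z :: "'a \<Rightarrow> real"
  assumes Z [measurable]: "Z \<in> borel_measurable M" and \<sigma>: "0 < \<sigma>" and t: "0 < t"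
    and mgf: "\<And>s. (\<integral>\<^sup>+x. ennreal (exp (s * Z x)) \<partial>M) \<le> ennreal (exp (s\<^sup>2 * \<sigma>\<^sup>2 / 2))"
  shows "prob {x \<in> space M. t \<le> \<bar>Z x\<bar>} \<le> 2 * exp (- (t\<^sup>2 / (2 * \<sigma>\<^sup>2)))"
proof -
  \<comment> \<open>The minimiser of the Chernoff exponent
    \<open>s\<^sup>2 * \<sigma>\<^sup>2 / 2 - s * t\<close>.\<close>
  define s where "s = t / \<sigma>\<^sup>2"
  have s: "0 < s" using \<sigma> t by (simp add: s_def)
  have e: "exp (s\<^sup>2 * \<sigma>\<^sup>2 / 2) / exp (s * t) = exp (- (t\<^sup>2 / (2 * \<sigma>\<^sup>2)))"
    using \<sigma> by (simp add: s_def exp_diff[symmetric] field_simps power2_eq_square)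
  have 1: "prob {x \<in> space M. exp (s * t) \<le> exp (a * Z x)} \<le> exp (- (t\<^sup>2 / (2 * \<sigma>\<^sup>2)))" if "a\<^sup>2 = s\<^sup>2" for a
    using Markov_exp[where f = "\<lambda>x. exp (a * Z x)", OF _ _ mgf[of a], of "exp (s * t)"] e that by simp
  have "{x \<in> space M. t \<le> \<bar>Z x\<bar>} = {x \<in> space M. exp (s * t) \<le> exp (s * Z x)} \<union> {x \<in> space M. exp (s * t) \<le> exp (- s * Z x)}"
  proof -
    have "exp (s * t) \<le> exp (s * Z x) \<longleftrightarrow> t \<le> Z x" "exp (s * t) \<le> exp (- s * Z x) \<longleftrightarrow> t \<le> - Z x" for x
      using mult_le_cancel_left_pos[OF s, of t "Z x"] mult_le_cancel_left_pos[OF s, of t "- Z x"] by simp_all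
    then show ?thesis by auto
  qed
  then have "prob {x \<in> space M. t \<le> \<bar>Z x\<bar>}
     \<le> prob {x \<in> space M. exp (s * t) \<le> exp (s * Z x)} + prob {x \<in> space M. exp (s * t) \<le> exp (- s * Z x)}"
    by (auto intro!: measure_Un_le)
  also have "\<dots> \<le> exp (- (t\<^sup>2 / (2 * \<sigma>\<^sup>2))) + exp (- (t\<^sup>2 / (2 * \<sigma>\<^sup>2)))"
    by (intro add_mono 1) auto
  finally show ?thesis by simp
qed

text \<open>Averaging the exponential moments costs nothing, so the number \<open>n\<close> of variables does not
  enter the failure probability.\<close>
lemma (in prob_space) subgaussian_L2:
  fixes Z :: "nat \<Rightarrow> 'a \<Rightarrow> real"
  assumes Z [measurable]: "\<And>i. i < n \<Longrightarrow> Z i \<in> borel_measurable M" and \<sigma>: "0 < \<sigma>" and n: "0 < n" and K: "2 \<le> K"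
    and mgf: "\<And>i s. i < n \<Longrightarrow> (\<integral>\<^sup>+x. ennreal (exp (s * Z i x)) \<partial>M) \<le> ennreal (exp (s\<^sup>2 * \<sigma>\<^sup>2 / 2))"
  shows "prob {x \<in> space M. 150 * \<sigma> * sqrt (real n) * sqrt (ln (real K)) < L2_set (\<lambda>i. Z i x) {..<n}} \<le> 1 / real K ^ 103"
proof -
  define L where "L = ln (real K)"
  have "exp (1 / 2 :: real) \<le> 2"
  proof (rule power2_le_imp_le)
    have "(exp (1 / 2 :: real))\<^sup>2 = exp 1" by (simp add: power2_eq_square flip: exp_add)
    then show "(exp (1 / 2 :: real))\<^sup>2 \<le> 2\<^sup>2" using exp_le by simp
  qed simp
  then have "ln (exp (1 / 2 :: real)) \<le> ln 2" by (simp del: ln_exp)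
  also have "ln 2 \<le> L" using K by (simp add: L_def)
  finally have L: "1 / 2 \<le> L" by simp
  \<comment> \<open>With this scale every exponential moment is at most \<open>exp (L / 2)\<close>,
    the square root of \<open>K\<close>.\<close>
  define s where "s = sqrt L / \<sigma>"
  have s: "0 < s" "s\<^sup>2 * \<sigma>\<^sup>2 = L" using L \<sigma> by (simp_all add: s_def power_divide)
  define f where "f x = (\<Sum>i<n. exp (s * Z i x) + exp (- s * Z i x)) / real n" for x
  have fm [measurable]: "f \<in> borel_measurable M"
    unfolding f_def[abs_def] by (intro borel_measurable_divide borel_measurable_sum) auto
  have KL: "real K = exp L" using K by (simp add: L_def)
  have "(\<integral>\<^sup>+x. ennreal (f x) \<partial>M)
      = (\<integral>\<^sup>+x. ennreal (1 / real n) * (\<Sum>i<n. ennreal (exp (s * Z i x)) + ennreal (exp (- s * Z i x))) \<partial>M)"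
  proof (rule nn_integral_cong)
    fix x
    have "(\<Sum>i<n. ennreal (exp (s * Z i x)) + ennreal (exp (- s * Z i x))) = (\<Sum>i<n. ennreal (exp (s * Z i x) + exp (- s * Z i x)))"
      by (intro sum.cong) auto
    also have "\<dots> = ennreal (\<Sum>i<n. exp (s * Z i x) + exp (- s * Z i x))"
      by (intro sum_ennreal) (simp add: add_nonneg_nonneg)
    finally show "ennreal (f x) = ennreal (1 / real n) * (\<Sum>i<n. ennreal (exp (s * Z i x)) + ennreal (exp (- s * Z i x)))"
      by (simp only: f_def) (subst ennreal_mult[symmetric], auto intro!: sum_nonneg add_nonneg_nonneg)
  qed
  also have "\<dots> = ennreal (1 / real n) * (\<Sum>i<n. (\<integral>\<^sup>+x. ennreal (exp (s * Z i x)) \<partial>M) + (\<integral>\<^sup>+x. ennreal (exp (- s * Z i x)) \<partial>M))"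
    by (subst nn_integral_cmult, simp, subst nn_integral_sum) (auto simp: nn_integral_add intro!: sum.cong)
  also have "\<dots> \<le> ennreal (1 / real n) * (\<Sum>i<n. ennreal (exp (L / 2)) + ennreal (exp (L / 2)))"
    using mgf[of _ s] mgf[of _ "- s"] s by (intro mult_left_mono sum_mono add_mono) auto
  also have "\<dots> = ennreal (2 * exp (L / 2))"
  proof -
    have "ennreal (exp (L / 2)) + ennreal (exp (L / 2)) = ennreal (2 * exp (L / 2))"
      by (simp flip: ennreal_plus)
    then have "(\<Sum>i<n. ennreal (exp (L / 2)) + ennreal (exp (L / 2))) = ennreal (real n * (2 * exp (L / 2)))"
      by (simp add: ennreal_of_nat_eq_real_of_nat flip: ennreal_mult)
    then show ?thesis using n by (simp flip: ennreal_mult)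
  qed
  finally have Ef: "(\<integral>\<^sup>+x. ennreal (f x) \<partial>M) \<le> ennreal (2 * exp (L / 2))" .
  \<comment> \<open>The threshold is \<open>K ^ 105\<close>. Of its exponent 1/2 is lost to the
    moment bound and at most 3/2 to the factor 2, which leaves 103.\<close>
  have "prob {x \<in> space M. exp (105 * L) \<le> f x} \<le> 2 * exp (L / 2) / exp (105 * L)"
    by (rule Markov_exp[OF fm _ Ef]) (auto simp: f_def intro!: divide_nonneg_nonneg sum_nonneg add_nonneg_nonneg)
  also have "\<dots> \<le> exp (L * 3 / 2) * exp (L / 2) / exp (105 * L)"
  proof -
    have "2 = exp (ln (2 :: real))" by simp
    also have "\<dots> \<le> exp (L * 3 / 2)" unfolding exp_le_cancel_iff using \<open>ln 2 \<le> L\<close> L by linarith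
    finally show ?thesis by (intro divide_right_mono mult_right_mono) auto
  qed
  also have "\<dots> = exp (L * 3 / 2 + L / 2 - 105 * L)" by (subst exp_diff, subst exp_add) (rule refl)
  also have "L * 3 / 2 + L / 2 - 105 * L = - (103 * L)" by simp
  also have "exp (- (103 * L)) = 1 / real K ^ 103"
    using exp_of_nat_mult[of 103 L] by (simp add: KL exp_minus inverse_eq_divide)
  finally have P: "prob {x \<in> space M. exp (105 * L) \<le> f x} \<le> 1 / real K ^ 103" .
  have "{x \<in> space M. 150 * \<sigma> * sqrt (real n) * sqrt (ln (real K)) < L2_set (\<lambda>i. Z i x) {..<n}} \<subseteq> {x \<in> space M. exp (105 * L) \<le> f x}"
  proof safe
    fix x assume x: "x \<in> space M" and big: "150 * \<sigma> * sqrt (real n) * sqrt (ln (real K)) < L2_set (\<lambda>i. Z i x) {..<n}"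
    show "exp (105 * L) \<le> f x"
    proof (rule ccontr)
      assume "\<not> exp (105 * L) \<le> f x"
      then have fx: "f x \<le> exp (105 * L)" by simp
      \<comment> \<open>Squares are traded for exponentials: up to the level \<open>105 * L\<close>
        the square is bounded directly, and beyond it the excess \<open>w\<close> satisfies
        \<open>2 * w\<^sup>2 \<le> 4 * exp w\<close>. Summed over \<open>i\<close>, the exponentials
        form \<open>f x\<close>.\<close>
      have sq: "(s * Z i x)\<^sup>2 \<le> 2 * (105 * L)\<^sup>2 + 4 * exp (- 105 * L) * (exp (s * Z i x) + exp (- s * Z i x))" for i
      proof -
        define z where "z = \<bar>s * Z i x\<bar>"
        have e: "exp z \<le> exp (s * Z i x) + exp (- s * Z i x)"
          by (cases "s * Z i x \<ge> 0") (auto simp: z_def)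
        have z2: "z\<^sup>2 \<le> 2 * (105 * L)\<^sup>2 + 4 * exp (- 105 * L) * exp z"
        proof (cases "z \<le> 105 * L")
          case True
          then have "z\<^sup>2 \<le> (105 * L)\<^sup>2" by (intro power_mono) (auto simp: z_def)
          moreover have "0 \<le> 4 * exp (- 105 * L) * exp z" "0 \<le> (105 * L)\<^sup>2" by simp_all
          ultimately show ?thesis by linarith
        next
          case False
          define w where "w = z - 105 * L"
          have w: "0 \<le> w" "z = 105 * L + w" using False by (simp_all add: w_def)
          have "z\<^sup>2 \<le> 2 * (105 * L)\<^sup>2 + 2 * w\<^sup>2"
            using zero_le_power2[of "105 * L - w"] w by (simp add: power2_eq_square algebra_simps)
          also have "2 * w\<^sup>2 \<le> 4 * exp w"
            using exp_lower_Taylor_quadratic[OF w(1)] w(1) by simp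
          also have "exp w = exp (- 105 * L) * exp z" by (simp add: w_def flip: exp_add)
          finally show ?thesis by simp
        qed
        also have "4 * exp (- 105 * L) * exp z \<le> 4 * exp (- 105 * L) * (exp (s * Z i x) + exp (- s * Z i x))"
          using e by (intro mult_left_mono) auto
        finally show ?thesis by (simp add: z_def)
      qed
      have "s\<^sup>2 * (\<Sum>i<n. (Z i x)\<^sup>2) = (\<Sum>i<n. (s * Z i x)\<^sup>2)"
        by (simp add: power_mult_distrib sum_distrib_left)
      also have "\<dots> \<le> (\<Sum>i<n. 2 * (105 * L)\<^sup>2 + 4 * exp (- 105 * L) * (exp (s * Z i x) + exp (- s * Z i x)))"
        by (intro sum_mono sq)
      also have "\<dots> = real n * (2 * (105 * L)\<^sup>2 + 4 * exp (- 105 * L) * f x)"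
      proof -
        have lin: "(\<Sum>i<n. a + b * y i) = real n * a + b * (\<Sum>i<n. y i)" for a b and y :: "nat \<Rightarrow> real"
          by (simp add: sum.distrib sum_distrib_left)
        show ?thesis unfolding lin f_def using n by (simp add: field_simps del: sum.distrib)
      qed
      also have "\<dots> \<le> real n * (2 * (105 * L)\<^sup>2 + 4 * exp (- 105 * L) * exp (105 * L))"
        using fx by (intro mult_left_mono add_left_mono) auto
      also have "\<dots> = real n * (22050 * L\<^sup>2 + 4)" by (simp add: power_mult_distrib flip: exp_add)
      \<comment> \<open>22050 is twice the square of 105 and 22500 the square of 150; the constant 4
        fits in between because \<open>1 / 2 \<le> L\<close>.\<close>
      also have "\<dots> \<le> real n * (22500 * L\<^sup>2)"
        using power_mono[OF L, of 2] by (intro mult_left_mono) (auto simp: power_divide)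
      finally have "s\<^sup>2 * (\<Sum>i<n. (Z i x)\<^sup>2) \<le> real n * (22500 * L\<^sup>2)" .
      moreover have "s\<^sup>2 = L / \<sigma>\<^sup>2" using s \<sigma> by (simp add: eq_divide_eq)
      ultimately have "L / \<sigma>\<^sup>2 * (\<Sum>i<n. (Z i x)\<^sup>2) \<le> real n * (22500 * L\<^sup>2)" by simp
      then have "L * (\<Sum>i<n. (Z i x)\<^sup>2) \<le> L * (22500 * \<sigma>\<^sup>2 * real n * L)"
        using \<sigma> by (simp add: field_simps power2_eq_square)
      then have "(\<Sum>i<n. (Z i x)\<^sup>2) \<le> 22500 * \<sigma>\<^sup>2 * real n * L"
        using L by (subst (asm) mult_le_cancel_left_pos) auto
      also have "\<dots> = (150 * \<sigma> * sqrt (real n) * sqrt L)\<^sup>2"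
        using L by (simp add: power_mult_distrib)
      finally have "L2_set (\<lambda>i. Z i x) {..<n} \<le> 150 * \<sigma> * sqrt (real n) * sqrt L"
        unfolding L2_set_power2[symmetric] by (rule power2_le_imp_le) (use \<sigma> L in auto)
      then show False using big by (simp add: L_def)
    qed
  qed
  then have "prob {x \<in> space M. 150 * \<sigma> * sqrt (real n) * sqrt (ln (real K)) < L2_set (\<lambda>i. Z i x) {..<n}}
      \<le> prob {x \<in> space M. exp (105 * L) \<le> f x}"
    by (intro finite_measure_mono) auto
  with P show ?thesis by linarith
qed

section \<open>Sub-Gaussian random networks with balanced output weights, and their kernels\<close>

definition balanced :: "nat \<Rightarrow> (nat \<Rightarrow> real) \<Rightarrow> bool" where
  "balanced k v \<longleftrightarrow> 0 < k \<and> (\<forall>r<k. v r \<in> {1 / sqrt (real k), - (1 / sqrt (real k)), 0}) \<and>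
     card {r. r < k \<and> v r = 1 / sqrt (real k)} = k div 2 \<and>
     card {r. r < k \<and> v r = - (1 / sqrt (real k))} = k div 2"

text \<open>Neurons of opposite output weight are matched; \<open>G 0 = 1\<close> disposes of the
  silent neuron when \<open>k\<close> is odd.\<close>

lemma balanced_prod:
  fixes G :: "real \<Rightarrow> 'c::comm_monoid_mult"
  assumes b: "balanced k v" and G0: "G 0 = 1"
  shows "(\<Prod>r<k. G (v r)) = (G (1 / sqrt (real k)) * G (- (1 / sqrt (real k)))) ^ (k div 2)"
proof -
  define p where "p = 1 / sqrt (real k)"
  define A where "A = {r. r < k \<and> v r = p}"
  define B where "B = {r. r < k \<and> v r = - p}"
  have p: "0 < p" using b by (simp add: p_def balanced_def)
  have AB: "finite A" "finite B" "A \<inter> B = {}" "card A = k div 2" "card B = k div 2"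
    using b p by (auto simp: A_def B_def balanced_def simp flip: p_def)
  have "(\<Prod>r<k. G (v r)) = (\<Prod>r\<in>A \<union> B. G (v r))"
    using b G0 by (intro prod.mono_neutral_right) (auto simp: A_def B_def balanced_def simp flip: p_def)
  also have "\<dots> = (\<Prod>r\<in>A. G (v r)) * (\<Prod>r\<in>B. G (v r))"
    using AB by (intro prod.union_disjoint)
  also have "(\<Prod>r\<in>A. G (v r)) = (\<Prod>r\<in>A. G p)" by (intro prod.cong) (auto simp: A_def)
  also have "(\<Prod>r\<in>B. G (v r)) = (\<Prod>r\<in>B. G (- p))" by (intro prod.cong) (auto simp: B_def)
  finally show ?thesis by (simp add: AB power_mult_distrib p_def)
qed

text \<open>The hyperbolic cosine is monotone in the modulus, which the exponential is not. This is
  why a bound on the modulus of \<psi> suffices once neurons are paired.\<close>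

lemma exp_sum_abs_mono:
  fixes x y :: real
  assumes "\<bar>x\<bar> \<le> \<bar>y\<bar>"
  shows "exp x + exp (- x) \<le> exp y + exp (- y)"
proof -
  have "cosh \<bar>x\<bar> \<le> cosh \<bar>y\<bar>" using assms by (subst cosh_real_nonneg_le_iff) auto
  then show ?thesis by (simp add: cosh_real_abs) (simp add: cosh_field_def)
qed

text \<open>For a pair of opposite weights the product of the two moment generating functions is at
  most the square of their mean. That mean is the expectation of \<open>cosh (a * \<psi> w)\<close>,
  dominated by the one for the Gaussian variable \<open>L * lin d u w\<close>.\<close>

lemma random_net_mgf:
  assumes v: "balanced k v" and \<psi> [measurable]: "\<psi> \<in> borel_measurable (std_gaussian {..<d})"
    and le: "\<And>w. \<bar>\<psi> w\<bar> \<le> L * \<bar>lin d u w\<bar>" and L: "0 \<le> L"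
  shows "(\<integral>\<^sup>+\<omega>. ennreal (exp (s * (\<Sum>r<k. v r * \<psi> (neuron d r \<omega>)))) \<partial>std_gaussian ({..<k} \<times> {..<d}))
     \<le> ennreal (exp (s\<^sup>2 * (L * L2_set u {..<d})\<^sup>2 / 2))"
proof -
  define G where "G a = (\<integral>\<^sup>+w. ennreal (exp (s * a * \<psi> w)) \<partial>std_gaussian {..<d})" for a
  define a where "a = s * (1 / sqrt (real k))"
  define c where "c = exp (a\<^sup>2 * (L * L2_set u {..<d})\<^sup>2 / 2)"
  have k: "0 < k" using v by (simp add: balanced_def)
  have G0: "G 0 = 1"
    using prob_space.emeasure_space_1[OF prob_space_std_gaussian, of "{..<d}"] by (simp add: G_def)
  have "(\<integral>\<^sup>+\<omega>. ennreal (exp (s * (\<Sum>r<k. v r * \<psi> (neuron d r \<omega>)))) \<partial>std_gaussian ({..<k} \<times> {..<d}))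
     = (\<integral>\<^sup>+\<omega>. (\<Prod>r<k. ennreal (exp (s * v r * \<psi> (neuron d r \<omega>)))) \<partial>std_gaussian ({..<k} \<times> {..<d}))"
    by (intro nn_integral_cong) (simp add: sum_distrib_left exp_sum prod_ennreal mult.assoc)
  also have "\<dots> = (\<Prod>r<k. G (v r))"
    unfolding G_def by (rule nn_integral_prod_neurons) measurable
  also have "\<dots> = (G (1 / sqrt (real k)) * G (- (1 / sqrt (real k)))) ^ (k div 2)"
    by (rule balanced_prod[where G = G, OF v G0])
  also have "G (1 / sqrt (real k)) * G (- (1 / sqrt (real k))) \<le> ennreal (c\<^sup>2)"
  proof -
    have "G (1 / sqrt (real k)) + G (- (1 / sqrt (real k)))
        = (\<integral>\<^sup>+w. ennreal (exp (a * \<psi> w) + exp (- (a * \<psi> w))) \<partial>std_gaussian {..<d})"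
      unfolding G_def a_def by (subst nn_integral_add[symmetric]) (auto intro!: nn_integral_cong)
    also have "\<dots> \<le> (\<integral>\<^sup>+w. ennreal (exp (a * L * lin d u w) + exp (- (a * L * lin d u w))) \<partial>std_gaussian {..<d})"
    proof (intro nn_integral_mono ennreal_leI exp_sum_abs_mono)
      fix w
      show "\<bar>a * \<psi> w\<bar> \<le> \<bar>a * L * lin d u w\<bar>"
        using mult_left_mono[OF le[of w], of "\<bar>a\<bar>"] L by (simp add: abs_mult mult.assoc)
    qed
    also have "\<dots> = (\<integral>\<^sup>+w. ennreal (exp (a * L * lin d u w)) \<partial>std_gaussian {..<d}) + (\<integral>\<^sup>+w. ennreal (exp (- (a * L) * lin d u w)) \<partial>std_gaussian {..<d})"
      by (subst nn_integral_add[symmetric]) (auto intro!: nn_integral_cong)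
    also have "\<dots> = ennreal (2 * c)"
      unfolding lin_mgf by (simp add: c_def power_mult_distrib flip: ennreal_plus)
    finally have le: "G (1 / sqrt (real k)) + G (- (1 / sqrt (real k))) \<le> ennreal (2 * c)" .
    obtain g where g: "G (1 / sqrt (real k)) = ennreal g" "0 \<le> g"
      using le by (cases "G (1 / sqrt (real k))") (auto simp: top_unique)
    obtain g' where g': "G (- (1 / sqrt (real k))) = ennreal g'" "0 \<le> g'"
      using le by (cases "G (- (1 / sqrt (real k)))") (auto simp: top_unique)
    have gg: "g + g' \<le> 2 * c" using le g g' by (simp add: c_def flip: ennreal_plus)
    have "4 * (g * g') \<le> (g + g')\<^sup>2"
      using zero_le_power2[of "g - g'"] by (simp add: power2_eq_square algebra_simps)
    also have "\<dots> \<le> (2 * c)\<^sup>2" using gg g g' by (intro power_mono) auto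
    finally have "g * g' \<le> c\<^sup>2" by (simp add: power_mult_distrib)
    then show ?thesis using g g' by (simp flip: ennreal_mult)
  qed
  then have "(G (1 / sqrt (real k)) * G (- (1 / sqrt (real k)))) ^ (k div 2) \<le> ennreal (c\<^sup>2) ^ (k div 2)"
    by (intro power_mono) auto
  also have "\<dots> = ennreal ((c\<^sup>2) ^ (k div 2))" by (simp add: c_def ennreal_power)
  \<comment> \<open>Since \<open>a\<^sup>2\<close> is \<open>s\<^sup>2 / k\<close>, the at most
    \<open>k / 2\<close> pairs together reproduce the exponent of a single Gaussian.\<close>
  also have "(c\<^sup>2) ^ (k div 2) \<le> exp (s\<^sup>2 * (L * L2_set u {..<d})\<^sup>2 / 2)"
  proof -
    have "(c\<^sup>2) ^ (k div 2) = exp (real (k div 2) * (a\<^sup>2 * (L * L2_set u {..<d})\<^sup>2))"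
    proof -
      have "(exp (x / 2))\<^sup>2 = exp x" for x :: real by (simp add: power2_eq_square flip: exp_add)
      then show ?thesis by (simp add: c_def exp_of_nat_mult)
    qed
    also have "\<dots> \<le> exp (s\<^sup>2 * (L * L2_set u {..<d})\<^sup>2 / 2)"
    proof -
      have "real (k div 2) * a\<^sup>2 = s\<^sup>2 * (real (k div 2) / real k)"
        using k by (simp add: a_def power_mult_distrib power_divide)
      also have "\<dots> \<le> s\<^sup>2 * (1 / 2)" using k by (intro mult_left_mono) (auto simp: field_simps)
      finally have "real (k div 2) * a\<^sup>2 * (L * L2_set u {..<d})\<^sup>2 \<le> s\<^sup>2 * (1 / 2) * (L * L2_set u {..<d})\<^sup>2"
        by (rule mult_right_mono) simp
      then show ?thesis by (simp add: mult.assoc)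
    qed
    finally show ?thesis .
  qed
  finally show ?thesis by (simp add: ennreal_leI)
qed


lemma preact_square_mgf_le:
  assumes u: "L2_set u {..<d} \<le> \<epsilon>" "0 < \<epsilon>"
  shows "(\<integral>\<^sup>+\<omega>. ennreal (exp ((L2_set (preact d \<omega> u) {..<k})\<^sup>2 / (4 * \<epsilon>\<^sup>2))) \<partial>std_gaussian ({..<k} \<times> {..<d})) \<le> ennreal (exp (real k / 2))"
proof -
  have e: "sqrt 2 ^ k \<le> exp (real k / 2)"
  proof -
    have "sqrt 2 \<le> exp (1 / 2 :: real)"
    proof -
      have "sqrt 2 \<le> (3 / 2 :: real)" by (rule power2_le_imp_le) (simp_all add: power_divide)
      then show ?thesis using exp_ge_add_one_self[of "1/2 :: real"] by simp
    qed
    then have "sqrt 2 ^ k \<le> exp (1 / 2) ^ k" by (intro power_mono) auto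
    then show ?thesis by (simp flip: exp_of_nat_mult)
  qed
  show ?thesis
  proof (cases "L2_set u {..<d} = 0")
    case True
    then have "preact d \<omega> u r = 0" for \<omega> r by (simp add: L2_set_eq_0_iff preact_def)
    then show ?thesis
      using prob_space.emeasure_space_1[OF prob_space_std_gaussian, of "{..<k} \<times> {..<d}"] by (simp add: L2_set_def)
  next
    case False
    then have u0: "0 < L2_set u {..<d}" by (simp add: L2_set_nonneg order_less_le)
    have "(\<integral>\<^sup>+\<omega>. ennreal (exp ((L2_set (preact d \<omega> u) {..<k})\<^sup>2 / (4 * \<epsilon>\<^sup>2))) \<partial>std_gaussian ({..<k} \<times> {..<d}))
      \<le> (\<integral>\<^sup>+\<omega>. ennreal (exp ((L2_set (preact d \<omega> u) {..<k})\<^sup>2 / (4 * (L2_set u {..<d})\<^sup>2))) \<partial>std_gaussian ({..<k} \<times> {..<d}))"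
      using u u0 by (intro nn_integral_mono ennreal_leI) (auto intro!: divide_left_mono power_mono)
    also have "\<dots> \<le> ennreal (exp (real k / 2))"
      unfolding preact_square_mgf[OF u0] using e by (rule ennreal_leI)
    finally show ?thesis .
  qed
qed

lemma L2_preact_measurable [measurable]:
  "(\<lambda>\<omega>. L2_set (preact d \<omega> u) {..<k}) \<in> borel_measurable (std_gaussian ({..<k} \<times> {..<d}))"
proof -
  have [measurable]: "(\<lambda>\<omega>. \<Sum>r<k. (preact d \<omega> u r)\<^sup>2) \<in> borel_measurable (std_gaussian ({..<k} \<times> {..<d}))"
    by (intro borel_measurable_sum borel_measurable_power) auto
  show ?thesis unfolding L2_set_def by measurable
qed

text \<open>The device of \<open>subgaussian_L2\<close> for squared norms: Markov's inequality is
  applied to the average of the exponentials, so \<open>n\<close> does not enter, and convexity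
  returns from exponentials to squares.\<close>

lemma preact_L2_average:
  assumes u: "\<And>i. i < n \<Longrightarrow> L2_set (u i) {..<d} \<le> \<epsilon>" and \<epsilon>: "0 < \<epsilon>" and n: "0 < n" and K: "2 \<le> K"
    and k: "ln (real K) \<le> real k"
  shows "measure (std_gaussian ({..<k} \<times> {..<d})) {\<omega> \<in> space (std_gaussian ({..<k} \<times> {..<d})).
     21 * sqrt (real n) * sqrt (real k) * \<epsilon> < L2_set (\<lambda>i. L2_set (preact d \<omega> (u i)) {..<k}) {..<n}} \<le> 1 / real K ^ 103"
proof -
  interpret prob_space "std_gaussian ({..<k} \<times> {..<d})" by (rule prob_space_std_gaussian)
  let ?M = "std_gaussian ({..<k} \<times> {..<d})"
  define S where "S i \<omega> = (L2_set (preact d \<omega> (u i)) {..<k})\<^sup>2 / (4 * \<epsilon>\<^sup>2)" for i \<omega>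
  define f where "f \<omega> = 1 / real n * (\<Sum>i<n. exp (S i \<omega>))" for \<omega>
  \<comment> \<open>The excess over the moment exponent \<open>k / 2\<close> is what Markov's
    inequality turns into \<open>1 / K ^ 103\<close>.\<close>
  define A where "A = real k / 2 + 103 * ln (real K)"
  have Sm [measurable]: "S i \<in> borel_measurable ?M" for i
    unfolding S_def[abs_def] by measurable
  have fm [measurable]: "f \<in> borel_measurable ?M"
    unfolding f_def[abs_def] by measurable
  have eA: "exp A = exp (real k / 2) * real K ^ 103"
    using exp_of_nat_mult[of 103 "ln (real K)"] K by (simp add: A_def exp_add)
  have "(\<integral>\<^sup>+x. ennreal (f x) \<partial>?M) = (\<integral>\<^sup>+x. ennreal (1 / real n) * (\<Sum>i<n. ennreal (exp (S i x))) \<partial>?M)"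
    by (intro nn_integral_cong) (simp add: f_def sum_nonneg flip: ennreal_mult)
  also have "\<dots> = ennreal (1 / real n) * (\<Sum>i<n. (\<integral>\<^sup>+x. ennreal (exp (S i x)) \<partial>?M))"
    by (subst nn_integral_cmult, simp, subst nn_integral_sum) auto
  also have "\<dots> \<le> ennreal (1 / real n) * (\<Sum>i<n. ennreal (exp (real k / 2)))"
    unfolding S_def using preact_square_mgf_le[OF u \<epsilon>] by (intro mult_left_mono sum_mono) auto
  also have "\<dots> = ennreal (exp (real k / 2))"
    using n by (simp add: ennreal_of_nat_eq_real_of_nat flip: ennreal_mult)
  finally have Ef: "(\<integral>\<^sup>+x. ennreal (f x) \<partial>?M) \<le> ennreal (exp (real k / 2))" .
  have "prob {x \<in> space ?M. exp A \<le> f x} \<le> exp (real k / 2) / exp A"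
    by (rule Markov_exp[OF fm _ Ef]) (auto simp: f_def intro!: divide_nonneg_nonneg sum_nonneg)
  also have "\<dots> = 1 / real K ^ 103" by (simp add: eA)
  finally have P: "prob {x \<in> space ?M. exp A \<le> f x} \<le> 1 / real K ^ 103" .
  have "{\<omega> \<in> space ?M. 21 * sqrt (real n) * sqrt (real k) * \<epsilon> < L2_set (\<lambda>i. L2_set (preact d \<omega> (u i)) {..<k}) {..<n}}
     \<subseteq> {x \<in> space ?M. exp A \<le> f x}"
  proof safe
    fix x assume x: "x \<in> space ?M"
      and big: "21 * sqrt (real n) * sqrt (real k) * \<epsilon> < L2_set (\<lambda>i. L2_set (preact d x (u i)) {..<k}) {..<n}"
    show "exp A \<le> f x"
    proof (rule ccontr)
      assume "\<not> exp A \<le> f x"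
      then have fx: "f x \<le> exp A" by simp
      \<comment> \<open>The tangent of the exponential at \<open>A\<close>, that is, Jensen's
        inequality in pointwise form.\<close>
      have S: "S i x \<le> A - 1 + exp (- A) * exp (S i x)" for i
        using exp_ge_add_one_self[of "S i x - A"] by (simp add: exp_diff exp_minus divide_inverse mult.commute)
      have "(\<Sum>i<n. S i x) \<le> (\<Sum>i<n. A - 1 + exp (- A) * exp (S i x))"
        by (intro sum_mono S)
      also have "\<dots> = real n * (A - 1 + exp (- A) * f x)"
        using n by (simp add: f_def sum.distrib sum_subtractf sum_distrib_left algebra_simps)
      also have "\<dots> \<le> real n * (A - 1 + exp (- A) * exp A)"
        using fx by (intro mult_left_mono add_left_mono) auto
      also have "\<dots> = real n * A" by (simp flip: exp_add)
      \<comment> \<open>By \<open>ln K \<le> k\<close>. Multiplied by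
        \<open>4 * \<epsilon>\<^sup>2\<close> this gives 416, rounded up to 441, the square of
        21.\<close>
      also have "\<dots> \<le> real n * (104 * real k)" using k by (intro mult_left_mono) (auto simp: A_def)
      finally have "(\<Sum>i<n. (L2_set (preact d x (u i)) {..<k})\<^sup>2) / (4 * \<epsilon>\<^sup>2) \<le> real n * (104 * real k)"
        by (simp add: S_def sum_divide_distrib)
      then have "(\<Sum>i<n. (L2_set (preact d x (u i)) {..<k})\<^sup>2) \<le> 416 * real n * real k * \<epsilon>\<^sup>2"
        using \<epsilon> by (simp add: divide_le_eq)
      also have "\<dots> \<le> 441 * real n * real k * \<epsilon>\<^sup>2" by (intro mult_right_mono) auto
      also have "\<dots> = (21 * sqrt (real n) * sqrt (real k) * \<epsilon>)\<^sup>2" by (simp add: power_mult_distrib)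
      finally have "L2_set (\<lambda>i. L2_set (preact d x (u i)) {..<k}) {..<n} \<le> 21 * sqrt (real n) * sqrt (real k) * \<epsilon>"
        unfolding L2_set_power2[symmetric] by (rule power2_le_imp_le) (use \<epsilon> in auto)
      then show False using big by simp
    qed
  qed
  then have "prob {\<omega> \<in> space ?M. 21 * sqrt (real n) * sqrt (real k) * \<epsilon> < L2_set (\<lambda>i. L2_set (preact d \<omega> (u i)) {..<k}) {..<n}}
     \<le> prob {x \<in> space ?M. exp A \<le> f x}"
    by (intro finite_measure_mono) auto
  with P show ?thesis by linarith
qed

text \<open>The value is 1 for even \<open>k\<close> and \<open>1 - 1 / k\<close> for odd
  \<open>k\<close>, where one neuron is silent.\<close>

lemma balanced_sum_square:
  assumes "balanced k v"
  shows "(\<Sum>r<k. (v r)\<^sup>2) = 2 * real (k div 2) / real k"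
proof -
  define p where "p = 1 / sqrt (real k)"
  define A where "A = {r. r < k \<and> v r = p}"
  define B where "B = {r. r < k \<and> v r = - p}"
  have k: "0 < k" and p: "0 < p" using assms by (simp_all add: p_def balanced_def)
  have AB: "finite A" "finite B" "A \<inter> B = {}" "card A = k div 2" "card B = k div 2"
    using assms p by (auto simp: A_def B_def balanced_def simp flip: p_def)
  have "(\<Sum>r<k. (v r)\<^sup>2) = (\<Sum>r\<in>A \<union> B. (v r)\<^sup>2)"
    using assms by (intro sum.mono_neutral_right) (auto simp: A_def B_def balanced_def simp flip: p_def)
  also have "\<dots> = (\<Sum>r\<in>A \<union> B. 1 / real k)"
    using k by (intro sum.cong) (auto simp: A_def B_def p_def power_divide)
  also have "\<dots> = 2 * real (k div 2) / real k"
    using AB by (simp add: card_Un_disjoint)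
  finally show ?thesis .
qed

text \<open>Hoeffding's inequality: the neurons are independent and each summand lies within
  \<open>\<Gamma>\<^sup>2 / k\<close> of 0. The mean carries the factor from
  \<open>balanced_sum_square\<close>, different from 1 for odd \<open>k\<close>.\<close>

lemma kernel_concentration:
  fixes a c v :: "nat \<Rightarrow> real" and d k :: nat
  assumes v: "balanced k v" and \<phi>' [measurable]: "\<phi>' \<in> borel_measurable borel" and b: "\<And>z. \<bar>\<phi>' z\<bar> \<le> \<Gamma>" and \<Gamma>: "0 < \<Gamma>" and t: "0 \<le> t"
  defines "E \<equiv> \<integral>w. \<phi>' (lin d a w) * \<phi>' (lin d c w) \<partial>std_gaussian {..<d}"
  shows "measure (std_gaussian ({..<k} \<times> {..<d})) {\<omega> \<in> space (std_gaussian ({..<k} \<times> {..<d})).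
     t \<le> \<bar>(\<Sum>r<k. (v r)\<^sup>2 * (\<phi>' (preact d \<omega> a r) * \<phi>' (preact d \<omega> c r))) - 2 * real (k div 2) / real k * E\<bar>}
     \<le> 2 * exp (- (t\<^sup>2 * real k / (2 * \<Gamma>^4)))"
proof -
  interpret prob_space "std_gaussian ({..<k} \<times> {..<d})" by (rule prob_space_std_gaussian)
  let ?M = "std_gaussian ({..<k} \<times> {..<d})"
  define X where "X r \<omega> = (v r)\<^sup>2 * (\<phi>' (lin d a (neuron d r \<omega>)) * \<phi>' (lin d c (neuron d r \<omega>)))" for r \<omega>
  have k: "0 < k" using v by (simp add: balanced_def)
  have v2: "(v r)\<^sup>2 \<le> 1 / real k" if "r < k" for r
    using v that k by (fastforce simp: balanced_def power_divide)
  have Xb: "\<bar>X r \<omega>\<bar> \<le> \<Gamma>\<^sup>2 / real k" if "r < k" for r \<omega>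
  proof -
    have "\<bar>X r \<omega>\<bar> = (v r)\<^sup>2 * (\<bar>\<phi>' (lin d a (neuron d r \<omega>))\<bar> * \<bar>\<phi>' (lin d c (neuron d r \<omega>))\<bar>)"
      by (simp add: X_def abs_mult)
    also have "\<dots> \<le> 1 / real k * (\<Gamma> * \<Gamma>)"
      using \<Gamma> by (intro mult_mono v2 b that) auto
    finally show ?thesis by (simp add: power2_eq_square)
  qed
  interpret Hoeffding_ineq ?M "{..<k}" X "\<lambda>_. - (\<Gamma>\<^sup>2 / real k)" "\<lambda>_. \<Gamma>\<^sup>2 / real k" "\<Sum>r<k. expectation (X r)"
  proof unfold_locales
    show "indep_vars (\<lambda>_. borel) X {..<k}"
      unfolding X_def[abs_def] by (rule indep_vars_compose2[OF indep_neurons]) measurable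
    show "AE x in ?M. X i x \<in> {- (\<Gamma>\<^sup>2 / real k)..\<Gamma>\<^sup>2 / real k}" if "i \<in> {..<k}" for i
      using Xb[of i] that by (auto simp: abs_le_iff) (use minus_le_iff in blast)
  qed auto
  have EX: "expectation (X r) = (v r)\<^sup>2 * E" if r: "r < k" for r
  proof -
    have "(\<integral>\<omega>. \<phi>' (lin d a (neuron d r \<omega>)) * \<phi>' (lin d c (neuron d r \<omega>)) \<partial>?M) = E"
      unfolding E_def by (subst distr_neuron[OF r, symmetric], subst integral_distr[OF neuron_measurable[OF r]]) auto
    then show ?thesis unfolding X_def by simp
  qed
  have \<mu>: "(\<Sum>r<k. expectation (X r)) = 2 * real (k div 2) / real k * E"
    using EX by (simp add: balanced_sum_square[OF v, symmetric] sum_distrib_right)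
  have s: "(\<Sum>r<k. (\<Gamma>\<^sup>2 / real k - - (\<Gamma>\<^sup>2 / real k))\<^sup>2) = 4 * \<Gamma>^4 / real k"
    using k by (simp add: power2_eq_square eval_nat_numeral field_simps)
  have "prob {\<omega> \<in> space ?M. t \<le> \<bar>(\<Sum>r<k. X r \<omega>) - (\<Sum>r<k. expectation (X r))\<bar>} \<le> 2 * exp (- 2 * t\<^sup>2 / (4 * \<Gamma>^4 / real k))"
    using Hoeffding_ineq_abs_ge[OF t, unfolded s] \<Gamma> k by simp
  also have "- 2 * t\<^sup>2 / (4 * \<Gamma>^4 / real k) = - (t\<^sup>2 * real k / (2 * \<Gamma>^4))"
    using k \<Gamma> by (simp add: field_simps)
  finally show ?thesis unfolding \<mu> by (simp add: X_def preact_lin)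
qed

section \<open>Grids and chaining\<close>

text \<open>Rounding towards zero never increases the modulus, so rounded points stay in the ball,
  which rounding down would not guarantee.\<close>

definition trunc :: "real \<Rightarrow> int" where
  "trunc x = (if 0 \<le> x then \<lfloor>x\<rfloor> else - \<lfloor>- x\<rfloor>)"

lemma trunc_abs: "\<bar>real_of_int (trunc x)\<bar> \<le> \<bar>x\<bar>" (is ?A)
  and trunc_diff: "\<bar>x - real_of_int (trunc x)\<bar> \<le> 1" (is ?B)
proof -
  have *: "0 \<le> real_of_int \<lfloor>y\<rfloor>" "real_of_int \<lfloor>y\<rfloor> \<le> y" "y \<le> real_of_int \<lfloor>y\<rfloor> + 1" if "0 \<le> y" for y :: real
    using that by (simp_all add: real_of_int_floor_add_one_ge)
  show ?A ?B
    using *[of x] *[of "- x"] by (cases "0 \<le> x"; simp add: trunc_def abs_if; linarith)+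
qed

text \<open>Each half is a geometric series of ratio \<open>q\<close>, of sum at most
  \<open>N\<close> because \<open>1 + 1 / N \<le> exp (1 / N)\<close>; the term at 0 is at most
  \<open>N\<close> as well.\<close>

lemma sum_exp_abs_le:
  assumes N: "1 \<le> (N::real)"
  shows "(\<Sum>a\<in>{- int m..int m}. exp (- (\<bar>real_of_int a\<bar> / N))) \<le> 3 * N"
proof -
  define q where "q = exp (- (1 / N))"
  have q: "0 < q" "q < 1" using N by (simp_all add: q_def)
  have geo: "(\<Sum>j<m. q ^ Suc j) \<le> N"
  proof -
    have "1 + 1 / N \<le> exp (1 / N)" by (rule exp_ge_add_one_self)
    then have "q * (1 + 1 / N) \<le> q * exp (1 / N)" using q by (intro mult_left_mono) auto
    also have "\<dots> = 1" by (simp add: q_def flip: exp_add)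
    finally have "q \<le> N * (1 - q)" using N by (simp add: field_simps)
    moreover have "(\<Sum>j<m. q ^ Suc j) = q * ((1 - q ^ m) / (1 - q))"
      using q by (simp add: sum_distrib_left[symmetric] sum_gp_strict)
    moreover have "q * ((1 - q ^ m) / (1 - q)) \<le> q * (1 / (1 - q))"
      using q by (intro mult_left_mono divide_right_mono) auto
    moreover have "q * (1 / (1 - q)) \<le> N" using \<open>q \<le> N * (1 - q)\<close> q by (simp add: divide_le_eq)
    ultimately show ?thesis by linarith
  qed
  have split: "{- int m..int m} = {0} \<union> (\<lambda>j. int (Suc j)) ` {..<m} \<union> (\<lambda>j. - int (Suc j)) ` {..<m}"
  proof (rule equalityI; rule subsetI)
    fix a assume "a \<in> {- int m..int m}"
    then have a: "- int m \<le> a" "a \<le> int m" by auto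
    consider "a = 0" | "0 < a" | "a < 0" by linarith
    then show "a \<in> {0} \<union> (\<lambda>j. int (Suc j)) ` {..<m} \<union> (\<lambda>j. - int (Suc j)) ` {..<m}"
    proof cases
      case 2
      then have "a = int (Suc (nat a - 1))" "nat a - 1 < m" using a by auto
      then show ?thesis by blast
    next
      case 3
      then have "a = - int (Suc (nat (- a) - 1))" "nat (- a) - 1 < m" using a by auto
      then show ?thesis by blast
    qed simp
  qed auto
  have e: "exp (- (\<bar>real_of_int a\<bar> / N)) = q ^ nat \<bar>a\<bar>" for a
    unfolding q_def exp_of_nat_mult[symmetric] by simp
  have "(\<Sum>a\<in>{- int m..int m}. q ^ nat \<bar>a\<bar>) = 1 + (\<Sum>j<m. q ^ Suc j) + (\<Sum>j<m. q ^ Suc j)"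
    unfolding split by (subst sum.union_disjoint, simp, simp, force, subst sum.union_disjoint)
      (auto simp: sum.reindex inj_on_def nat_add_distrib simp del: of_nat_Suc)
  also have "\<dots> \<le> 1 + N + N" using geo by linarith
  finally show ?thesis unfolding e using N by linarith
qed

text \<open>Lattice points of an l1 ball. The unit Euclidean ball, scaled by
  \<open>sqrt d * 2 ^ j\<close>, fits into it by Cauchy-Schwarz, and the l1 norm splits over the
  coordinates, which makes counting easy and gives a cardinality of the form constant to the power
  \<open>d\<close>.\<close>

definition grid :: "nat \<Rightarrow> nat \<Rightarrow> (nat \<Rightarrow> int) set" where
  "grid d j = {z \<in> PiE {..<d} (\<lambda>_. {- int (d * 2 ^ j)..int (d * 2 ^ j)}). (\<Sum>i<d. \<bar>z i\<bar>) \<le> int (d * 2 ^ j)}"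

lemma finite_box: "finite (PiE {..<d::nat} (\<lambda>_. {a..b::int}))"
  by (rule finite_PiE) auto

lemma finite_grid: "finite (grid d j)"
  unfolding grid_def 
  by (rule finite_subset[of _ "PiE {..<d} (\<lambda>_. {- int (d * 2 ^ j)..int (d * 2 ^ j)})"]) (simp_all add: finite_box)

text \<open>Chernoff: count lattice points against the weight \<open>exp (d - \<Sum>|z i| / 2 ^ j) \<ge> 1\<close>.\<close>
lemma card_grid: "real (card (grid d j)) \<le> (9 * 2 ^ j) ^ d"
proof -
  define N where "N = (2::real) ^ j"
  have N: "1 \<le> N" by (simp add: N_def)
  let ?B = "{- int (d * 2 ^ j)..int (d * 2 ^ j)}"
  have "real (card (grid d j)) = (\<Sum>z\<in>grid d j. 1)" by simp
  also have "\<dots> \<le> (\<Sum>z\<in>grid d j. exp (real d) * (\<Prod>i<d. exp (- (\<bar>real_of_int (z i)\<bar> / N))))"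
  proof (rule sum_mono)
    fix z assume "z \<in> grid d j"
    then have "real_of_int (\<Sum>i<d. \<bar>z i\<bar>) \<le> real_of_int (int (d * 2 ^ j))"
      unfolding of_int_le_iff by (simp add: grid_def)
    then have "(\<Sum>i<d. \<bar>real_of_int (z i)\<bar>) \<le> real d * N" by (simp add: N_def)
    then have "(\<Sum>i<d. \<bar>real_of_int (z i)\<bar>) / N \<le> real d" using N by (simp add: divide_le_eq)
    then have "0 \<le> real d + (\<Sum>i<d. - (\<bar>real_of_int (z i)\<bar> / N))"
      by (simp add: sum_negf sum_divide_distrib)
    then have "1 \<le> exp (real d + (\<Sum>i<d. - (\<bar>real_of_int (z i)\<bar> / N)))" by simp
    then show "1 \<le> exp (real d) * (\<Prod>i<d. exp (- (\<bar>real_of_int (z i)\<bar> / N)))"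
      by (simp add: exp_add exp_sum)
  qed
  also have "\<dots> \<le> (\<Sum>z\<in>PiE {..<d} (\<lambda>_. ?B). exp (real d) * (\<Prod>i<d. exp (- (\<bar>real_of_int (z i)\<bar> / N))))"
  proof (rule sum_mono2[OF finite_box])
    show "grid d j \<subseteq> PiE {..<d} (\<lambda>_. ?B)" unfolding grid_def by blast
  qed (simp add: prod_nonneg)
  also have "\<dots> = exp (real d) * (\<Prod>i<d. \<Sum>a\<in>?B. exp (- (\<bar>real_of_int a\<bar> / N)))"
    by (subst prod_sum_PiE) (auto simp: sum_distrib_left)
  also have "\<dots> \<le> exp (real d) * (\<Prod>i<d. 3 * N)"
    by (intro mult_left_mono prod_mono) (use sum_exp_abs_le[OF N, of "d * 2 ^ j"] in \<open>auto intro!: sum_nonneg\<close>)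
  also have "\<dots> = (exp 1 * (3 * N)) ^ d"
    by (simp add: power_mult_distrib flip: exp_of_nat_mult)
  also have "\<dots> \<le> (9 * 2 ^ j) ^ d"
    using exp_le by (intro power_mono) (auto simp: N_def)
  finally show ?thesis .
qed

text \<open>The mesh \<open>1 / (sqrt d * 2 ^ j)\<close> keeps the Euclidean error of coordinatewise
  rounding below \<open>1 / 2 ^ j\<close>.\<close>

definition gpoint :: "nat \<Rightarrow> nat \<Rightarrow> (nat \<Rightarrow> int) \<Rightarrow> nat \<Rightarrow> real" where
  "gpoint d j z i = real_of_int (z i) / (sqrt (real d) * 2 ^ j)"

definition ground :: "nat \<Rightarrow> nat \<Rightarrow> (nat \<Rightarrow> real) \<Rightarrow> nat \<Rightarrow> int" where
  "ground d j u = (\<lambda>i\<in>{..<d}. trunc (u i * (sqrt (real d) * 2 ^ j)))"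

lemma ground_grid:
  assumes d: "0 < d" and u: "L2_set u {..<d} \<le> 1"
  shows "ground d j u \<in> grid d j"
proof -
  let ?s = "sqrt (real d) * 2 ^ j"
  have s: "0 < ?s" using d by simp
  have "(\<Sum>i<d. \<bar>u i\<bar>) \<le> L2_set u {..<d} * L2_set (\<lambda>_. 1) {..<d}"
    using L2_set_mult_ineq[of u "\<lambda>_. 1" "{..<d}"] by simp
  also have "\<dots> \<le> 1 * sqrt (real d)"
    using u by (intro mult_mono) (auto simp: L2_set_def)
  finally have u1: "(\<Sum>i<d. \<bar>u i\<bar>) \<le> sqrt (real d)" by simp
  have "real_of_int (\<Sum>i<d. \<bar>ground d j u i\<bar>) = (\<Sum>i<d. \<bar>real_of_int (trunc (u i * ?s))\<bar>)"
    by (simp add: ground_def)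
  also have "\<dots> \<le> (\<Sum>i<d. \<bar>u i\<bar> * ?s)"
    using trunc_abs[of "u _ * ?s"] s by (intro sum_mono) (simp add: abs_mult)
  also have "\<dots> \<le> sqrt (real d) * ?s"
    unfolding sum_distrib_right[symmetric] using s by (intro mult_right_mono u1) auto
  also have "\<dots> = real_of_int (int (d * 2 ^ j))" by simp
  finally have le: "(\<Sum>i<d. \<bar>ground d j u i\<bar>) \<le> int (d * 2 ^ j)" unfolding of_int_le_iff .
  have "\<bar>ground d j u i\<bar> \<le> int (d * 2 ^ j)" if "i < d" for i
    using le member_le_sum[of i "{..<d}" "\<lambda>i. \<bar>ground d j u i\<bar>"] that by simp
  then have "ground d j u \<in> PiE {..<d} (\<lambda>_. {- int (d * 2 ^ j)..int (d * 2 ^ j)})"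
    by (auto simp: ground_def abs_le_iff minus_le_iff split: if_splits)
  with le show ?thesis by (simp add: grid_def)
qed

lemma gpoint_ground:
  assumes d: "0 < d"
  shows "L2_set (\<lambda>i. u i - gpoint d j (ground d j u) i) {..<d} \<le> 1 / 2 ^ j"
    and "L2_set (gpoint d j (ground d j u)) {..<d} \<le> L2_set u {..<d}"
proof -
  let ?s = "sqrt (real d) * 2 ^ j"
  have s: "0 < ?s" using d by simp
  have "L2_set (\<lambda>i. u i - gpoint d j (ground d j u) i) {..<d} \<le> L2_set (\<lambda>i. 1 / ?s) {..<d}"
  proof (rule L2_set_abs_mono)
    fix i assume "i \<in> {..<d}"
    then have "u i - gpoint d j (ground d j u) i = (u i * ?s - real_of_int (trunc (u i * ?s))) / ?s"
      using s by (simp add: gpoint_def ground_def diff_divide_distrib)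
    then show "\<bar>u i - gpoint d j (ground d j u) i\<bar> \<le> \<bar>1 / ?s\<bar>"
      using trunc_diff[of "u i * ?s"] s by (simp add: abs_divide divide_right_mono)
  qed
  also have "\<dots> = 1 / 2 ^ j" using d by (simp add: L2_set_def real_sqrt_mult power_divide real_sqrt_divide)
  finally show "L2_set (\<lambda>i. u i - gpoint d j (ground d j u) i) {..<d} \<le> 1 / 2 ^ j" .
  show "L2_set (gpoint d j (ground d j u)) {..<d} \<le> L2_set u {..<d}"
  proof (rule L2_set_abs_mono)
    fix i assume "i \<in> {..<d}"
    then show "\<bar>gpoint d j (ground d j u) i\<bar> \<le> \<bar>u i\<bar>"
      using trunc_abs[of "u i * ?s"] s by (simp add: gpoint_def ground_def abs_divide abs_mult divide_le_eq)
  qed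
qed

text \<open>A bound on the half-net extends to the ball by iterating \<open>u \<mapsto> 2 (u - \<pi> u)\<close>.\<close>
lemma operator_norm_from_grid:
  assumes d: "0 < d"
    and B: "\<And>z. z \<in> grid d 1 \<Longrightarrow> L2_set (gpoint d 1 z) {..<d} \<le> 1 \<Longrightarrow> L2_set (preact d W (gpoint d 1 z)) {..<k} \<le> B"
  shows "L2_set (preact d W u) {..<k} \<le> 2 * B * L2_set u {..<d}"
proof -
  define F where "F = L2_set W ({..<k} \<times> {..<d})"
  have B0: "0 \<le> B"
  proof -
    have "ground d 1 (\<lambda>_. 0) \<in> grid d 1" by (rule ground_grid[OF d]) (simp add: L2_set_def)
    moreover have "L2_set (gpoint d 1 (ground d 1 (\<lambda>_. 0))) {..<d} \<le> 1"
      using gpoint_ground(2)[OF d, of 1 "\<lambda>_. 0"] by (simp add: L2_set_def)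
    ultimately show ?thesis using B L2_set_nonneg order_trans by blast
  qed
  have lin: "preact d W (\<lambda>i. a * x i) r = a * preact d W x r" for a x r
    by (simp add: preact_def sum_distrib_left mult_ac)
  \<comment> \<open>The Frobenius norm \<open>F\<close> only starts the induction; each round halves
    its share, and \<open>2 * B\<close> is the fixed point of adding \<open>B\<close> to half the
    previous bound.\<close>
  have it: "L2_set (preact d W u) {..<k} \<le> 2 * B + F / 2 ^ m" if "L2_set u {..<d} \<le> 1" for m u
    using that
  proof (induction m arbitrary: u)
    case 0
    have "L2_set (preact d W u) {..<k} \<le> F * L2_set u {..<d}" unfolding F_def by (rule preact_L2)
    also have "\<dots> \<le> F * 1" by (intro mult_left_mono 0) (simp add: F_def L2_set_nonneg)
    finally show ?case using B0 by simp
  next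
    case (Suc m)
    define p where "p = gpoint d 1 (ground d 1 u)"
    have Bp: "L2_set (preact d W p) {..<k} \<le> B"
      unfolding p_def by (rule B[OF ground_grid[OF d Suc.prems]]) (use gpoint_ground(2)[OF d, of 1 u] Suc.prems in linarith)
    have "L2_set (\<lambda>i. 2 * (u i - p i)) {..<d} \<le> 1"
      using gpoint_ground(1)[OF d, of u 1] unfolding L2_set_scale by (simp add: p_def)
    from Suc.IH[OF this] have IH: "2 * L2_set (preact d W (\<lambda>i. u i - p i)) {..<k} \<le> 2 * B + F / 2 ^ m"
      using L2_set_scale[of 2 "preact d W (\<lambda>i. u i - p i)"] lin[of 2 "\<lambda>i. u i - p i"] by (simp add: lin[abs_def])
    then have IH2: "L2_set (preact d W (\<lambda>i. u i - p i)) {..<k} \<le> (2 * B + F / 2 ^ m) / 2" by simp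
    have "L2_set (preact d W u) {..<k} = L2_set (\<lambda>r. preact d W p r + preact d W (\<lambda>i. u i - p i) r) {..<k}"
      by (simp flip: preact_diff_right)
    also have "\<dots> \<le> B + (2 * B + F / 2 ^ m) / 2"
      by (rule order_trans[OF L2_set_triangle_ineq add_mono[OF Bp IH2]])
    finally show ?case by (simp add: field_simps)
  qed
  have unit: "L2_set (preact d W u) {..<k} \<le> 2 * B" if "L2_set u {..<d} \<le> 1" for u
  proof (rule LIMSEQ_le_const)
    show "(\<lambda>m. 2 * B + F * (1 / 2) ^ m) \<longlonglongrightarrow> 2 * B"
      by (rule tendsto_eq_intros tendsto_mult_right_zero LIMSEQ_power_zero | simp)+
    show "\<exists>N. \<forall>m\<ge>N. L2_set (preact d W u) {..<k} \<le> 2 * B + F * (1 / 2) ^ m"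
      using it[OF that] by (simp add: power_divide)
  qed
  show ?thesis
  proof (cases "L2_set u {..<d} = 0")
    case True
    then have "preact d W u r = 0" for r by (simp add: L2_set_eq_0_iff preact_def)
    then show ?thesis using True by (simp add: L2_set_def)
  next
    case False
    then have u: "0 < L2_set u {..<d}" by (simp add: L2_set_nonneg order_less_le)
    have "L2_set (\<lambda>i. 1 / L2_set u {..<d} * u i) {..<d} \<le> 1"
      unfolding L2_set_scale using u by simp
    note * = unit[OF this]
    have "preact d W (\<lambda>i. 1 / L2_set u {..<d} * u i) = (\<lambda>r. 1 / L2_set u {..<d} * preact d W u r)"
      by (rule ext) (rule lin)
    from *[unfolded this L2_set_scale] have "1 / L2_set u {..<d} * L2_set (preact d W u) {..<k} \<le> 2 * B"
      using u by simp
    then show ?thesis using u by (simp add: field_simps)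
  qed
qed

lemma sum_Suc_halves: "(\<Sum>j<m. real (Suc j) / 2 ^ j) \<le> 4"
proof -
  have "(\<Sum>j<m. real (Suc j) / 2 ^ j) = 4 - (2 * real m + 4) / 2 ^ m"
  proof (induction m)
    case (Suc m)
    show ?case unfolding sum.lessThan_Suc Suc.IH by (simp add: field_simps)
  qed simp
  then show ?thesis by simp
qed

text \<open>The level is shifted by one: level 0 is the origin alone, the common starting point of
  all chains, and level \<open>Suc i\<close> is the grid of precision
  \<open>1 / 2 ^ i\<close>.\<close>

definition chain :: "nat \<Rightarrow> nat \<Rightarrow> (nat \<Rightarrow> real) set" where
  "chain d j = (case j of 0 \<Rightarrow> {\<lambda>_. 0} | Suc i \<Rightarrow> gpoint d i ` grid d i)"

lemma finite_chain: "finite (chain d j)"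
  by (cases j) (simp_all add: chain_def finite_grid)

lemma card_chain: "real (card (chain d j)) \<le> (9 * 2 ^ j) ^ d"
proof (cases j)
  case (Suc i)
  have "real (card (chain d j)) \<le> real (card (grid d i))"
    using card_image_le[OF finite_grid] by (simp add: chain_def Suc)
  also have "\<dots> \<le> (9 * 2 ^ i) ^ d" by (rule card_grid)
  also have "\<dots> \<le> (9 * 2 ^ j) ^ d" by (intro power_mono) (auto simp: Suc)
  finally show ?thesis .
qed (simp add: chain_def)

text \<open>Telescoping along the successive roundings of \<open>u\<close>. The permitted increments
  carry the factor \<open>Suc j\<close>, which pays for the growing number of pairs at level
  \<open>j\<close> and still sums to 4. The constant \<open>F\<close> may be arbitrarily large,
  since it only serves to pass to the limit.\<close>

lemma chaining:
  fixes g :: "(nat \<Rightarrow> real) \<Rightarrow> real"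
  assumes d: "0 < d" and u: "L2_set u {..<d} \<le> 1" and M: "0 \<le> M"
    and lip: "\<And>x y. \<bar>g x - g y\<bar> \<le> F * L2_set (\<lambda>i. x i - y i) {..<d}"
    and inc: "\<And>j p q. p \<in> chain d j \<Longrightarrow> q \<in> chain d (Suc j) \<Longrightarrow> L2_set (\<lambda>i. q i - p i) {..<d} \<le> 3 / 2 ^ j \<Longrightarrow>
       \<bar>g q - g p\<bar> \<le> M * (real (Suc j) / 2 ^ j)"
  shows "\<bar>g u - g (\<lambda>_. 0)\<bar> \<le> 4 * M"
proof -
  define p where "p j = (case j of 0 \<Rightarrow> (\<lambda>_. 0) | Suc i \<Rightarrow> gpoint d i (ground d i u))" for j
  have p: "p j \<in> chain d j" for j
    using ground_grid[OF d u] by (cases j) (auto simp: p_def chain_def)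
  have dist: "L2_set (\<lambda>i. u i - p (Suc j) i) {..<d} \<le> 1 / 2 ^ j" for j
    using gpoint_ground(1)[OF d] by (simp add: p_def)
  have close: "L2_set (\<lambda>i. p (Suc j) i - p j i) {..<d} \<le> 3 / 2 ^ j" for j
  proof (cases j)
    case 0
    then show ?thesis using gpoint_ground(2)[OF d, of 0 u] u by (simp add: p_def)
  next
    case (Suc i)
    have "L2_set (\<lambda>i. p (Suc j) i - p j i) {..<d} = L2_set (\<lambda>i. (u i - p j i) - (u i - p (Suc j) i)) {..<d}"
      by simp
    also have "\<dots> \<le> 1 / 2 ^ i + 1 / 2 ^ j"
      using dist[of j] dist[of i] Suc by (intro order_trans[OF L2_set_triangle_diff]) simp
    also have "\<dots> = 3 / 2 ^ j" by (simp add: Suc)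
    finally show ?thesis .
  qed
  have tele: "\<bar>g (p m) - g (\<lambda>_. 0)\<bar> \<le> M * (\<Sum>j<m. real (Suc j) / 2 ^ j)" for m
  proof (induction m)
    case 0
    then show ?case by (simp add: p_def)
  next
    case (Suc m)
    have "\<bar>g (p (Suc m)) - g (p m)\<bar> \<le> M * (real (Suc m) / 2 ^ m)" by (rule inc[OF p p close])
    with Suc show ?case by (simp add: distrib_left)
  qed
  \<comment> \<open>Nonnegativity of \<open>F\<close> is read off from the Lipschitz condition at
    two points of distance \<open>sqrt d\<close>.\<close>
  have "0 \<le> F * sqrt (real d)"
    using order_trans[OF abs_ge_zero lip[of "\<lambda>_. 1" "\<lambda>_. 0"]] by (simp add: L2_set_def)
  then have F: "0 \<le> F" using d by (simp add: zero_le_mult_iff)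
  show ?thesis
  proof (rule LIMSEQ_le_const)
    show "(\<lambda>m. 4 * M + F * (1 / 2) ^ m) \<longlonglongrightarrow> 4 * M"
      by (rule tendsto_eq_intros tendsto_mult_right_zero LIMSEQ_power_zero | simp)+
    have "\<bar>g u - g (\<lambda>_. 0)\<bar> \<le> 4 * M + F * (1 / 2) ^ m" for m
    proof -
      have "M * (\<Sum>j<Suc m. real (Suc j) / 2 ^ j) \<le> M * 4" by (intro mult_left_mono sum_Suc_halves M)
      moreover have "F * L2_set (\<lambda>i. u i - p (Suc m) i) {..<d} \<le> F * (1 / 2) ^ m"
        using dist[of m] F by (intro mult_left_mono) (simp_all add: power_divide)
      ultimately show ?thesis using tele[of "Suc m"] lip[of u "p (Suc m)"] by linarith
    qed
    then show "\<exists>N. \<forall>m\<ge>N. \<bar>g u - g (\<lambda>_. 0)\<bar> \<le> 4 * M + F * (1 / 2) ^ m" by blast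
  qed
qed

section \<open>The random initialisation\<close>

lemma (in prob_space) prob_UN_le:
  assumes "finite I" "\<And>i. i \<in> I \<Longrightarrow> A i \<in> events" "\<And>i. i \<in> I \<Longrightarrow> prob (A i) \<le> b"
  shows "prob (\<Union>i\<in>I. A i) \<le> real (card I) * b"
proof -
  have "prob (\<Union>i\<in>I. A i) \<le> (\<Sum>i\<in>I. prob (A i))"
    using assms by (intro measure_UNION_le) auto
  also have "\<dots> \<le> real (card I) * b" using assms sum_bounded_above[of I "\<lambda>i. prob (A i)" b] by simp
  finally show ?thesis .
qed

lemma (in prob_space) prob_UN_halves_le:
  assumes "\<And>j::nat. A j \<in> events" "\<And>j. prob (A j) \<le> b * (1 / 2) ^ j" "0 \<le> b"
  shows "prob (\<Union>j. A j) \<le> 2 * b"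
proof -
  have s: "summable (\<lambda>j. b * (1 / 2 :: real) ^ j)" by (intro summable_mult summable_geometric) simp
  have s': "summable (\<lambda>j. prob (A j))"
    by (rule summable_comparison_test[OF _ s]) (use assms in auto)
  have "prob (\<Union>j. A j) \<le> (\<Sum>j. prob (A j))"
    using assms(1) s' by (intro finite_measure_subadditive_countably) auto
  also have "\<dots> \<le> (\<Sum>j. b * (1 / 2) ^ j)" by (intro suminf_le assms s s')
  also have "\<dots> = 2 * b" by (subst suminf_mult) (simp_all add: suminf_geometric summable_geometric)
  finally show ?thesis .
qed

context shallow_net
begin

abbreviation "MW \<equiv> std_gaussian P"

lemma phi_lip: "\<bar>\<phi> a - \<phi> b\<bar> \<le> \<Gamma> * \<bar>a - b\<bar>"
proof (induction a b rule: linorder_wlog)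
  case (le a b)
  show ?case
  proof (cases "a = b")
    case False
    then have "\<exists>z. a < z \<and> z < b \<and> \<phi> b - \<phi> a = (b - a) * \<phi>' z"
      using le by (intro MVT2 deriv) auto
    then obtain z where "\<phi> b - \<phi> a = (b - a) * \<phi>' z" by blast
    then show ?thesis using bound[of z] le
      by (simp add: abs_minus_commute[of "\<phi> a"] abs_mult mult_right_mono mult.commute abs_minus_commute[of a])
  qed simp
qed (simp add: abs_minus_commute)

lemma phi_measurable [measurable]: "\<phi> \<in> borel_measurable borel"
  by (intro borel_measurable_continuous_onI continuous_at_imp_continuous_on ballI DERIV_isCont[OF deriv])

lemma phi'_continuous: "continuous_on UNIV \<phi>'"
proof -
  have "\<Gamma>-lipschitz_on UNIV \<phi>'"
    using lip \<Gamma> by (intro lipschitz_onI) (auto simp: dist_real_def)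
  then show ?thesis by (rule lipschitz_on_continuous_on)
qed

lemma phi'_measurable [measurable]: "\<phi>' \<in> borel_measurable borel"
  by (intro borel_measurable_continuous_onI phi'_continuous)

lemma out_measurable [measurable]: "(\<lambda>\<omega>. out \<omega> x) \<in> borel_measurable MW"
  unfolding out_def by (intro borel_measurable_sum borel_measurable_times) auto

text \<open>A pathwise bound with the random Frobenius norm: too crude for estimates, but enough for
  coinciding inputs and as the constant \<open>F\<close> in \<open>chaining\<close>.\<close>

lemma out_lip: "\<bar>out W x - out W x'\<bar> \<le> \<Gamma> * L2_set W P * L2_set (\<lambda>j. x j - x' j) {..<d}"
proof -
  have "out W x - out W x' = (\<Sum>r<k. v r * (\<phi> (preact d W x r) - \<phi> (preact d W x' r)))"
    by (simp add: out_def right_diff_distrib sum_subtractf)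
  also have "\<bar>\<dots>\<bar> \<le> (\<Sum>r<k. \<bar>1 / sqrt (real k)\<bar> * \<bar>\<Gamma> * (preact d W x r - preact d W x' r)\<bar>)"
  proof (rule order_trans[OF sum_abs sum_mono])
    fix r assume "r \<in> {..<k}"
    then show "\<bar>v r * (\<phi> (preact d W x r) - \<phi> (preact d W x' r))\<bar> \<le> \<bar>1 / sqrt (real k)\<bar> * \<bar>\<Gamma> * (preact d W x r - preact d W x' r)\<bar>"
      unfolding abs_mult using v \<Gamma> phi_lip[of "preact d W x r" "preact d W x' r"] by (intro mult_mono) auto
  qed
  also have "\<dots> \<le> L2_set (\<lambda>_. 1 / sqrt (real k)) {..<k} * L2_set (\<lambda>r. \<Gamma> * (preact d W x r - preact d W x' r)) {..<k}"
    by (rule L2_set_mult_ineq)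
  also have "\<dots> = \<Gamma> * L2_set (preact d W (\<lambda>j. x j - x' j)) {..<k}"
    unfolding L2_set_scale using k \<Gamma> by (simp add: L2_set_def power_divide preact_diff_right)
  also have "\<dots> \<le> \<Gamma> * (L2_set W P * L2_set (\<lambda>j. x j - x' j) {..<d})"
    using \<Gamma> by (intro mult_left_mono preact_L2) auto
  finally show ?thesis by (simp add: mult.assoc)
qed

text \<open>The increment is a balanced random network with activation
  \<open>\<phi> (lin d x w) - \<phi> (lin d x' w)\<close>, which is dominated by \<Gamma> times the
  linear form of \<open>x - x'\<close>.\<close>

lemma increment_mgf:
  assumes "balanced k v" "L2_set (\<lambda>j. x j - x' j) {..<d} \<le> \<epsilon>"
  shows "(\<integral>\<^sup>+\<omega>. ennreal (exp (s * (out \<omega> x - out \<omega> x'))) \<partial>MW) \<le> ennreal (exp (s\<^sup>2 * (\<Gamma> * \<epsilon>)\<^sup>2 / 2))"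
proof -
  define \<psi> where "\<psi> w = \<phi> (lin d x w) - \<phi> (lin d x' w)" for w
  have diff: "out \<omega> x - out \<omega> x' = (\<Sum>r<k. v r * \<psi> (neuron d r \<omega>))" for \<omega>
    by (simp add: out_def \<psi>_def right_diff_distrib sum_subtractf preact_lin)
  have "(\<integral>\<^sup>+\<omega>. ennreal (exp (s * (\<Sum>r<k. v r * \<psi> (neuron d r \<omega>)))) \<partial>MW)
      \<le> ennreal (exp (s\<^sup>2 * (\<Gamma> * L2_set (\<lambda>j. x j - x' j) {..<d})\<^sup>2 / 2))"
  proof (rule random_net_mgf[OF assms(1)])
    show "\<psi> \<in> borel_measurable (std_gaussian {..<d})" unfolding \<psi>_def[abs_def] by measurable
    show "\<bar>\<psi> w\<bar> \<le> \<Gamma> * \<bar>lin d (\<lambda>j. x j - x' j) w\<bar>" for w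
      using phi_lip[of "lin d x w" "lin d x' w"] by (simp add: \<psi>_def lin_def sum_subtractf right_diff_distrib)
  qed (use \<Gamma> in simp)
  also have "\<dots> \<le> ennreal (exp (s\<^sup>2 * (\<Gamma> * \<epsilon>)\<^sup>2 / 2))"
    using assms(2) \<Gamma> by (intro ennreal_leI) (auto intro!: mult_left_mono power_mono divide_right_mono L2_set_nonneg mult_nonneg_nonneg)
  finally show ?thesis by (simp add: diff)
qed

text \<open>The output weights sum to zero, so the value \<open>\<phi> 0\<close> cancels. The output
  at \<open>x\<close> is thus the increment from the origin, and \<open>increment_mgf\<close>
  applies to it.\<close>

lemma out_zero: "balanced k v \<Longrightarrow> out W (\<lambda>_. 0) = 0"
proof -
  assume b: "balanced k v"
  define p where "p = 1 / sqrt (real k)"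
  define A where "A = {r. r < k \<and> v r = p}"
  define B where "B = {r. r < k \<and> v r = - p}"
  have p: "0 < p" using k by (simp add: p_def)
  have AB: "finite A" "finite B" "A \<inter> B = {}" "card A = k div 2" "card B = k div 2"
    using b p by (auto simp: A_def B_def balanced_def simp flip: p_def)
  have "(\<Sum>r<k. v r) = (\<Sum>r\<in>A \<union> B. v r)"
    using b by (intro sum.mono_neutral_right) (auto simp: A_def B_def balanced_def simp flip: p_def)
  also have "\<dots> = (\<Sum>r\<in>A. v r) + (\<Sum>r\<in>B. v r)" using AB by (intro sum.union_disjoint)
  also have "(\<Sum>r\<in>A. v r) = (\<Sum>r\<in>A. p)" by (intro sum.cong) (auto simp: A_def)
  also have "(\<Sum>r\<in>B. v r) = (\<Sum>r\<in>B. - p)" by (intro sum.cong) (auto simp: B_def)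
  finally have "(\<Sum>r<k. v r) = 0" by (simp add: AB)
  then show "out W (\<lambda>_. 0) = 0" by (simp add: out_def preact_def flip: sum_distrib_right)
qed

lemma prob_initial_output:
  assumes b: "balanced k v" and X: "\<And>i. i < n \<Longrightarrow> L2_set (X i) {..<d} = 1" and n: "0 < n" and K: "2 \<le> K"
  shows "measure MW {\<omega> \<in> space MW. 150 * \<Gamma> * sqrt (real n) * sqrt (ln (real K)) < L2_set (\<lambda>i. out \<omega> (X i)) {..<n}} \<le> 1 / real K ^ 103"
proof -
  interpret prob_space MW by (rule prob_space_std_gaussian)
  show ?thesis
  proof (rule subgaussian_L2[OF out_measurable _ n K])
    fix i s assume "i < n"
    then show "(\<integral>\<^sup>+\<omega>. ennreal (exp (s * out \<omega> (X i))) \<partial>MW) \<le> ennreal (exp (s\<^sup>2 * \<Gamma>\<^sup>2 / 2))"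
      using increment_mgf[OF b, of "X i" "\<lambda>_. 0" 1 s] X by (simp add: out_zero[OF b])
  qed (use \<Gamma> in auto)
qed

lemma prob_initial_gap:
  assumes b: "balanced k v" and XY: "\<And>i. i < n \<Longrightarrow> L2_set (\<lambda>j. X i j - Y i j) {..<d} \<le> \<epsilon>"
    and n: "0 < n" and K: "2 \<le> K"
  shows "measure MW {\<omega> \<in> space MW. 150 * (\<Gamma> * \<epsilon>) * sqrt (real n) * sqrt (ln (real K)) < L2_set (\<lambda>i. out \<omega> (X i) - out \<omega> (Y i)) {..<n}} \<le> 1 / real K ^ 103"
proof (cases "\<epsilon> = 0")
  case True
  have "out \<omega> (X i) - out \<omega> (Y i) = 0" if "i < n" for \<omega> i
    using out_lip[of \<omega> "X i" "Y i"] XY[OF that] L2_set_nonneg[of "\<lambda>j. X i j - Y i j" "{..<d}"] True by simp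
  then have "L2_set (\<lambda>i. out \<omega> (X i) - out \<omega> (Y i)) {..<n} = 0" for \<omega> by (simp add: L2_set_eq_0_iff)
  then show ?thesis using True by simp
next
  case False
  have \<epsilon>: "0 < \<epsilon>" using order_trans[OF L2_set_nonneg XY[OF n]] False by simp
  interpret prob_space MW by (rule prob_space_std_gaussian)
  show ?thesis
    by (rule subgaussian_L2[OF _ _ n K]) (use \<Gamma> \<epsilon> increment_mgf[OF b XY] in auto)
qed

lemma prob_initial_preact:
  assumes XY: "\<And>i. i < n \<Longrightarrow> L2_set (u i) {..<d} \<le> \<epsilon>" and n: "0 < n" and K: "2 \<le> K" and k: "ln (real K) \<le> real k"
  shows "measure MW {\<omega> \<in> space MW. 21 * sqrt (real n) * sqrt (real k) * \<epsilon> < L2_set (\<lambda>i. L2_set (preact d \<omega> (u i)) {..<k}) {..<n}} \<le> 1 / real K ^ 103"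
proof (cases "\<epsilon> = 0")
  case True
  have "preact d \<omega> (u i) r = 0" if "i < n" for \<omega> i r
  proof -
    have "L2_set (u i) {..<d} = 0" using XY[OF that] L2_set_nonneg[of "u i" "{..<d}"] True by simp
    then show ?thesis by (simp add: L2_set_eq_0_iff preact_def)
  qed
  then have "L2_set (\<lambda>i. L2_set (preact d \<omega> (u i)) {..<k}) {..<n} = 0" for \<omega> by (simp add: L2_set_eq_0_iff)
  then show ?thesis using True by simp
next
  case False
  have \<epsilon>: "0 < \<epsilon>" using order_trans[OF L2_set_nonneg XY[OF n]] False by simp
  show ?thesis by (rule preact_L2_average[OF XY \<epsilon> n K k])
qed

text \<open>A union bound over the half-net, extended to all \<open>u\<close> by
  \<open>operator_norm_from_grid\<close>. The good event is given as a measurable set, so nothing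
  has to be shown about a quantifier over uncountably many \<open>u\<close>.\<close>

lemma prob_operator:
  assumes d: "0 < d"
  obtains G where "G \<in> sets MW" "measure MW (space MW - G) \<le> exp (- 100 * real d) / 4"
    "\<And>\<omega> u. \<omega> \<in> G \<Longrightarrow> L2_set (preact d \<omega> u) {..<k} \<le> 42 * (sqrt (real k) + sqrt (real d)) * L2_set u {..<d}"
proof -
  interpret prob_space MW by (rule prob_space_std_gaussian)
  define Q where "Q = {z \<in> grid d 1. L2_set (gpoint d 1 z) {..<d} \<le> 1}"
  have Q: "finite Q" "real (card Q) \<le> 18 ^ d"
  proof -
    show "finite Q" by (simp add: Q_def finite_grid)
    have "real (card Q) \<le> real (card (grid d 1))"
      by (intro of_nat_mono card_mono finite_grid) (auto simp: Q_def)
    then show "real (card Q) \<le> 18 ^ d" using card_grid[of d 1] by simp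
  qed
  \<comment> \<open>The surplus \<open>110 * d\<close> in the exponent beats the at most
    \<open>18 ^ d\<close> grid points, a number below \<open>exp (4 * d)\<close>, and leaves
    \<open>exp (- 106 * d)\<close>.\<close>
  define A where "A z = {\<omega> \<in> space MW. exp (real k / 2 + 110 * real d) \<le> exp ((L2_set (preact d \<omega> (gpoint d 1 z)) {..<k})\<^sup>2 / (4 * 1\<^sup>2))}" for z
  have A [measurable]: "A z \<in> sets MW" for z unfolding A_def by measurable
  have PA: "prob (A z) \<le> exp (- 110 * real d)" if "z \<in> Q" for z
  proof -
    have "prob (A z) \<le> exp (real k / 2) / exp (real k / 2 + 110 * real d)"
      unfolding A_def
      by (rule Markov_exp[OF _ _ preact_square_mgf_le]) (use that in \<open>auto simp: Q_def\<close>)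
    then show ?thesis by (simp flip: exp_diff)
  qed
  define G where "G = space MW - (\<Union>z\<in>Q. A z)"
  show ?thesis
  proof (rule that[of G])
    show "G \<in> sets MW" unfolding G_def using Q(1) by (intro sets.Diff sets.finite_UN) auto
    have "space MW - G = (\<Union>z\<in>Q. A z)" by (auto simp: G_def A_def)
    then have "measure MW (space MW - G) \<le> real (card Q) * exp (- 110 * real d)"
      using prob_UN_le[OF Q(1) _ PA] A by simp
    also have "\<dots> \<le> exp 4 ^ d * exp (- 110 * real d)"
    proof (intro mult_right_mono order_trans[OF Q(2)] power_mono)
      have "(18 :: real) \<le> (5 / 2) ^ 4" by (simp add: power_divide)
      also have "\<dots> \<le> exp 1 ^ 4" using exp_lower_Taylor_quadratic[of "1::real"] by (intro power_mono) auto
      finally show "(18::real) \<le> exp 4" by (simp flip: exp_of_nat_mult)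
    qed auto
    also have "\<dots> = exp (- 106 * real d)" by (simp flip: exp_of_nat_mult exp_add)
    also have "\<dots> \<le> exp (- 6 - 100 * real d)" using d by simp
    also have "\<dots> = exp (- 6) * exp (- 100 * real d)" by (simp flip: exp_add)
    also have "\<dots> \<le> 1 / 4 * exp (- 100 * real d)"
    proof (intro mult_right_mono)
      have "4 \<le> exp (6::real)" using exp_ge_add_one_self[of "6::real"] by simp
      then show "exp (- 6) \<le> (1 / 4 :: real)" by (simp add: exp_minus field_simps)
    qed simp
    finally show "measure MW (space MW - G) \<le> exp (- 100 * real d) / 4" by simp
    fix \<omega> u assume \<omega>: "\<omega> \<in> G"
    have "L2_set (preact d \<omega> u) {..<k} \<le> 2 * (21 * (sqrt (real k) + sqrt (real d))) * L2_set u {..<d}"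
    proof (rule operator_norm_from_grid[OF d])
      fix z assume z: "z \<in> grid d 1" "L2_set (gpoint d 1 z) {..<d} \<le> 1"
      then have "\<omega> \<notin> A z" using \<omega> by (auto simp: G_def Q_def)
      then have "(L2_set (preact d \<omega> (gpoint d 1 z)) {..<k})\<^sup>2 \<le> 2 * real k + 440 * real d"
        using \<omega> by (simp add: A_def G_def not_le)
      also have "\<dots> \<le> (21 * (sqrt (real k) + sqrt (real d)))\<^sup>2"
        by (simp add: power_mult_distrib power2_sum)
      finally show "L2_set (preact d \<omega> (gpoint d 1 z)) {..<k} \<le> 21 * (sqrt (real k) + sqrt (real d))"
        by (rule power2_le_imp_le) simp
    qed
    then show "L2_set (preact d \<omega> u) {..<k} \<le> 42 * (sqrt (real k) + sqrt (real d)) * L2_set u {..<d}" by simp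
  qed
qed

text \<open>At level \<open>j\<close> an increment has sub-Gaussian parameter
  \<open>3 * \<Gamma> * \<epsilon> / 2 ^ j\<close> and may reach
  \<open>15 * sqrt d * (j + 1)\<close> times that, so it fails with probability at most
  \<open>2 * exp (- 112 * d * (j + 1))\<close>, against \<open>(162 * 4 ^ j) ^ d\<close>
  pairs.\<close>

lemma prob_chaining:
  assumes b: "balanced k v" and d: "0 < d" and \<epsilon>0: "0 \<le> \<epsilon>"
  obtains G where "G \<in> sets MW" "measure MW (space MW - G) \<le> exp (- 100 * real d) / 4"
    "\<And>\<omega> z. \<omega> \<in> G \<Longrightarrow> L2_set (\<lambda>j. z j - c j) {..<d} \<le> \<epsilon> \<Longrightarrow> \<bar>out \<omega> z - out \<omega> c\<bar> \<le> 180 * \<Gamma> * \<epsilon> * sqrt (real d)"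
proof (cases "\<epsilon> = 0")
  case True
  show ?thesis
  proof (rule that[of "space MW"])
    fix \<omega> z assume "L2_set (\<lambda>j. z j - c j) {..<d} \<le> \<epsilon>"
    then have "L2_set (\<lambda>j. z j - c j) {..<d} = 0" using True L2_set_nonneg[of "\<lambda>j. z j - c j" "{..<d}"] by simp
    then show "\<bar>out \<omega> z - out \<omega> c\<bar> \<le> 180 * \<Gamma> * \<epsilon> * sqrt (real d)" using out_lip[of \<omega> z c] True by simp
  qed auto
next
  case False
  then have \<epsilon>: "0 < \<epsilon>" using \<epsilon>0 by simp
  interpret prob_space MW by (rule prob_space_std_gaussian)
  define g where "g \<omega> u = out \<omega> (\<lambda>i. c i + \<epsilon> * u i)" for \<omega> u
  \<comment> \<open>45 is 15 standard deviations times the distance factor 3; chaining multiplies by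
    4, which gives 180.\<close>
  define M where "M = 45 * \<Gamma> * \<epsilon> * sqrt (real d)"
  define I where "I j = {pq \<in> chain d j \<times> chain d (Suc j). L2_set (\<lambda>i. snd pq i - fst pq i) {..<d} \<le> 3 / 2 ^ j}" for j
  define A where "A j pq = {\<omega> \<in> space MW. M * (real (Suc j) / 2 ^ j) \<le> \<bar>g \<omega> (snd pq) - g \<omega> (fst pq)\<bar>}" for j pq
  have A [measurable]: "A j pq \<in> sets MW" for j pq unfolding A_def g_def by measurable
  have M0: "0 < M" using \<Gamma> \<epsilon> d by (simp add: M_def)
  have PA: "prob (A j pq) \<le> 2 * exp (- 112 * real d * real (Suc j))" if "pq \<in> I j" for j pq
  proof -
    let ?s = "\<Gamma> * (\<epsilon> * (3 / 2 ^ j))"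
    have s: "0 < ?s" using \<Gamma> \<epsilon> by simp
    have "prob (A j pq) \<le> 2 * exp (- ((M * (real (Suc j) / 2 ^ j))\<^sup>2 / (2 * ?s\<^sup>2)))"
      unfolding A_def
    proof (rule subgaussian_tail[OF _ s])
      show "(\<lambda>\<omega>. g \<omega> (snd pq) - g \<omega> (fst pq)) \<in> borel_measurable MW" unfolding g_def by measurable
      show "0 < M * (real (Suc j) / 2 ^ j)" using M0 by simp
      have "L2_set (\<lambda>i. \<epsilon> * (snd pq i - fst pq i)) {..<d} \<le> \<epsilon> * (3 / 2 ^ j)"
        unfolding L2_set_scale using mult_left_mono[of "L2_set (\<lambda>i. snd pq i - fst pq i) {..<d}" "3 / 2 ^ j" \<epsilon>] that \<epsilon>
        by (simp add: I_def)
      then show "(\<integral>\<^sup>+\<omega>. ennreal (exp (s * (g \<omega> (snd pq) - g \<omega> (fst pq)))) \<partial>MW) \<le> ennreal (exp (s\<^sup>2 * ?s\<^sup>2 / 2))" for s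
        unfolding g_def by (intro increment_mgf[OF b]) (simp add: right_diff_distrib)
    qed
    also have "(M * (real (Suc j) / 2 ^ j))\<^sup>2 / (2 * ?s\<^sup>2) = (15 * sqrt (real d) * real (Suc j))\<^sup>2 / 2"
    proof -
      have "M * (real (Suc j) / 2 ^ j) = ?s * (15 * sqrt (real d) * real (Suc j))" by (simp add: M_def)
      moreover have "(x * y)\<^sup>2 / (2 * x\<^sup>2) = y\<^sup>2 / 2" if "0 < x" for x y :: real
        using that by (simp add: power_mult_distrib)
      ultimately show ?thesis using s by (simp only:)
    qed
    also have "\<dots> = 225 / 2 * real d * (real (Suc j) * real (Suc j))"
      by (simp add: power_mult_distrib power2_eq_square)
    also have "2 * exp (- \<dots>) \<le> 2 * exp (- 112 * real d * real (Suc j))"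
    proof -
      have "real (Suc j) * 1 \<le> real (Suc j) * real (Suc j)" by (intro mult_left_mono) auto
      then have "112 * real d * real (Suc j) \<le> 225 / 2 * real d * (real (Suc j) * real (Suc j))"
        by (intro mult_mono) auto
      then show ?thesis by simp
    qed
    finally show ?thesis .
  qed
  have I: "finite (I j)" "real (card (I j)) \<le> (162 * 4 ^ j) ^ d" for j
  proof -
    have f: "finite (chain d j \<times> chain d (Suc j))" by (simp add: finite_chain)
    show "finite (I j)" unfolding I_def by (rule finite_subset[OF _ f]) auto
    have "real (card (I j)) \<le> real (card (chain d j \<times> chain d (Suc j)))"
      by (intro of_nat_mono card_mono f) (auto simp: I_def)
    also have "\<dots> \<le> (9 * 2 ^ j) ^ d * (9 * 2 ^ Suc j) ^ d"
      unfolding card_cartesian_product of_nat_mult by (intro mult_mono card_chain) auto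
    also have "\<dots> = (162 * 4 ^ j) ^ d"
    proof -
      have "9 * 2 ^ j * (9 * 2 ^ Suc j) = (162 * 4 ^ j :: real)"
        using power_mult_distrib[of "2::real" 2 j] by simp
      then show ?thesis by (simp only: power_mult_distrib[symmetric])
    qed
    finally show "real (card (I j)) \<le> (162 * 4 ^ j) ^ d" .
  qed
  define B where "B j = (\<Union>pq\<in>I j. A j pq)" for j
  have B [measurable]: "B j \<in> sets MW" for j unfolding B_def using I(1) by (intro sets.finite_UN) auto
  have PB: "prob (B j) \<le> exp (- 100 * real d) / 8 * (1 / 2) ^ j" for j
  proof -
    have "prob (B j) \<le> real (card (I j)) * (2 * exp (- 112 * real d * real (Suc j)))"
      unfolding B_def by (rule prob_UN_le[OF I(1) A PA])
    also have "\<dots> \<le> (exp 6 * exp 2 ^ j) ^ d * (2 * exp (- 112 * real d * real (Suc j)))"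
    proof (intro mult_right_mono order_trans[OF I(2)] power_mono mult_mono)
      have 2: "2 \<le> exp (1::real)" using exp_ge_add_one_self[of "1::real"] by simp
      show "(4::real) \<le> exp 2" using power_mono[OF 2, of 2] by (simp flip: exp_of_nat_mult)
      have "(162::real) \<le> (5/2) ^ 6" by (simp add: power_divide)
      also have "\<dots> \<le> exp 1 ^ 6"
        using exp_lower_Taylor_quadratic[of "1::real"] by (intro power_mono) auto
      finally show "(162::real) \<le> exp 6" by (simp flip: exp_of_nat_mult)
    qed auto
    also have "\<dots> = 2 * exp (real d * (6 + 2 * real j) - 112 * real d * real (Suc j))"
    proof -
      have 1: "exp 6 * exp 2 ^ j = exp (6 + 2 * real j)"
        using exp_of_nat_mult[of j "2::real"] by (simp add: exp_add mult.commute)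
      have 2: "exp (6 + 2 * real j) ^ d = exp (real d * (6 + 2 * real j))"
        by (rule exp_of_nat_mult[symmetric])
      have "exp x * (2 * exp (- y)) = 2 * exp (x - y)" for x y :: real
        by (simp add: exp_diff exp_minus divide_inverse)
      from this[of "real d * (6 + 2 * real j)" "112 * real d * real (Suc j)"] show ?thesis
        unfolding 1 2 by simp
    qed
    \<comment> \<open>The exponent is \<open>- d * (106 + 110 * j)\<close>. As \<open>d\<close> is
      at least 1, all beyond \<open>- 100 * d\<close> is spent on a factor 1/8 and on summability
      over the levels.\<close>
    also have "\<dots> \<le> 2 * exp (- 100 * real d - 6 - real j)"
    proof -
      have "1 * (6 + 110 * real j) \<le> real d * (6 + 110 * real j)" using d by (intro mult_right_mono) auto
      then have "real d * (6 + 2 * real j) - 112 * real d * real (Suc j) \<le> - 100 * real d - 6 - real j"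
        by (simp add: algebra_simps)
      then show ?thesis by simp
    qed
    also have "\<dots> = exp (- 100 * real d) * (2 * exp (- 6)) * exp (- 1) ^ j"
    proof -
      have 1: "exp (- 1) ^ j = exp (- real j)" using exp_of_nat_mult[of j "- 1 :: real"] by simp
      have "2 * exp (x - y - z) = exp x * (2 * exp (- y)) * exp (- z)" for x y z :: real
        by (simp add: exp_diff exp_minus divide_inverse)
      then show ?thesis unfolding 1 .
    qed
    also have "\<dots> \<le> exp (- 100 * real d) * (1 / 8) * (1 / 2) ^ j"
    proof (intro mult_mono power_mono)
      have 2: "2 \<le> exp (1::real)" using exp_ge_add_one_self[of "1::real"] by simp
      then show "exp (- 1) \<le> (1 / 2 :: real)" by (simp add: exp_minus field_simps)
      have "(2::real) ^ 6 \<le> exp 1 ^ 6" using 2 by (intro power_mono) auto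
      then have "64 \<le> exp (6::real)" by (simp flip: exp_of_nat_mult)
      then show "2 * exp (- 6) \<le> (1 / 8 :: real)" by (simp add: exp_minus field_simps)
    qed auto
    finally show ?thesis by simp
  qed
  define G where "G = space MW - (\<Union>j. B j)"
  show ?thesis
  proof (rule that[of G])
    show "G \<in> sets MW" unfolding G_def by measurable
    have "space MW - G = (\<Union>j. B j)" by (auto simp: G_def A_def B_def)
    then show "measure MW (space MW - G) \<le> exp (- 100 * real d) / 4"
      using prob_UN_halves_le[OF B PB] by simp
    fix \<omega> z assume \<omega>: "\<omega> \<in> G" and z: "L2_set (\<lambda>j. z j - c j) {..<d} \<le> \<epsilon>"
    define u where "u i = (z i - c i) / \<epsilon>" for i
    have "\<bar>g \<omega> u - g \<omega> (\<lambda>_. 0)\<bar> \<le> 4 * M"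
    proof (rule chaining[OF d _ less_imp_le[OF M0]])
      have "L2_set u {..<d} = 1 / \<epsilon> * L2_set (\<lambda>j. z j - c j) {..<d}"
        using \<epsilon> L2_set_scale[of "1 / \<epsilon>" "\<lambda>j. z j - c j" "{..<d}"] by (simp add: u_def[abs_def])
      then show "L2_set u {..<d} \<le> 1" using z \<epsilon> by (simp add: divide_le_eq)
      show "\<bar>g \<omega> x - g \<omega> y\<bar> \<le> \<Gamma> * L2_set \<omega> P * \<epsilon> * L2_set (\<lambda>i. x i - y i) {..<d}" for x y
        using out_lip[of \<omega> "\<lambda>i. c i + \<epsilon> * x i" "\<lambda>i. c i + \<epsilon> * y i"] \<epsilon> L2_set_scale[of \<epsilon> "\<lambda>i. x i - y i" "{..<d}"]
        by (simp add: g_def right_diff_distrib)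
      fix j p q assume pq: "p \<in> chain d j" "q \<in> chain d (Suc j)" "L2_set (\<lambda>i. q i - p i) {..<d} \<le> 3 / 2 ^ j"
      then have "(p, q) \<in> I j" by (simp add: I_def)
      then have "\<omega> \<notin> A j (p, q)" using \<omega> by (auto simp: G_def B_def)
      then show "\<bar>g \<omega> q - g \<omega> p\<bar> \<le> M * (real (Suc j) / 2 ^ j)"
        using \<omega> by (auto simp: A_def G_def)
    qed
    then show "\<bar>out \<omega> z - out \<omega> c\<bar> \<le> 180 * \<Gamma> * \<epsilon> * sqrt (real d)"
      using \<epsilon> by (simp add: g_def u_def M_def)
  qed
qed

end

section \<open>Rayleigh quotients and spectral norms\<close>

lemma compact_PiE_UNIV:
  fixes C :: "nat \<Rightarrow> real set"
  assumes "\<And>i. compact (C i)"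
  shows "compact {u. \<forall>i. u i \<in> C i}"
proof -
  have "compactin (product_topology (\<lambda>i. euclidean) UNIV) (PiE UNIV C)"
    using assms by (simp add: compactin_PiE compactin_euclidean_iff)
  then have "compact (PiE UNIV C)"
    by (simp add: euclidean_product_topology compactin_euclidean_iff)
  moreover have "PiE UNIV C = {u. \<forall>i. u i \<in> C i}" by (auto simp: PiE_UNIV_domain Pi_def)
  ultimately show ?thesis by simp
qed

text \<open>A copy of \<open>d\<close>-dimensional space inside
  \<open>nat \<Rightarrow> real\<close>. As dimensions are numbers and not types, compactness comes
  from Tychonoff's theorem with the remaining coordinates fixed at 0.\<close>

definition supp :: "nat \<Rightarrow> (nat \<Rightarrow> real) set" where
  "supp d = {u. \<forall>i\<ge>d. u i = 0}"

lemma continuous_L2_set [continuous_intros]: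
  "(\<And>i. i \<in> A \<Longrightarrow> continuous_on S (f i)) \<Longrightarrow> continuous_on S (\<lambda>u. L2_set (\<lambda>i. f i u) A)"
  unfolding L2_set_def by (intro continuous_intros)

lemma continuous_on_coord [continuous_intros]: "continuous_on S (\<lambda>u :: nat \<Rightarrow> real. u i)"
  by (rule continuous_on_subset[OF continuous_on_product_coordinates]) simp

lemma compact_supp_closed:
  assumes "closed F" and F: "\<And>u i. u \<in> supp d \<Longrightarrow> u \<in> F \<Longrightarrow> i < d \<Longrightarrow> \<bar>u i\<bar> \<le> b i"
  shows "compact (supp d \<inter> F)"
proof -
  let ?B = "{u :: nat \<Rightarrow> real. \<forall>i. u i \<in> (if i < d then {- b i..b i} else {0})}"
  have "compact ?B" by (rule compact_PiE_UNIV) auto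
  then have "compact (?B \<inter> F)" using assms(1) by (rule compact_Int_closed)
  moreover have "?B \<inter> F = supp d \<inter> F"
  proof (rule equalityI; rule subsetI)
    fix u assume u: "u \<in> ?B \<inter> F"
    then have "u i = 0" if "i \<ge> d" for i using that by (auto dest!: spec[of _ i])
    then show "u \<in> supp d \<inter> F" using u by (simp add: supp_def)
  next
    fix u assume "u \<in> supp d \<inter> F"
    then show "u \<in> ?B \<inter> F" using F[of u] by (auto simp: supp_def abs_le_iff minus_le_iff)
  qed
  ultimately show ?thesis by simp
qed

lemma abs_le_L2_set: "i \<in> A \<Longrightarrow> finite A \<Longrightarrow> \<bar>f i\<bar> \<le> L2_set f A"
  using member_le_L2_set[of A i "\<lambda>i. \<bar>f i\<bar>"] by (simp add: L2_set_def)

lemma compact_ball_supp: "compact (supp d \<inter> {u. L2_set (\<lambda>i. u i - c i) {..<d} \<le> e})"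
proof (rule compact_supp_closed[where b = "\<lambda>i. \<bar>c i\<bar> + e"])
  show "closed {u. L2_set (\<lambda>i. u i - c i) {..<d} \<le> e}"
    by (intro closed_Collect_le continuous_intros)
  fix u :: "nat \<Rightarrow> real" and i assume "u \<in> {u. L2_set (\<lambda>i. u i - c i) {..<d} \<le> e}" "i < d"
  then show "\<bar>u i\<bar> \<le> \<bar>c i\<bar> + e"
    using abs_le_L2_set[of i "{..<d}" "\<lambda>i. u i - c i"] by simp
qed

lemma compact_sphere_supp: "compact (supp d \<inter> {u. L2_set u {..<d} = 1})"
proof (rule compact_supp_closed[where b = "\<lambda>_. 1"])
  show "closed {u. L2_set u {..<d} = 1}"
    by (intro closed_Collect_eq continuous_intros)
  fix u :: "nat \<Rightarrow> real" and i assume "u \<in> {u. L2_set u {..<d} = 1}" "i < d"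
  then show "\<bar>u i\<bar> \<le> 1" using abs_le_L2_set[of i "{..<d}" u] by simp
qed

text \<open>The first-order condition at a minimum, in a form free of derivatives.\<close>

lemma quadratic_nonneg_linear_zero:
  fixes p r :: real
  assumes "\<And>t. 0 \<le> 2 * t * p + t\<^sup>2 * r"
  shows "p = 0"
proof (rule ccontr)
  assume p: "p \<noteq> 0"
  \<comment> \<open>A step against the slope, so short that the quadratic term recovers at most half
    of the linear gain.\<close>
  define t where "t = - p / (\<bar>r\<bar> + 1)"
  have "0 \<le> 2 * t * p + t\<^sup>2 * r" by (rule assms)
  also have "\<dots> \<le> 2 * t * p + t\<^sup>2 * (\<bar>r\<bar> + 1)" by (intro add_left_mono mult_left_mono) auto
  also have "t\<^sup>2 * (\<bar>r\<bar> + 1) = - t * p" by (simp add: t_def power2_eq_square)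
  also have "2 * t * p + - t * p = - (p\<^sup>2 / (\<bar>r\<bar> + 1))" by (simp add: t_def power2_eq_square)
  also have "\<dots> < 0" using p by (simp add: divide_pos_pos)
  finally show False by simp
qed

text \<open>A minimiser of the Rayleigh quotient is an eigenvector.\<close>
lemma min_spectrum_le_quadratic_form:
  fixes A :: "real Matrix.mat"
  assumes A: "A \<in> carrier_mat K K" and K: "0 < K"
    and sym: "\<And>i j. i < K \<Longrightarrow> j < K \<Longrightarrow> A $$ (i, j) = A $$ (j, i)"
  shows "Min (spectrum A) * (L2_set u {..<K})\<^sup>2 \<le> (\<Sum>i<K. u i * (\<Sum>j<K. A $$ (i, j) * u j))"
proof -
  define Q where "Q u w = (\<Sum>i<K. u i * (\<Sum>j<K. A $$ (i, j) * w j))" for u w :: "nat \<Rightarrow> real"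
  have Q_add: "Q (\<lambda>i. x i + t * y i) (\<lambda>i. x i + t * y i) = Q x x + 2 * t * Q y x + t\<^sup>2 * Q y y" for x y t
  proof -
    have "Q x y = Q y x"
      unfolding Q_def sum_distrib_left by (subst sum.swap) (auto intro!: sum.cong simp: sym mult_ac)
    moreover have "Q (\<lambda>i. x i + t * y i) (\<lambda>i. x i + t * y i) = Q x x + t * Q x y + t * Q y x + t * t * Q y y"
      by (simp add: Q_def algebra_simps sum.distrib sum_distrib_left)
    ultimately show ?thesis by (simp add: power2_eq_square)
  qed
  define S where "S = supp K \<inter> {u. L2_set u {..<K} = 1}"
  have "(\<lambda>i. if i = 0 then 1 else 0) \<in> S"
    using K by (auto simp: S_def supp_def L2_set_def if_distrib[where f = "\<lambda>x. x\<^sup>2"] cong: if_cong)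
  then have S0: "S \<noteq> {}" by blast
  have S1: "compact S" unfolding S_def by (rule compact_sphere_supp)
  have S2: "continuous_on S (\<lambda>u. Q u u)" unfolding Q_def by (intro continuous_intros)
  obtain w where w: "w \<in> S" and min: "\<forall>u\<in>S. Q w w \<le> Q u u"
    using continuous_attains_inf[OF S1 S0 S2] by (rule bexE)
  define \<mu> where "\<mu> = Q w w"
  have w1: "L2_set w {..<K} = 1" using w by (simp add: S_def)
  have ge: "\<mu> * (L2_set u {..<K})\<^sup>2 \<le> Q u u" for u
  proof (cases "L2_set u {..<K} = 0")
    case True
    then have "u i = 0" if "i < K" for i using that by (simp add: L2_set_eq_0_iff)
    then show ?thesis using True by (simp add: Q_def)
  next
    case False
    define z where "z i = (if i < K then 1 / L2_set u {..<K} * u i else 0)" for i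
    have z: "L2_set z {..<K} = L2_set (\<lambda>i. 1 / L2_set u {..<K} * u i) {..<K}"
      by (intro L2_set_cong) (auto simp: z_def)
    then have "z \<in> S"
      unfolding L2_set_scale using False by (simp add: S_def supp_def L2_set_nonneg z_def)
    then have "\<mu> \<le> Q z z" unfolding \<mu>_def using min by (rule bspec[rotated])
    also have "Q z z = Q u u / (L2_set u {..<K})\<^sup>2"
      by (simp add: Q_def z_def sum_divide_distrib power2_eq_square sum_distrib_left)
    finally show ?thesis using False by (simp add: field_simps)
  qed
  \<comment> \<open>The form \<open>Q u u\<close> minus \<mu> times the squared norm is nonnegative
    and vanishes at \<open>w\<close>. Varying \<open>w\<close> along the \<open>i\<close>-th unit
    vector, the linear coefficient must vanish: this is row \<open>i\<close> of the eigenvalue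
    equation.\<close>
  have eig: "(\<Sum>j<K. A $$ (i, j) * w j) = \<mu> * w i" if i: "i < K" for i
  proof -
    define y where "y j = (if j = i then 1 else 0 :: real)" for j
    have Qy: "Q y x = (\<Sum>j<K. A $$ (i, j) * x j)" for x
      using i by (simp add: Q_def y_def if_distrib[where f = "\<lambda>x. x * _"] cong: if_cong)
    have "(\<Sum>j<K. A $$ (i, j) * w j) - \<mu> * w i = 0"
    proof (rule quadratic_nonneg_linear_zero)
      fix t
      have "(L2_set (\<lambda>j. w j + t * y j) {..<K})\<^sup>2 = (\<Sum>j<K. (w j)\<^sup>2 + 2 * t * (w j * y j) + t\<^sup>2 * (y j)\<^sup>2)"
        unfolding L2_set_power2 by (intro sum.cong) (auto simp: power2_eq_square algebra_simps)
      also have "\<dots> = 1 + 2 * t * w i + t\<^sup>2"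
        using i w1 L2_set_power2[of w "{..<K}"]
        by (simp add: sum.distrib y_def sum_distrib_left[symmetric] if_distrib[where f = "\<lambda>x. x\<^sup>2"]
            if_distrib[where f = "\<lambda>x. _ * x"] cong: if_cong)
      finally show "0 \<le> 2 * t * ((\<Sum>j<K. A $$ (i, j) * w j) - \<mu> * w i) + t\<^sup>2 * (Q y y - \<mu>)"
        using ge[of "\<lambda>j. w j + t * y j"] unfolding Q_add Qy \<mu>_def[symmetric]
        by (simp add: algebra_simps)
    qed
    then show ?thesis by simp
  qed
  have "eigenvector A (Matrix.vec K w) \<mu>"
  proof -
    have "A *\<^sub>v Matrix.vec K w = \<mu> \<cdot>\<^sub>v Matrix.vec K w"
      using A eig by (intro eq_vecI) (auto simp: scalar_prod_def atLeast0LessThan)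
    moreover have "Matrix.vec K w \<noteq> 0\<^sub>v K"
    proof
      assume "Matrix.vec K w = 0\<^sub>v K"
      then have "w i = 0" if "i < K" for i using that by (metis index_vec index_zero_vec(1))
      then show False using w1 by (simp add: L2_set_def)
    qed
    ultimately show ?thesis using A by (simp add: eigenvector_def)
  qed
  then have "\<mu> \<in> spectrum A" by (auto simp: spectrum_def eigenvalue_def)
  then have "Min (spectrum A) \<le> \<mu>" using card_finite_spectrum(1)[OF A] by (rule Min_le[rotated])
  then have "Min (spectrum A) * (L2_set u {..<K})\<^sup>2 \<le> \<mu> * (L2_set u {..<K})\<^sup>2" by (rule mult_right_mono) simp
  with ge[of u] show ?thesis by (simp add: Q_def)
qed

lemma l2_norm_L2_set: "l2_norm u = L2_set (\<lambda>i. u $ i) {..<dim_vec u}"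
  by (simp add: l2_norm_def L2_set_def scalar_prod_def power2_eq_square atLeast0LessThan)

text \<open>The lower bound 1 is attained by testing on row 0, a unit vector. The Frobenius norm
  \<open>sqrt K\<close> gives the upper bound and also the boundedness without which the supremum in
  \<open>spectral_norm\<close> would be meaningless. The last claim is for the transpose, the form
  needed for gradients.\<close>

lemma spectral_norm_properties:
  assumes C: "C \<in> carrier_mat K d" and rows: "\<And>l. l < K \<Longrightarrow> l2_norm (Matrix.row C l) = 1" and K: "0 < K"
  shows "1 \<le> spectral_norm C" "(spectral_norm C)\<^sup>2 \<le> real K"
    "L2_set (\<lambda>j. \<Sum>l<K. C $$ (l, j) * q l) {..<d} \<le> spectral_norm C * L2_set q {..<K}"
proof -
  let ?S = "{u \<in> carrier_vec (dim_col C). l2_norm u \<le> 1}"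
  have Cu: "l2_norm (C *\<^sub>v u) = L2_set (\<lambda>l. \<Sum>j<d. C $$ (l, j) * u $ j) {..<K}" if "u \<in> carrier_vec d" for u
    unfolding l2_norm_L2_set using C that by (auto intro!: L2_set_cong simp: scalar_prod_def atLeast0LessThan)
  have row1: "L2_set (\<lambda>j. C $$ (l, j)) {..<d} = 1" if "l < K" for l
  proof -
    have "L2_set (\<lambda>j. C $$ (l, j)) {..<d} = L2_set (($) (Matrix.row C l)) {..<d}"
      using C that by (intro L2_set_cong) auto
    then show ?thesis using rows[OF that] C that by (simp add: l2_norm_L2_set)
  qed
  have bnd: "l2_norm (C *\<^sub>v u) \<le> sqrt (real K)" if u: "u \<in> ?S" for u
  proof -
    have u': "u \<in> carrier_vec d" "L2_set (\<lambda>j. u $ j) {..<d} \<le> 1"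
      using u C by (auto simp: l2_norm_L2_set)
    have "l2_norm (C *\<^sub>v u) \<le> L2_set (\<lambda>p. C $$ (fst p, snd p)) ({..<K} \<times> {..<d}) * L2_set (\<lambda>j. u $ j) {..<d}"
      unfolding Cu[OF u'(1)] by (rule L2_set_apply_le)
    also have "\<dots> \<le> sqrt (real K) * 1"
    proof (intro mult_mono u'(2))
      have "L2_set (\<lambda>p. C $$ (fst p, snd p)) ({..<K} \<times> {..<d}) = L2_set (\<lambda>l. 1) {..<K}"
        by (rule trans[OF L2_set_Times[of "\<lambda>l j. C $$ (l, j)"] L2_set_cong[OF refl row1]]) simp
      then show "L2_set (\<lambda>p. C $$ (fst p, snd p)) ({..<K} \<times> {..<d}) \<le> sqrt (real K)" by (simp add: L2_set_def)
    qed (auto simp: L2_set_nonneg)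
    finally show ?thesis by simp
  qed
  have bdd: "bdd_above ((\<lambda>u. l2_norm (C *\<^sub>v u)) ` ?S)"
    using bnd by (auto intro!: bdd_aboveI2)
  have ne: "?S \<noteq> {}"
  proof -
    have "0\<^sub>v d \<in> ?S" using C by (auto simp: l2_norm_L2_set L2_set_def)
    then show ?thesis by blast
  qed
  have le: "l2_norm (C *\<^sub>v u) \<le> spectral_norm C" if "u \<in> ?S" for u
    unfolding spectral_norm_def using that bdd by (rule cSUP_upper)
  have sK: "spectral_norm C \<le> sqrt (real K)"
    unfolding spectral_norm_def using ne bnd by (rule cSUP_least)
  show s1: "1 \<le> spectral_norm C"
  proof -
    define u where "u = Matrix.vec d (\<lambda>j. C $$ (0, j))"
    have "L2_set (\<lambda>j. u $ j) {..<d} = L2_set (\<lambda>j. C $$ (0, j)) {..<d}"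
      by (intro L2_set_cong) (auto simp: u_def)
    then have u: "u \<in> ?S" using C row1[OF K] by (simp add: u_def l2_norm_L2_set)
    have "(\<Sum>j<d. C $$ (0, j) * u $ j) = (L2_set (\<lambda>j. C $$ (0, j)) {..<d})\<^sup>2"
      unfolding L2_set_power2 by (simp add: power2_eq_square u_def)
    then have "1 = \<bar>\<Sum>j<d. C $$ (0, j) * u $ j\<bar>" using row1[OF K] by simp
    also have "\<dots> \<le> l2_norm (C *\<^sub>v u)"
      using abs_le_L2_set[of 0 "{..<K}" "\<lambda>l. \<Sum>j<d. C $$ (l, j) * u $ j"] K by (subst Cu) (auto simp: u_def)
    also have "\<dots> \<le> spectral_norm C" by (rule le[OF u])
    finally show ?thesis .
  qed
  show "(spectral_norm C)\<^sup>2 \<le> real K"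
    using power_mono[OF sK, of 2] s1 by simp
  have op: "L2_set (\<lambda>l. \<Sum>j<d. C $$ (l, j) * u j) {..<K} \<le> spectral_norm C * L2_set u {..<d}" for u
  proof (cases "L2_set u {..<d} = 0")
    case True
    then have "u j = 0" if "j < d" for j using that by (simp add: L2_set_eq_0_iff)
    then have "(\<Sum>j<d. C $$ (l, j) * u j) = 0" for l by simp
    then show ?thesis by (simp only: True) (simp add: L2_set_def)
  next
    case False
    define z where "z = Matrix.vec d (\<lambda>j. 1 / L2_set u {..<d} * u j)"
    have z: "z \<in> carrier_vec d" by (simp add: z_def)
    have "l2_norm z = L2_set (\<lambda>j. 1 / L2_set u {..<d} * u j) {..<d}"
      unfolding l2_norm_L2_set z_def by (intro L2_set_cong) auto
    also have "\<dots> = 1" unfolding L2_set_scale using False by (simp add: L2_set_nonneg)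
    finally have "z \<in> ?S" using C z by simp
    from le[OF this] have "L2_set (\<lambda>l. \<Sum>j<d. C $$ (l, j) * z $ j) {..<K} \<le> spectral_norm C"
      by (simp add: Cu[OF z])
    also have "L2_set (\<lambda>l. \<Sum>j<d. C $$ (l, j) * z $ j) {..<K} = L2_set (\<lambda>l. 1 / L2_set u {..<d} * (\<Sum>j<d. C $$ (l, j) * u j)) {..<K}"
      by (intro L2_set_cong) (auto simp: z_def sum_distrib_left mult_ac)
    also have "\<dots> = L2_set (\<lambda>l. \<Sum>j<d. C $$ (l, j) * u j) {..<K} / L2_set u {..<d}"
      unfolding L2_set_scale by (simp add: L2_set_nonneg)
    finally show ?thesis using False L2_set_nonneg[of u "{..<d}"] by (simp add: field_simps)
  qed
  show "L2_set (\<lambda>j. \<Sum>l<K. C $$ (l, j) * q l) {..<d} \<le> spectral_norm C * L2_set q {..<K}"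
    using operator_bound_transpose[where B = "\<lambda>j l. C $$ (l, j)" and L = "{..<d}" and P = "{..<K}" and u = q, OF _ op] s1
    by simp
qed

text \<open>On a compact set a positive continuous function has a positive margin
  \<open>1 / Suc m\<close>. With a margin the condition is closed and may be tested on a countable
  dense subset, so the event is a countable union of countable intersections.\<close>

lemma sets_Collect_ball_compact:
  fixes G :: "'w \<Rightarrow> (nat \<Rightarrow> real) \<Rightarrow> real"
  assumes B: "compact B" and cont: "\<And>\<omega>. \<omega> \<in> space M \<Longrightarrow> continuous_on B (G \<omega>)"
    and meas: "\<And>z. z \<in> B \<Longrightarrow> (\<lambda>\<omega>. G \<omega> z) \<in> borel_measurable M"
  shows "{\<omega> \<in> space M. \<forall>z\<in>B. 0 < G \<omega> z} \<in> sets M"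
proof -
  obtain D where D: "countable D" "D \<subseteq> B" "B \<subseteq> closure D" by (rule separable)
  have "{\<omega> \<in> space M. \<forall>z\<in>B. 0 < G \<omega> z} = (\<Union>m. \<Inter>z\<in>D. {\<omega> \<in> space M. 1 / real (Suc m) \<le> G \<omega> z}) \<inter> space M"
  proof (rule equalityI; rule subsetI)
    fix \<omega> assume \<omega>: "\<omega> \<in> {\<omega> \<in> space M. \<forall>z\<in>B. 0 < G \<omega> z}"
    show "\<omega> \<in> (\<Union>m. \<Inter>z\<in>D. {\<omega> \<in> space M. 1 / real (Suc m) \<le> G \<omega> z}) \<inter> space M"
    proof (cases "B = {}")
      case False
      then obtain w where w: "w \<in> B" "\<And>z. z \<in> B \<Longrightarrow> G \<omega> w \<le> G \<omega> z"
        using continuous_attains_inf[OF B False cont] \<omega> by blast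
      obtain m where "inverse (real (Suc m)) < G \<omega> w" using reals_Archimedean \<omega> w(1) by blast
      then have "1 / real (Suc m) \<le> G \<omega> z" if "z \<in> D" for z
        using w(2)[of z] that D(2) by (auto simp: inverse_eq_divide intro: order_trans less_imp_le)
      then show ?thesis using \<omega> by blast
    qed (use \<omega> D in auto)
  next
    fix \<omega> assume "\<omega> \<in> (\<Union>m. \<Inter>z\<in>D. {\<omega> \<in> space M. 1 / real (Suc m) \<le> G \<omega> z}) \<inter> space M"
    then obtain m where m: "\<And>z. z \<in> D \<Longrightarrow> 1 / real (Suc m) \<le> G \<omega> z" and \<omega>: "\<omega> \<in> space M" by auto
    have "B = B \<inter> closure D" using D by blast
    have "1 / real (Suc m) \<le> G \<omega> z" if z: "z \<in> B" for z
    proof -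
      let ?F = "B \<inter> G \<omega> -` {1 / real (Suc m)..}"
      have "closedin (top_of_set B) ?F"
        by (rule continuous_closedin_preimage[OF cont[OF \<omega>] closed_atLeast])
      then have "closed ?F" by (rule closedin_closed_trans) (rule compact_imp_closed[OF B])
      moreover have "D \<subseteq> ?F" using D m by auto
      ultimately have "closure D \<subseteq> ?F" by (rule closure_minimal[rotated])
      then show ?thesis using z D(3) by auto
    qed
    then show "\<omega> \<in> {\<omega> \<in> space M. \<forall>z\<in>B. 0 < G \<omega> z}"
      using \<omega> by (auto intro: less_le_trans[of 0 "1 / real (Suc m)"])
  qed
  also have "\<dots> \<in> sets M"
  proof (cases "D = {}")
    case False
    then show ?thesis
      using D meas by (intro sets.Int sets.countable_UN sets.top image_subsetI sets.countable_INT') auto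
  qed simp
  finally show ?thesis .
qed

section \<open>The constants of the training regime\<close>

lemma mult_le_self: "0 \<le> x \<Longrightarrow> y \<le> 1 \<Longrightarrow> x * y \<le> (x::real)"
  by (simp add: mult_left_le)

text \<open>The square roots \<open>L\<close>, \<open>\<kappa>\<close>, \<open>\<nu>\<close>, \<open>l\<close>, \<open>q\<close>, \<open>u\<close> stand for those of \<open>\<lambda>(C)\<close>, \<open>K\<close>, \<open>n\<close>,
  \<open>ln K\<close>, \<open>k\<close>, \<open>c_up\<close>, and \<open>g\<^sup>2\<close> for \<open>c_low / 2\<close>; \<open>T\<close> is the total step length \<open>\<tau> \<eta>\<close>.\<close>
locale regime_constants =
  fixes \<Gamma> L \<kappa> \<nu> s l \<Lambda> \<epsilon> q g u T C1 c1 S2 CR :: real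
  assumes \<Gamma>: "1 \<le> \<Gamma>" and L: "0 < L" "L \<le> \<Gamma>" and \<kappa>: "1 \<le> \<kappa>" and \<nu>: "1 \<le> \<nu>"
    and s: "1 \<le> s" "s \<le> \<kappa>" and l: "2 / 3 \<le> l" "l \<le> 1500 * \<Lambda>^3" "l \<le> 120 * \<Lambda>\<^sup>2"
    and \<Lambda>: "1 / 12 \<le> \<Lambda>"
    and \<epsilon>: "0 \<le> \<epsilon>" "\<epsilon> \<le> c1 * L\<^sup>2 / (\<Gamma>\<^sup>2 * \<kappa>\<^sup>2 * \<Lambda>)"
    and q: "S2 * \<Gamma>^5 * \<kappa>\<^sup>2 * s\<^sup>2 * \<Lambda>^3 / L^4 \<le> q"
    and g: "0 < g" and u: "1 \<le> u"
    and T: "0 \<le> T" "T \<le> 2 * C1 * \<kappa>\<^sup>2 * \<Lambda> / (\<nu>\<^sup>2 * L\<^sup>2)"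
    and CR: "CR = 1818 / g + 1" and C1: "0 < C1"
    and c1: "0 < c1" "8448 * u * c1 \<le> g\<^sup>2" "736 * C1 * u * c1 \<le> 1" "1800 * c1 \<le> 1"
      "276 * c1 * CR \<le> 1" "18400 * C1 * c1 \<le> 1"
    and S2: "48000 * u * CR / g\<^sup>2 \<le> S2" "1500 * CR \<le> S2"
begin

text \<open>In units of \<open>\<Gamma> * \<nu> * l\<close>: 152 is 150 for the initial outputs and
  at most 2 for the labels; 400 is an a priori bound verified in \<open>budget\<close>, an eighth of
  which, 50, is allotted to the drift. The radius constant \<open>CR\<close> is
  \<open>9 * (152 + 50) / g\<close> plus 1, and 23 is 2 + 21.\<close>

definition "\<beta> = \<Gamma> * s * u * \<nu> / \<kappa>"
definition "\<mu> = L * g * \<nu> / \<kappa>"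
definition "R = CR * \<Gamma> * \<kappa> * l / L"
definition "a = 150 * \<Gamma> * \<epsilon> * \<nu> * l"
definition "b = 152 * \<Gamma> * \<nu> * l"
definition "\<rho> = 400 * \<Gamma> * \<nu> * l"
definition "D = 23 * \<Gamma> * \<epsilon> * \<nu>"

lemma pos: "0 < \<Gamma>" "0 < \<kappa>" "0 < \<nu>" "0 < s" "0 < l" "0 < \<Lambda>" "0 < u" "0 < CR" "0 < S2"
  using \<Gamma> \<kappa> \<nu> s l \<Lambda> u g S2(2) by (auto simp: CR add_pos_pos intro: less_le_trans[of 0 "1500 * (1818 / g + 1)"])

text \<open>The smallness of \<epsilon> in the forms used later. Dropping \<Lambda> costs the factor
  12, and surplus powers of \<open>\<Gamma> * \<kappa> / L\<close>, which is at least 1, are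
  discarded.\<close>

lemma eps: "\<epsilon> * \<Gamma>\<^sup>2 * \<kappa>\<^sup>2 * \<Lambda> \<le> c1 * L\<^sup>2" "\<epsilon> * \<Gamma>\<^sup>2 * \<kappa>\<^sup>2 \<le> 12 * c1 * L\<^sup>2" "\<epsilon> * \<kappa> \<le> 12 * c1 * L / \<Gamma>" "\<epsilon> \<le> 12 * c1"
proof -
  show 1: "\<epsilon> * \<Gamma>\<^sup>2 * \<kappa>\<^sup>2 * \<Lambda> \<le> c1 * L\<^sup>2" using \<epsilon>(2) pos by (simp add: le_divide_eq mult.assoc)
  have "\<epsilon> * \<Gamma>\<^sup>2 * \<kappa>\<^sup>2 * (1 / 12) \<le> \<epsilon> * \<Gamma>\<^sup>2 * \<kappa>\<^sup>2 * \<Lambda>" using \<epsilon> \<Lambda> by (intro mult_left_mono) auto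
  with 1 show 2: "\<epsilon> * \<Gamma>\<^sup>2 * \<kappa>\<^sup>2 \<le> 12 * c1 * L\<^sup>2" by simp
  have "\<epsilon> * \<kappa> = \<epsilon> * \<Gamma>\<^sup>2 * \<kappa>\<^sup>2 / (\<Gamma>\<^sup>2 * \<kappa>)" using pos by (simp add: power2_eq_square)
  also have "\<dots> \<le> 12 * c1 * L\<^sup>2 / (\<Gamma>\<^sup>2 * \<kappa>)" using 2 pos by (intro divide_right_mono) auto
  also have "\<dots> = 12 * c1 * L / \<Gamma> * (L / (\<Gamma> * \<kappa>))" using pos by (simp add: power2_eq_square)
  also have "\<dots> \<le> 12 * c1 * L / \<Gamma>"
  proof (rule mult_le_self)
    have "L \<le> \<Gamma> * \<kappa>" using L \<kappa> pos mult_left_mono[of 1 \<kappa> \<Gamma>] by linarith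
    then show "L / (\<Gamma> * \<kappa>) \<le> 1" using pos by simp
  qed (use c1 L pos in auto)
  finally show 3: "\<epsilon> * \<kappa> \<le> 12 * c1 * L / \<Gamma>" .
  have "\<epsilon> * 1 \<le> \<epsilon> * \<kappa>" using \<epsilon> \<kappa> by (intro mult_left_mono) auto
  also have "\<dots> \<le> 12 * c1 * (L / \<Gamma>)" using 3 by simp
  also have "\<dots> \<le> 12 * c1" using c1 L pos by (intro mult_le_self) auto
  finally show "\<epsilon> \<le> 12 * c1" by simp
qed

lemma R_pos: "0 < R" using pos L by (simp add: R_def)

text \<open>\<open>R / q\<close> is the relative movement of the preactivations. The power of
  \<Lambda> in the width condition absorbs the factor \<open>l\<close> of the radius.\<close>

lemma R_q: "R / q \<le> 1500 * CR / S2 * (L^3 / (\<Gamma>^4 * \<kappa> * s\<^sup>2))" "0 < q"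
proof -
  define Q where "Q = S2 * \<Gamma>^5 * \<kappa>\<^sup>2 * s\<^sup>2 * \<Lambda>^3 / L^4"
  have Q: "0 < Q" "Q \<le> q" using pos L q by (auto simp: Q_def)
  then show "0 < q" by simp
  have "R / q \<le> R / Q" using Q R_pos by (intro divide_left_mono) auto
  also have "\<dots> = CR / S2 * (L^3 / (\<Gamma>^4 * \<kappa> * s\<^sup>2)) * (l / \<Lambda>^3)"
    using pos L by (simp add: Q_def R_def field_simps eval_nat_numeral)
  also have "\<dots> \<le> CR / S2 * (L^3 / (\<Gamma>^4 * \<kappa> * s\<^sup>2)) * 1500"
    using pos L l(2) by (intro mult_left_mono) (auto simp: divide_le_eq)
  finally show "R / q \<le> 1500 * CR / S2 * (L^3 / (\<Gamma>^4 * \<kappa> * s\<^sup>2))" by (simp add: mult_ac)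
qed

lemma Rk: "R \<le> q"
proof -
  have "L^3 \<le> \<Gamma>^4 * \<kappa> * s\<^sup>2"
  proof -
    have "L^3 \<le> \<Gamma>^3" using L by (intro power_mono) auto
    also have "\<dots> \<le> \<Gamma>^4" using \<Gamma> by (intro power_increasing) auto
    also have "\<dots> = \<Gamma>^4 * 1 * 1\<^sup>2" by simp
    also have "\<dots> \<le> \<Gamma>^4 * \<kappa> * s\<^sup>2" using \<kappa> s pos by (intro mult_mono power_mono) auto
    finally show ?thesis .
  qed
  then have "L^3 / (\<Gamma>^4 * \<kappa> * s\<^sup>2) \<le> 1" using pos by simp
  moreover have "1500 * CR / S2 \<le> 1" using S2(2) pos by simp
  ultimately have "1500 * CR / S2 * (L^3 / (\<Gamma>^4 * \<kappa> * s\<^sup>2)) \<le> 1 * 1"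
    using pos L by (intro mult_mono) auto
  then have "R / q \<le> 1" using R_q(1) by linarith
  then show ?thesis using R_q(2) by simp
qed

lemma small: "\<beta> * (\<nu> * \<Gamma> * ((1 + 21) * \<epsilon> + R / q)) \<le> \<mu>\<^sup>2 / 8"
proof -
  \<comment> \<open>The two sources of kernel movement, off-center inputs and moving weights, each
    get \<open>\<mu>\<^sup>2 / 32\<close>. This fixes 8448 = 22 * 12 * 32 and 48000 = 1500 *
    32.\<close>
  have 1: "22 * (s * u * \<nu>\<^sup>2 / \<kappa>) * (\<Gamma>\<^sup>2 * \<epsilon>) \<le> \<mu>\<^sup>2 / 32"
  proof -
    have "22 * (s * u * \<nu>\<^sup>2 / \<kappa>) * (\<Gamma>\<^sup>2 * \<epsilon>) = 22 * u * \<nu>\<^sup>2 / \<kappa>\<^sup>2 * (\<epsilon> * \<Gamma>\<^sup>2 * \<kappa>\<^sup>2) * (s / \<kappa>)"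
      using pos by (simp add: field_simps power2_eq_square)
    also have "\<dots> \<le> 22 * u * \<nu>\<^sup>2 / \<kappa>\<^sup>2 * (\<epsilon> * \<Gamma>\<^sup>2 * \<kappa>\<^sup>2)"
      using pos s \<epsilon> by (intro mult_le_self) auto
    also have "\<dots> \<le> 22 * u * \<nu>\<^sup>2 / \<kappa>\<^sup>2 * (12 * c1 * L\<^sup>2)"
      using pos by (intro mult_left_mono eps) auto
    also have "\<dots> = (8448 * u * c1) * (\<nu>\<^sup>2 / \<kappa>\<^sup>2 * L\<^sup>2) / 32" by simp
    also have "\<dots> \<le> g\<^sup>2 * (\<nu>\<^sup>2 / \<kappa>\<^sup>2 * L\<^sup>2) / 32"
      using c1 by (intro divide_right_mono mult_right_mono) auto
    also have "\<dots> = \<mu>\<^sup>2 / 32" by (simp add: \<mu>_def power_mult_distrib power_divide mult_ac)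
    finally show ?thesis .
  qed
  have 2: "\<Gamma>\<^sup>2 * (s * u * \<nu>\<^sup>2 / \<kappa>) * (R / q) \<le> \<mu>\<^sup>2 / 32"
  proof -
    have "\<Gamma>\<^sup>2 * (s * u * \<nu>\<^sup>2 / \<kappa>) * (R / q) \<le> \<Gamma>\<^sup>2 * (s * u * \<nu>\<^sup>2 / \<kappa>) * (1500 * CR / S2 * (L^3 / (\<Gamma>^4 * \<kappa> * s\<^sup>2)))"
      using pos by (intro mult_left_mono R_q) auto
    also have "\<dots> = 1500 * u * CR / S2 * (\<nu>\<^sup>2 * L\<^sup>2 / \<kappa>\<^sup>2) * (L / (\<Gamma>\<^sup>2 * s))"
      using pos by (simp add: field_simps eval_nat_numeral)
    also have "\<dots> \<le> 1500 * u * CR / S2 * (\<nu>\<^sup>2 * L\<^sup>2 / \<kappa>\<^sup>2)"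
    proof (rule mult_le_self)
      have "L * (1 * 1) \<le> \<Gamma> * (\<Gamma> * s)" using L \<Gamma> s by (intro mult_mono) auto
      then show "L / (\<Gamma>\<^sup>2 * s) \<le> 1" using pos by (simp add: power2_eq_square mult.assoc)
    qed (use pos in auto)
    also have "\<dots> \<le> g\<^sup>2 / 32 * (\<nu>\<^sup>2 * L\<^sup>2 / \<kappa>\<^sup>2)"
    proof (rule mult_right_mono)
      show "1500 * u * CR / S2 \<le> g\<^sup>2 / 32" using S2(1) pos g by (simp add: field_simps)
    qed auto
    also have "\<dots> = \<mu>\<^sup>2 / 32" by (simp add: \<mu>_def power_mult_distrib power_divide mult_ac)
    finally show ?thesis .
  qed
  have "\<beta> * (\<nu> * \<Gamma> * ((1 + 21) * \<epsilon> + R / q)) = 22 * (s * u * \<nu>\<^sup>2 / \<kappa>) * (\<Gamma>\<^sup>2 * \<epsilon>) + \<Gamma>\<^sup>2 * (s * u * \<nu>\<^sup>2 / \<kappa>) * (R / q)"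
    by (simp add: \<beta>_def power2_eq_square algebra_simps add_divide_distrib)
  also have "\<dots> \<le> \<mu>\<^sup>2 / 32 + \<mu>\<^sup>2 / 32" using 1 2 by (rule add_mono)
  also have "\<dots> \<le> \<mu>\<^sup>2 / 8" by simp
  finally show ?thesis .
qed

text \<open>Amplification of the residual bound into accumulated noise over the whole training time.
  Here 92 = 4 * 23, and the condition with 736 = 8 * 92 makes it at most 1/8.\<close>

lemma drift: "2 * T * \<beta> * D \<le> 92 * C1 * u * (\<epsilon> * \<Gamma>\<^sup>2 * \<kappa>\<^sup>2 * \<Lambda> / L\<^sup>2)" "2 * T * \<beta> * D \<le> 1 / 8"
proof -
  have "2 * T * (\<beta> * D) \<le> 2 * (2 * C1 * \<kappa>\<^sup>2 * \<Lambda> / (\<nu>\<^sup>2 * L\<^sup>2)) * (\<beta> * D)"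
    using T pos \<epsilon> by (intro mult_right_mono mult_left_mono) (auto simp: \<beta>_def D_def)
  also have "\<dots> = 92 * C1 * u * (\<epsilon> * \<Gamma>\<^sup>2 * \<kappa>\<^sup>2 * \<Lambda> / L\<^sup>2) * (s / \<kappa>)"
    using pos L by (simp add: \<beta>_def D_def field_simps power2_eq_square)
  also have "\<dots> \<le> 92 * C1 * u * (\<epsilon> * \<Gamma>\<^sup>2 * \<kappa>\<^sup>2 * \<Lambda> / L\<^sup>2)"
    using pos L C1 \<epsilon> s by (intro mult_le_self) auto
  finally show 1: "2 * T * \<beta> * D \<le> 92 * C1 * u * (\<epsilon> * \<Gamma>\<^sup>2 * \<kappa>\<^sup>2 * \<Lambda> / L\<^sup>2)" by (simp add: mult.assoc)
  also have "\<dots> \<le> 92 * C1 * u * c1"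
    using eps(1) pos L C1 by (intro mult_left_mono) (auto simp: divide_le_eq)
  also have "\<dots> \<le> 1 / 8" using c1(3) by simp
  finally show "2 * T * \<beta> * D \<le> 1 / 8" .
qed

lemma DR: "D * R \<le> \<Gamma> * \<nu> * l"
proof -
  have "D * R = 23 * CR * (\<Gamma> * \<nu> * l) * (\<epsilon> * \<kappa> * \<Gamma> / L)" by (simp add: D_def R_def)
  also have "\<dots> \<le> 23 * CR * (\<Gamma> * \<nu> * l) * (12 * c1)"
    using pos L eps(3) by (intro mult_left_mono) (auto simp: field_simps)
  also have "\<dots> = (\<Gamma> * \<nu> * l) * (276 * c1 * CR)" by simp
  also have "\<dots> \<le> \<Gamma> * \<nu> * l" using pos c1(5) by (intro mult_le_self) auto
  finally show ?thesis .
qed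

text \<open>In units of \<open>\<Gamma> * \<nu> * l\<close> the left side is at most 152 + 50 + 1 +
  1 + 3/2, well below 400.\<close>

lemma budget: "b + 2 * T * \<beta> * (D * \<rho>) + (a + D * R) + \<nu> \<le> \<rho>"
proof -
  define w where "w = \<Gamma> * \<nu> * l"
  have w: "0 < w" using pos by (simp add: w_def)
  have "2 * T * \<beta> * D * \<rho> \<le> 1 / 8 * \<rho>" using drift(2) pos by (intro mult_right_mono) (auto simp: \<rho>_def)
  then have 1: "2 * T * \<beta> * (D * \<rho>) \<le> 50 * w" by (simp add: \<rho>_def w_def mult.assoc)
  have "a = w * (150 * \<epsilon>)" by (simp add: a_def w_def)
  also have "\<dots> \<le> w" using w eps(4) c1(4) by (intro mult_le_self) auto
  finally have 2: "a \<le> w" .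
  have "\<nu> * 1 \<le> \<nu> * (\<Gamma> * (3 / 2 * l))"
  proof (intro mult_left_mono)
    have "1 * 1 \<le> \<Gamma> * (3 / 2 * l)" using \<Gamma> l by (intro mult_mono) auto
    then show "1 \<le> \<Gamma> * (3 / 2 * l)" by simp
  qed (use pos in auto)
  then have 3: "\<nu> \<le> 3 / 2 * w" by (simp add: w_def mult_ac)
  have 4: "b = 152 * w" "\<rho> = 400 * w" "D * R \<le> w" using DR by (simp_all add: b_def \<rho>_def w_def)
  from 1 2 3 4 w show ?thesis by linarith
qed

text \<open>The first term gives 9 * 202 = 1818 over \<open>g\<close>. The direct drift
  \<open>T * (D * \<rho>)\<close>, with 18400 = 2 * 23 * 400, is at most one further unit by the
  last condition on \<open>c1\<close>.\<close>

lemma radius: "9 / \<mu> * (b + 2 * T * \<beta> * (D * \<rho>)) + T * (D * \<rho>) \<le> R"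
proof -
  define w where "w = \<Gamma> * \<nu> * l"
  define r where "r = \<Gamma> * \<kappa> * l / L"
  have w: "0 < w" and r: "0 < r" using pos L by (simp_all add: w_def r_def)
  have \<mu>0: "0 < \<mu>" using pos L g by (simp add: \<mu>_def)
  have "2 * T * \<beta> * D * \<rho> \<le> 1 / 8 * \<rho>" using drift(2) pos by (intro mult_right_mono) (auto simp: \<rho>_def)
  then have "b + 2 * T * \<beta> * (D * \<rho>) \<le> 202 * w" by (simp add: b_def \<rho>_def w_def mult.assoc)
  then have "9 / \<mu> * (b + 2 * T * \<beta> * (D * \<rho>)) \<le> 9 / \<mu> * (202 * w)" using \<mu>0 by (intro mult_left_mono) auto
  also have "\<dots> = 1818 / g * r" using pos L g by (simp add: \<mu>_def w_def r_def field_simps)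
  finally have 1: "9 / \<mu> * (b + 2 * T * \<beta> * (D * \<rho>)) \<le> 1818 / g * r" .
  have "T * (D * \<rho>) \<le> (2 * C1 * \<kappa>\<^sup>2 * \<Lambda> / (\<nu>\<^sup>2 * L\<^sup>2)) * (D * \<rho>)"
    using T pos \<epsilon> by (intro mult_right_mono) (auto simp: D_def \<rho>_def)
  also have "\<dots> = 18400 * C1 * l * (\<epsilon> * \<Gamma>\<^sup>2 * \<kappa>\<^sup>2 * \<Lambda> / L\<^sup>2)"
    using pos L by (simp add: D_def \<rho>_def field_simps power2_eq_square)
  also have "\<dots> \<le> 18400 * C1 * l * c1"
    using eps(1) pos L C1 by (intro mult_left_mono) (auto simp: divide_le_eq)
  also have "\<dots> = l * (18400 * C1 * c1)" by simp
  also have "\<dots> \<le> l" using pos c1(6) by (intro mult_le_self) auto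
  also have "\<dots> \<le> r"
  proof -
    have "L * 1 \<le> \<Gamma> * \<kappa>" using L \<kappa> \<Gamma> by (intro mult_mono) auto
    then have "l * L \<le> l * (\<Gamma> * \<kappa>)" using pos by (intro mult_left_mono) auto
    then show ?thesis using L by (simp add: r_def le_divide_eq mult_ac)
  qed
  finally have 2: "T * (D * \<rho>) \<le> r" .
  have "R = 1818 / g * r + r" unfolding R_def r_def by (subst CR) (simp add: distrib_right add_divide_distrib)
  with 1 2 show ?thesis by linarith
qed

text \<open>The error scale common to the first two items of the theorem, with
  \<open>L\<^sup>2\<close>, \<open>\<kappa>\<^sup>2\<close> and \<open>l\<close> for \<lambda>(C),
  \<open>K\<close> and the root of \<open>ln K\<close>.\<close>

definition "E = \<epsilon> * \<Gamma>^3 * \<kappa>\<^sup>2 * l / L\<^sup>2 * \<Lambda>"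

lemma E_nonneg: "0 \<le> E" using pos \<epsilon> by (simp add: E_def)

lemma floor_bound: "2 * T * \<beta> * (D * \<rho>) \<le> 36800 * C1 * u * E * \<nu>"
proof -
  have "2 * T * \<beta> * D * \<rho> \<le> 92 * C1 * u * (\<epsilon> * \<Gamma>\<^sup>2 * \<kappa>\<^sup>2 * \<Lambda> / L\<^sup>2) * \<rho>"
    using drift(1) pos by (intro mult_right_mono) (auto simp: \<rho>_def)
  also have "\<dots> = 36800 * C1 * u * E * \<nu>" by (simp add: \<rho>_def E_def eval_nat_numeral)
  finally show ?thesis by (simp add: mult.assoc)
qed

lemma gap_bound: "a + D * R \<le> 12 * (150 + 23 * CR) * E * \<nu>"
proof -
  define e where "e = \<epsilon> * \<Gamma>^3 * \<kappa>\<^sup>2 * l / L\<^sup>2"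
  have e0: "0 \<le> e" using pos \<epsilon> by (simp add: e_def)
  have LG: "L * 1 \<le> \<Gamma> * \<kappa>" using L \<kappa> \<Gamma> by (intro mult_mono) auto
  then have p: "L / (\<Gamma> * \<kappa>) \<le> 1" using pos by simp
  have "a + D * R = 150 * \<nu> * (e * ((L / (\<Gamma> * \<kappa>)) * (L / (\<Gamma> * \<kappa>)))) + 23 * CR * \<nu> * (e * (L / (\<Gamma> * \<kappa>)))"
    using pos L by (simp add: a_def D_def R_def e_def field_simps eval_nat_numeral)
  also have "\<dots> \<le> 150 * \<nu> * (e * 1) + 23 * CR * \<nu> * (e * 1)"
    using p pos L e0 mult_mono[OF p p] by (intro add_mono mult_left_mono) auto
  also have "\<dots> = (150 + 23 * CR) * \<nu> * (e * 1)" by (simp add: algebra_simps)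
  also have "\<dots> \<le> (150 + 23 * CR) * \<nu> * (e * (12 * \<Lambda>))"
    using pos e0 \<Lambda> by (intro mult_left_mono) auto
  also have "\<dots> = 12 * (150 + 23 * CR) * E * \<nu>" by (simp add: E_def e_def)
  finally show ?thesis .
qed

lemma path_bound:
  assumes t: "0 \<le> t"
  shows "9 / \<mu> * (b + 2 * t * \<beta> * (D * \<rho>)) + t * (D * \<rho>)
    \<le> (1368 / g + 20976000 * u / g + 1104000) * (\<Gamma> * (\<kappa> * l / L) + t * \<epsilon> * (\<Gamma>^4 * \<kappa>\<^sup>2 * \<nu>\<^sup>2 / L\<^sup>2) * \<Lambda>\<^sup>2)"
proof -
  define X where "X = \<Gamma> * (\<kappa> * l / L)"
  define Y where "Y = t * \<epsilon> * (\<Gamma>^4 * \<kappa>\<^sup>2 * \<nu>\<^sup>2 / L\<^sup>2) * \<Lambda>\<^sup>2"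
  have X: "0 \<le> X" and Y: "0 \<le> Y" using pos L \<epsilon> t by (simp_all add: X_def Y_def)
  have 1: "9 / \<mu> * b = 1368 / g * X" using pos L g by (simp add: \<mu>_def b_def X_def field_simps)
  have LG: "L * 1 \<le> \<Gamma> * \<kappa>" using L \<kappa> \<Gamma> by (intro mult_mono) auto
  have p: "s * L / (\<kappa> * (\<kappa> * \<Gamma>)) \<le> 1"
  proof -
    have "s * L \<le> \<kappa> * (\<Gamma> * \<kappa>)" using s LG L pos by (intro mult_mono) auto
    then show ?thesis using pos by (simp add: mult_ac)
  qed
  have lL: "l / \<Lambda>\<^sup>2 \<le> 120" using l(3) pos by (simp add: divide_le_eq)
  \<comment> \<open>The coefficient is 9 * 2 * 23 * 400 = 165600 = 174800 - 9200; after the factor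
    120 it is rounded up to 20976000 = 120 * 174800.\<close>
  have "9 / \<mu> * (2 * t * \<beta> * (D * \<rho>)) = (174800 - 9200) * u / g * Y * (s * L / (\<kappa> * (\<kappa> * \<Gamma>))) * (l / \<Lambda>\<^sup>2)"
    using pos L g by (simp add: \<mu>_def \<beta>_def D_def \<rho>_def Y_def field_simps eval_nat_numeral)
  also have "\<dots> \<le> (174800 - 9200) * u / g * Y * 1 * 120"
    using pos L g Y p lL by (intro mult_mono mult_left_mono mult_nonneg_nonneg) auto
  also have "\<dots> \<le> 20976000 * u / g * Y" using pos g Y by (simp add: mult_right_mono divide_right_mono)
  finally have 2: "9 / \<mu> * (2 * t * \<beta> * (D * \<rho>)) \<le> 20976000 * u / g * Y" .
  have p': "L * L / (\<Gamma> * \<kappa> * (\<Gamma> * \<kappa>)) \<le> 1"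
    using mult_mono[OF LG LG] pos L by simp
  have "t * (D * \<rho>) = 9200 * Y * (L * L / (\<Gamma> * \<kappa> * (\<Gamma> * \<kappa>))) * (l / \<Lambda>\<^sup>2)"
    using pos L by (simp add: D_def \<rho>_def Y_def field_simps eval_nat_numeral)
  also have "\<dots> \<le> 9200 * Y * 1 * 120"
    using pos L Y p' lL by (intro mult_mono mult_left_mono mult_nonneg_nonneg) auto
  finally have 3: "t * (D * \<rho>) \<le> 1104000 * Y" by simp
  have "9 / \<mu> * (b + 2 * t * \<beta> * (D * \<rho>)) + t * (D * \<rho>) \<le> 1368 / g * X + (20976000 * u / g * Y + 1104000 * Y)"
    using 1 2 3 by (simp add: distrib_left)
  also have "\<dots> \<le> (1368 / g + 20976000 * u / g + 1104000) * X + (1368 / g + 20976000 * u / g + 1104000) * Y"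
    unfolding distrib_right[symmetric] using g pos X Y
    by (intro add_mono mult_right_mono) auto
  finally show ?thesis by (simp add: X_def Y_def distrib_left)
qed

end

section \<open>Guarantees along the trajectory\<close>

text \<open>The corruption level is called \<open>rh\<close> here, since \<open>\<rho>\<close> is the bound on the residuals.\<close>
locale training = clustered_gd k d v \<phi> \<phi>' \<Gamma> n K cl X c y \<eta> \<epsilon> W0 +
  rc: regime_constants \<Gamma> L \<kappa> \<nu> s l \<Lambda> \<epsilon> q g u T C1 c1 S2 CR
  for k d v \<phi> \<phi>' \<Gamma> n K cl X c y \<eta> \<epsilon> W0 L \<kappa> \<nu> s l \<Lambda> q g u T C1 c1 S2 CR +
  fixes \<tau> :: nat and rh :: real and lab :: "nat \<Rightarrow> real"
  assumes roots: "\<kappa> = sqrt (real K)" "\<nu> = sqrt (real n)" "q = sqrt (real k)" "T = real \<tau> * \<eta>"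
    and block_lower: "\<And>l. l < K \<Longrightarrow> 2 * g\<^sup>2 * (real n / real K) \<le> real (card (block l))"
    and block_upper: "\<And>l. l < K \<Longrightarrow> real (card (block l)) \<le> u\<^sup>2 * (real n / real K)"
    and kernel: "\<And>x. L\<^sup>2 / 2 * (L2_set x {..<K})\<^sup>2 \<le> (\<Sum>i<K. \<Sum>j<K. x i * x j * ((\<Sum>m<d. c i m * c j m) *
       (\<Sum>r<k. (v r)\<^sup>2 * (\<phi>' (preact d W0 (c i) r) * \<phi>' (preact d W0 (c j) r)))))"
    and spectral: "\<And>x. L2_set (\<lambda>j. \<Sum>i<K. c i j * x i) {..<d} \<le> s * L2_set x {..<K}"
    and step_size: "\<eta> * (2 * u\<^sup>2 * \<nu>\<^sup>2 * \<Gamma>\<^sup>2 * s\<^sup>2) \<le> \<kappa>\<^sup>2"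
    and init_near0: "L2_set (\<lambda>i. L2_set (preact d W0 (\<lambda>j. X i j - c (cl i) j)) {..<k}) {..<n} \<le> 21 * sqrt (real n) * sqrt (real k) * \<epsilon>"
    and init_out: "L2_set (\<lambda>i. out W0 (X i)) {..<n} \<le> 150 * \<Gamma> * \<nu> * l"
    and init_gap: "L2_set (gap W0) {..<n} \<le> 150 * (\<Gamma> * \<epsilon>) * \<nu> * l"
    and T_lower: "C1 * \<kappa>\<^sup>2 * \<Lambda> / (2 * \<nu>\<^sup>2 * L\<^sup>2) \<le> T" and C1g: "C1 * g\<^sup>2 = 1600"
    and rh: "0 < rh" "rh * exp \<Lambda> = \<Gamma> * \<nu> * l"
    and gu: "g \<le> u"
    and corrupted: "\<And>l. l < K \<Longrightarrow> real (card {i \<in> block l. y i \<noteq> lab (cl i)}) \<le> rh * real (card (block l))"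
    and lab: "\<And>l. l < K \<Longrightarrow> \<bar>lab l\<bar> \<le> 1"
begin

lemma card_block_positive:
  assumes "m < K" shows "0 < card (block m)"
proof -
  have "0 < real n" "0 < real K" using rc.pos by (simp_all add: roots)
  then have "0 < 2 * g\<^sup>2 * (real n / real K)" using rc.g by simp
  also have "\<dots> \<le> real (card (block m))" by (rule block_lower[OF assms])
  finally show ?thesis by simp
qed

text \<open>For each neuron the image is the transposed center matrix applied to a rescaled vector,
  so the spectral norm of the centers enters. Summing over the neurons then only adds up squares of
  the output weights.\<close>

lemma op_W0: "L2_set (\<lambda>p. \<Sum>i<K. cjac W0 i p * x i) P \<le> rc.\<beta> * L2_set x {..<K}"
proof -
  define f where "f r i = v r * \<phi>' (preact d W0 (c i) r) * (sqrt (real (card (block i))) * x i)" for r i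
  define B where "B = \<Gamma> / sqrt (real k) * (u * \<nu> / \<kappa>)"
  have B0: "0 \<le> B" using rc.pos k by (simp add: B_def)
  have f: "L2_set (f r) {..<K} \<le> B * L2_set x {..<K}" if r: "r < k" for r
  proof -
    have "L2_set (f r) {..<K} \<le> L2_set (\<lambda>i. B * x i) {..<K}"
    proof (rule L2_set_abs_mono)
      fix i assume i: "i \<in> {..<K}"
      have "sqrt (real (card (block i))) \<le> sqrt (u\<^sup>2 * (real n / real K))"
        using block_upper i by (intro real_sqrt_le_mono) auto
      also have "\<dots> = u * \<nu> / \<kappa>" using rc.u by (simp add: roots real_sqrt_mult real_sqrt_divide)
      finally have N: "sqrt (real (card (block i))) \<le> u * \<nu> / \<kappa>" .
      have "\<bar>f r i\<bar> = (\<bar>v r\<bar> * \<bar>\<phi>' (preact d W0 (c i) r)\<bar>) * (sqrt (real (card (block i))) * \<bar>x i\<bar>)"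
        by (simp add: f_def abs_mult)
      also have "\<dots> \<le> (1 / sqrt (real k) * \<Gamma>) * (u * \<nu> / \<kappa> * \<bar>x i\<bar>)"
        using rc.pos by (intro mult_mono v r bound N) auto
      also have "\<dots> = B * \<bar>x i\<bar>" by (simp add: B_def)
      finally show "\<bar>f r i\<bar> \<le> \<bar>B * x i\<bar>" using B0 by (simp add: abs_mult)
    qed
    then show ?thesis unfolding L2_set_scale using B0 by simp
  qed
  have "L2_set (\<lambda>p. \<Sum>i<K. cjac W0 i p * x i) P = L2_set (\<lambda>p. (\<lambda>r j. \<Sum>i<K. c i j * f r i) (fst p) (snd p)) P"
    by (simp add: cjac_def jac_def f_def mult_ac)
  also have "\<dots> = L2_set (\<lambda>r. L2_set (\<lambda>j. \<Sum>i<K. c i j * f r i) {..<d}) {..<k}"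
    by (rule L2_set_Times)
  also have "\<dots> \<le> L2_set (\<lambda>r. s * (B * L2_set x {..<K})) {..<k}"
  proof (rule L2_set_mono)
    fix r assume "r \<in> {..<k}"
    then show "L2_set (\<lambda>j. \<Sum>i<K. c i j * f r i) {..<d} \<le> s * (B * L2_set x {..<K})"
      using order_trans[OF spectral mult_left_mono[OF f]] rc.pos by simp
  qed (rule L2_set_nonneg)
  also have "\<dots> = sqrt (real k) * (s * (B * L2_set x {..<K}))"
    unfolding L2_set_const using rc.pos B0 by (simp add: L2_set_nonneg)
  also have "\<dots> = rc.\<beta> * L2_set x {..<K}"
    using k by (simp add: B_def rc.\<beta>_def)
  finally show ?thesis .
qed

text \<open>The squared norm is the quadratic form of the random kernel at the vector weighted by
  square roots of block sizes. The kernel gives \<open>L\<^sup>2 / 2\<close> and the blocks give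
  \<open>2 * g\<^sup>2 * n / K\<close>, together the square of \<open>rc.\<mu>\<close>.\<close>

lemma low_W0: "rc.\<mu> * L2_set x {..<K} \<le> L2_set (\<lambda>p. \<Sum>i<K. cjac W0 i p * x i) P"
proof (rule power2_le_imp_le)
  define N where "N i = sqrt (real (card (block i))) * x i" for i
  define h where "h r i = v r * \<phi>' (preact d W0 (c i) r)" for r i
  have "(L2_set (\<lambda>p. \<Sum>i<K. cjac W0 i p * x i) P)\<^sup>2 = (\<Sum>r<k. \<Sum>m<d. (\<Sum>i<K. N i * (h r i * c i m))\<^sup>2)"
    unfolding L2_set_power2 by (simp add: sum.cartesian_product case_prod_beta cjac_def jac_def N_def h_def mult_ac)
  also have "\<dots> = (\<Sum>r<k. \<Sum>m<d. \<Sum>i<K. \<Sum>j<K. N i * N j * (c i m * c j m * (h r i * h r j)))"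
    unfolding power2_eq_square sum_product by (simp add: mult_ac)
  also have "\<dots> = (\<Sum>r<k. \<Sum>i<K. \<Sum>j<K. \<Sum>m<d. N i * N j * (c i m * c j m * (h r i * h r j)))"
    by (rule sum.cong[OF refl], subst sum.swap, rule sum.cong[OF refl], rule sum.swap)
  also have "\<dots> = (\<Sum>i<K. \<Sum>j<K. \<Sum>r<k. \<Sum>m<d. N i * N j * (c i m * c j m * (h r i * h r j)))"
    by (subst sum.swap, rule sum.cong[OF refl], rule sum.swap)
  also have "\<dots> = (\<Sum>i<K. \<Sum>j<K. N i * N j * ((\<Sum>m<d. c i m * c j m) *
       (\<Sum>r<k. (v r)\<^sup>2 * (\<phi>' (preact d W0 (c i) r) * \<phi>' (preact d W0 (c j) r)))))"
  proof (intro sum.cong refl)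
    fix i j
    have "(\<Sum>r<k. \<Sum>m<d. N i * N j * (c i m * c j m * (h r i * h r j)))
        = N i * N j * (\<Sum>r<k. \<Sum>m<d. (h r i * h r j) * (c i m * c j m))"
      by (simp add: sum_distrib_left mult_ac)
    also have "(\<Sum>r<k. \<Sum>m<d. (h r i * h r j) * (c i m * c j m)) = (\<Sum>r<k. h r i * h r j) * (\<Sum>m<d. c i m * c j m)"
      by (simp add: sum_product)
    also have "(\<Sum>r<k. h r i * h r j) = (\<Sum>r<k. (v r)\<^sup>2 * (\<phi>' (preact d W0 (c i) r) * \<phi>' (preact d W0 (c j) r)))"
      by (intro sum.cong) (auto simp: h_def power2_eq_square)
    finally show "(\<Sum>r<k. \<Sum>m<d. N i * N j * (c i m * c j m * (h r i * h r j))) = N i * N j * ((\<Sum>m<d. c i m * c j m) *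
       (\<Sum>r<k. (v r)\<^sup>2 * (\<phi>' (preact d W0 (c i) r) * \<phi>' (preact d W0 (c j) r))))"
      by (simp add: mult.commute)
  qed
  finally have eq: "(L2_set (\<lambda>p. \<Sum>i<K. cjac W0 i p * x i) P)\<^sup>2 = \<dots>" .
  have "(rc.\<mu> * L2_set x {..<K})\<^sup>2 = L\<^sup>2 / 2 * (2 * g\<^sup>2 * (real n / real K) * (\<Sum>i<K. (x i)\<^sup>2))"
  proof -
    have "real n = \<nu>\<^sup>2" "real K = \<kappa>\<^sup>2" by (simp_all add: roots)
    then show ?thesis by (simp add: rc.\<mu>_def power_mult_distrib power_divide L2_set_power2)
  qed
  also have "2 * g\<^sup>2 * (real n / real K) * (\<Sum>i<K. (x i)\<^sup>2) \<le> (\<Sum>i<K. real (card (block i)) * (x i)\<^sup>2)"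
    unfolding sum_distrib_left by (intro sum_mono mult_right_mono block_lower) auto
  also have "(\<Sum>i<K. real (card (block i)) * (x i)\<^sup>2) = (L2_set N {..<K})\<^sup>2"
    unfolding L2_set_power2 by (simp add: N_def power_mult_distrib)
  also have "L\<^sup>2 / 2 * (L2_set N {..<K})\<^sup>2 \<le> (L2_set (\<lambda>p. \<Sum>i<K. cjac W0 i p * x i) P)\<^sup>2"
    unfolding eq by (rule kernel)
  finally show "(rc.\<mu> * L2_set x {..<K})\<^sup>2 \<le> (L2_set (\<lambda>p. \<Sum>i<K. cjac W0 i p * x i) P)\<^sup>2"
    using mult_left_mono by fastforce
qed (rule L2_set_nonneg)

lemma rc_nonneg: "0 \<le> rc.\<rho>" "0 < rc.\<mu>" "0 < rc.\<beta>"
  using rc.pos rc.L rc.g by (simp_all add: rc.\<rho>_def rc.\<mu>_def rc.\<beta>_def)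

lemma mu_le_beta: "rc.\<mu> \<le> rc.\<beta>"
proof -
  have "\<Gamma> * 1 \<le> \<Gamma> * s" using rc.s rc.pos by (intro mult_left_mono) auto
  then have "L \<le> \<Gamma> * s" using rc.L by linarith
  then have "L * g \<le> (\<Gamma> * s) * u" using rc.L rc.pos gu rc.g by (intro mult_mono) auto
  then have "L * g * (\<nu> / \<kappa>) \<le> \<Gamma> * s * u * (\<nu> / \<kappa>)" using rc.pos by (intro mult_right_mono) auto
  then show ?thesis by (simp add: rc.\<mu>_def rc.\<beta>_def)
qed

lemma eta_beta: "\<eta> * rc.\<beta>\<^sup>2 \<le> 1"
proof -
  have "\<eta> * rc.\<beta>\<^sup>2 = \<eta> * (2 * u\<^sup>2 * \<nu>\<^sup>2 * \<Gamma>\<^sup>2 * s\<^sup>2) / (2 * \<kappa>\<^sup>2)"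
    by (simp add: rc.\<beta>_def power_mult_distrib power_divide mult_ac)
  also have "\<dots> \<le> \<kappa>\<^sup>2 / (2 * \<kappa>\<^sup>2)" by (intro divide_right_mono step_size) simp
  also have "\<dots> \<le> 1" using rc.pos by simp
  finally show ?thesis .
qed

lemma init_res: "L2_set (res W0) {..<n} \<le> rc.b"
proof -
  have "L2_set (res W0) {..<n} \<le> L2_set (\<lambda>i. out W0 (X i)) {..<n} + L2_set y {..<n}"
    unfolding res_def by (rule L2_set_triangle_diff)
  also have "L2_set y {..<n} \<le> L2_set (\<lambda>_. 1) {..<n}" by (rule L2_set_abs_mono) (use y in auto)
  also have "\<dots> = \<nu>" by (simp add: L2_set_const roots)
  also have "\<nu> \<le> \<nu> * (\<Gamma> * (3 / 2 * l))"
  proof -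
    have "1 * 1 \<le> \<Gamma> * (3 / 2 * l)" using rc.\<Gamma> rc.l by (intro mult_mono) auto
    then show ?thesis using mult_left_mono[of 1 "\<Gamma> * (3 / 2 * l)" \<nu>] rc.pos by simp
  qed
  also have "\<dots> \<le> \<nu> * (\<Gamma> * (2 * l))" using rc.pos by (intro mult_left_mono) auto
  finally show ?thesis using init_out by (simp add: rc.b_def mult_ac)
qed

sublocale gd_regime k d v \<phi> \<phi>' \<Gamma> n K cl X c y \<eta> \<epsilon> W0 21 rc.\<beta> rc.\<mu> rc.a rc.b rc.R rc.D rc.\<rho> \<tau>
proof unfold_locales
  show "rc.R \<le> sqrt (real k)" using rc.Rk by (simp add: roots)
  show "rc.D = (2 + 21) * \<Gamma> * \<epsilon> * sqrt (real n)" unfolding rc.D_def roots(2)[symmetric] by simp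
  show "rc.\<beta> * (sqrt (real n) * \<Gamma> * ((1 + 21) * \<epsilon> + rc.R / sqrt (real k))) \<le> rc.\<mu>\<^sup>2 / 8"
    using rc.small by (simp add: roots)
  show "L2_set (gap W0) {..<n} \<le> rc.a" using init_gap by (simp add: rc.a_def mult_ac)
  show "rc.b + 2 * real \<tau> * \<eta> * rc.\<beta> * (rc.D * rc.\<rho>) + (rc.a + rc.D * rc.R) + sqrt (real n) \<le> rc.\<rho>"
    using rc.budget by (simp add: roots mult.assoc)
  show "9 / rc.\<mu> * (rc.b + 2 * real \<tau> * \<eta> * rc.\<beta> * (rc.D * rc.\<rho>)) + real \<tau> * \<eta> * (rc.D * rc.\<rho>) \<le> rc.R"
    using rc.radius by (simp add: roots mult.assoc)
qed (use init_near0 op_W0 low_W0 rc_nonneg mu_le_beta eta_beta init_res in simp_all)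

definition "Cerr = 36800 * C1 * u + 12 * (150 + 23 * CR)"

lemma Cerr_pos: "0 < Cerr"
  using rc.C1 rc.pos by (simp add: Cerr_def add_pos_pos)

text \<open>By \<open>C1 * g\<^sup>2 = 1600\<close> the contraction exponent is at least
  \<open>100 * \<Lambda>\<close>. One \<Lambda> converts the initial size
  \<open>\<Gamma> * \<nu> * l\<close> into \<open>rh\<close>; the remaining 99 give an exponent of
  at least 8, and \<open>exp 8\<close> exceeds 152.\<close>

lemma decay: "(1 - \<eta> * rc.\<mu>\<^sup>2 / 8) ^ \<tau> * rc.b \<le> rh"
proof -
  have "\<eta> * rc.\<mu>\<^sup>2 \<le> \<eta> * rc.\<beta>\<^sup>2" using rc_nonneg mu_le_beta \<eta> by (intro mult_left_mono power_mono) auto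
  then have n: "0 \<le> 1 - \<eta> * rc.\<mu>\<^sup>2 / 8" using eta_beta by simp
  have "100 * \<Lambda> = C1 * \<kappa>\<^sup>2 * \<Lambda> / (2 * \<nu>\<^sup>2 * L\<^sup>2) * rc.\<mu>\<^sup>2 / 8"
  proof -
    have "C1 * \<kappa>\<^sup>2 * \<Lambda> / (2 * \<nu>\<^sup>2 * L\<^sup>2) * rc.\<mu>\<^sup>2 / 8 = C1 * g\<^sup>2 * \<Lambda> / 16"
      using rc.pos rc.L by (simp add: rc.\<mu>_def power_mult_distrib power_divide)
    then show ?thesis by (simp add: C1g)
  qed
  also have "\<dots> \<le> T * rc.\<mu>\<^sup>2 / 8" by (intro divide_right_mono mult_right_mono T_lower) auto
  finally have T: "100 * \<Lambda> \<le> T * rc.\<mu>\<^sup>2 / 8" .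
  have "1 - \<eta> * rc.\<mu>\<^sup>2 / 8 \<le> exp (- (\<eta> * rc.\<mu>\<^sup>2 / 8))"
    using exp_ge_add_one_self[of "- (\<eta> * rc.\<mu>\<^sup>2 / 8)"] by simp
  then have "(1 - \<eta> * rc.\<mu>\<^sup>2 / 8) ^ \<tau> \<le> exp (- (\<eta> * rc.\<mu>\<^sup>2 / 8)) ^ \<tau>" using n by (intro power_mono)
  also have "\<dots> = exp (- (T * rc.\<mu>\<^sup>2 / 8))" by (simp add: roots mult.assoc flip: exp_of_nat_mult)
  also have "\<dots> \<le> exp (- (100 * \<Lambda>))" using T by simp
  finally have "(1 - \<eta> * rc.\<mu>\<^sup>2 / 8) ^ \<tau> * rc.b \<le> exp (- (100 * \<Lambda>)) * rc.b"
    using rc.pos by (intro mult_right_mono) (auto simp: rc.b_def)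
  also have "exp (- (100 * \<Lambda>)) * rc.b = rh * (152 * exp (- (99 * \<Lambda>)))"
  proof -
    have 1: "rc.b = 152 * (rh * exp \<Lambda>)" by (simp add: rc.b_def rh)
    have 2: "exp (- (99 * \<Lambda>)) = exp (- (100 * \<Lambda>)) * exp \<Lambda>" by (simp flip: exp_add)
    show ?thesis unfolding 1 2 by (simp only: mult_ac)
  qed
  also have "\<dots> \<le> rh * 1"
  proof (intro mult_left_mono)
    have "(2::real) ^ 8 \<le> exp 1 ^ 8" using exp_ge_add_one_self[of "1::real"] by (intro power_mono) auto
    also have "\<dots> = exp 8" by (simp flip: exp_of_nat_mult)
    also have "\<dots> \<le> exp (99 * \<Lambda>)" using rc.\<Lambda> by simp
    finally have "152 \<le> exp (99 * \<Lambda>)" by simp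
    then show "152 * exp (- (99 * \<Lambda>)) \<le> 1" by (simp add: exp_minus field_simps)
  qed (use rh in simp)
  finally show ?thesis by simp
qed

lemma final_agg: "L2_set (agg (res (gd \<tau>))) {..<K} \<le> rh + 36800 * C1 * u * rc.E * \<nu>"
proof -
  have "2 * real \<tau> * \<eta> * rc.\<beta> * (rc.D * rc.\<rho>) = 2 * T * rc.\<beta> * (rc.D * rc.\<rho>)" by (simp add: roots(4))
  then show ?thesis using trajectory(3)[OF order_refl] decay rc.floor_bound by linarith
qed

lemma final_gap: "L2_set (gap (gd \<tau>)) {..<n} \<le> 12 * (150 + 23 * CR) * rc.E * \<nu>"
  using gap_L2[OF trajectory_ball[OF order_refl]] rc.gap_bound by simp

text \<open>The summand is the output at input \<open>i\<close> minus the average of the corrupted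
  labels in its cluster; \<open>residual_split\<close> makes this visible. In this form the labels
  drop out of both parts that are estimated.\<close>

lemma final_fluctuation:
  "L2_set (\<lambda>i. avg (res (gd \<tau>)) (cl i) + (gap (gd \<tau>) i - avg (gap (gd \<tau>)) (cl i))) {..<n} \<le> rh + Cerr * rc.E * \<nu>"
proof -
  have "L2_set (\<lambda>i. avg (res (gd \<tau>)) (cl i) + (gap (gd \<tau>) i - avg (gap (gd \<tau>)) (cl i))) {..<n}
      \<le> L2_set (\<lambda>i. avg (res (gd \<tau>)) (cl i)) {..<n} + L2_set (\<lambda>i. gap (gd \<tau>) i - avg (gap (gd \<tau>)) (cl i)) {..<n}"
    by (rule L2_set_triangle_ineq)
  also have "\<dots> \<le> (rh + 36800 * C1 * u * rc.E * \<nu>) + 12 * (150 + 23 * CR) * rc.E * \<nu>"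
    unfolding avg_L2 by (intro add_mono final_agg order_trans[OF resid_avg_L2 final_gap])
  finally show ?thesis by (simp add: Cerr_def algebra_simps)
qed

lemma avg_label:
  assumes m: "m < K"
  shows "\<bar>avg y m - lab m\<bar> \<le> 2 * rh"
proof -
  let ?N = "real (card (block m))"
  have N: "0 < ?N" using card_block_positive[OF m] by simp
  have "avg y m - lab m = (\<Sum>i\<in>block m. y i - lab m) / ?N"
  proof -
    have "block m \<noteq> {}" using N by auto
    then show ?thesis by (simp add: avg_def sum_subtractf diff_divide_distrib)
  qed
  also have "\<bar>\<dots>\<bar> \<le> (\<Sum>i\<in>block m. \<bar>y i - lab m\<bar>) / ?N"
    unfolding abs_divide using N by (intro divide_mono sum_abs) auto
  also have "(\<Sum>i\<in>block m. \<bar>y i - lab m\<bar>) = (\<Sum>i\<in>{i \<in> block m. y i \<noteq> lab (cl i)}. \<bar>y i - lab m\<bar>)"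
    by (rule sum.mono_neutral_right) (auto simp: block_def)
  also have "\<dots> \<le> (\<Sum>i\<in>{i \<in> block m. y i \<noteq> lab (cl i)}. 2)"
  proof (rule sum_mono)
    fix i assume "i \<in> {i \<in> block m. y i \<noteq> lab (cl i)}"
    then have "i < n" by (simp add: block_def)
    then show "\<bar>y i - lab m\<bar> \<le> 2" using y[of i] lab[OF m] by linarith
  qed
  also have "\<dots> \<le> 2 * (rh * ?N)" using corrupted[OF m] by simp
  finally have "\<bar>avg y m - lab m\<bar> \<le> 2 * (rh * ?N) / ?N"
    using N by (simp only: divide_right_mono)
  then show ?thesis using N by (cases "block m = {}") auto
qed

lemma residual_split:
  assumes i: "i < n"
  shows "out W (X i) - lab (cl i) = (avg (res W) (cl i) + (gap W i - avg (gap W) (cl i))) + (avg y (cl i) - lab (cl i))"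
proof -
  have "res W j = gap W j + (out W (c (cl i)) - y j)" if "j \<in> block (cl i)" for j
    using that by (simp add: res_def gap_def block_def)
  then have "avg (res W) (cl i) = avg (gap W) (cl i) + (out W (c (cl i)) - avg y (cl i))"
    using card_block_pos[OF i] by (auto simp: avg_def sum.distrib sum_subtractf add_divide_distrib diff_divide_distrib card_gt_0_iff)
  then show ?thesis by (simp add: gap_def)
qed

lemma error_bound:
  "L2_set (\<lambda>i. out (gd \<tau>) (X i) - lab (cl i)) {..<n} / sqrt (real n) \<le> 4 * rh + Cerr * rc.E"
proof -
  have "L2_set (\<lambda>i. out (gd \<tau>) (X i) - lab (cl i)) {..<n}
     = L2_set (\<lambda>i. (avg (res (gd \<tau>)) (cl i) + (gap (gd \<tau>) i - avg (gap (gd \<tau>)) (cl i))) + (avg y (cl i) - lab (cl i))) {..<n}"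
    by (intro L2_set_cong refl residual_split) simp
  also have "\<dots> \<le> (rh + Cerr * rc.E * \<nu>) + 2 * rh * \<nu>"
  proof (rule order_trans[OF L2_set_triangle_ineq add_mono[OF final_fluctuation]])
    have "L2_set (\<lambda>i. avg y (cl i) - lab (cl i)) {..<n} \<le> L2_set (\<lambda>_. 2 * rh) {..<n}"
      using avg_label cl rh by (intro L2_set_abs_mono) auto
    then show "L2_set (\<lambda>i. avg y (cl i) - lab (cl i)) {..<n} \<le> 2 * rh * \<nu>"
      unfolding L2_set_const using rh by (simp add: roots mult_ac)
  qed
  also have "\<dots> \<le> (4 * rh + Cerr * rc.E) * \<nu>"
  proof -
    have "rh * 1 \<le> rh * \<nu>" using rh rc.\<nu> by (intro mult_left_mono) auto
    moreover have "0 \<le> rh * \<nu>" using rh rc.pos by simp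
    ultimately show ?thesis by (simp add: algebra_simps)
  qed
  finally show ?thesis using rc.pos by (simp add: roots divide_le_eq)
qed

text \<open>Label averages are off by at most \<open>2 * rh \<le> \<delta> / 4\<close>, so each
  error needs a deviation of at least \<open>\<delta> / 4\<close> from the average. A Chebyshev
  count bounds the fraction by the square of \<open>8 * F / \<delta>\<close>; as the fraction is at
  most 1, the bound also holds without the square.\<close>

lemma misclassified_bound:
  assumes \<delta>: "0 < \<delta>" "rh \<le> \<delta> / 8"
  shows "real (card {i. i < n \<and> \<delta> / 2 \<le> \<bar>out (gd \<tau>) (X i) - lab (cl i)\<bar>}) / real n \<le> 8 * Cerr * rc.E / \<delta>"
proof -
  define w where "w i = avg (res (gd \<tau>)) (cl i) + (gap (gd \<tau>) i - avg (gap (gd \<tau>)) (cl i))" for i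
  define M where "M = {i. i < n \<and> \<delta> / 2 \<le> \<bar>out (gd \<tau>) (X i) - lab (cl i)\<bar>}"
  define F where "F = Cerr * rc.E"
  have F0: "0 \<le> F" using Cerr_pos rc.E_nonneg by (simp add: F_def)
  have M: "finite M" "M \<subseteq> {..<n}" by (auto simp: M_def)
  have n0: "0 < real n" using rc.pos by (simp add: roots)
  have wM: "\<delta> / 4 \<le> \<bar>w i\<bar>" if "i \<in> M" for i
  proof -
    have i: "i < n" "\<delta> / 2 \<le> \<bar>out (gd \<tau>) (X i) - lab (cl i)\<bar>" using that by (auto simp: M_def)
    then show ?thesis
      using residual_split[of i "gd \<tau>"] avg_label[OF cl[OF i(1)]] \<delta>(2) unfolding w_def[symmetric] by linarith
  qed
  have "real (card M) / real n \<le> 8 * F / \<delta>"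
  proof (cases "M = {}")
    case False
    then have c1: "1 \<le> sqrt (real (card M))" using M by (simp add: Suc_leI card_gt_0_iff)
    have "sqrt (real (card M)) * (\<delta> / 4) = L2_set (\<lambda>_. \<delta> / 4) M"
      using \<delta> by (simp add: L2_set_def real_sqrt_mult)
    also have "\<dots> \<le> L2_set w M" by (rule L2_set_abs_mono) (use wM \<delta> in auto)
    also have "\<dots> \<le> L2_set w {..<n}"
      unfolding L2_set_def by (intro real_sqrt_le_mono sum_mono2) (use M in auto)
    also have "\<dots> \<le> \<delta> / 8 + F * \<nu>" using final_fluctuation \<delta>(2) by (simp add: w_def[abs_def] F_def)
    \<comment> \<open>For nonempty \<open>M\<close> the contribution of \<open>rh\<close> is
      absorbed by half of the left side, so the corruption level leaves no trace in the final
      count.\<close>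
    also have "\<dots> \<le> sqrt (real (card M)) * (\<delta> / 8) + F * \<nu>"
      using mult_right_mono[OF c1, of "\<delta> / 8"] \<delta> by simp
    finally have "sqrt (real (card M)) \<le> 8 * F / \<delta> * \<nu>" using \<delta> by (simp add: field_simps)
    then have "(sqrt (real (card M)))\<^sup>2 \<le> (8 * F / \<delta> * \<nu>)\<^sup>2" by (intro power_mono) auto
    moreover have "(8 * F / \<delta> * \<nu>)\<^sup>2 = (8 * F / \<delta>)\<^sup>2 * real n"
      unfolding power_mult_distrib[of _ \<nu>] by (simp add: roots)
    ultimately have sq: "real (card M) / real n \<le> (8 * F / \<delta>)\<^sup>2"
      using n0 by (simp add: divide_le_eq)
    have le1: "real (card M) / real n \<le> 1"
      using card_mono[OF _ M(2)] n0 by simp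
    show ?thesis
    proof (cases "8 * F / \<delta> \<le> 1")
      case True
      then have "(8 * F / \<delta>)\<^sup>2 \<le> 8 * F / \<delta>"
        unfolding power2_eq_square using F0 \<delta> by (intro mult_le_self) auto
      then show ?thesis using sq by linarith
    qed (use le1 in linarith)
  qed (use F0 \<delta> in simp)
  then show ?thesis by (simp add: M_def F_def mult.assoc)
qed

lemma path_length:
  assumes "t \<le> \<tau>"
  shows "L2_set (\<lambda>p. gd t p - W0 p) P
    \<le> (1368 / g + 20976000 * u / g + 1104000) * (\<Gamma> * (\<kappa> * l / L) + real t * \<eta> * \<epsilon> * (\<Gamma>^4 * \<kappa>\<^sup>2 * \<nu>\<^sup>2 / L\<^sup>2) * \<Lambda>\<^sup>2)"
  using trajectory(2)[OF assms] rc.path_bound[of "real t * \<eta>"] \<eta> by (simp add: mult.assoc)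

text \<open>First the value at the center, then the passage from the center to \<open>z\<close>: its
  fluctuation at initialisation comes from chaining, its change during training from the mean value
  theorem. The shares of \<delta> are 3/8 + 1/32 and 1/32, in total below 1/2.\<close>

lemma robust_bound:
  assumes \<delta>: "0 < \<delta>" "rh \<le> \<delta> / 8" and m: "m < K" and d: "0 < d"
    and c': "0 < c'" "c' * (120 * Cerr / g) \<le> 1 / 32" "c' * (222 + 66000 * CR) \<le> 1 / 32"
    and \<epsilon>1: "\<epsilon> \<le> c' * \<delta> * (L^4 / (\<Gamma>^5 * \<kappa>^4 * \<Lambda>^3))" and \<epsilon>2: "\<epsilon> \<le> c' * \<delta> * (1 / (\<Gamma> * sqrt (real d)))"
    and init_ball: "\<bar>out W0 z - out W0 (c m)\<bar> \<le> 180 * \<Gamma> * \<epsilon> * sqrt (real d)"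
    and init_op: "L2_set (preact d W0 (\<lambda>j. z j - c m j)) {..<k} \<le> 42 * (sqrt (real k) + sqrt (real d)) * \<epsilon>"
    and z: "L2_set (\<lambda>j. z j - c m j) {..<d} \<le> \<epsilon>"
  shows "\<bar>out (gd \<tau>) z - lab m\<bar> < \<delta> / 2"
proof -
  let ?N = "real (card (block m))"
  have N: "0 < ?N" using card_block_positive[OF m] by simp
  define A where "A = L2_set (agg (res (gd \<tau>))) {..<K} + L2_set (gap (gd \<tau>)) {..<n}"
  have agg_le: "\<bar>avg f m\<bar> \<le> L2_set (agg f) {..<K} / sqrt ?N" for f
  proof -
    have "avg f m = agg f m / sqrt ?N" using N by (simp add: avg_def agg_def)
    then show ?thesis
      using member_le_L2_set[of "{..<K}" m "\<lambda>i. \<bar>agg f i\<bar>"] m N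
      by (simp add: abs_divide L2_set_def divide_right_mono)
  qed
  \<comment> \<open>Reading off one cluster from a norm over all clusters costs the factor
    \<open>\<kappa> / g\<close> relative to the average error; the stronger smallness of \<epsilon>
    pays for it.\<close>
  have eN: "sqrt ?N \<ge> g * \<nu> / \<kappa>"
  proof -
    have "(g * \<nu> / \<kappa>)\<^sup>2 = g\<^sup>2 * (real n / real K)" by (simp add: power_mult_distrib power_divide roots)
    also have "\<dots> \<le> 2 * g\<^sup>2 * (real n / real K)" by (intro mult_right_mono) auto
    also have "\<dots> \<le> ?N" by (rule block_lower[OF m])
    finally have "sqrt ((g * \<nu> / \<kappa>)\<^sup>2) \<le> sqrt ?N" by (rule real_sqrt_le_mono)
    then show ?thesis using rc.pos rc.g by simp
  qed
  have "A \<le> rh + Cerr * rc.E * \<nu>"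
    using final_agg final_gap by (simp add: A_def Cerr_def algebra_simps)
  then have "A / sqrt ?N \<le> (rh + Cerr * rc.E * \<nu>) / sqrt ?N" using N by (intro divide_right_mono) auto
  also have "\<dots> = rh / sqrt ?N + Cerr * rc.E * \<nu> / sqrt ?N" by (rule add_divide_distrib)
  also have "\<dots> \<le> rh + Cerr * rc.E * \<nu> / (g * \<nu> / \<kappa>)"
  proof (rule add_mono)
    have "1 \<le> sqrt ?N" using card_block_positive[OF m] by simp
    then show "rh / sqrt ?N \<le> rh" using rh by (simp add: divide_le_eq)
    show "Cerr * rc.E * \<nu> / sqrt ?N \<le> Cerr * rc.E * \<nu> / (g * \<nu> / \<kappa>)"
      using eN N rc.pos rc.g Cerr_pos rc.E_nonneg by (intro divide_left_mono) auto
  qed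
  also have "Cerr * rc.E * \<nu> / (g * \<nu> / \<kappa>) = Cerr / g * (\<epsilon> * (\<Gamma>^3 * \<kappa>^3 * l / L\<^sup>2 * \<Lambda>))"
    using rc.pos rc.g by (simp add: rc.E_def field_simps eval_nat_numeral)
  finally have f1: "A / sqrt ?N \<le> rh + Cerr / g * (\<epsilon> * (\<Gamma>^3 * \<kappa>^3 * l / L\<^sup>2 * \<Lambda>))" .
  have "\<epsilon> * (\<Gamma>^3 * \<kappa>^3 * l / L\<^sup>2 * \<Lambda>) \<le> c' * \<delta> * (L^4 / (\<Gamma>^5 * \<kappa>^4 * \<Lambda>^3)) * (\<Gamma>^3 * \<kappa>^3 * l / L\<^sup>2 * \<Lambda>)"
    using rc.pos rc.L by (intro mult_right_mono \<epsilon>1) auto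
  also have "\<dots> = c' * \<delta> * ((L / \<Gamma>) * (L / \<Gamma>) / \<kappa> * (l / \<Lambda>\<^sup>2))"
    using rc.pos rc.L by (simp add: field_simps eval_nat_numeral)
  also have "\<dots> \<le> c' * \<delta> * (1 * 1 / 1 * 120)"
    using rc.pos rc.L rc.l rc.\<kappa> c' \<delta> by (intro mult_left_mono mult_mono frac_le) (auto simp: divide_le_eq)
  finally have "Cerr / g * (\<epsilon> * (\<Gamma>^3 * \<kappa>^3 * l / L\<^sup>2 * \<Lambda>)) \<le> Cerr / g * (c' * \<delta> * (1 * 1 / 1 * 120))"
    using Cerr_pos rc.g by (intro mult_left_mono) auto
  also have "\<dots> = \<delta> * (c' * (120 * Cerr / g))" by simp
  also have "\<dots> \<le> \<delta> * (1 / 32)" using c' \<delta> by (intro mult_left_mono) auto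
  finally have A: "A / sqrt ?N \<le> rh + \<delta> / 32" using f1 by linarith
  obtain i where i: "i \<in> block m" using N by fastforce
  then have i: "i < n" "cl i = m" by (auto simp: block_def)
  have "out (gd \<tau>) (c m) - lab m = avg (res (gd \<tau>)) m - avg (gap (gd \<tau>)) m + (avg y m - lab m)"
    using residual_split[OF i(1), of "gd \<tau>"] by (simp add: gap_def i)
  moreover have "\<bar>avg (res (gd \<tau>)) m\<bar> + \<bar>avg (gap (gd \<tau>)) m\<bar> \<le> A / sqrt ?N"
    unfolding A_def add_divide_distrib
    using agg_le[of "gap (gd \<tau>)"] divide_right_mono[OF agg_L2[of "gap (gd \<tau>)"], of "sqrt ?N"]
    by (intro add_mono agg_le) simp
  ultimately have center: "\<bar>out (gd \<tau>) (c m) - lab m\<bar> \<le> 3 * \<delta> / 8 + \<delta> / 32"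
    using A avg_label[OF m] \<delta>(2) by linarith
  obtain t where t: "0 \<le> t" "t \<le> 1" "(out (gd \<tau>) z - out (gd \<tau>) (c m)) - (out W0 z - out W0 (c m))
       = (\<Sum>p\<in>P. (jac (interp t W0 (gd \<tau>)) z p - jac (interp t W0 (gd \<tau>)) (c m) p) * (gd \<tau> p - W0 p))"
    by (rule out_mvt_diff)
  have ball: "L2_set (\<lambda>p. interp t W0 (gd \<tau>) p - W0 p) P \<le> rc.R"
    using rc.R_pos trajectory_ball[of \<tau>] by (intro interp_dist t) (auto simp: L2_set_def)
  let ?J = "L2_set (\<lambda>p. jac (interp t W0 (gd \<tau>)) z p - jac (interp t W0 (gd \<tau>)) (c m) p) P"
  have q0: "0 < q" by (rule rc.R_q(2))
  have sd: "0 < sqrt (real d)" using d by simp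
  have "?J \<le> \<Gamma> * \<epsilon> + \<Gamma> / sqrt (real k) * (rc.R * \<epsilon> + L2_set (preact d W0 (\<lambda>j. z j - c m j)) {..<k})"
    by (rule jac_diff_ball[OF ball z c[OF m]])
  also have "\<dots> \<le> \<Gamma> * \<epsilon> + \<Gamma> / q * (q * \<epsilon> + 42 * (q + sqrt (real d)) * \<epsilon>)"
    using init_op rc.Rk rc.R_pos q0 rc.pos \<epsilon>
    by (intro add_left_mono mult_mono add_mono mult_right_mono)
      (auto simp: roots[symmetric] L2_set_nonneg intro!: add_nonneg_nonneg)
  also have "\<dots> = 44 * \<Gamma> * \<epsilon> + 42 * \<Gamma> * \<epsilon> * sqrt (real d) / q"
    using q0 by (simp add: field_simps)
  finally have J: "?J \<le> 44 * \<Gamma> * \<epsilon> + 42 * \<Gamma> * \<epsilon> * sqrt (real d) / q" .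
  have "\<bar>(out (gd \<tau>) z - out (gd \<tau>) (c m)) - (out W0 z - out W0 (c m))\<bar> \<le> ?J * L2_set (\<lambda>p. gd \<tau> p - W0 p) P"
    unfolding t(3) by (rule L2_set_Cauchy_Schwarz)
  also have "\<dots> \<le> (44 * \<Gamma> * \<epsilon> + 42 * \<Gamma> * \<epsilon> * sqrt (real d) / q) * rc.R"
    using J trajectory_ball[of \<tau>] rc.pos q0 \<epsilon> by (intro mult_mono) (auto simp: L2_set_nonneg)
  also have "\<dots> = 44 * (\<Gamma> * \<epsilon> * rc.R) + 42 * (\<Gamma> * \<epsilon> * sqrt (real d)) * (rc.R / q)"
    by (simp add: algebra_simps)
  \<comment> \<open>The two parts of the minimum in the assumption on \<epsilon> act separately: the
    first bounds \<open>\<Gamma> * \<epsilon> * rc.R\<close>, the second bounds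
    \<open>\<Gamma> * \<epsilon> * sqrt d\<close>.\<close>
  also have "\<dots> \<le> 44 * (1500 * CR * (c' * \<delta>)) + 42 * (c' * \<delta>) * 1"
  proof -
    have 1: "rc.R / q \<le> 1" using rc.Rk q0 by simp
    have 2: "\<Gamma> * \<epsilon> * sqrt (real d) \<le> c' * \<delta>"
      using \<epsilon>2 rc.pos sd by (simp add: field_simps)
    have "\<Gamma> * \<epsilon> * rc.R = \<epsilon> * (CR * \<Gamma>\<^sup>2 * \<kappa> * l / L)" by (simp add: rc.R_def power2_eq_square)
    also have "\<dots> \<le> c' * \<delta> * (L^4 / (\<Gamma>^5 * \<kappa>^4 * \<Lambda>^3)) * (CR * \<Gamma>\<^sup>2 * \<kappa> * l / L)"
      using rc.pos rc.L by (intro mult_right_mono \<epsilon>1) auto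
    also have "\<dots> = CR * (c' * \<delta>) * (((L / \<Gamma>) * (L / \<Gamma>) * (L / \<Gamma>)) * (l / \<Lambda>^3) / \<kappa>^3)"
      using rc.pos rc.L by (simp add: field_simps eval_nat_numeral)
    also have "\<dots> \<le> CR * (c' * \<delta>) * ((1 * 1 * 1) * 1500 / 1)"
      using rc.pos rc.L rc.l rc.\<kappa> c' \<delta>
      by (intro mult_left_mono mult_mono frac_le) (auto simp: divide_le_eq one_le_power)
    finally have 3: "\<Gamma> * \<epsilon> * rc.R \<le> 1500 * CR * (c' * \<delta>)" by simp
    have "\<Gamma> * \<epsilon> * sqrt (real d) * (rc.R / q) \<le> c' * \<delta> * 1"
      using c' \<delta> rc.R_pos q0 by (intro mult_mono 1 2) auto
    with 3 show ?thesis by linarith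
  qed
  finally have move: "\<bar>(out (gd \<tau>) z - out (gd \<tau>) (c m)) - (out W0 z - out W0 (c m))\<bar> \<le> 66000 * CR * (c' * \<delta>) + 42 * (c' * \<delta>)"
    by simp
  have "\<Gamma> * \<epsilon> * sqrt (real d) \<le> c' * \<delta>" using \<epsilon>2 rc.pos sd by (simp add: field_simps)
  then have "\<bar>out W0 z - out W0 (c m)\<bar> \<le> 180 * (c' * \<delta>)" using init_ball by linarith
  with move have "\<bar>out (gd \<tau>) z - out (gd \<tau>) (c m)\<bar> \<le> 66000 * CR * (c' * \<delta>) + 222 * (c' * \<delta>)" by linarith
  also have "\<dots> = \<delta> * (c' * (222 + 66000 * CR))" by (simp add: algebra_simps)
  also have "\<dots> \<le> \<delta> * (1 / 32)" using c' \<delta> by (intro mult_left_mono) auto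
  finally have "\<bar>out (gd \<tau>) z - out (gd \<tau>) (c m)\<bar> \<le> \<delta> / 32" by simp
  with center \<delta>(1) show ?thesis by linarith
qed

end

section \<open>The initial kernel\<close>

lemma exp_ln_nat_power: "0 < K \<Longrightarrow> exp (- (real m * ln (real K))) = 1 / real K ^ m"
  by (simp add: exp_minus exp_of_nat_mult inverse_eq_divide)

context shallow_net
begin

text \<open>The factor \<open>2 * (k div 2) / k\<close> is at least 3/4 for
  \<open>k \<ge> 4\<close>. Entrywise errors \<open>lam / (4 * K)\<close> cost
  \<open>lam / 4\<close> because the squared l1 norm is at most \<open>K\<close> times the squared
  Euclidean norm; 3/4 - 1/4 = 1/2.\<close>

lemma kernel_lower_bound:
  assumes k4: "4 \<le> k" and lam: "0 < lam"
    and c: "\<And>i. i < K \<Longrightarrow> L2_set (c i) {..<d} = 1"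
    and pos: "\<And>x. lam * (L2_set x {..<K})\<^sup>2 \<le> (\<Sum>i<K. \<Sum>j<K. x i * x j * ((\<Sum>m<d. c i m * c j m) * E i j))"
    and close: "\<And>i j. i < K \<Longrightarrow> j < K \<Longrightarrow> \<bar>S i j - 2 * real (k div 2) / real k * E i j\<bar> \<le> lam / (4 * real K)"
  shows "lam / 2 * (L2_set x {..<K})\<^sup>2 \<le> (\<Sum>i<K. \<Sum>j<K. x i * x j * ((\<Sum>m<d. c i m * c j m) * S i j))"
proof (cases "K = 0")
  case False
  define \<theta> where "\<theta> = 2 * real (k div 2) / real k"
  define N where "N = (L2_set x {..<K})\<^sup>2"
  define e where "e i j = S i j - \<theta> * E i j" for i j
  have "3 * real k \<le> 4 * (2 * real (k div 2))" using k4 by linarith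
  then have \<theta>: "3 / 4 \<le> \<theta>" using k4 by (simp add: \<theta>_def le_divide_eq)
  have N0: "0 \<le> N" by (simp add: N_def)
  have "\<bar>\<Sum>i<K. \<Sum>j<K. x i * x j * ((\<Sum>m<d. c i m * c j m) * e i j)\<bar>
      \<le> (\<Sum>i<K. \<Sum>j<K. \<bar>x i\<bar> * \<bar>x j\<bar> * (1 * (lam / (4 * real K))))"
  proof (intro order_trans[OF sum_abs] sum_mono)
    fix i j assume ij: "i \<in> {..<K}" "j \<in> {..<K}"
    have "\<bar>\<Sum>m<d. c i m * c j m\<bar> \<le> 1" using L2_set_Cauchy_Schwarz[of "c i" "c j" "{..<d}"] c ij by simp
    then have "\<bar>\<Sum>m<d. c i m * c j m\<bar> * \<bar>e i j\<bar> \<le> 1 * (lam / (4 * real K))"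
      using close[of i j] ij by (intro mult_mono) (auto simp: e_def \<theta>_def)
    then show "\<bar>x i * x j * ((\<Sum>m<d. c i m * c j m) * e i j)\<bar> \<le> \<bar>x i\<bar> * \<bar>x j\<bar> * (1 * (lam / (4 * real K)))"
      unfolding abs_mult by (intro mult_left_mono) auto
  qed
  also have "\<dots> = (\<Sum>i<K. \<bar>x i\<bar>)\<^sup>2 * (1 * (lam / (4 * real K)))"
  proof -
    have "(\<Sum>i<K. \<bar>x i\<bar>)\<^sup>2 = (\<Sum>i<K. \<Sum>j<K. \<bar>x i\<bar> * \<bar>x j\<bar>)"
      by (simp only: power2_eq_square sum_product)
    then show ?thesis by (simp only: sum_distrib_right)
  qed
  also have "\<dots> = (\<Sum>i<K. \<bar>x i\<bar>)\<^sup>2 * (lam / (4 * real K))" by simp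
  also have "\<dots> \<le> (real K * N) * (lam / (4 * real K))"
  proof (intro mult_right_mono)
    have "(\<Sum>i<K. \<bar>x i\<bar>) \<le> L2_set (\<lambda>_. 1) {..<K} * L2_set x {..<K}"
      using L2_set_mult_ineq[of "\<lambda>_. 1" x "{..<K}"] by simp
    also have "L2_set (\<lambda>_. 1) {..<K} = sqrt (real K)" by (simp add: L2_set_def)
    finally have "(\<Sum>i<K. \<bar>x i\<bar>)\<^sup>2 \<le> (sqrt (real K) * L2_set x {..<K})\<^sup>2"
      by (intro power_mono sum_nonneg) auto
    then show "(\<Sum>i<K. \<bar>x i\<bar>)\<^sup>2 \<le> real K * N" by (simp add: power_mult_distrib N_def)
  qed (use lam in simp)
  also have "\<dots> = lam / 4 * N" using False by simp
  finally have err: "\<bar>\<Sum>i<K. \<Sum>j<K. x i * x j * ((\<Sum>m<d. c i m * c j m) * e i j)\<bar> \<le> lam / 4 * N" .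
  have "3 / 4 * (lam * N) \<le> \<theta> * (lam * N)" using \<theta> lam N0 by (intro mult_right_mono) auto
  also have "\<dots> \<le> \<theta> * (\<Sum>i<K. \<Sum>j<K. x i * x j * ((\<Sum>m<d. c i m * c j m) * E i j))"
    using pos[of x] \<theta> by (intro mult_left_mono) (auto simp: N_def)
  finally have main: "3 / 4 * (lam * N) \<le> \<theta> * (\<Sum>i<K. \<Sum>j<K. x i * x j * ((\<Sum>m<d. c i m * c j m) * E i j))" .
  have "(\<Sum>i<K. \<Sum>j<K. x i * x j * ((\<Sum>m<d. c i m * c j m) * S i j))
      = \<theta> * (\<Sum>i<K. \<Sum>j<K. x i * x j * ((\<Sum>m<d. c i m * c j m) * E i j))
        + (\<Sum>i<K. \<Sum>j<K. x i * x j * ((\<Sum>m<d. c i m * c j m) * e i j))"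
    unfolding sum_distrib_left[of \<theta>] sum.distrib[symmetric]
    by (intro sum.cong refl) (simp add: e_def algebra_simps)
  then show ?thesis using err main by (simp add: N_def[symmetric])
qed (simp add: L2_set_def)

text \<open>Four events fail with probability \<open>1 / K ^ 103\<close> each; the operator norm and
  the \<open>K\<close> chaining events fail with probability \<open>exp (- 100 * d) / 4\<close>
  each.\<close>

lemma good_initialization:
  fixes c X :: "nat \<Rightarrow> nat \<Rightarrow> real" and cl :: "nat \<Rightarrow> nat"
  defines "E \<equiv> \<lambda>i j. \<integral>w. \<phi>' (lin d (c i) w) * \<phi>' (lin d (c j) w) \<partial>std_gaussian {..<d}"
  assumes b: "balanced k v" and d: "0 < d" and K: "2 \<le> K" and n: "0 < n" and \<epsilon>: "0 \<le> \<epsilon>"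
    and X: "\<And>i. i < n \<Longrightarrow> L2_set (X i) {..<d} = 1"
    and c: "\<And>l. l < K \<Longrightarrow> L2_set (c l) {..<d} = 1"
    and near: "\<And>i. i < n \<Longrightarrow> L2_set (\<lambda>j. X i j - c (cl i) j) {..<d} \<le> \<epsilon>"
    and lam: "0 < lam" "\<And>x. lam * (L2_set x {..<K})\<^sup>2 \<le> (\<Sum>i<K. \<Sum>j<K. x i * x j * ((\<Sum>m<d. c i m * c j m) * E i j))"
    and k4: "4 \<le> k" and kK: "ln (real K) \<le> real k"
    and kbig: "3400 * ((real K)\<^sup>2 * \<Gamma>^4 * ln (real K)) \<le> lam\<^sup>2 * real k"
  obtains G where "G \<in> sets MW" "1 - 3 / real K ^ 100 - real K * exp (- 100 * real d) \<le> measure MW G"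
    "\<And>\<omega>. \<omega> \<in> G \<Longrightarrow> L2_set (\<lambda>i. out \<omega> (X i)) {..<n} \<le> 150 * \<Gamma> * sqrt (real n) * sqrt (ln (real K))"
    "\<And>\<omega>. \<omega> \<in> G \<Longrightarrow> L2_set (\<lambda>i. out \<omega> (X i) - out \<omega> (c (cl i))) {..<n} \<le> 150 * (\<Gamma> * \<epsilon>) * sqrt (real n) * sqrt (ln (real K))"
    "\<And>\<omega>. \<omega> \<in> G \<Longrightarrow> L2_set (\<lambda>i. L2_set (preact d \<omega> (\<lambda>j. X i j - c (cl i) j)) {..<k}) {..<n} \<le> 21 * sqrt (real n) * sqrt (real k) * \<epsilon>"
    "\<And>\<omega> x. \<omega> \<in> G \<Longrightarrow> lam / 2 * (L2_set x {..<K})\<^sup>2 \<le> (\<Sum>i<K. \<Sum>j<K. x i * x j * ((\<Sum>m<d. c i m * c j m) *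
       (\<Sum>r<k. (v r)\<^sup>2 * (\<phi>' (preact d \<omega> (c i) r) * \<phi>' (preact d \<omega> (c j) r)))))"
    "\<And>\<omega> l z. \<omega> \<in> G \<Longrightarrow> l < K \<Longrightarrow> L2_set (\<lambda>j. z j - c l j) {..<d} \<le> \<epsilon> \<Longrightarrow>
       \<bar>out \<omega> z - out \<omega> (c l)\<bar> \<le> 180 * \<Gamma> * \<epsilon> * sqrt (real d)"
    "\<And>\<omega> u. \<omega> \<in> G \<Longrightarrow> L2_set (preact d \<omega> u) {..<k} \<le> 42 * (sqrt (real k) + sqrt (real d)) * L2_set u {..<d}"
proof -
  interpret prob_space MW by (rule prob_space_std_gaussian)
  define S where "S \<omega> i j = (\<Sum>r<k. (v r)\<^sup>2 * (\<phi>' (preact d \<omega> (c i) r) * \<phi>' (preact d \<omega> (c j) r)))" for \<omega> i j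
  define t where "t = lam / (4 * real K)"
  have t: "0 \<le> t" using lam by (simp add: t_def)
  have Sm [measurable]: "(\<lambda>\<omega>. S \<omega> i j) \<in> borel_measurable MW" for i j
    unfolding S_def by (intro borel_measurable_sum borel_measurable_times) auto
  define B1 where "B1 = {\<omega> \<in> space MW. 150 * \<Gamma> * sqrt (real n) * sqrt (ln (real K)) < L2_set (\<lambda>i. out \<omega> (X i)) {..<n}}"
  define B2 where "B2 = {\<omega> \<in> space MW. 150 * (\<Gamma> * \<epsilon>) * sqrt (real n) * sqrt (ln (real K)) < L2_set (\<lambda>i. out \<omega> (X i) - out \<omega> (c (cl i))) {..<n}}"
  define B3 where "B3 = {\<omega> \<in> space MW. 21 * sqrt (real n) * sqrt (real k) * \<epsilon> < L2_set (\<lambda>i. L2_set (preact d \<omega> (\<lambda>j. X i j - c (cl i) j)) {..<k}) {..<n}}"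
  define A4 where "A4 ij = {\<omega> \<in> space MW. t \<le> \<bar>S \<omega> (fst ij) (snd ij) - 2 * real (k div 2) / real k * E (fst ij) (snd ij)\<bar>}" for ij
  define B4 where "B4 = (\<Union>ij\<in>{..<K} \<times> {..<K}. A4 ij)"
  have L2m: "(\<lambda>\<omega>. L2_set (\<lambda>i. Z i \<omega>) {..<n}) \<in> borel_measurable MW" if "\<And>i. (\<lambda>\<omega>. Z i \<omega>) \<in> borel_measurable MW" for Z
  proof -
    have [measurable]: "(\<lambda>\<omega>. \<Sum>i<n. (Z i \<omega>)\<^sup>2) \<in> borel_measurable MW"
      by (intro borel_measurable_sum borel_measurable_power that)
    show ?thesis unfolding L2_set_def by measurable
  qed
  have B1m: "B1 \<in> sets MW" unfolding B1_def by (rule borel_measurable_less[OF borel_measurable_const L2m]) measurable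
  have B2m: "B2 \<in> sets MW" unfolding B2_def by (rule borel_measurable_less[OF borel_measurable_const L2m]) measurable
  have B3m: "B3 \<in> sets MW" unfolding B3_def by (rule borel_measurable_less[OF borel_measurable_const L2m]) measurable
  have A4m: "A4 ij \<in> sets MW" for ij unfolding A4_def by measurable
  have B4m: "B4 \<in> sets MW" unfolding B4_def by (intro sets.finite_UN A4m) auto
  have P1: "prob B1 \<le> 1 / real K ^ 103" unfolding B1_def by (rule prob_initial_output[OF b X n K])
  have P2: "prob B2 \<le> 1 / real K ^ 103" unfolding B2_def by (rule prob_initial_gap[OF b near n K])
  have P3: "prob B3 \<le> 1 / real K ^ 103" unfolding B3_def by (rule prob_initial_preact[OF near n K kK])
  have PA4: "prob (A4 ij) \<le> 2 * (1 / real K ^ 106)" for ij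
  proof -
    have "prob (A4 ij) \<le> 2 * exp (- (t\<^sup>2 * real k / (2 * \<Gamma>^4)))"
      unfolding A4_def S_def E_def by (rule kernel_concentration[OF b phi'_measurable bound _ t]) (use \<Gamma> in simp)
    \<comment> \<open>With \<open>t = lam / (4 * K)\<close> the exponent is
      \<open>lam\<^sup>2 * k / (32 * K\<^sup>2 * \<Gamma>^4)\<close>; 32 * 106 = 3392 is rounded to
      3400. Exponent 106 leaves 103 after the union over \<open>K\<^sup>2\<close> entries and the
      factor 2.\<close>
    also have "\<dots> \<le> 2 * exp (- (real 106 * ln (real K)))"
    proof -
      have K2: "0 < (real K)\<^sup>2 * \<Gamma>^4" using K \<Gamma> by simp
      have L0: "0 \<le> ln (real K)" using K by simp
      have "106 * ln (real K) * (32 * ((real K)\<^sup>2 * \<Gamma>^4)) \<le> lam\<^sup>2 * real k"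
        using kbig mult_nonneg_nonneg[OF less_imp_le[OF K2] L0] by (simp add: mult_ac)
      then have "106 * ln (real K) \<le> lam\<^sup>2 * real k / (32 * ((real K)\<^sup>2 * \<Gamma>^4))"
        using K2 by (subst pos_le_divide_eq) auto
      also have "\<dots> = t\<^sup>2 * real k / (2 * \<Gamma>^4)" using K \<Gamma> by (simp add: t_def power_divide power_mult_distrib)
      finally show ?thesis by simp
    qed
    also have "exp (- (real 106 * ln (real K))) = 1 / real K ^ 106" using K by (intro exp_ln_nat_power) simp
    finally show ?thesis .
  qed
  have P4: "prob B4 \<le> 1 / real K ^ 103"
  proof -
    have "prob B4 \<le> real (card ({..<K} \<times> {..<K})) * (2 * (1 / real K ^ 106))"
      unfolding B4_def by (rule prob_UN_le) (auto intro: A4m PA4[simplified])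
    also have "\<dots> = 2 * (1 / real K ^ 104)" using K by (simp add: card_cartesian_product field_simps eval_nat_numeral)
    also have "\<dots> \<le> real K * (1 / real K ^ 104)" using K by (intro mult_right_mono) auto
    also have "\<dots> = 1 / real K ^ 103" using K by (simp add: field_simps eval_nat_numeral)
    finally show ?thesis .
  qed
  obtain G5 where G5: "G5 \<in> sets MW" "prob (space MW - G5) \<le> exp (- 100 * real d) / 4"
    "\<And>\<omega> u. \<omega> \<in> G5 \<Longrightarrow> L2_set (preact d \<omega> u) {..<k} \<le> 42 * (sqrt (real k) + sqrt (real d)) * L2_set u {..<d}"
    by (rule prob_operator[OF d]) blast
  have ex6: "\<exists>G. G \<in> sets MW \<and> prob (space MW - G) \<le> exp (- 100 * real d) / 4 \<and>
    (\<forall>\<omega> z. \<omega> \<in> G \<longrightarrow> L2_set (\<lambda>j. z j - c l j) {..<d} \<le> \<epsilon> \<longrightarrow> \<bar>out \<omega> z - out \<omega> (c l)\<bar> \<le> 180 * \<Gamma> * \<epsilon> * sqrt (real d))" for l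
    by (rule prob_chaining[OF b d \<epsilon>, of "c l"]) blast
  obtain G6 where G6: "G6 l \<in> sets MW \<and> prob (space MW - G6 l) \<le> exp (- 100 * real d) / 4 \<and>
    (\<forall>\<omega> z. \<omega> \<in> G6 l \<longrightarrow> L2_set (\<lambda>j. z j - c l j) {..<d} \<le> \<epsilon> \<longrightarrow> \<bar>out \<omega> z - out \<omega> (c l)\<bar> \<le> 180 * \<Gamma> * \<epsilon> * sqrt (real d))" for l
    by (rule exE[OF choice[OF allI[OF ex6]]]) (rule that, erule spec)
  define B5 where "B5 = space MW - G5"
  define B6 where "B6 = (\<Union>l<K. space MW - G6 l)"
  have B5m: "B5 \<in> sets MW" unfolding B5_def using G5(1) by auto
  have B6m: "B6 \<in> sets MW" unfolding B6_def using G6 by (intro sets.finite_UN) auto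
  have P6: "prob B6 \<le> real K * (exp (- 100 * real d) / 4)"
    using prob_UN_le[of "{..<K}" "\<lambda>l. space MW - G6 l" "exp (- 100 * real d) / 4"] G6 by (auto simp: B6_def)
  define B where "B = B1 \<union> B2 \<union> B3 \<union> B4 \<union> B5 \<union> B6"
  note Bm = B1m B2m B3m B4m B5m B6m
  have Bmm: "B \<in> sets MW" unfolding B_def using Bm by (intro sets.Un)
  have "prob B \<le> prob (B1 \<union> B2 \<union> B3 \<union> B4 \<union> B5) + prob B6"
    unfolding B_def using Bm by (intro measure_Un_le sets.Un)
  also have "prob (B1 \<union> B2 \<union> B3 \<union> B4 \<union> B5) \<le> prob (B1 \<union> B2 \<union> B3 \<union> B4) + prob B5"
    using Bm by (intro measure_Un_le sets.Un)
  also have "prob (B1 \<union> B2 \<union> B3 \<union> B4) \<le> prob (B1 \<union> B2 \<union> B3) + prob B4"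
    using Bm by (intro measure_Un_le sets.Un)
  also have "prob (B1 \<union> B2 \<union> B3) \<le> prob (B1 \<union> B2) + prob B3"
    using Bm by (intro measure_Un_le sets.Un)
  also have "prob (B1 \<union> B2) \<le> prob B1 + prob B2" using Bm by (intro measure_Un_le)
  finally have "prob B \<le> 4 * (1 / real K ^ 103) + (1 + real K) * (exp (- 100 * real d) / 4)"
    using P1 P2 P3 P4 G5(2) P6 unfolding B5_def distrib_right by linarith
  also have "\<dots> \<le> 3 / real K ^ 100 + real K * exp (- 100 * real d)"
  proof (rule add_mono)
    have "4 * (1 / real K ^ 103) \<le> real K ^ 3 * (1 / real K ^ 103)"
      using K power_mono[of 2 "real K" 3] by (intro mult_right_mono) auto
    also have "\<dots> = 1 / real K ^ 100" using K power_add[of "real K" 3 100] by (simp add: field_simps)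
    also have "\<dots> \<le> 3 / real K ^ 100" by (intro divide_right_mono) auto
    finally show "4 * (1 / real K ^ 103) \<le> 3 / real K ^ 100" .
    have "(1 + real K) / 4 * exp (- 100 * real d) \<le> real K * exp (- 100 * real d)"
      using K by (intro mult_right_mono) auto
    then show "(1 + real K) * (exp (- 100 * real d) / 4) \<le> real K * exp (- 100 * real d)" by simp
  qed
  finally have PB: "prob B \<le> 3 / real K ^ 100 + real K * exp (- 100 * real d)" .
  show thesis
  proof (rule that[of "space MW - B"])
    show "space MW - B \<in> sets MW" using Bmm by auto
    show "1 - 3 / real K ^ 100 - real K * exp (- 100 * real d) \<le> prob (space MW - B)"
      using PB prob_compl[OF Bmm] by linarith
    fix \<omega> assume "\<omega> \<in> space MW - B"
    then have \<omega>: "\<omega> \<in> space MW" "\<omega> \<notin> B1" "\<omega> \<notin> B2" "\<omega> \<notin> B3" "\<omega> \<notin> B4" "\<omega> \<notin> B5" "\<omega> \<notin> B6" by (auto simp: B_def)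
    show "L2_set (\<lambda>i. out \<omega> (X i)) {..<n} \<le> 150 * \<Gamma> * sqrt (real n) * sqrt (ln (real K))"
      using \<omega> by (simp add: B1_def not_less)
    show "L2_set (\<lambda>i. out \<omega> (X i) - out \<omega> (c (cl i))) {..<n} \<le> 150 * (\<Gamma> * \<epsilon>) * sqrt (real n) * sqrt (ln (real K))"
      using \<omega> by (simp add: B2_def not_less)
    show "L2_set (\<lambda>i. L2_set (preact d \<omega> (\<lambda>j. X i j - c (cl i) j)) {..<k}) {..<n} \<le> 21 * sqrt (real n) * sqrt (real k) * \<epsilon>"
      using \<omega> by (simp add: B3_def not_less)
    show "L2_set (preact d \<omega> u) {..<k} \<le> 42 * (sqrt (real k) + sqrt (real d)) * L2_set u {..<d}" for u
      using \<omega> G5(3) by (auto simp: B5_def)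
    show "\<bar>out \<omega> z - out \<omega> (c l)\<bar> \<le> 180 * \<Gamma> * \<epsilon> * sqrt (real d)"
      if "l < K" "L2_set (\<lambda>j. z j - c l j) {..<d} \<le> \<epsilon>" for l z
      using \<omega> G6[of l] that by (auto simp: B6_def)
    have "\<bar>S \<omega> i j - 2 * real (k div 2) / real k * E i j\<bar> \<le> lam / (4 * real K)" if "i < K" "j < K" for i j
    proof -
      have "\<omega> \<notin> A4 (i, j)" using \<omega>(5) that by (auto simp: B4_def)
      then show ?thesis using \<omega>(1) by (simp add: A4_def t_def not_le)
    qed
    from kernel_lower_bound[OF k4 lam(1) c lam(2) this]
    show "lam / 2 * (L2_set x {..<K})\<^sup>2 \<le> (\<Sum>i<K. \<Sum>j<K. x i * x j * ((\<Sum>m<d. c i m * c j m) *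
       (\<Sum>r<k. (v r)\<^sup>2 * (\<phi>' (preact d \<omega> (c i) r) * \<phi>' (preact d \<omega> (c j) r)))))" for x
      unfolding S_def by simp
  qed
qed

end

section \<open>Matrix gradient descent and measurability\<close>

text \<open>A unique nearest label is expressed by positivity of continuous functions of the output,
  the form that suits both measurability and the compactness argument.\<close>

lemma nearest_labels_eq_singleton:
  "nearest_labels A y = {a} \<longleftrightarrow> a \<in> A \<and> (\<forall>b\<in>A. b \<noteq> a \<longrightarrow> 0 < \<bar>y - b\<bar> - \<bar>y - a\<bar>)"
proof
  assume eq: "nearest_labels A y = {a}"
  then have a: "is_arg_min (\<lambda>a. \<bar>y - a\<bar>) (\<lambda>a. a \<in> A) a" by (auto simp: nearest_labels_def)
  have "0 < \<bar>y - b\<bar> - \<bar>y - a\<bar>" if b: "b \<in> A" "b \<noteq> a" for b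
  proof (rule ccontr)
    assume "\<not> ?thesis"
    then have "is_arg_min (\<lambda>a. \<bar>y - a\<bar>) (\<lambda>a. a \<in> A) b"
      using a b unfolding is_arg_min_def by force
    then show False using eq b by (auto simp: nearest_labels_def)
  qed
  then show "a \<in> A \<and> (\<forall>b\<in>A. b \<noteq> a \<longrightarrow> 0 < \<bar>y - b\<bar> - \<bar>y - a\<bar>)" using a by (auto simp: is_arg_min_def)
next
  assume r: "a \<in> A \<and> (\<forall>b\<in>A. b \<noteq> a \<longrightarrow> 0 < \<bar>y - b\<bar> - \<bar>y - a\<bar>)"
  show "nearest_labels A y = {a}"
  proof (rule equalityI; rule subsetI)
    fix b assume "b \<in> nearest_labels A y"
    then have "b \<in> A" "\<not> \<bar>y - a\<bar> < \<bar>y - b\<bar>" using r by (auto simp: nearest_labels_def is_arg_min_def)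
    then show "b \<in> {a}" using r by force
  next
    fix b assume "b \<in> {a}"
    then show "b \<in> nearest_labels A y"
      using r by (force simp: nearest_labels_def is_arg_min_def)
  qed
qed

lemma nearest_labels_separated:
  assumes "a \<in> A" "\<And>b. b \<in> A \<Longrightarrow> b \<noteq> a \<Longrightarrow> \<delta> \<le> \<bar>b - a\<bar>" "\<bar>y - a\<bar> < \<delta> / 2"
  shows "nearest_labels A y = {a}"
  unfolding nearest_labels_eq_singleton
proof (intro conjI ballI impI)
  fix b assume "b \<in> A" "b \<noteq> a"
  then have "\<delta> \<le> \<bar>b - a\<bar>" by (rule assms(2))
  then show "0 < \<bar>y - b\<bar> - \<bar>y - a\<bar>" using assms(3) by linarith
qed (rule assms(1))

context shallow_net
begin

text \<open>The recursion of \<open>gd\<close> with the initial weights as an argument: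
  measurability in the initialisation has to be stated before any particular one is fixed.\<close>

primrec descent :: "nat \<Rightarrow> (nat \<Rightarrow> nat \<Rightarrow> real) \<Rightarrow> (nat \<Rightarrow> real) \<Rightarrow> real \<Rightarrow> (nat \<times> nat \<Rightarrow> real) \<Rightarrow> nat \<Rightarrow> nat \<times> nat \<Rightarrow> real" where
  "descent n X y \<eta> W0 0 = W0"
| "descent n X y \<eta> W0 (Suc t) = (\<lambda>p. descent n X y \<eta> W0 t p
     - \<eta> * (\<Sum>i<n. (out (descent n X y \<eta> W0 t) (X i) - y i) * jac (descent n X y \<eta> W0 t) (X i) p))"

lemma out_cong: "(\<And>p. p \<in> P \<Longrightarrow> W p = W' p) \<Longrightarrow> (\<And>j. j < d \<Longrightarrow> x j = x' j) \<Longrightarrow> out W x = out W' x'"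
  by (simp add: out_def preact_def)

lemma out_measurable_compose:
  assumes "\<And>p. p \<in> P \<Longrightarrow> (\<lambda>\<omega>. H \<omega> p) \<in> borel_measurable M"
  shows "(\<lambda>\<omega>. out (H \<omega>) x) \<in> borel_measurable M"
    "p \<in> P \<Longrightarrow> (\<lambda>\<omega>. jac (H \<omega>) x p) \<in> borel_measurable M"
proof -
  have pre: "(\<lambda>\<omega>. preact d (H \<omega>) x r) \<in> borel_measurable M" if "r < k" for r
    unfolding preact_def by (intro borel_measurable_sum borel_measurable_times assms) (use that in auto)
  show "(\<lambda>\<omega>. out (H \<omega>) x) \<in> borel_measurable M"
    unfolding out_def by (intro borel_measurable_sum borel_measurable_times borel_measurable_const measurable_compose[OF pre]) auto
  show "(\<lambda>\<omega>. jac (H \<omega>) x p) \<in> borel_measurable M" if "p \<in> P"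
    unfolding jac_def using that by (intro borel_measurable_times borel_measurable_const measurable_compose[OF pre]) auto
qed

lemma descent_measurable: "p \<in> P \<Longrightarrow> (\<lambda>\<omega>. descent n X y \<eta> \<omega> t p) \<in> borel_measurable MW"
proof (induction t arbitrary: p)
  case 0
  then show ?case by (simp add: std_gaussian_def)
next
  case (Suc t)
  then show ?case
    by (simp, intro borel_measurable_diff borel_measurable_times borel_measurable_sum borel_measurable_const out_measurable_compose)
qed

lemma out_continuous: "continuous_on S (out W)"
proof -
  have "continuous_on UNIV \<phi>"
    by (intro continuous_at_imp_continuous_on ballI DERIV_isCont[OF deriv])
  then have "continuous_on S (\<lambda>x. \<phi> (preact d W x r))" for r
    by (rule continuous_on_compose2) (auto simp: preact_def intro!: continuous_intros)
  then show ?thesis unfolding out_def by (intro continuous_intros)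
qed

lemma out_deriv_entry:
  assumes p: "p \<in> P"
  shows "((\<lambda>s. out (W(p := s)) x) has_real_derivative jac W x p) (at (W p))"
proof -
  \<comment> \<open>The direction is the unit matrix at \<open>p\<close>; the parameter
    \<open>s - W p\<close> then makes the segment agree with the single-entry update.\<close>
  define W' where "W' = W(p := W p + 1)"
  have i: "interp (s - W p) W W' = W(p := s)" for s
    by (auto simp: interp_def W'_def fun_eq_iff)
  have "((\<lambda>s. out (interp s W W') x) has_real_derivative
     (\<Sum>p\<in>P. jac (interp (W p - W p) W W') x p * (W' p - W p))) (at (W p - W p))"
    using out_interp_deriv[of W W' x "W p - W p"] by simp
  then have "((\<lambda>s. out (interp (s - W p) W W') x) has_real_derivative
     (\<Sum>p\<in>P. jac W x p * (W' p - W p)) * 1) (at (W p))"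
    by (intro DERIV_chain2[where f = "\<lambda>s. out (interp s W W') x"]) (auto intro!: derivative_eq_intros)
  moreover have "(\<Sum>q\<in>P. jac W x q * (W' q - W q)) = (\<Sum>q\<in>P. if q = p then jac W x p else 0)"
    by (intro sum.cong) (auto simp: W'_def)
  ultimately show ?thesis using p by (simp add: i)
qed

lemma net_eq_out:
  assumes "vv \<in> carrier_vec k" "\<And>r. r < k \<Longrightarrow> vv $ r = v r" "z \<in> carrier_vec d"
  shows "net \<phi> vv (Matrix.mat k d W) z = out W (\<lambda>j. z $ j)"
  using assms by (auto simp: net_def out_def preact_def scalar_prod_def atLeast0LessThan intro!: sum.cong arg_cong[where f = \<phi>])

lemma grad_loss:
  assumes vv: "vv \<in> carrier_vec k" "\<And>r. r < k \<Longrightarrow> vv $ r = v r" and x: "\<And>i. i < n \<Longrightarrow> x i \<in> carrier_vec d"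
  shows "grad (loss \<phi> vv n x y) (Matrix.mat k d W)
    = Matrix.mat k d (\<lambda>p. \<Sum>i<n. (out W (\<lambda>j. x i $ j) - y i) * jac W (\<lambda>j. x i $ j) p)"
proof (rule eq_matI)
  fix r j assume "r < dim_row (Matrix.mat k d (\<lambda>p. \<Sum>i<n. (out W (\<lambda>j. x i $ j) - y i) * jac W (\<lambda>j. x i $ j) p))"
    "j < dim_col (Matrix.mat k d (\<lambda>p. \<Sum>i<n. (out W (\<lambda>j. x i $ j) - y i) * jac W (\<lambda>j. x i $ j) p))"
  then have rj: "r < k" "j < d" by auto
  let ?p = "(r, j)"
  have m: "Matrix.mat k d (\<lambda>q. if q = ?p then s else Matrix.mat k d W $$ q) = Matrix.mat k d (W(?p := s))" for s
    by (rule eq_matI) auto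
  have L: "loss \<phi> vv n x y (Matrix.mat k d W') = (1 / 2) * (\<Sum>i<n. (y i - out W' (\<lambda>j. x i $ j))\<^sup>2)" for W'
    unfolding loss_def using net_eq_out[OF vv x] by simp
  have "((\<lambda>s. (1 / 2) * (\<Sum>i<n. (y i - out (W(?p := s)) (\<lambda>j. x i $ j))\<^sup>2)) has_real_derivative
     (1 / 2) * (\<Sum>i<n. 2 * (y i - out (W(?p := W ?p)) (\<lambda>j. x i $ j)) * (0 - jac W (\<lambda>j. x i $ j) ?p))) (at (W ?p))"
  proof (intro DERIV_cmult DERIV_sum)
    fix i
    have "((\<lambda>s. y i - out (W(?p := s)) (\<lambda>j. x i $ j)) has_real_derivative 0 - jac W (\<lambda>j. x i $ j) ?p) (at (W ?p))"
      using rj by (intro DERIV_diff DERIV_const out_deriv_entry) auto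
    from DERIV_power[OF this, of 2]
    show "((\<lambda>s. (y i - out (W(?p := s)) (\<lambda>j. x i $ j))\<^sup>2) has_real_derivative
      2 * (y i - out (W(?p := W ?p)) (\<lambda>j. x i $ j)) * (0 - jac W (\<lambda>j. x i $ j) ?p)) (at (W ?p))"
      by (simp add: algebra_simps)
  qed
  also have "(1 / 2) * (\<Sum>i<n. 2 * (y i - out (W(?p := W ?p)) (\<lambda>j. x i $ j)) * (0 - jac W (\<lambda>j. x i $ j) ?p))
      = (\<Sum>i<n. (out W (\<lambda>j. x i $ j) - y i) * jac W (\<lambda>j. x i $ j) ?p)"
    unfolding sum_distrib_left by (intro sum.cong) (auto simp: algebra_simps)
  finally have D: "((\<lambda>s. (1 / 2) * (\<Sum>i<n. (y i - out (W(?p := s)) (\<lambda>j. x i $ j))\<^sup>2)) has_real_derivative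
     (\<Sum>i<n. (out W (\<lambda>j. x i $ j) - y i) * jac W (\<lambda>j. x i $ j) ?p)) (at (W ?p))" .
  have "grad (loss \<phi> vv n x y) (Matrix.mat k d W) $$ ?p
     = deriv (\<lambda>s. loss \<phi> vv n x y (Matrix.mat k d (\<lambda>q. if q = ?p then s else Matrix.mat k d W $$ q))) (W ?p)"
    using rj by (simp add: grad_def)
  also have "\<dots> = (\<Sum>i<n. (out W (\<lambda>j. x i $ j) - y i) * jac W (\<lambda>j. x i $ j) ?p)"
    unfolding m L by (rule DERIV_imp_deriv[OF D])
  finally show "grad (loss \<phi> vv n x y) (Matrix.mat k d W) $$ (r, j)
     = Matrix.mat k d (\<lambda>p. \<Sum>i<n. (out W (\<lambda>j. x i $ j) - y i) * jac W (\<lambda>j. x i $ j) p) $$ (r, j)"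
    using rj by simp
qed (simp_all add: grad_def)

lemma grad_descent_eq_descent:
  assumes vv: "vv \<in> carrier_vec k" "\<And>r. r < k \<Longrightarrow> vv $ r = v r" and x: "\<And>i. i < n \<Longrightarrow> x i \<in> carrier_vec d"
  shows "grad_descent (loss \<phi> vv n x y) \<eta> (Matrix.mat k d W) t = Matrix.mat k d (descent n (\<lambda>i j. x i $ j) y \<eta> W t)"
proof (induction t)
  case (Suc t)
  have "grad (loss \<phi> vv n x y) (Matrix.mat k d (descent n (\<lambda>i j. x i $ j) y \<eta> W t))
      = Matrix.mat k d (\<lambda>p. \<Sum>i<n. (out (descent n (\<lambda>i j. x i $ j) y \<eta> W t) (\<lambda>j. x i $ j) - y i)
          * jac (descent n (\<lambda>i j. x i $ j) y \<eta> W t) (\<lambda>j. x i $ j) p)"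
    by (rule grad_loss[OF assms])
  then show ?case unfolding grad_descent.simps Suc.IH by (intro eq_matI) auto
qed simp

end

lemma (in clustered_gd) gd_eq_descent: "gd t = descent n X y \<eta> W0 t"
  by (induction t) (simp_all add: gr_def res_def)

section \<open>Measurability of the training event and the good event for the random
  initialisation\<close>

lemma borel_measurable_card:
  fixes n :: nat
  assumes "\<And>i. i < n \<Longrightarrow> {\<omega> \<in> space M. Q i \<omega>} \<in> sets M"
  shows "(\<lambda>\<omega>. real (card {i. i < n \<and> Q i \<omega>})) \<in> borel_measurable M"
proof -
  have "real (card {i. i < n \<and> Q i \<omega>}) = (\<Sum>i<n. if Q i \<omega> then 1 else 0)" for \<omega>
  proof -
    have "{i. i < n \<and> Q i \<omega>} = {..<n} \<inter> {i. Q i \<omega>}" by auto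
    then show ?thesis
      using sum.inter_restrict[OF finite_lessThan[of n], of "\<lambda>_. 1 :: real" "{i. Q i \<omega>}"] by simp
  qed
  moreover have "(\<lambda>\<omega>. \<Sum>i<n. if Q i \<omega> then 1 else 0 :: real) \<in> borel_measurable M"
    by (intro borel_measurable_sum measurable_If assms) auto
  ultimately show ?thesis by simp
qed

context shallow_net
begin

lemma L2_diff_measurable:
  assumes "\<And>i. i \<in> A \<Longrightarrow> (\<lambda>\<omega>. Z \<omega> i) \<in> borel_measurable M"
  shows "(\<lambda>\<omega>. L2_set (Z \<omega>) A) \<in> borel_measurable M"
proof -
  have [measurable]: "(\<lambda>\<omega>. \<Sum>i\<in>A. (Z \<omega> i)\<^sup>2) \<in> borel_measurable M"
    by (intro borel_measurable_sum borel_measurable_power assms)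
  show ?thesis unfolding L2_set_def by measurable
qed

lemma descent_coord: "p \<in> P \<Longrightarrow> (\<lambda>\<omega>. \<omega> p) \<in> borel_measurable MW"
  using descent_measurable[of p 0 _ _ _ 0] by simp

lemma sets_nearest_labels:
  assumes f: "f \<in> borel_measurable M" and A: "finite A"
  shows "{\<omega> \<in> space M. nearest_labels A (f \<omega>) \<noteq> {a}} \<in> sets M"
proof -
  have "{\<omega> \<in> space M. a \<in> A \<and> (\<forall>b\<in>A. b \<noteq> a \<longrightarrow> 0 < \<bar>f \<omega> - b\<bar> - \<bar>f \<omega> - a\<bar>)} \<in> sets M"
    using f by (intro sets.sets_Collect_conj sets.sets_Collect_finite_All A sets.sets_Collect_imp sets.sets_Collect_const
        borel_measurable_less borel_measurable_diff borel_measurable_abs borel_measurable_const) auto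
  then have "{\<omega> \<in> space M. nearest_labels A (f \<omega>) = {a}} \<in> sets M"
    by (simp only: nearest_labels_eq_singleton)
  then show ?thesis by (rule sets.sets_Collect_neg)
qed

text \<open>The lower bound for the probability is inherited from a smaller good set, and
  monotonicity of \<open>measure\<close> requires this event to be measurable. The delicate part is
  the third one, a quantifier over an uncountable ball.\<close>

lemma sets_training_event:
  fixes K :: nat
  assumes A: "finite A" and aK: "\<And>l. l < K \<Longrightarrow> lab l \<in> A"
  shows "{\<omega> \<in> space MW.
      L2_set (\<lambda>i. out (descent n X y \<eta> \<omega> \<tau>) (X i) - yt i) {..<n} / sqrt (real n) \<le> e1
    \<and> (Q2 \<longrightarrow> real (card {i. i < n \<and> nearest_labels A (out (descent n X y \<eta> \<omega> \<tau>) (X i)) \<noteq> {yt i}}) / real n \<le> e2)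
    \<and> (Q3 \<longrightarrow> (\<forall>l<K. \<forall>z\<in>supp d \<inter> {z. L2_set (\<lambda>j. z j - c l j) {..<d} \<le> \<epsilon>}.
          nearest_labels A (out (descent n X y \<eta> \<omega> \<tau>) z) = {lab l}))
    \<and> (\<forall>t\<le>\<tau>. L2_set (\<lambda>p. descent n X y \<eta> \<omega> t p - \<omega> p) P \<le> e4 t)} \<in> sets MW"
proof -
  note om = out_measurable_compose(1)[OF descent_measurable]
  have 1: "{\<omega> \<in> space MW. L2_set (\<lambda>i. out (descent n X y \<eta> \<omega> \<tau>) (X i) - yt i) {..<n} / sqrt (real n) \<le> e1} \<in> sets MW"
    by (intro borel_measurable_le borel_measurable_divide L2_diff_measurable borel_measurable_diff om borel_measurable_const)
  have "{\<omega> \<in> space MW. real (card {i. i < n \<and> nearest_labels A (out (descent n X y \<eta> \<omega> \<tau>) (X i)) \<noteq> {yt i}}) / real n \<le> e2} \<in> sets MW"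
    by (intro borel_measurable_le borel_measurable_divide borel_measurable_card sets_nearest_labels om A borel_measurable_const)
  then have 2: "{\<omega> \<in> space MW. Q2 \<longrightarrow> real (card {i. i < n \<and> nearest_labels A (out (descent n X y \<eta> \<omega> \<tau>) (X i)) \<noteq> {yt i}}) / real n \<le> e2} \<in> sets MW"
    by (rule sets.sets_Collect_imp) (rule sets.sets_Collect_const)
  have ball: "{\<omega> \<in> space MW. \<forall>z\<in>supp d \<inter> {z. L2_set (\<lambda>j. z j - c l j) {..<d} \<le> \<epsilon>}.
          nearest_labels A (out (descent n X y \<eta> \<omega> \<tau>) z) = {lab l}} \<in> sets MW" if "l < K" for l
  proof -
    let ?B = "supp d \<inter> {z. L2_set (\<lambda>j. z j - c l j) {..<d} \<le> \<epsilon>}"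
    let ?f = "\<lambda>\<omega>. out (descent n X y \<eta> \<omega> \<tau>)"
    \<comment> \<open>The quantifiers over labels and points are exchanged: for each competing label
      a single margin function must be positive on a compact ball.\<close>
    have "{\<omega> \<in> space MW. \<forall>b\<in>A. b \<noteq> lab l \<longrightarrow> (\<forall>z\<in>?B. 0 < \<bar>?f \<omega> z - b\<bar> - \<bar>?f \<omega> z - lab l\<bar>)} \<in> sets MW"
    proof (rule sets.sets_Collect_finite_All[OF _ A])
      fix b assume "b \<in> A"
      have "{\<omega> \<in> space MW. \<forall>z\<in>?B. 0 < \<bar>?f \<omega> z - b\<bar> - \<bar>?f \<omega> z - lab l\<bar>} \<in> sets MW"
        by (intro sets_Collect_ball_compact compact_ball_supp borel_measurable_diff borel_measurable_abs om borel_measurable_const)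
          (intro continuous_intros out_continuous)
      then show "{\<omega> \<in> space MW. b \<noteq> lab l \<longrightarrow> (\<forall>z\<in>?B. 0 < \<bar>?f \<omega> z - b\<bar> - \<bar>?f \<omega> z - lab l\<bar>)} \<in> sets MW"
        by (rule sets.sets_Collect_imp) (rule sets.sets_Collect_const)
    qed
    also have "{\<omega> \<in> space MW. \<forall>b\<in>A. b \<noteq> lab l \<longrightarrow> (\<forall>z\<in>?B. 0 < \<bar>?f \<omega> z - b\<bar> - \<bar>?f \<omega> z - lab l\<bar>)}
      = {\<omega> \<in> space MW. \<forall>z\<in>?B. nearest_labels A (?f \<omega> z) = {lab l}}"
      using aK[OF that] by (auto simp: nearest_labels_eq_singleton)
    finally show ?thesis .
  qed
  have "{\<omega> \<in> space MW. \<forall>l\<in>{..<K}. \<forall>z\<in>supp d \<inter> {z. L2_set (\<lambda>j. z j - c l j) {..<d} \<le> \<epsilon>}.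
          nearest_labels A (out (descent n X y \<eta> \<omega> \<tau>) z) = {lab l}} \<in> sets MW"
    by (rule sets.sets_Collect_finite_All[where S = "{..<K}" and P = "\<lambda>l \<omega>. \<forall>z\<in>supp d \<inter> {z. L2_set (\<lambda>j. z j - c l j) {..<d} \<le> \<epsilon>}.
          nearest_labels A (out (descent n X y \<eta> \<omega> \<tau>) z) = {lab l}"]) (use ball in simp_all)
  then have "{\<omega> \<in> space MW. Q3 \<longrightarrow> (\<forall>l\<in>{..<K}. \<forall>z\<in>supp d \<inter> {z. L2_set (\<lambda>j. z j - c l j) {..<d} \<le> \<epsilon>}.
          nearest_labels A (out (descent n X y \<eta> \<omega> \<tau>) z) = {lab l})} \<in> sets MW"
    by (rule sets.sets_Collect_imp) (rule sets.sets_Collect_const)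
  then have 3: "{\<omega> \<in> space MW. Q3 \<longrightarrow> (\<forall>l<K. \<forall>z\<in>supp d \<inter> {z. L2_set (\<lambda>j. z j - c l j) {..<d} \<le> \<epsilon>}.
          nearest_labels A (out (descent n X y \<eta> \<omega> \<tau>) z) = {lab l})} \<in> sets MW"
    by (simp only: Ball_def lessThan_iff)
  have "{\<omega> \<in> space MW. \<forall>t\<in>{..\<tau>}. L2_set (\<lambda>p. descent n X y \<eta> \<omega> t p - \<omega> p) P \<le> e4 t} \<in> sets MW"
    by (intro sets.sets_Collect_finite_All borel_measurable_le L2_diff_measurable borel_measurable_diff
        descent_measurable descent_coord borel_measurable_const) auto
  then have 4: "{\<omega> \<in> space MW. \<forall>t\<le>\<tau>. L2_set (\<lambda>p. descent n X y \<eta> \<omega> t p - \<omega> p) P \<le> e4 t} \<in> sets MW"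
    by (simp only: Ball_def atMost_iff)
  show ?thesis by (intro sets.sets_Collect_conj 1 2 3 4)
qed

lemma training_whp:
  fixes c X :: "nat \<Rightarrow> nat \<Rightarrow> real" and cl :: "nat \<Rightarrow> nat"
  defines "E \<equiv> \<lambda>i j. \<integral>w. \<phi>' (lin d (c i) w) * \<phi>' (lin d (c j) w) \<partial>std_gaussian {..<d}"
  assumes b: "balanced k v" and d: "0 < d" and K: "2 \<le> K" and n: "0 < n" and \<epsilon>: "0 \<le> \<epsilon>"
    and X: "\<And>i. i < n \<Longrightarrow> L2_set (X i) {..<d} = 1"
    and c: "\<And>l. l < K \<Longrightarrow> L2_set (c l) {..<d} = 1"
    and cl: "\<And>i. i < n \<Longrightarrow> cl i < K"
    and near: "\<And>i. i < n \<Longrightarrow> L2_set (\<lambda>j. X i j - c (cl i) j) {..<d} \<le> \<epsilon>"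
    and lam: "0 < lam" "\<And>x. lam * (L2_set x {..<K})\<^sup>2 \<le> (\<Sum>i<K. \<Sum>j<K. x i * x j * ((\<Sum>m<d. c i m * c j m) * E i j))"
    and k4: "4 \<le> k" and kK: "ln (real K) \<le> real k"
    and kbig: "3400 * ((real K)\<^sup>2 * \<Gamma>^4 * ln (real K)) \<le> lam\<^sup>2 * real k"
    and y: "\<And>i. i < n \<Longrightarrow> \<bar>y i\<bar> \<le> 1" and \<eta>: "0 < \<eta>"
    and rc: "regime_constants \<Gamma> (sqrt lam) (sqrt (real K)) (sqrt (real n)) s (sqrt (ln (real K))) \<Lambda> \<epsilon> (sqrt (real k)) g u (real \<tau> * \<eta>) C1 c1 S2 CR"
    and low: "\<And>l. l < K \<Longrightarrow> 2 * g\<^sup>2 * (real n / real K) \<le> real (card {i. i < n \<and> cl i = l})"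
    and up: "\<And>l. l < K \<Longrightarrow> real (card {i. i < n \<and> cl i = l}) \<le> u\<^sup>2 * (real n / real K)"
    and spectral: "\<And>x. L2_set (\<lambda>j. \<Sum>i<K. c i j * x i) {..<d} \<le> s * L2_set x {..<K}"
    and step_size: "\<eta> * (2 * u\<^sup>2 * real n * \<Gamma>\<^sup>2 * s\<^sup>2) \<le> real K"
    and T: "C1 * real K * \<Lambda> / (2 * real n * lam) \<le> real \<tau> * \<eta>" and C1g: "C1 * g\<^sup>2 = 1600"
    and rh: "0 < rh" "rh * exp \<Lambda> = \<Gamma> * sqrt (real n) * sqrt (ln (real K))" and gu: "g \<le> u"
    and corrupted: "\<And>l. l < K \<Longrightarrow> real (card {i. i < n \<and> cl i = l \<and> y i \<noteq> lab (cl i)}) \<le> rh * real (card {i. i < n \<and> cl i = l})"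
    and lab: "\<And>l. l < K \<Longrightarrow> \<bar>lab l\<bar> \<le> 1"
  obtains G where "G \<in> sets MW" "1 - 3 / real K ^ 100 - real K * exp (- 100 * real d) \<le> measure MW G"
    "\<And>\<omega>. \<omega> \<in> G \<Longrightarrow> training k d v \<phi> \<phi>' \<Gamma> n K cl X c y \<eta> \<epsilon> \<omega> (sqrt lam) (sqrt (real K)) (sqrt (real n)) s (sqrt (ln (real K))) \<Lambda> (sqrt (real k)) g u (real \<tau> * \<eta>) C1 c1 S2 CR \<tau> rh lab"
    "\<And>\<omega> l z. \<omega> \<in> G \<Longrightarrow> l < K \<Longrightarrow> L2_set (\<lambda>j. z j - c l j) {..<d} \<le> \<epsilon> \<Longrightarrow>
       \<bar>out \<omega> z - out \<omega> (c l)\<bar> \<le> 180 * \<Gamma> * \<epsilon> * sqrt (real d)"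
    "\<And>\<omega> u. \<omega> \<in> G \<Longrightarrow> L2_set (preact d \<omega> u) {..<k} \<le> 42 * (sqrt (real k) + sqrt (real d)) * L2_set u {..<d}"
proof -
  show thesis
  proof (rule good_initialization[OF b d K n \<epsilon> X c near lam[unfolded E_def] k4 kK kbig])
    fix G assume G: "G \<in> sets MW" "1 - 3 / real K ^ 100 - real K * exp (- 100 * real d) \<le> measure MW G"
    "\<And>\<omega>. \<omega> \<in> G \<Longrightarrow> L2_set (\<lambda>i. out \<omega> (X i)) {..<n} \<le> 150 * \<Gamma> * sqrt (real n) * sqrt (ln (real K))"
    "\<And>\<omega>. \<omega> \<in> G \<Longrightarrow> L2_set (\<lambda>i. out \<omega> (X i) - out \<omega> (c (cl i))) {..<n} \<le> 150 * (\<Gamma> * \<epsilon>) * sqrt (real n) * sqrt (ln (real K))"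
    "\<And>\<omega>. \<omega> \<in> G \<Longrightarrow> L2_set (\<lambda>i. L2_set (preact d \<omega> (\<lambda>j. X i j - c (cl i) j)) {..<k}) {..<n} \<le> 21 * sqrt (real n) * sqrt (real k) * \<epsilon>"
    "\<And>\<omega> x. \<omega> \<in> G \<Longrightarrow> lam / 2 * (L2_set x {..<K})\<^sup>2 \<le> (\<Sum>i<K. \<Sum>j<K. x i * x j * ((\<Sum>m<d. c i m * c j m) *
       (\<Sum>r<k. (v r)\<^sup>2 * (\<phi>' (preact d \<omega> (c i) r) * \<phi>' (preact d \<omega> (c j) r)))))"
    "\<And>\<omega> l z. \<omega> \<in> G \<Longrightarrow> l < K \<Longrightarrow> L2_set (\<lambda>j. z j - c l j) {..<d} \<le> \<epsilon> \<Longrightarrow>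
       \<bar>out \<omega> z - out \<omega> (c l)\<bar> \<le> 180 * \<Gamma> * \<epsilon> * sqrt (real d)"
    "\<And>\<omega> u. \<omega> \<in> G \<Longrightarrow> L2_set (preact d \<omega> u) {..<k} \<le> 42 * (sqrt (real k) + sqrt (real d)) * L2_set u {..<d}"
  show thesis
  proof (rule that[OF G(1,2) _ G(7,8)])
    fix \<omega> assume \<omega>: "\<omega> \<in> G"
    interpret clustered_gd k d v \<phi> \<phi>' \<Gamma> n K cl X c y \<eta> \<epsilon> \<omega>
      by unfold_locales (use cl X c near y \<eta> \<epsilon> in auto)
    interpret rc: regime_constants \<Gamma> "sqrt lam" "sqrt (real K)" "sqrt (real n)" s "sqrt (ln (real K))" \<Lambda> \<epsilon> "sqrt (real k)" g u "real \<tau> * \<eta>" C1 c1 S2 CR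
      by (rule rc)
    have bl: "block l = {i. i < n \<and> cl i = l}" for l by (simp add: block_def)
    have bc: "{i \<in> block l. y i \<noteq> lab (cl i)} = {i. i < n \<and> cl i = l \<and> y i \<noteq> lab (cl i)}" for l by (auto simp: block_def)
    show "training k d v \<phi> \<phi>' \<Gamma> n K cl X c y \<eta> \<epsilon> \<omega> (sqrt lam) (sqrt (real K)) (sqrt (real n)) s (sqrt (ln (real K))) \<Lambda> (sqrt (real k)) g u (real \<tau> * \<eta>) C1 c1 S2 CR \<tau> rh lab"
    proof unfold_locales
      show "L2_set (gap \<omega>) {..<n} \<le> 150 * (\<Gamma> * \<epsilon>) * sqrt (real n) * sqrt (ln (real K))"
        using G(4)[OF \<omega>] by (simp add: gap_def[abs_def])
      show "(sqrt lam)\<^sup>2 / 2 * (L2_set x {..<K})\<^sup>2 \<le> (\<Sum>i<K. \<Sum>j<K. x i * x j * ((\<Sum>m<d. c i m * c j m) *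
       (\<Sum>r<k. (v r)\<^sup>2 * (\<phi>' (preact d \<omega> (c i) r) * \<phi>' (preact d \<omega> (c j) r)))))" for x
        using G(6)[OF \<omega>, of x] lam by simp
      show "\<eta> * (2 * u\<^sup>2 * (sqrt (real n))\<^sup>2 * \<Gamma>\<^sup>2 * s\<^sup>2) \<le> (sqrt (real K))\<^sup>2" using step_size by simp
      show "C1 * (sqrt (real K))\<^sup>2 * \<Lambda> / (2 * (sqrt (real n))\<^sup>2 * (sqrt lam)\<^sup>2) \<le> real \<tau> * \<eta>" using T lam by simp
    qed (use G(3,5)[OF \<omega>] spectral low up C1g rh gu corrupted lab in \<open>simp_all add: bl bc\<close>)
  qed
  qed
qed

lemma frobenius_norm_mat_diff:
  "frobenius_norm (Matrix.mat k d A - Matrix.mat k d B) = L2_set (\<lambda>p. A p - B p) P"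
  by (simp add: frobenius_norm_def L2_set_def sum.cartesian_product case_prod_beta)

text \<open>Moves the quantifier from vectors to a compact set of functions. Outputs depend on the
  first \<open>d\<close> coordinates only, so padding by zeros changes nothing.\<close>

lemma all_carrier_vec_ball:
  assumes C: "C \<in> carrier_mat K d" "l < K"
  shows "(\<forall>z\<in>carrier_vec d. l2_norm (z - Matrix.row C l) \<le> \<epsilon> \<longrightarrow> Q (out W (\<lambda>j. z $ j)))
    \<longleftrightarrow> (\<forall>z\<in>supp d \<inter> {z. L2_set (\<lambda>j. z j - C $$ (l, j)) {..<d} \<le> \<epsilon>}. Q (out W z))"
proof -
  have n: "l2_norm (z - Matrix.row C l) = L2_set (\<lambda>j. z $ j - C $$ (l, j)) {..<d}" if "z \<in> carrier_vec d" for z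
    unfolding l2_norm_L2_set using C that by (auto intro!: L2_set_cong)
  show ?thesis
  proof safe
    fix z assume all: "\<forall>z\<in>carrier_vec d. l2_norm (z - Matrix.row C l) \<le> \<epsilon> \<longrightarrow> Q (out W (\<lambda>j. z $ j))"
      and z: "z \<in> supp d" "L2_set (\<lambda>j. z j - C $$ (l, j)) {..<d} \<le> \<epsilon>"
    have v: "Matrix.vec d z \<in> carrier_vec d" by simp
    have "L2_set (\<lambda>j. Matrix.vec d z $ j - C $$ (l, j)) {..<d} = L2_set (\<lambda>j. z j - C $$ (l, j)) {..<d}"
      by (intro L2_set_cong) auto
    then have "Q (out W (\<lambda>j. Matrix.vec d z $ j))" using all v z n[OF v] by simp
    moreover have "out W (\<lambda>j. Matrix.vec d z $ j) = out W z" by (rule out_cong) auto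
    ultimately show "Q (out W z)" by simp
  next
    fix z assume all: "\<forall>z\<in>supp d \<inter> {z. L2_set (\<lambda>j. z j - C $$ (l, j)) {..<d} \<le> \<epsilon>}. Q (out W z)"
      and z: "z \<in> carrier_vec d" "l2_norm (z - Matrix.row C l) \<le> \<epsilon>"
    define w where "w j = (if j < d then z $ j else 0)" for j
    have "L2_set (\<lambda>j. w j - C $$ (l, j)) {..<d} = L2_set (\<lambda>j. z $ j - C $$ (l, j)) {..<d}"
      by (intro L2_set_cong) (auto simp: w_def)
    then have "Q (out W w)" using all z n[OF z(1)] by (auto simp: supp_def w_def)
    moreover have "out W w = out W (\<lambda>j. z $ j)" by (rule out_cong) (auto simp: w_def)
    ultimately show "Q (out W (\<lambda>j. z $ j))" by simp
  qed
qed

end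

section \<open>Choice of the parameters\<close>

text \<open>From \<open>K \<le> n\<close>, \<open>1 \<le> \<Gamma>\<close> and
  \<open>\<rho> \<le> 1\<close>, \<Lambda> is at least half of \<open>ln K + ln (ln K)\<close>, and
  \<open>ln (ln K) \<ge> - 1 / 2\<close> because \<open>ln K \<ge> 2 / 3\<close>. Hence
  \<open>ln K \<le> 8 * \<Lambda>\<close> and \<open>\<Lambda> \<ge> 1 / 12\<close>.\<close>

lemma ln_K_bounds:
  assumes K: "2 \<le> K" "K \<le> n" and \<Gamma>: "1 \<le> \<Gamma>" and \<rho>: "0 < \<rho>" "\<rho> \<le> 1"
  defines "\<Lambda> \<equiv> ln (\<Gamma> * sqrt (real n * ln (real K)) / \<rho>)"
  shows "2 / 3 \<le> ln (real K)" "ln (real K) \<le> 8 * \<Lambda>" "1 / 12 \<le> \<Lambda>"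
    "\<rho> * exp \<Lambda> = \<Gamma> * sqrt (real n) * sqrt (ln (real K))"
    "2 / 3 \<le> sqrt (ln (real K))" "sqrt (ln (real K)) \<le> 1500 * \<Lambda>^3" "sqrt (ln (real K)) \<le> 120 * \<Lambda>\<^sup>2"
    "ln (real K) \<le> 2000000 * \<Lambda>^6"
proof -
  have "ln 2 \<le> ln (real K)" using K by simp
  then show l: "2 / 3 \<le> ln (real K)" using ln2_ge_two_thirds by linarith
  define z where "z = \<Gamma> * sqrt (real n * ln (real K)) / \<rho>"
  have z0: "0 < z" using K \<Gamma> \<rho> l by (simp add: z_def)
  show "\<rho> * exp \<Lambda> = \<Gamma> * sqrt (real n) * sqrt (ln (real K))"
    using z0 \<rho> by (simp add: \<Lambda>_def real_sqrt_mult flip: z_def) (simp add: z_def real_sqrt_mult)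
  have "sqrt (real K * ln (real K)) \<le> z"
  proof -
    have "1 * sqrt (real K * ln (real K)) / 1 \<le> \<Gamma> * sqrt (real n * ln (real K)) / \<rho>"
      using K \<Gamma> \<rho> l by (intro frac_le mult_mono real_sqrt_le_mono mult_right_mono) auto
    then show ?thesis by (simp add: z_def)
  qed
  then have "ln (sqrt (real K * ln (real K))) \<le> \<Lambda>"
    unfolding \<Lambda>_def z_def[symmetric] using K l by (subst ln_le_cancel_iff) (auto simp: z0)
  moreover have "ln (sqrt (real K * ln (real K))) = (ln (real K) + ln (ln (real K))) / 2"
    using K l by (simp add: ln_sqrt ln_mult)
  moreover have "- (1 / 2) \<le> ln (ln (real K))"
  proof -
    have "ln (3 / 2 :: real) \<le> 3 / 2 - 1" by (rule ln_le_minus_one) simp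
    then have "- (1 / 2) \<le> ln (2 / 3 :: real)" using ln_inverse[of "3 / 2 :: real"] by (simp add: inverse_eq_divide)
    also have "\<dots> \<le> ln (ln (real K))" using l by (subst ln_le_cancel_iff) auto
    finally show ?thesis .
  qed
  moreover have "a \<le> 8 * r" if "w \<le> r" "w = (a + e) / 2" "- (1 / 2) \<le> e" "2 / 3 \<le> a" for a e w r :: real
  proof -
    have "2 * w = a + e" using that(2) by simp
    then have "4 * a - 2 \<le> 8 * w" using that(3) by simp
    then show ?thesis using that(1,4) by simp
  qed
  ultimately show l8: "ln (real K) \<le> 8 * \<Lambda>" using l by blast
  then show L: "1 / 12 \<le> \<Lambda>" using l by linarith
  show "2 / 3 \<le> sqrt (ln (real K))" using l by (intro real_le_rsqrt) (simp add: power2_eq_square)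
  \<comment> \<open>Powers of \<open>12 * \<Lambda>\<close> are at least 1, so they may be
    multiplied in to reach any higher power of \<Lambda>.\<close>
  have p: "1 \<le> (12 * \<Lambda>) ^ m" for m using L by (intro one_le_power) auto
  have "\<Lambda> * 1 \<le> \<Lambda> * (12 * \<Lambda>) ^ 5" by (rule mult_left_mono[OF p]) (use L in simp)
  then have 6: "8 * \<Lambda> \<le> 1990656 * \<Lambda>^6" by (simp add: eval_nat_numeral)
  have L6: "0 \<le> \<Lambda>^6" by simp
  then show "ln (real K) \<le> 2000000 * \<Lambda>^6" using l8 6 by linarith
  have "ln (real K) \<le> (1500 * \<Lambda>^3)\<^sup>2"
  proof -
    have "(1500 * \<Lambda>^3)\<^sup>2 = 2250000 * \<Lambda>^6" by (simp add: power_mult_distrib flip: power_mult)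
    then show ?thesis using l8 6 L6 by linarith
  qed
  then show "sqrt (ln (real K)) \<le> 1500 * \<Lambda>^3" using L by (intro real_le_lsqrt) auto
  have "\<Lambda> * 1 \<le> \<Lambda> * (12 * \<Lambda>) ^ 3" by (rule mult_left_mono[OF p]) (use L in simp)
  then have 4: "8 * \<Lambda> \<le> 13824 * \<Lambda>^4" by (simp add: eval_nat_numeral)
  have "ln (real K) \<le> (120 * \<Lambda>\<^sup>2)\<^sup>2"
  proof -
    have "(120 * \<Lambda>\<^sup>2)\<^sup>2 = 14400 * \<Lambda>^4" by (simp add: power_mult_distrib flip: power_mult)
    moreover have "0 \<le> \<Lambda>^4" by simp
    ultimately show ?thesis using l8 4 by linarith
  qed
  then show "sqrt (ln (real K)) \<le> 120 * \<Lambda>\<^sup>2" using L by (intro real_le_lsqrt) auto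
qed

text \<open>One width condition serves two purposes: the summand \<open>S2\<^sup>2\<close> of the
  constant keeps the kernel stable during training, the summand \<open>10^10\<close> makes it
  concentrate at initialisation.\<close>

lemma width_bounds:
  fixes \<Gamma> lam s \<Lambda> :: real
  assumes k: "C2 * \<Gamma>^10 * ((real K)\<^sup>2 * s^4 / lam^4) * \<Lambda>^6 \<le> real k"
    and C2: "S2\<^sup>2 + 10^10 \<le> C2" and S2: "0 \<le> S2" and \<Gamma>: "1 \<le> \<Gamma>" and lam: "0 < lam" "lam \<le> \<Gamma>\<^sup>2"
    and s: "1 \<le> s" and K: "2 \<le> K" and \<Lambda>: "1 / 12 \<le> \<Lambda>" "ln (real K) \<le> 2000000 * \<Lambda>^6" "2 / 3 \<le> ln (real K)"
  shows "S2 * \<Gamma>^5 * real K * s\<^sup>2 * \<Lambda>^3 / lam\<^sup>2 \<le> sqrt (real k)"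
    "3400 * ((real K)\<^sup>2 * \<Gamma>^4 * ln (real K)) \<le> lam\<^sup>2 * real k" "4 \<le> k" "ln (real K) \<le> real k"
proof -
  define M where "M = \<Gamma>^10 * ((real K)\<^sup>2 * s^4 / lam^4) * \<Lambda>^6"
  have M0: "0 \<le> M" using \<Gamma> lam \<Lambda> by (simp add: M_def)
  have kM: "C2 * M \<le> real k" using k by (simp add: M_def mult.assoc)
  have "S2\<^sup>2 * M \<le> C2 * M" using C2 by (intro mult_right_mono M0) auto
  moreover have "(S2 * \<Gamma>^5 * real K * s\<^sup>2 * \<Lambda>^3 / lam\<^sup>2)\<^sup>2 = S2\<^sup>2 * M"
    by (simp add: M_def power_mult_distrib power_divide flip: power_mult)
  ultimately show "S2 * \<Gamma>^5 * real K * s\<^sup>2 * \<Lambda>^3 / lam\<^sup>2 \<le> sqrt (real k)"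
    using kM by (intro real_le_rsqrt) linarith
  have l2: "lam\<^sup>2 \<le> \<Gamma>^4" using power_mono[OF lam(2), of 2] lam by (simp flip: power_mult)
  have big: "10^10 * ((real K)\<^sup>2 * \<Gamma>^4 * \<Lambda>^6) \<le> lam\<^sup>2 * real k"
  proof -
    have "(real K)\<^sup>2 * \<Gamma>^4 * \<Lambda>^6 \<le> (real K)\<^sup>2 * \<Gamma>^4 * \<Lambda>^6 * ((\<Gamma>^4 / lam\<^sup>2) * (\<Gamma>\<^sup>2 * s^4))"
    proof -
      have "1 * (1 * 1) \<le> (\<Gamma>^4 / lam\<^sup>2) * (\<Gamma>\<^sup>2 * s^4)"
        using l2 lam \<Gamma> s by (intro mult_mono) (auto simp: le_divide_eq one_le_power)
      then show ?thesis using mult_left_mono[of 1 "(\<Gamma>^4 / lam\<^sup>2) * (\<Gamma>\<^sup>2 * s^4)" "(real K)\<^sup>2 * \<Gamma>^4 * \<Lambda>^6"] \<Gamma> \<Lambda> by simp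
    qed
    also have "\<dots> = lam\<^sup>2 * M" using lam by (simp add: M_def field_simps eval_nat_numeral)
    finally have "10^10 * ((real K)\<^sup>2 * \<Gamma>^4 * \<Lambda>^6) \<le> 10^10 * (lam\<^sup>2 * M)" by (intro mult_left_mono) auto
    also have "\<dots> = lam\<^sup>2 * (10^10 * M)" by simp
    also have "10^10 * M \<le> C2 * M" using C2 by (intro mult_right_mono M0) (auto intro: order_trans[rotated])
    also have "C2 * M \<le> real k" by (rule kM)
    finally show ?thesis using lam by (simp add: mult_left_mono)
  qed
  have "3400 * ((real K)\<^sup>2 * \<Gamma>^4 * ln (real K)) \<le> 3400 * ((real K)\<^sup>2 * \<Gamma>^4 * (2000000 * \<Lambda>^6))"
    using \<Lambda> \<Gamma> by (intro mult_left_mono) auto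
  also have "\<dots> = 68 / 100 * (10^10 * ((real K)\<^sup>2 * \<Gamma>^4 * \<Lambda>^6))" by simp
  also have "\<dots> \<le> 1 * (10^10 * ((real K)\<^sup>2 * \<Gamma>^4 * \<Lambda>^6))" using \<Gamma> \<Lambda> by (intro mult_right_mono) auto
  finally show kb: "3400 * ((real K)\<^sup>2 * \<Gamma>^4 * ln (real K)) \<le> lam\<^sup>2 * real k" using big by linarith
  have "lam\<^sup>2 * real k \<le> \<Gamma>^4 * real k" using l2 by (intro mult_right_mono) auto
  with kb have "\<Gamma>^4 * (3400 * ((real K)\<^sup>2 * ln (real K))) \<le> \<Gamma>^4 * real k" by (simp add: mult_ac)
  then have kk: "3400 * ((real K)\<^sup>2 * ln (real K)) \<le> real k" using \<Gamma> by (simp add: mult_le_cancel_left_pos)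
  have "1 * ln (real K) \<le> (real K)\<^sup>2 * ln (real K)" using K \<Lambda> by (intro mult_right_mono one_le_power) auto
  with kk \<Lambda> show "ln (real K) \<le> real k" "4 \<le> k" by linarith+
qed

text \<open>An iteration count of at least 1 changes by at most a factor 2 under rounding, which the
  constants of the regime allow for in both directions.\<close>

lemma rounded_steps:
  assumes X: "1 \<le> X" and \<eta>: "0 < \<eta>"
  shows "real (nat (round X)) * \<eta> \<le> 2 * (X * \<eta>)" "X * \<eta> / 2 \<le> real (nat (round X)) * \<eta>"
proof -
  have r: "\<bar>real_of_int (round X) - X\<bar> \<le> 1 / 2" by (rule of_int_round_abs_le)
  then have "0 \<le> round X" using X by linarith
  then have e: "real (nat (round X)) = real_of_int (round X)" by simp
  have "real_of_int (round X) \<le> 2 * X" "X / 2 \<le> real_of_int (round X)" using r X by linarith+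
  from mult_right_mono[OF this(1), of \<eta>] mult_right_mono[OF this(2), of \<eta>] \<eta>
  show "real (nat (round X)) * \<eta> \<le> 2 * (X * \<eta>)" "X * \<eta> / 2 \<le> real (nat (round X)) * \<eta>"
    by (simp_all add: e)
qed

text \<open>The upper bound tests the quadratic form on the first unit vector: the corresponding
  diagonal entry is the expectation of a squared slope, as the center has norm 1.\<close>

lemma cluster_cov_properties:
  fixes C :: rmat
  assumes C: "C \<in> carrier_mat K d" and K: "0 < K" and meas: "\<phi>' \<in> borel_measurable borel"
    and b: "\<And>z. \<bar>\<phi>' z\<bar> \<le> \<Gamma>" and rows: "\<And>l. l < K \<Longrightarrow> l2_norm (Matrix.row C l) = 1"
  defines "c \<equiv> \<lambda>l j. C $$ (l, j)"
  defines "E \<equiv> \<lambda>i j. \<integral>w. \<phi>' (lin d (c i) w) * \<phi>' (lin d (c j) w) \<partial>std_gaussian {..<d}"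
  shows "min_eig_cov \<phi>' C * (L2_set x {..<K})\<^sup>2 \<le> (\<Sum>i<K. \<Sum>j<K. x i * x j * ((\<Sum>m<d. c i m * c j m) * E i j))"
    "min_eig_cov \<phi>' C \<le> \<Gamma>\<^sup>2"
proof -
  interpret prob_space "std_gaussian {..<d}" by (rule prob_space_std_gaussian)
  define A where "A = cluster_cov \<phi>' C"
  have A: "A \<in> carrier_mat K K" using C by (simp add: A_def cluster_cov_def)
  have Aij: "A $$ (i, j) = (\<Sum>m<d. c i m * c j m) * E i j" if "i < K" "j < K" for i j
  proof -
    have "map_vec \<phi>' (C *\<^sub>v Matrix.vec (dim_col C) \<omega>) $ l = \<phi>' (lin d (c l) \<omega>)" if "l < K" for l \<omega>
      using C that by (simp add: lin_def c_def scalar_prod_def atLeast0LessThan mult.commute)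
    moreover have "(C * transpose_mat C) $$ (i, j) = (\<Sum>m<d. c i m * c j m)"
      using C that by (simp add: c_def scalar_prod_def atLeast0LessThan)
    ultimately show ?thesis using C that by (simp add: A_def cluster_cov_def E_def)
  qed
  have "A $$ (i, j) = A $$ (j, i)" if "i < K" "j < K" for i j
    using that by (simp add: Aij E_def mult.commute)
  from min_spectrum_le_quadratic_form[OF A K this]
  have ray: "min_eig_cov \<phi>' C * (L2_set x {..<K})\<^sup>2 \<le> (\<Sum>i<K. \<Sum>j<K. x i * x j * ((\<Sum>m<d. c i m * c j m) * E i j))" for x
    by (simp add: min_eig_cov_def A_def[symmetric] Aij sum_distrib_left mult_ac)
  then show "min_eig_cov \<phi>' C * (L2_set x {..<K})\<^sup>2 \<le> (\<Sum>i<K. \<Sum>j<K. x i * x j * ((\<Sum>m<d. c i m * c j m) * E i j))" .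
  define e where "e i = (if i = 0 then 1 else 0 :: real)" for i :: nat
  have e2: "(L2_set e {..<K})\<^sup>2 = 1"
    unfolding L2_set_power2 using K by (simp add: e_def if_distrib[where f = "\<lambda>x. x\<^sup>2"] cong: if_cong)
  have del: "(\<Sum>i<K. e i * f i) = f 0" for f
    using K by (simp add: e_def if_distrib[where f = "\<lambda>x. x * _"] cong: if_cong)
  have "(\<Sum>i<K. \<Sum>j<K. e i * e j * ((\<Sum>m<d. c i m * c j m) * E i j))
      = (\<Sum>i<K. e i * (\<Sum>j<K. e j * ((\<Sum>m<d. c i m * c j m) * E i j)))"
    unfolding sum_distrib_left[of "e _"] by (simp only: mult.assoc)
  also have "\<dots> = (\<Sum>m<d. c 0 m * c 0 m) * E 0 0" unfolding del by (rule refl)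
  also have "(\<Sum>m<d. c 0 m * c 0 m) = 1"
  proof -
    have "(l2_norm (Matrix.row C 0))\<^sup>2 = (\<Sum>m<d. c 0 m * c 0 m)"
      unfolding l2_norm_L2_set L2_set_power2 using C K by (auto simp: c_def power2_eq_square intro!: sum.cong)
    then show ?thesis using rows[OF K] by simp
  qed
  finally have "min_eig_cov \<phi>' C \<le> E 0 0" using ray[of e] e2 by simp
  also have "E 0 0 \<le> \<Gamma>\<^sup>2"
  proof -
    have bb: "\<bar>\<phi>' (lin d (c 0) w) * \<phi>' (lin d (c 0) w)\<bar> \<le> \<Gamma>\<^sup>2" for w
      unfolding abs_mult power2_eq_square using b[of "lin d (c 0) w"] by (intro mult_mono) auto
    have "integrable (std_gaussian {..<d}) (\<lambda>w. \<phi>' (lin d (c 0) w) * \<phi>' (lin d (c 0) w))"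
      using meas bb by (intro integrable_const_bound[of _ "\<Gamma>\<^sup>2"]) auto
    then show ?thesis unfolding E_def
      by (rule integral_le_const) (use bb in \<open>auto intro: order_trans[OF abs_ge_self]\<close>)
  qed
  finally show "min_eig_cov \<phi>' C \<le> \<Gamma>\<^sup>2" .
qed

lemma min_five_pos:
  fixes a1 a2 a3 a4 a5 :: real
  assumes "0 < a1" "0 < a2" "0 < a3" "0 < a4" "0 < a5"
  obtains x where "0 < x" "x \<le> a1" "x \<le> a2" "x \<le> a3" "x \<le> a4" "x \<le> a5"
  by (rule that[of "Min {a1, a2, a3, a4, a5}"]) (use assms in simp_all)

lemma (in training) training_outcome:
  assumes A: "\<And>l. l < K \<Longrightarrow> lab l \<in> A"
    and sep: "\<And>p q. p \<in> A \<Longrightarrow> q \<in> A \<Longrightarrow> p \<noteq> q \<Longrightarrow> \<delta> \<le> \<bar>p - q\<bar>"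
    and \<delta>: "0 < \<delta>" and d: "0 < d"
    and c': "0 < c'" "c' * (120 * Cerr / g) \<le> 1 / 32" "c' * (222 + 66000 * CR) \<le> 1 / 32"
    and init_ball: "\<And>m z. m < K \<Longrightarrow> L2_set (\<lambda>j. z j - c m j) {..<d} \<le> \<epsilon> \<Longrightarrow>
       \<bar>out W0 z - out W0 (c m)\<bar> \<le> 180 * \<Gamma> * \<epsilon> * sqrt (real d)"
    and init_op: "\<And>z. L2_set (preact d W0 z) {..<k} \<le> 42 * (sqrt (real k) + sqrt (real d)) * L2_set z {..<d}"
  shows "L2_set (\<lambda>i. out (descent n X y \<eta> W0 \<tau>) (X i) - lab (cl i)) {..<n} / sqrt (real n)
      \<le> 4 * rh + 8 * Cerr * (\<epsilon> * \<Gamma>^3 * \<kappa>\<^sup>2 * l / L\<^sup>2) * \<Lambda>" (is ?A)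
    and "rh \<le> \<delta> / 8 \<Longrightarrow>
      real (card {i. i < n \<and> nearest_labels A (out (descent n X y \<eta> W0 \<tau>) (X i)) \<noteq> {lab (cl i)}}) / real n
      \<le> 8 * Cerr * (\<epsilon> * \<kappa>\<^sup>2 / \<delta>) * (\<Gamma>^3 * l / L\<^sup>2) * \<Lambda>" (is "_ \<Longrightarrow> ?B")
    and "rh \<le> \<delta> / 8 \<Longrightarrow> \<epsilon> \<le> c' * \<delta> * min (L^4 / (\<Gamma>^5 * \<kappa>^4 * \<Lambda>^3)) (1 / (\<Gamma> * sqrt (real d))) \<Longrightarrow>
      m < K \<Longrightarrow> L2_set (\<lambda>j. z j - c m j) {..<d} \<le> \<epsilon> \<Longrightarrow>
      nearest_labels A (out (descent n X y \<eta> W0 \<tau>) z) = {lab m}" (is "_ \<Longrightarrow> _ \<Longrightarrow> _ \<Longrightarrow> _ \<Longrightarrow> ?C")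
proof -
  have nearest: "nearest_labels A x = {lab m}" if "m < K" "\<bar>x - lab m\<bar> < \<delta> / 2" for m x
    using that by (intro nearest_labels_separated[OF A sep[OF _ A]]) auto
  have "4 * rh + Cerr * rc.E \<le> 4 * rh + 8 * Cerr * (\<epsilon> * \<Gamma>^3 * \<kappa>\<^sup>2 * l / L\<^sup>2) * \<Lambda>"
  proof -
    have e: "8 * Cerr * (\<epsilon> * \<Gamma>^3 * \<kappa>\<^sup>2 * l / L\<^sup>2) * \<Lambda> = 8 * (Cerr * rc.E)" by (simp add: rc.E_def)
    show ?thesis unfolding e using mult_nonneg_nonneg[OF less_imp_le[OF Cerr_pos] rc.E_nonneg] by linarith
  qed
  with error_bound show ?A by (simp add: gd_eq_descent)
  show ?B if rh: "rh \<le> \<delta> / 8"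
  proof -
    have "\<delta> / 2 \<le> \<bar>out (gd \<tau>) (X i) - lab (cl i)\<bar>"
      if "i < n" "nearest_labels A (out (gd \<tau>) (X i)) \<noteq> {lab (cl i)}" for i
      using nearest[OF cl[OF that(1)]] that(2) by (meson not_less)
    then have "real (card {i. i < n \<and> nearest_labels A (out (gd \<tau>) (X i)) \<noteq> {lab (cl i)}})
       \<le> real (card {i. i < n \<and> \<delta> / 2 \<le> \<bar>out (gd \<tau>) (X i) - lab (cl i)\<bar>})"
      by (intro of_nat_mono card_mono) auto
    then have "real (card {i. i < n \<and> nearest_labels A (out (gd \<tau>) (X i)) \<noteq> {lab (cl i)}}) / real n
       \<le> 8 * Cerr * rc.E / \<delta>"
      by (intro order_trans[OF divide_right_mono misclassified_bound[OF \<delta> rh]]) auto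
    also have "\<dots> = 8 * Cerr * (\<epsilon> * \<kappa>\<^sup>2 / \<delta>) * (\<Gamma>^3 * l / L\<^sup>2) * \<Lambda>"
      by (simp add: rc.E_def mult_ac)
    finally show ?thesis by (simp add: gd_eq_descent)
  qed
  show ?C if rh: "rh \<le> \<delta> / 8" and \<epsilon>: "\<epsilon> \<le> c' * \<delta> * min (L^4 / (\<Gamma>^5 * \<kappa>^4 * \<Lambda>^3)) (1 / (\<Gamma> * sqrt (real d)))"
    and m: "m < K" and z: "L2_set (\<lambda>j. z j - c m j) {..<d} \<le> \<epsilon>"
  proof -
    have p: "0 \<le> c' * \<delta>" using c' \<delta> by simp
    have "\<epsilon> \<le> c' * \<delta> * (L^4 / (\<Gamma>^5 * \<kappa>^4 * \<Lambda>^3))" "\<epsilon> \<le> c' * \<delta> * (1 / (\<Gamma> * sqrt (real d)))"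
      by (rule order_trans[OF \<epsilon> mult_left_mono[OF min.cobounded1 p]], rule order_trans[OF \<epsilon> mult_left_mono[OF min.cobounded2 p]])
    note e = this
    have o: "L2_set (preact d W0 (\<lambda>j. z j - c m j)) {..<k} \<le> 42 * (sqrt (real k) + sqrt (real d)) * \<epsilon>"
      by (rule order_trans[OF init_op mult_left_mono[OF z]]) simp
    have "\<bar>out (gd \<tau>) z - lab m\<bar> < \<delta> / 2"
      by (rule robust_bound[OF \<delta> rh m d c' e init_ball[OF m z] o z])
    then show ?thesis using nearest[OF m] by (simp add: gd_eq_descent)
  qed
qed

text \<open>Summing the size bounds over all clusters compares the balance constants with 1; the
  positive lower bound makes every cluster nonempty, whence \<open>K \<le> n\<close>.\<close>

lemma cluster_sizes:
  fixes cl :: "nat \<Rightarrow> nat" and c_low c_up :: real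
  assumes n: "0 < n" and K0: "0 < K" and cl: "\<And>i. i < n \<Longrightarrow> cl i < K"
    and low: "\<And>l. l < K \<Longrightarrow> c_low * (real n / real K) \<le> real (card {i. i < n \<and> cl i = l})"
    and up: "\<And>l. l < K \<Longrightarrow> real (card {i. i < n \<and> cl i = l}) \<le> c_up * (real n / real K)"
    and c_low: "0 < c_low"
  shows "1 \<le> c_up" "c_low \<le> 1" "K \<le> n"
proof -
  have KR: "0 < real K" and nR: "0 < real n" using K0 n by auto
  interpret clusters n K cl by unfold_locales (rule cl)
  have card_n: "real n = (\<Sum>l<K. real (card {i. i < n \<and> cl i = l}))"
    using sum_clusters[of "\<lambda>_. 1 :: real"] by (simp add: block_def)
  have "real n \<le> (\<Sum>l<K. c_up * (real n / real K))" by (subst card_n) (intro sum_mono up, simp)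
  then show "1 \<le> c_up" using KR nR by simp
  have "(\<Sum>l<K. c_low * (real n / real K)) \<le> (\<Sum>l<K. real (card {i. i < n \<and> cl i = l}))" by (intro sum_mono low) simp
  then have "(\<Sum>l<K. c_low * (real n / real K)) \<le> real n" by (simp only: card_n[symmetric])
  then show "c_low \<le> 1" using KR nR by simp
  have "{..<K} \<subseteq> cl ` {..<n}"
  proof
    fix l assume l: "l \<in> {..<K}"
    have "0 < c_low * (real n / real K)" using c_low KR nR by simp
    also have "\<dots> \<le> real (card {i. i < n \<and> cl i = l})" using l by (intro low) simp
    finally have "{i. i < n \<and> cl i = l} \<noteq> {}" by force
    then show "l \<in> cl ` {..<n}" by auto
  qed
  then have "card {..<K} \<le> card {..<n}" by (rule surj_card_le[rotated]) simp
  then show "K \<le> n" by simp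
qed

lemma balanced_output_iff:
  assumes "0 < k"
  shows "balanced_output k w \<longleftrightarrow> w \<in> carrier_vec k \<and> balanced k (\<lambda>r. w $ r)"
  using assms unfolding balanced_output_def balanced_def by blast

theorem theorem8p13:
  fixes c_low c_up :: real
  assumes "0 < c_low" and "c_low < c_up"
  shows
  "\<exists>c c' c\<^sub>1 C\<^sub>1 C\<^sub>2 C\<^sub>3 :: real.
     0 < c \<and> 0 < c' \<and> 0 < c\<^sub>1 \<and> 0 < C\<^sub>1 \<and> 0 < C\<^sub>2 \<and> 0 < C\<^sub>3 \<and>
     (\<forall>(n::nat) (d::nat) (K::nat) (Kbar::nat) (k::nat)
        (\<rho>::real) (\<epsilon>\<^sub>0::real) (\<delta>::real) (\<Gamma>::real) (\<eta>::real)
        (x :: nat \<Rightarrow> real Matrix.vec) (y :: nat \<Rightarrow> real) (ytil :: nat \<Rightarrow> real)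
        (cl :: nat \<Rightarrow> nat) (C :: real Matrix.mat) (\<alpha> :: nat \<Rightarrow> real) (cls :: nat \<Rightarrow> nat)
        (\<phi> :: real \<Rightarrow> real) (\<phi>' :: real \<Rightarrow> real) (\<phi>'' :: real \<Rightarrow> real)
        (v :: real Matrix.vec) (lam::real) (\<Lambda>::real) (\<tau>::nat).
        corrupted_dataset c_low c_up \<rho> \<epsilon>\<^sub>0 \<delta> n d K Kbar x y ytil cl C \<alpha> cls \<longrightarrow>
        0 < \<rho> \<longrightarrow>
        (\<forall>z. (\<phi> has_real_derivative \<phi>' z) (at z)) \<longrightarrow>
        (\<forall>z. (\<phi>' has_real_derivative \<phi>'' z) (at z)) \<longrightarrow>
        lam = min_eig_cov \<phi>' C \<longrightarrow>
        0 < lam \<longrightarrow>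
        1 \<le> \<Gamma> \<longrightarrow>
        \<bar>\<phi> 0\<bar> \<le> \<Gamma> \<longrightarrow>
        (\<forall>z. \<bar>\<phi>' z\<bar> \<le> \<Gamma>) \<longrightarrow>
        (\<forall>z. \<bar>\<phi>'' z\<bar> \<le> \<Gamma>) \<longrightarrow>
        \<Lambda> = ln (\<Gamma> * sqrt (real n * ln (real K)) / \<rho>) \<longrightarrow>
        \<epsilon>\<^sub>0 \<le> c\<^sub>1 * (lam / (\<Gamma>^2 * real K * \<Lambda>)) \<longrightarrow>
        real k \<ge> C\<^sub>2 * \<Gamma>^10 * ((real K)^2 * (spectral_norm C)^4 / lam^4) * \<Lambda>^6 \<longrightarrow>
        balanced_output k v \<longrightarrow>
        0 < \<eta> \<longrightarrow>
        \<eta> \<le> real K / (2 * c_up * real n * \<Gamma>^2 * (spectral_norm C)^2) \<longrightarrow>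
        \<tau> = nat (round (C\<^sub>1 * (real K / (\<eta> * real n * lam)) * \<Lambda>)) \<longrightarrow>
        measure (std_gaussian ({..<k} \<times> {..<d}))
          {\<omega> \<in> space (std_gaussian ({..<k} \<times> {..<d})).
             let W = grad_descent (loss \<phi> v n x y) \<eta> (Matrix.mat k d \<omega>);
                 f = net \<phi> v
             in
               l2_norm (Matrix.vec n (\<lambda>i. f (W \<tau>) (x i)) - Matrix.vec n ytil) / sqrt (real n)
                 \<le> 4 * \<rho> + c * (\<epsilon>\<^sub>0 * \<Gamma>^3 * real K * sqrt (ln (real K)) / lam) * \<Lambda>
             \<and> (\<rho> \<le> \<delta> / 8 \<longrightarrow>
                 real (card {i. i < n \<and> nearest_labels (\<alpha> ` {..<Kbar}) (f (W \<tau>) (x i)) \<noteq> {ytil i}})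
                     / real n
                   \<le> c * (\<epsilon>\<^sub>0 * real K / \<delta>) * (\<Gamma>^3 * sqrt (ln (real K)) / lam) * \<Lambda>)
             \<and> (\<rho> \<le> \<delta> / 8 \<and>
                \<epsilon>\<^sub>0 \<le> c' * \<delta> * min (lam^2 / (\<Gamma>^5 * (real K)^2 * \<Lambda>^3)) (1 / (\<Gamma> * sqrt (real d))) \<longrightarrow>
                 (\<forall>l<K. \<forall>z \<in> carrier_vec d. l2_norm (z - Matrix.row C l) \<le> \<epsilon>\<^sub>0 \<longrightarrow>
                    nearest_labels (\<alpha> ` {..<Kbar}) (f (W \<tau>) z) = {\<alpha> (cls l)}))
             \<and> (\<forall>t\<le>\<tau>.
                 frobenius_norm (W t - W 0)
                   \<le> C\<^sub>3 * (\<Gamma> * sqrt (real K * ln (real K) / lam)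
                        + real t * \<eta> * \<epsilon>\<^sub>0 * (\<Gamma>^4 * real K * real n / lam) * \<Lambda>^2))}
        \<ge> 1 - 3 / (real K)^100 - real K * exp (- 100 * real d))"
proof -
  \<comment> \<open>\<open>g\<close> joins the smallest block size with the factor 1/2 lost in
    passing to the random kernel, so the squared lower singular value is
    \<open>lam * g\<^sup>2 * n / K\<close>.\<close>
  define g where "g = sqrt (c_low / 2)"
  \<comment> \<open>The constants precede the dataset, and only a dataset forces
    \<open>1 \<le> c_up\<close>; the maximum secures \<open>1 \<le> u\<close> in advance.\<close>
  define u where "u = sqrt (max 1 c_up)"
  define CR where "CR = 1818 / g + 1"
  define C1 where "C1 = 1600 / g\<^sup>2"
  define S2 where "S2 = max (48000 * u * CR / g\<^sup>2) (1500 * CR)"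
  define C2 where "C2 = S2\<^sup>2 + 10^10"
  define Ce where "Ce = 36800 * C1 * u + 12 * (150 + 23 * CR)"
  define C3 where "C3 = 1368 / g + 20976000 * u / g + 1104000"
  have g: "0 < g" "2 * g\<^sup>2 = c_low" using assms by (simp_all add: g_def)
  have u: "1 \<le> u" by (simp add: u_def)
  have CR: "0 < CR" using g by (simp add: CR_def add_pos_pos)
  have C1: "0 < C1" "C1 * g\<^sup>2 = 1600" using g by (simp_all add: C1_def)
  have S2: "0 \<le> S2" "48000 * u * CR / g\<^sup>2 \<le> S2" "1500 * CR \<le> S2" using CR by (auto simp: S2_def le_max_iff_disj)
  have C2: "0 < C2" by (simp add: C2_def add_nonneg_pos)
  have Ce: "0 < Ce" using C1 u CR by (simp add: Ce_def add_pos_pos)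
  have C3: "0 < C3" using g u by (simp add: C3_def add_pos_pos)
  obtain c1 where c1: "0 < c1" "c1 \<le> g\<^sup>2 / (8448 * u)" "c1 \<le> 1 / (736 * C1 * u)" "c1 \<le> 1 / 1800" "c1 \<le> 1 / (276 * CR)" "c1 \<le> 1 / (18400 * C1)"
    by (rule min_five_pos[of "g\<^sup>2 / (8448 * u)" "1 / (736 * C1 * u)" "1 / 1800" "1 / (276 * CR)" "1 / (18400 * C1)"])
      (use g u CR C1 in auto)
  have c1': "8448 * u * c1 \<le> g\<^sup>2" "736 * C1 * u * c1 \<le> 1" "1800 * c1 \<le> 1" "276 * c1 * CR \<le> 1" "18400 * C1 * c1 \<le> 1"
    using c1 g u CR C1 by (simp_all add: le_divide_eq mult_ac)
  define c' where "c' = min (1 / (32 * (120 * Ce / g))) (1 / (32 * (222 + 66000 * CR)))"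
  have c': "0 < c'" "c' * (120 * Ce / g) \<le> 1 / 32" "c' * (222 + 66000 * CR) \<le> 1 / 32"
  proof -
    show "0 < c'" using Ce g CR by (simp add: c'_def add_pos_pos)
    have "c' * (120 * Ce / g) \<le> 1 / (32 * (120 * Ce / g)) * (120 * Ce / g)"
      using Ce g by (intro mult_right_mono) (auto simp: c'_def)
    then show "c' * (120 * Ce / g) \<le> 1 / 32" using Ce g by simp
    have "c' * (222 + 66000 * CR) \<le> 1 / (32 * (222 + 66000 * CR)) * (222 + 66000 * CR)"
      using CR by (intro mult_right_mono) (auto simp: c'_def)
    also have "\<dots> = 1 / 32" using CR by (simp add: divide_simps)
    finally show "c' * (222 + 66000 * CR) \<le> 1 / 32" .
  qed
  show ?thesis
  proof (rule exI[of _ "8 * Ce"], rule exI[of _ c'], rule exI[of _ c1], rule exI[of _ C1], rule exI[of _ C2], rule exI[of _ C3],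
      intro conjI allI impI)
    fix n d K Kbar k :: nat and \<rho> \<epsilon>\<^sub>0 \<delta> \<Gamma> \<eta> :: real
      and x :: "nat \<Rightarrow> real Matrix.vec" and y ytil :: "nat \<Rightarrow> real" and cl :: "nat \<Rightarrow> nat" and C :: "real Matrix.mat"
      and \<alpha> :: "nat \<Rightarrow> real" and cls :: "nat \<Rightarrow> nat" and \<phi> \<phi>' \<phi>'' :: "real \<Rightarrow> real" and v :: "real Matrix.vec"
      and lam \<Lambda> :: real and \<tau> :: nat
    assume data: "corrupted_dataset c_low c_up \<rho> \<epsilon>\<^sub>0 \<delta> n d K Kbar x y ytil cl C \<alpha> cls" and \<rho>: "0 < \<rho>"
      and d1: "\<forall>z. (\<phi> has_real_derivative \<phi>' z) (at z)" and d2: "\<forall>z. (\<phi>' has_real_derivative \<phi>'' z) (at z)"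
      and lam: "lam = min_eig_cov \<phi>' C" "0 < lam" and \<Gamma>: "1 \<le> \<Gamma>"
      and "\<bar>\<phi> 0\<bar> \<le> \<Gamma>" and b1: "\<forall>z. \<bar>\<phi>' z\<bar> \<le> \<Gamma>" and b2: "\<forall>z. \<bar>\<phi>'' z\<bar> \<le> \<Gamma>"
      and \<Lambda>: "\<Lambda> = ln (\<Gamma> * sqrt (real n * ln (real K)) / \<rho>)"
      and \<epsilon>: "\<epsilon>\<^sub>0 \<le> c1 * (lam / (\<Gamma>\<^sup>2 * real K * \<Lambda>))"
      and k: "C2 * \<Gamma>^10 * ((real K)\<^sup>2 * (spectral_norm C)^4 / lam^4) * \<Lambda>^6 \<le> real k"
      and v: "balanced_output k v" and \<eta>: "0 < \<eta>"
      and step: "\<eta> \<le> real K / (2 * c_up * real n * \<Gamma>\<^sup>2 * (spectral_norm C)\<^sup>2)"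
      and \<tau>: "\<tau> = nat (round (C1 * (real K / (\<eta> * real n * lam)) * \<Lambda>))"
    let ?M = "std_gaussian ({..<k} \<times> {..<d})"
    let ?A = "\<alpha> ` {..<Kbar}"
    define s where "s = spectral_norm C"
    define X where "X i j = x i $ j" for i j
    define c where "c l j = C $$ (l, j)" for l j
    define lab where "lab l = \<alpha> (cls l)" for l
    have n: "0 < n" and K0: "0 < K" and \<delta>: "0 < \<delta>" and x: "\<And>i. i < n \<Longrightarrow> x i \<in> carrier_vec d"
      and xn: "\<And>i. i < n \<Longrightarrow> l2_norm (x i) = 1" and cl: "\<And>i. i < n \<Longrightarrow> cl i < K"
      and low: "\<And>l. l < K \<Longrightarrow> c_low * (real n / real K) \<le> real (card {i. i < n \<and> cl i = l})"
      and up: "\<And>l. l < K \<Longrightarrow> real (card {i. i < n \<and> cl i = l}) \<le> c_up * (real n / real K)"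
      and C: "C \<in> carrier_mat K d" and rows: "\<And>l. l < K \<Longrightarrow> l2_norm (Matrix.row C l) = 1"
      and near: "\<And>i. i < n \<Longrightarrow> l2_norm (x i - Matrix.row C (cl i)) \<le> \<epsilon>\<^sub>0"
      and \<alpha>1: "\<And>r. r < Kbar \<Longrightarrow> \<bar>\<alpha> r\<bar> \<le> 1"
      and sep: "\<And>r s. r < Kbar \<Longrightarrow> s < Kbar \<Longrightarrow> r \<noteq> s \<Longrightarrow> \<delta> \<le> \<bar>\<alpha> r - \<alpha> s\<bar>"
      and cls: "\<And>l. l < K \<Longrightarrow> cls l < Kbar" and ytil: "\<And>i. i < n \<Longrightarrow> ytil i = lab (cl i)"
      and \<rho>1: "\<rho> \<le> 1" and yA: "\<And>i. i < n \<Longrightarrow> y i \<in> ?A"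
      and corr: "\<And>l. l < K \<Longrightarrow> real (card {i. i < n \<and> cl i = l \<and> y i \<noteq> ytil i}) \<le> \<rho> * real (card {i. i < n \<and> cl i = l})"
      using data[unfolded corrupted_dataset_def clusterable_dataset_def] by (simp_all add: lab_def)
    interpret M: prob_space ?M by (rule prob_space_std_gaussian)
    show "1 - 3 / real K ^ 100 - real K * exp (- 100 * real d) \<le> measure ?M
          {\<omega> \<in> space ?M.
             let W = grad_descent (loss \<phi> v n x y) \<eta> (Matrix.mat k d \<omega>);
                 f = net \<phi> v
             in
               l2_norm (Matrix.vec n (\<lambda>i. f (W \<tau>) (x i)) - Matrix.vec n ytil) / sqrt (real n)
                 \<le> 4 * \<rho> + 8 * Ce * (\<epsilon>\<^sub>0 * \<Gamma>^3 * real K * sqrt (ln (real K)) / lam) * \<Lambda>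
             \<and> (\<rho> \<le> \<delta> / 8 \<longrightarrow>
                 real (card {i. i < n \<and> nearest_labels ?A (f (W \<tau>) (x i)) \<noteq> {ytil i}})
                     / real n
                   \<le> 8 * Ce * (\<epsilon>\<^sub>0 * real K / \<delta>) * (\<Gamma>^3 * sqrt (ln (real K)) / lam) * \<Lambda>)
             \<and> (\<rho> \<le> \<delta> / 8 \<and>
                \<epsilon>\<^sub>0 \<le> c' * \<delta> * min (lam^2 / (\<Gamma>^5 * (real K)^2 * \<Lambda>^3)) (1 / (\<Gamma> * sqrt (real d))) \<longrightarrow>
                 (\<forall>l<K. \<forall>z \<in> carrier_vec d. l2_norm (z - Matrix.row C l) \<le> \<epsilon>\<^sub>0 \<longrightarrow>
                    nearest_labels ?A (f (W \<tau>) z) = {\<alpha> (cls l)}))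
             \<and> (\<forall>t\<le>\<tau>.
                 frobenius_norm (W t - W 0)
                   \<le> C3 * (\<Gamma> * sqrt (real K * ln (real K) / lam)
                        + real t * \<eta> * \<epsilon>\<^sub>0 * (\<Gamma>^4 * real K * real n / lam) * \<Lambda>^2))}"
      (is "_ \<le> measure ?M ?S")
    \<comment> \<open>For a single cluster the claimed probability is negative. Otherwise
      \<open>ln K\<close> is bounded away from 0.\<close>
    proof (cases "K = 1")
      case True
      then have "1 - 3 / real K ^ 100 - real K * exp (- 100 * real d) \<le> 0" by (simp add: order_trans[OF _ exp_ge_zero])
      then show ?thesis using measure_nonneg[of ?M ?S] by linarith
    next
      case False
      then have K: "2 \<le> K" using K0 by simp
      have KR: "0 < real K" and nR: "0 < real n" using K n by auto
      note sizes = cluster_sizes[OF n K0 cl low up assms(1)]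
      have cup: "1 \<le> c_up" and clow: "c_low \<le> 1" and Kn: "K \<le> n" by (rule sizes; assumption)+
      have u2: "u\<^sup>2 = c_up" using cup by (simp add: u_def)
      have gu: "g \<le> u"
      proof -
        have "g \<le> sqrt 1" unfolding g_def using clow by (intro real_sqrt_le_mono) simp
        then show ?thesis using u by simp
      qed
      note lnK = ln_K_bounds[OF K Kn \<Gamma> \<rho> \<rho>1, folded \<Lambda>]
      have s: "1 \<le> s" "s\<^sup>2 \<le> real K" and spec: "\<And>q. L2_set (\<lambda>j. \<Sum>l<K. c l j * q l) {..<d} \<le> s * L2_set q {..<K}"
        using spectral_norm_properties[OF C rows K0] by (simp_all add: s_def c_def)
      have \<phi>'_meas: "\<phi>' \<in> borel_measurable borel"
        using d2 by (intro borel_measurable_continuous_onI continuous_at_imp_continuous_on ballI DERIV_isCont) blast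
      have cov: "lam * (L2_set z {..<K})\<^sup>2 \<le> (\<Sum>i<K. \<Sum>j<K. z i * z j * ((\<Sum>m<d. c i m * c j m) *
          (\<integral>w. \<phi>' (lin d (c i) w) * \<phi>' (lin d (c j) w) \<partial>std_gaussian {..<d})))" "lam \<le> \<Gamma>\<^sup>2" for z
        using cluster_cov_properties[OF C K0 \<phi>'_meas b1[rule_format] rows] by (simp_all only: c_def[abs_def] lam(1))
      note lam\<Gamma> = cov(2)
      have "S2\<^sup>2 + 10^10 \<le> C2" by (simp add: C2_def)
      note wb = width_bounds[OF k[folded s_def] this S2(1) \<Gamma> lam(2) lam\<Gamma> s(1) K lnK(3,8,1)]
      have k0: "0 < k" using wb(3) by simp
      have bal: "balanced k (\<lambda>r. v $ r)" and vk: "v \<in> carrier_vec k" using v balanced_output_iff[OF k0] by auto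
      interpret sn: shallow_net k d "\<lambda>r. v $ r" \<phi> \<phi>' \<Gamma>
      proof unfold_locales
        show "\<bar>v $ r\<bar> \<le> 1 / sqrt (real k)" if "r < k" for r
          using bal that by (auto simp: balanced_def)
        show "\<bar>\<phi>' a - \<phi>' b\<bar> \<le> \<Gamma> * \<bar>a - b\<bar>" for a b
          using field_differentiable_bound[of UNIV \<phi>' \<phi>'' \<Gamma> a b] d2 b2
          by simp
      qed (use k0 d1 b1 \<Gamma> in auto)
      have L4: "sqrt lam ^ 4 = lam\<^sup>2" and K4: "sqrt (real K) ^ 4 = (real K)\<^sup>2"
        using power_mult[of "sqrt lam" 2 2] power_mult[of "sqrt (real K)" 2 2] lam by simp_all
      have L2: "(sqrt lam)\<^sup>2 = lam" using lam by simp
      have \<epsilon>0: "0 \<le> \<epsilon>\<^sub>0" using near[OF n] by (simp add: l2_norm_L2_set order_trans[OF L2_set_nonneg])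
      have X1: "L2_set (X i) {..<d} = 1" if "i < n" for i
        using xn[OF that] x[OF that] by (simp add: l2_norm_L2_set X_def[abs_def])
      have d0: "0 < d" using X1[OF n] by (cases d) auto
      have cn: "L2_set (c l) {..<d} = 1" if "l < K" for l
      proof -
        have "L2_set (c l) {..<d} = l2_norm (Matrix.row C l)"
          unfolding l2_norm_L2_set using C that by (intro L2_set_cong) (auto simp: c_def)
        then show ?thesis using rows[OF that] by simp
      qed
      have near': "L2_set (\<lambda>j. X i j - c (cl i) j) {..<d} \<le> \<epsilon>\<^sub>0" if "i < n" for i
      proof -
        have "L2_set (\<lambda>j. X i j - c (cl i) j) {..<d} = l2_norm (x i - Matrix.row C (cl i))"
          unfolding l2_norm_L2_set using C x[OF that] cl[OF that] by (intro L2_set_cong) (auto simp: X_def c_def)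
        then show ?thesis using near[OF that] by simp
      qed
      have y1: "\<bar>y i\<bar> \<le> 1" if "i < n" for i using yA[OF that] \<alpha>1 by auto
      have lab1: "\<bar>lab l\<bar> \<le> 1" if "l < K" for l using \<alpha>1 cls[OF that] by (simp add: lab_def)
      define Y where "Y = C1 * (real K / (\<eta> * real n * lam)) * \<Lambda>"
      have step': "\<eta> * (2 * u\<^sup>2 * real n * \<Gamma>\<^sup>2 * s\<^sup>2) \<le> real K"
      proof -
        have "0 < 2 * u\<^sup>2 * real n * \<Gamma>\<^sup>2 * s\<^sup>2" using u nR \<Gamma> s by simp
        then show ?thesis using step by (simp add: le_divide_eq u2 s_def)
      qed
      \<comment> \<open>The step size bound makes \<open>K / (\<eta> * n * lam)\<close> at least 2,
        \<open>C1\<close> is at least 1600 and \<Lambda> at least 1/12, so rounding cannot produce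
        zero iterations.\<close>
      have Y1: "1 \<le> Y"
      proof -
        have "\<eta> * real n * lam * 2 \<le> \<eta> * real n * \<Gamma>\<^sup>2 * 2" using lam\<Gamma> \<eta> by (simp add: mult_left_mono)
        also have "\<dots> * 1 \<le> \<eta> * real n * \<Gamma>\<^sup>2 * 2 * (u\<^sup>2 * s\<^sup>2)"
        proof (rule mult_left_mono)
          have "1 * 1 \<le> u\<^sup>2 * s\<^sup>2" using u s by (intro mult_mono one_le_power) auto
          then show "1 \<le> u\<^sup>2 * s\<^sup>2" by simp
        qed (use \<eta> in simp)
        also have "\<dots> = \<eta> * (2 * u\<^sup>2 * real n * \<Gamma>\<^sup>2 * s\<^sup>2)" by (simp add: mult_ac)
        also note step'
        finally have r: "2 \<le> real K / (\<eta> * real n * lam)" using \<eta> nR lam by (simp add: le_divide_eq mult_ac)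
        have "g\<^sup>2 \<le> 1" using g clow by simp
        then have "1600 \<le> C1" using C1 mult_left_mono[of "g\<^sup>2" 1 C1] by simp
        with r lnK(3) have "1600 * 2 * (1 / 12) \<le> Y" unfolding Y_def
          by (intro mult_mono mult_nonneg_nonneg[of C1]) auto
        then show ?thesis by simp
      qed
      note rs = rounded_steps[OF Y1 \<eta>, folded \<tau>[folded Y_def]]
      have Y\<eta>: "Y * \<eta> = C1 * real K * \<Lambda> / (real n * lam)" using \<eta> by (simp add: Y_def)
      have rc: "regime_constants \<Gamma> (sqrt lam) (sqrt (real K)) (sqrt (real n)) s (sqrt (ln (real K))) \<Lambda> \<epsilon>\<^sub>0
          (sqrt (real k)) g u (real \<tau> * \<eta>) C1 c1 S2 CR"
      proof unfold_locales
        show "sqrt lam \<le> \<Gamma>" using lam\<Gamma> \<Gamma> by (intro real_le_lsqrt) auto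
        show "s \<le> sqrt (real K)" using s by (intro real_le_rsqrt) auto
        show "\<epsilon>\<^sub>0 \<le> c1 * (sqrt lam)\<^sup>2 / (\<Gamma>\<^sup>2 * (sqrt (real K))\<^sup>2 * \<Lambda>)" using \<epsilon> lam by simp
        show "S2 * \<Gamma>^5 * (sqrt (real K))\<^sup>2 * s\<^sup>2 * \<Lambda>^3 / sqrt lam ^ 4 \<le> sqrt (real k)" using wb(1) by (simp add: L4)
        show "real \<tau> * \<eta> \<le> 2 * C1 * (sqrt (real K))\<^sup>2 * \<Lambda> / ((sqrt (real n))\<^sup>2 * (sqrt lam)\<^sup>2)"
          using rs(1) lam by (simp add: Y\<eta>)
      qed (use \<Gamma> lam K n s lnK \<epsilon>0 g u \<eta> CR_def C1 c1 c1' S2 in auto)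
      have T: "C1 * real K * \<Lambda> / (2 * real n * lam) \<le> real \<tau> * \<eta>"
        using rs(2) by (simp add: Y\<eta> mult_ac)
      have corr': "real (card {i. i < n \<and> cl i = l \<and> y i \<noteq> lab (cl i)}) \<le> \<rho> * real (card {i. i < n \<and> cl i = l})" if "l < K" for l
      proof -
        have "{i. i < n \<and> cl i = l \<and> y i \<noteq> lab (cl i)} = {i. i < n \<and> cl i = l \<and> y i \<noteq> ytil i}" using ytil by auto
        then show ?thesis using corr[OF that] by simp
      qed
      have labA: "lab l \<in> ?A" if "l < K" for l using cls[OF that] by (simp add: lab_def)
      have sepA: "\<delta> \<le> \<bar>p - q\<bar>" if "p \<in> ?A" "q \<in> ?A" "p \<noteq> q" for p q
        using that sep by auto
      let ?D = "sn.descent n X y \<eta>"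
      \<comment> \<open>The event in terms of functions instead of matrices, with the third item
        over a compact set, which is the shape covered by
        \<open>sn.sets_training_event\<close>.\<close>
      define ev where "ev \<omega> \<longleftrightarrow>
          L2_set (\<lambda>i. sn.out (?D \<omega> \<tau>) (X i) - ytil i) {..<n} / sqrt (real n)
            \<le> 4 * \<rho> + 8 * Ce * (\<epsilon>\<^sub>0 * \<Gamma>^3 * real K * sqrt (ln (real K)) / lam) * \<Lambda>
        \<and> (\<rho> \<le> \<delta> / 8 \<longrightarrow> real (card {i. i < n \<and> nearest_labels ?A (sn.out (?D \<omega> \<tau>) (X i)) \<noteq> {ytil i}}) / real n
            \<le> 8 * Ce * (\<epsilon>\<^sub>0 * real K / \<delta>) * (\<Gamma>^3 * sqrt (ln (real K)) / lam) * \<Lambda>)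
        \<and> (\<rho> \<le> \<delta> / 8 \<and>
            \<epsilon>\<^sub>0 \<le> c' * \<delta> * min (lam^2 / (\<Gamma>^5 * (real K)^2 * \<Lambda>^3)) (1 / (\<Gamma> * sqrt (real d))) \<longrightarrow>
            (\<forall>l<K. \<forall>z\<in>supp d \<inter> {z. L2_set (\<lambda>j. z j - c l j) {..<d} \<le> \<epsilon>\<^sub>0}.
              nearest_labels ?A (sn.out (?D \<omega> \<tau>) z) = {lab l}))
        \<and> (\<forall>t\<le>\<tau>. L2_set (\<lambda>p. ?D \<omega> t p - \<omega> p) ({..<k} \<times> {..<d})
            \<le> C3 * (\<Gamma> * sqrt (real K * ln (real K) / lam)
              + real t * \<eta> * \<epsilon>\<^sub>0 * (\<Gamma>^4 * real K * real n / lam) * \<Lambda>^2))" for \<omega>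
      have ev_sets: "{\<omega> \<in> space ?M. ev \<omega>} \<in> sets ?M"
        unfolding ev_def by (rule sn.sets_training_event) (use labA in auto)
      have gde: "grad_descent (loss \<phi> v n x y) \<eta> (Matrix.mat k d \<omega>) t = Matrix.mat k d (?D \<omega> t)" for \<omega> t
        unfolding X_def[abs_def] by (rule sn.grad_descent_eq_descent[OF vk refl x])
      have S: "?S = {\<omega> \<in> space ?M. ev \<omega>}"
      proof -
        note no = sn.net_eq_out[OF vk refl]
        have 1: "l2_norm (Matrix.vec n (\<lambda>i. net \<phi> v (Matrix.mat k d W) (x i)) - Matrix.vec n ytil)
            = L2_set (\<lambda>i. sn.out W (X i) - ytil i) {..<n}" for W
          unfolding l2_norm_L2_set using no[OF x] by (intro L2_set_cong) (auto simp: X_def[abs_def])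
        have 2: "{i. i < n \<and> nearest_labels ?A (net \<phi> v (Matrix.mat k d W) (x i)) \<noteq> {ytil i}}
            = {i. i < n \<and> nearest_labels ?A (sn.out W (X i)) \<noteq> {ytil i}}" for W
          using no[OF x] by (auto simp: X_def[abs_def])
        have 3: "(\<forall>l<K. \<forall>z \<in> carrier_vec d. l2_norm (z - Matrix.row C l) \<le> \<epsilon>\<^sub>0 \<longrightarrow>
              nearest_labels ?A (net \<phi> v (Matrix.mat k d W) z) = {\<alpha> (cls l)})
            \<longleftrightarrow> (\<forall>l<K. \<forall>z\<in>supp d \<inter> {z. L2_set (\<lambda>j. z j - c l j) {..<d} \<le> \<epsilon>\<^sub>0}.
              nearest_labels ?A (sn.out W z) = {lab l})" for W
          using no sn.all_carrier_vec_ball[OF C, of _ \<epsilon>\<^sub>0 "\<lambda>a. nearest_labels ?A a = {lab _}" W]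
          by (simp add: c_def lab_def)
        show ?thesis
          unfolding ev_def Let_def gde 1 2 3 sn.frobenius_norm_mat_diff sn.descent.simps(1) by (rule refl)
      qed
      show ?thesis
      proof (rule sn.training_whp[OF bal d0 K n \<epsilon>0 X1 cn cl near' lam(2) cov(1) wb(3,4,2) y1 \<eta> rc _ _ spec step' T C1(2)
            \<rho> lnK(4) gu corr' lab1])
        fix G assume G: "G \<in> sets ?M" "1 - 3 / real K ^ 100 - real K * exp (- 100 * real d) \<le> measure ?M G"
          and tr: "\<And>\<omega>. \<omega> \<in> G \<Longrightarrow> training k d (\<lambda>r. v $ r) \<phi> \<phi>' \<Gamma> n K cl X c y \<eta> \<epsilon>\<^sub>0 \<omega> (sqrt lam) (sqrt (real K)) (sqrt (real n)) s (sqrt (ln (real K))) \<Lambda> (sqrt (real k)) g u (real \<tau> * \<eta>) C1 c1 S2 CR \<tau> \<rho> lab"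
          and ball: "\<And>\<omega> l z. \<omega> \<in> G \<Longrightarrow> l < K \<Longrightarrow> L2_set (\<lambda>j. z j - c l j) {..<d} \<le> \<epsilon>\<^sub>0 \<Longrightarrow>
            \<bar>sn.out \<omega> z - sn.out \<omega> (c l)\<bar> \<le> 180 * \<Gamma> * \<epsilon>\<^sub>0 * sqrt (real d)"
          and oper: "\<And>\<omega> u. \<omega> \<in> G \<Longrightarrow> L2_set (preact d \<omega> u) {..<k} \<le> 42 * (sqrt (real k) + sqrt (real d)) * L2_set u {..<d}"
        have "ev \<omega>" if \<omega>: "\<omega> \<in> G" for \<omega>
        proof -
          interpret tr: training k d "\<lambda>r. v $ r" \<phi> \<phi>' \<Gamma> n K cl X c y \<eta> \<epsilon>\<^sub>0 \<omega> "sqrt lam" "sqrt (real K)" "sqrt (real n)" s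
            "sqrt (ln (real K))" \<Lambda> "sqrt (real k)" g u "real \<tau> * \<eta>" C1 c1 S2 CR \<tau> \<rho> lab
            by (rule tr[OF \<omega>])
          have Ce_eq: "tr.Cerr = Ce" by (simp add: tr.Cerr_def Ce_def)
          note out = tr.training_outcome[OF labA sepA \<delta> d0 c'[folded Ce_eq] ball[OF \<omega>] oper[OF \<omega>], unfolded Ce_eq L2 L4 K4, simplified]
          have root: "sqrt (real K) * sqrt (ln (real K)) / sqrt lam = sqrt (real K * ln (real K) / lam)"
            by (simp add: real_sqrt_mult real_sqrt_divide)
          note path = tr.path_length[folded C3_def, unfolded root tr.gd_eq_descent L2, simplified]
          have o1: "L2_set (\<lambda>i. sn.out (?D \<omega> \<tau>) (X i) - ytil i) {..<n} = L2_set (\<lambda>i. sn.out (?D \<omega> \<tau>) (X i) - lab (cl i)) {..<n}"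
            by (intro L2_set_cong) (simp_all add: ytil)
          have o2: "{i. i < n \<and> nearest_labels ?A (sn.out (?D \<omega> \<tau>) (X i)) \<noteq> {ytil i}}
              = {i. i < n \<and> nearest_labels ?A (sn.out (?D \<omega> \<tau>) (X i)) \<noteq> {lab (cl i)}}"
            using ytil by auto
          show ?thesis unfolding ev_def o1 o2
            by (intro conjI impI allI ballI) (use out path in auto)
        qed
        then have "G \<subseteq> ?S" unfolding S using sets.sets_into_space[OF G(1)] by blast
        then have "measure ?M G \<le> measure ?M ?S" using ev_sets unfolding S by (rule M.finite_measure_mono)
        with G(2) show ?thesis by linarith
      qed (use low up g u2 in auto)
    qed
  qed (use Ce c' c1 C1 C2 C3 in auto)
qed

end
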